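(* Let $n\ge1$, let $\mathcal C$ be an $n$-Frobenius category, let $M\in\mathcal C$ and fix a unit conflation $\delta_M\in\operatorname{Ext}^n(M,\Omega^nM)$. Then $(\operatorname{Ext}^n(M,\Omega^nM)/\mathcal P,+,\circ)$ is a ring with identity element $\bar\delta_M$. Moreover, for any unit conflation $\delta\in\operatorname{Ext}^n(M,\Omega^nM)$, $\bar\delta$ is invertible in this ring.
   Context: Let $\mathcal A$ be an abelian category and $\mathcal C$ a full additive extension-closed subcategory with the inherited exact structure: conflations are short exact sequences of $\mathcal A$ with all terms in $\mathcal C$ (first map an inflation, second a deflation). $\operatorname{Ext}^t(A,B)=\operatorname{Ext}^t_{\mathcal C}(A,B)$ ($t\ge1$) is the abelian group (Baer sum) of equivalence classes of exact sequences $B\to X_{t-1}\to\cdots\to X_0\to A$ spliced from $t$ conflations. $g\gamma$, $\gamma h$ denote push-out along $g$ and pull-back along $h$. $P\in\mathcal C$ is $n$-projective (resp. $n$-injective) if $\operatorname{Ext}^i(P,Y)=0$ (resp. $\operatorname{Ext}^i(Y,P)=0$) for all $i>n$, $Y\in\mathcal C$. $\mathcal C$ is $n$-Frobenius if every object has a deflation from an $n$-projective and an inflation into an $n$-injective, and $n$-projectives and $n$-injectives coincide. $\mathcal P(X,Y)\subseteq\operatorname{Ext}^n(X,Y)$ is the subgroup of elements $\eta h$ with $h:X\to P$, $P$ $n$-projective, $\eta\in\operatorname{Ext}^n(P,Y)$; bars denote classes modulo $\mathcal P$, and $\bar\gamma+\bar\gamma':=\overline{\gamma+\gamma'}$ (Baer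 sum). A unit conflation of length $n$ is of the form $B\to P_{n-1}\to\cdots\to P_0\to A$ with all $P_i$ $n$-projective; $B$ is then an $n$-th syzygy $\Omega^nA$ of $A$; $\mathcal U^n(B)$ denotes the class of unit conflations of length $n$ beginning with $B$. A right unit factorization of $\gamma\in\operatorname{Ext}^n(M,\Omega^nN)$ is an equality $\gamma=\delta f$ with $\delta\in\mathcal U^n(\Omega^nN)$ and $f$ a morphism; these always exist. $\Sigma$ is the class of quasi-invertible morphisms: those $f:A\to B$ such that $\operatorname{Ext}^{n+1}(X,A)\to\operatorname{Ext}^{n+1}(X,B)$, $\gamma\mapsto f\gamma$, is an isomorphism for all $X\in\mathcal C$ (equivalently, the analogous condition with pull-backs). For $\delta,\delta'\in\mathcal U^n(B)$, a co-angled pair $[\delta a,\delta'b]$ consists of deflations $a,b\in\Sigma$ from a common object to the right end terms of $\delta,\delta'$ respectively, such that $\delta a=\delta'b$ is again in $\mathcal U^n(B)$; such pairs always exist. For $b:X\to X'$ in $\Sigma$ and $\gamma\in\operatorname{Ext}^n(X,Y)$, $\gamma b^{-1}$ denotes an element $\gamma'\in\operatorname{Ext}^n(X',Y)$ with $\gamma-\gamma'b\in\mathcal P$; it exists and is unique modulo $\mathcal P$. Composition: with the fixed unit conflation $\delta_M\in\operatorname{Ext}^n(M,\Omega^nM)$, for $\beta,\gamma\in\operatorname{Ext}^n(M,\Omega^nM)$ put $\bar\beta\circ\bar\gamma:=\overline{((\beta a_1)b_1^{-1})f}$, where $\gamma=\delta f$ is a right unit factorization and $[\delta_Ma_1,\delta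 b_1]$ is a co-angled pair; this is well-defined. *)

theory Defs
  imports "HOL-Algebra.Ring" "HOL-Algebra.Coset"
begin

section \<open>Abelian categories\<close>

text \<open>A category enriched in abelian groups is given by sets of objects and arrows; the
  composite \<open>g \<cdot> f\<close> means ``\<open>g\<close> after \<open>f\<close>'' and is only meaningful if \<open>Tgt f = Src g\<close>.
  \<open>HAdd\<close> and \<open>HZero A B\<close> are the group structure on the hom-sets.\<close>

record ('o, 'm) add_cat =
  Obj :: "'o set"
  Arr :: "'m set"
  Src :: "'m \<Rightarrow> 'o"
  Tgt :: "'m \<Rightarrow> 'o"
  Idt :: "'o \<Rightarrow> 'm"
  Comp :: "'m \<Rightarrow> 'm \<Rightarrow> 'm" (infixr "\<cdot>\<index>" 70)
  HAdd :: "'m \<Rightarrow> 'm \<Rightarrow> 'm"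
  HZero :: "'o \<Rightarrow> 'o \<Rightarrow> 'm"

definition Hom :: "('o, 'm) add_cat \<Rightarrow> 'o \<Rightarrow> 'o \<Rightarrow> 'm set" where
  "Hom C A B = {f \<in> Arr C. Src C f = A \<and> Tgt C f = B}"

definition hom_group :: "('o, 'm) add_cat \<Rightarrow> 'o \<Rightarrow> 'o \<Rightarrow> 'm monoid" where
  "hom_group C A B = \<lparr>carrier = Hom C A B, mult = HAdd C, one = HZero C A B\<rparr>"

definition is_zero_obj :: "('o, 'm) add_cat \<Rightarrow> 'o \<Rightarrow> bool" where
  "is_zero_obj C Z \<longleftrightarrow> Z \<in> Obj C \<and>
     (\<forall>A \<in> Obj C. (\<exists>!f. f \<in> Hom C A Z) \<and> (\<exists>!f. f \<in> Hom C Z A))"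

text \<open>A biproduct is recorded by its two injections and its two projections.\<close>

fun is_biproduct ::
    "('o, 'm) add_cat \<Rightarrow> 'o \<Rightarrow> 'o \<Rightarrow> 'o \<Rightarrow> 'm \<times> 'm \<times> 'm \<times> 'm \<Rightarrow> bool" where
  "is_biproduct C A B D (i, j, p, q) \<longleftrightarrow>
     A \<in> Obj C \<and> B \<in> Obj C \<and> D \<in> Obj C \<and>
     i \<in> Hom C A D \<and> j \<in> Hom C B D \<and> p \<in> Hom C D A \<and> q \<in> Hom C D B \<and>
     p \<cdot>\<^bsub>C\<^esub> i = Idt C A \<and> q \<cdot>\<^bsub>C\<^esub> j = Idt C B \<and>
     p \<cdot>\<^bsub>C\<^esub> j = HZero C B A \<and> q \<cdot>\<^bsub>C\<^esub> i = HZero C A B \<and>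
     HAdd C (i \<cdot>\<^bsub>C\<^esub> p) (j \<cdot>\<^bsub>C\<^esub> q) = Idt C D"

definition is_kernel :: "('o, 'm) add_cat \<Rightarrow> 'm \<Rightarrow> 'm \<Rightarrow> bool" where
  "is_kernel C f k \<longleftrightarrow> f \<in> Arr C \<and> k \<in> Arr C \<and> Tgt C k = Src C f \<and>
     f \<cdot>\<^bsub>C\<^esub> k = HZero C (Src C k) (Tgt C f) \<and>
     (\<forall>g \<in> Arr C. Tgt C g = Src C f \<and> f \<cdot>\<^bsub>C\<^esub> g = HZero C (Src C g) (Tgt C f) \<longrightarrow>
        (\<exists>!u. u \<in> Hom C (Src C g) (Src C k) \<and> k \<cdot>\<^bsub>C\<^esub> u = g))"

definition is_cokernel :: "('o, 'm) add_cat \<Rightarrow> 'm \<Rightarrow> 'm \<Rightarrow> bool" where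
  "is_cokernel C f c \<longleftrightarrow> f \<in> Arr C \<and> c \<in> Arr C \<and> Src C c = Tgt C f \<and>
     c \<cdot>\<^bsub>C\<^esub> f = HZero C (Src C f) (Tgt C c) \<and>
     (\<forall>g \<in> Arr C. Src C g = Tgt C f \<and> g \<cdot>\<^bsub>C\<^esub> f = HZero C (Src C f) (Tgt C g) \<longrightarrow>
        (\<exists>!u. u \<in> Hom C (Tgt C c) (Tgt C g) \<and> u \<cdot>\<^bsub>C\<^esub> c = g))"

definition is_mono :: "('o, 'm) add_cat \<Rightarrow> 'm \<Rightarrow> bool" where
  "is_mono C f \<longleftrightarrow> f \<in> Arr C \<and>
     (\<forall>g \<in> Arr C. \<forall>h \<in> Arr C. Tgt C g = Src C f \<and> Tgt C h = Src C f \<and> Src C g = Src C h \<and>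
        f \<cdot>\<^bsub>C\<^esub> g = f \<cdot>\<^bsub>C\<^esub> h \<longrightarrow> g = h)"

definition is_epi :: "('o, 'm) add_cat \<Rightarrow> 'm \<Rightarrow> bool" where
  "is_epi C f \<longleftrightarrow> f \<in> Arr C \<and>
     (\<forall>g \<in> Arr C. \<forall>h \<in> Arr C. Src C g = Tgt C f \<and> Src C h = Tgt C f \<and> Tgt C g = Tgt C h \<and>
        g \<cdot>\<^bsub>C\<^esub> f = h \<cdot>\<^bsub>C\<^esub> f \<longrightarrow> g = h)"

locale category =
  fixes C :: "('o, 'm) add_cat" (structure)
  assumes Src_closed: "f \<in> Arr C \<Longrightarrow> Src C f \<in> Obj C"
    and Tgt_closed: "f \<in> Arr C \<Longrightarrow> Tgt C f \<in> Obj C"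
    and Idt_closed: "A \<in> Obj C \<Longrightarrow> Idt C A \<in> Hom C A A"
    and Comp_closed: "f \<in> Hom C A B \<Longrightarrow> g \<in> Hom C B D \<Longrightarrow> g \<cdot> f \<in> Hom C A D"
    and Comp_assoc: "f \<in> Hom C A B \<Longrightarrow> g \<in> Hom C B D \<Longrightarrow> h \<in> Hom C D E \<Longrightarrow>
      (h \<cdot> g) \<cdot> f = h \<cdot> (g \<cdot> f)"
    and Comp_Idt: "f \<in> Hom C A B \<Longrightarrow> f \<cdot> Idt C A = f"
    and Idt_Comp: "f \<in> Hom C A B \<Longrightarrow> Idt C B \<cdot> f = f"

locale preadditive_category = category +
  assumes Hom_comm_group: "A \<in> Obj C \<Longrightarrow> B \<in> Obj C \<Longrightarrow> comm_group (hom_group C A B)"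
    and Comp_HAdd: "f \<in> Hom C A B \<Longrightarrow> f' \<in> Hom C A B \<Longrightarrow> g \<in> Hom C B D \<Longrightarrow>
      g \<cdot> HAdd C f f' = HAdd C (g \<cdot> f) (g \<cdot> f')"
    and HAdd_Comp: "f \<in> Hom C A B \<Longrightarrow> g \<in> Hom C B D \<Longrightarrow> g' \<in> Hom C B D \<Longrightarrow>
      HAdd C g g' \<cdot> f = HAdd C (g \<cdot> f) (g' \<cdot> f)"

locale abelian_category = preadditive_category +
  assumes zero_obj_exists: "\<exists>Z. is_zero_obj C Z"
    and biproduct_exists: "A \<in> Obj C \<Longrightarrow> B \<in> Obj C \<Longrightarrow> \<exists>D b. is_biproduct C A B D b"
    and kernel_exists: "f \<in> Arr C \<Longrightarrow> \<exists>k. is_kernel C f k"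
    and cokernel_exists: "f \<in> Arr C \<Longrightarrow> \<exists>c. is_cokernel C f c"
    and mono_normal: "is_mono C f \<Longrightarrow> \<exists>g. is_kernel C g f"
    and epi_normal: "is_epi C f \<Longrightarrow> \<exists>g. is_cokernel C g f"

definition short_exact :: "('o, 'm) add_cat \<Rightarrow> 'm \<Rightarrow> 'm \<Rightarrow> bool" where
  "short_exact C i p \<longleftrightarrow> is_kernel C p i \<and> is_cokernel C i p"

definition is_pushout :: "('o, 'm) add_cat \<Rightarrow> 'm \<Rightarrow> 'm \<Rightarrow> 'm \<Rightarrow> 'm \<Rightarrow> bool" where
  "is_pushout C i g i' g' \<longleftrightarrow>
     i \<in> Arr C \<and> g \<in> Arr C \<and> i' \<in> Arr C \<and> g' \<in> Arr C \<and>
     Src C i = Src C g \<and> Src C i' = Tgt C g \<and> Src C g' = Tgt C i \<and> Tgt C i' = Tgt C g' \<and>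
     i' \<cdot>\<^bsub>C\<^esub> g = g' \<cdot>\<^bsub>C\<^esub> i \<and>
     (\<forall>u \<in> Arr C. \<forall>v \<in> Arr C. Src C u = Tgt C i \<and> Src C v = Tgt C g \<and> Tgt C u = Tgt C v \<and>
        u \<cdot>\<^bsub>C\<^esub> i = v \<cdot>\<^bsub>C\<^esub> g \<longrightarrow>
        (\<exists>!w. w \<in> Hom C (Tgt C i') (Tgt C u) \<and> w \<cdot>\<^bsub>C\<^esub> g' = u \<and> w \<cdot>\<^bsub>C\<^esub> i' = v))"

definition is_pullback :: "('o, 'm) add_cat \<Rightarrow> 'm \<Rightarrow> 'm \<Rightarrow> 'm \<Rightarrow> 'm \<Rightarrow> bool" where
  "is_pullback C p h p' h' \<longleftrightarrow>
     p \<in> Arr C \<and> h \<in> Arr C \<and> p' \<in> Arr C \<and> h' \<in> Arr C \<and>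
     Tgt C p = Tgt C h \<and> Tgt C p' = Src C h \<and> Tgt C h' = Src C p \<and> Src C p' = Src C h' \<and>
     h \<cdot>\<^bsub>C\<^esub> p' = p \<cdot>\<^bsub>C\<^esub> h' \<and>
     (\<forall>u \<in> Arr C. \<forall>v \<in> Arr C. Tgt C u = Src C p \<and> Tgt C v = Src C h \<and> Src C u = Src C v \<and>
        p \<cdot>\<^bsub>C\<^esub> u = h \<cdot>\<^bsub>C\<^esub> v \<longrightarrow>
        (\<exists>!w. w \<in> Hom C (Src C u) (Src C p') \<and> h' \<cdot>\<^bsub>C\<^esub> w = u \<and> p' \<cdot>\<^bsub>C\<^esub> w = v))"


section \<open>Extension-closed subcategories\<close>

text \<open>The full subcategory is given by its set \<open>S\<close> of objects.\<close>

locale extension_closed_subcategory = abelian_category +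
  fixes S :: "'o set"
  assumes S_subset: "S \<subseteq> Obj C"
    and S_zero: "\<exists>Z \<in> S. is_zero_obj C Z"
    and S_biproduct: "A \<in> S \<Longrightarrow> B \<in> S \<Longrightarrow> \<exists>D \<in> S. \<exists>b. is_biproduct C A B D b"
    and S_extension:
      "short_exact C i p \<Longrightarrow> Src C i \<in> S \<Longrightarrow> Tgt C p \<in> S \<Longrightarrow> Tgt C i \<in> S"

definition conflation :: "('o, 'm) add_cat \<Rightarrow> 'o set \<Rightarrow> 'm \<Rightarrow> 'm \<Rightarrow> bool" where
  "conflation C S i p \<longleftrightarrow> short_exact C i p \<and> Src C i \<in> S \<and> Tgt C i \<in> S \<and> Tgt C p \<in> S"

definition inflation :: "('o, 'm) add_cat \<Rightarrow> 'o set \<Rightarrow> 'm \<Rightarrow> bool" where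
  "inflation C S i \<longleftrightarrow> (\<exists>p. conflation C S i p)"

definition deflation :: "('o, 'm) add_cat \<Rightarrow> 'o set \<Rightarrow> 'm \<Rightarrow> bool" where
  "deflation C S p \<longleftrightarrow> (\<exists>i. conflation C S i p)"


section \<open>Yoneda extensions\<close>

text \<open>An exact sequence \<open>B \<rightarrow> X\<^sub>t\<^sub>-\<^sub>1 \<rightarrow> \<dots> \<rightarrow> X\<^sub>0 \<rightarrow> A\<close> is the list of its \<open>t + 1\<close> maps, read from left
  to right. \<open>ext_seq C S t A B E\<close> says that \<open>E\<close> is such a sequence spliced from \<open>t\<close> conflations;
  note that it starts in \<open>B\<close> and ends in \<open>A\<close>.\<close>

inductive ext_seq :: "('o, 'm) add_cat \<Rightarrow> 'o set \<Rightarrow> nat \<Rightarrow> 'o \<Rightarrow> 'o \<Rightarrow> 'm list \<Rightarrow> bool"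
  for C S where
  single: "conflation C S i p \<Longrightarrow> ext_seq C S 1 (Tgt C p) (Src C i) [i, p]"
| splice: "conflation C S i p \<Longrightarrow> ext_seq C S t A (Tgt C p) (j # ds) \<Longrightarrow>
    ext_seq C S (Suc t) A (Src C i) (i # (j \<cdot>\<^bsub>C\<^esub> p) # ds)"

definition seq_objs :: "('o, 'm) add_cat \<Rightarrow> 'm list \<Rightarrow> 'o list" where
  "seq_objs C E = Src C (hd E) # map (Tgt C) E"

definition seq_morphism :: "('o, 'm) add_cat \<Rightarrow> 'm list \<Rightarrow> 'm list \<Rightarrow> 'm list \<Rightarrow> bool" where
  "seq_morphism C E E' \<phi> \<longleftrightarrow> length E' = length E \<and> length \<phi> = Suc (length E) \<and>
     (\<forall>k \<le> length E. \<phi> ! k \<in> Hom C (seq_objs C E ! k) (seq_objs C E' ! k)) \<and>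
     (\<forall>k < length E. \<phi> ! Suc k \<cdot>\<^bsub>C\<^esub> E ! k = E' ! k \<cdot>\<^bsub>C\<^esub> \<phi> ! k)"

definition yoneda_step :: "('o, 'm) add_cat \<Rightarrow> 'o set \<Rightarrow> ('m list \<times> 'm list) set" where
  "yoneda_step C S = {(E, E'). \<exists>t A B. ext_seq C S t A B E \<and> ext_seq C S t A B E' \<and>
     (\<exists>\<phi>. seq_morphism C E E' \<phi> \<and> hd \<phi> = Idt C B \<and> last \<phi> = Idt C A)}"

text \<open>The equivalence relation generated by \<open>yoneda_step\<close>, which is already reflexive on
  exact sequences.\<close>

definition yoneda_eq :: "('o, 'm) add_cat \<Rightarrow> 'o set \<Rightarrow> ('m list \<times> 'm list) set" where
  "yoneda_eq C S = (yoneda_step C S \<union> (yoneda_step C S)\<inverse>)\<^sup>+"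

definition Ext :: "('o, 'm) add_cat \<Rightarrow> 'o set \<Rightarrow> nat \<Rightarrow> 'o \<Rightarrow> 'o \<Rightarrow> 'm list set set" where
  "Ext C S t A B = {E. ext_seq C S t A B E} // yoneda_eq C S"

text \<open>Push-out of the first conflation and pull-back of the last one. The adjacent map of the
  sequence is replaced by the one which the universal property induces from the old map and
  the zero map.\<close>

inductive pushout_seq :: "('o, 'm) add_cat \<Rightarrow> 'm \<Rightarrow> 'm list \<Rightarrow> 'm list \<Rightarrow> bool" for C g where
  "is_pushout C i g i' g' \<Longrightarrow> d' \<in> Hom C (Tgt C i') (Tgt C d) \<Longrightarrow>
   d' \<cdot>\<^bsub>C\<^esub> g' = d \<Longrightarrow> d' \<cdot>\<^bsub>C\<^esub> i' = HZero C (Src C i') (Tgt C d) \<Longrightarrow>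
   pushout_seq C g (i # d # ds) (i' # d' # ds)"

inductive pullback_seq :: "('o, 'm) add_cat \<Rightarrow> 'm \<Rightarrow> 'm list \<Rightarrow> 'm list \<Rightarrow> bool" for C h where
  "is_pullback C p h p' h' \<Longrightarrow> d' \<in> Hom C (Src C d) (Src C p') \<Longrightarrow>
   h' \<cdot>\<^bsub>C\<^esub> d' = d \<Longrightarrow> p' \<cdot>\<^bsub>C\<^esub> d' = HZero C (Src C d) (Tgt C p') \<Longrightarrow>
   pullback_seq C h (ds @ [d, p]) (ds @ [d', p'])"

text \<open>The operations on classes below collect everything equivalent to the result of the
  construction on some representatives, for some choice of the (co)limits involved; as the
  constructions respect equivalence, this is again a single class.\<close>

definition ext_push :: "('o, 'm) add_cat \<Rightarrow> 'o set \<Rightarrow> 'm \<Rightarrow> 'm list set \<Rightarrow> 'm list set" where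
  "ext_push C S g \<gamma> = {G. \<exists>E \<in> \<gamma>. \<exists>F. pushout_seq C g E F \<and> (F, G) \<in> yoneda_eq C S}"

definition ext_pull :: "('o, 'm) add_cat \<Rightarrow> 'o set \<Rightarrow> 'm list set \<Rightarrow> 'm \<Rightarrow> 'm list set" where
  "ext_pull C S \<gamma> h = {G. \<exists>E \<in> \<gamma>. \<exists>F. pullback_seq C h E F \<and> (F, G) \<in> yoneda_eq C S}"

fun biprod_map :: "('o, 'm) add_cat \<Rightarrow> 'm \<times> 'm \<times> 'm \<times> 'm \<Rightarrow> 'm \<times> 'm \<times> 'm \<times> 'm \<Rightarrow>
    'm \<Rightarrow> 'm \<Rightarrow> 'm" where
  "biprod_map C (i, j, p, q) (i', j', p', q') f g =
     HAdd C (i' \<cdot>\<^bsub>C\<^esub> f \<cdot>\<^bsub>C\<^esub> p) (j' \<cdot>\<^bsub>C\<^esub> g \<cdot>\<^bsub>C\<^esub> q)"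

fun diagonal :: "('o, 'm) add_cat \<Rightarrow> 'm \<times> 'm \<times> 'm \<times> 'm \<Rightarrow> 'm" where
  "diagonal C (i, j, p, q) = HAdd C i j"

fun codiagonal :: "('o, 'm) add_cat \<Rightarrow> 'm \<times> 'm \<times> 'm \<times> 'm \<Rightarrow> 'm" where
  "codiagonal C (i, j, p, q) = HAdd C p q"

text \<open>\<open>F\<close> is the termwise direct sum of \<open>E\<close> and \<open>E'\<close> with respect to the list \<open>bs\<close> of biproducts.\<close>

definition direct_sum_seq :: "('o, 'm) add_cat \<Rightarrow> ('m \<times> 'm \<times> 'm \<times> 'm) list \<Rightarrow>
    'm list \<Rightarrow> 'm list \<Rightarrow> 'm list \<Rightarrow> bool" where
  "direct_sum_seq C bs E E' F \<longleftrightarrow>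
     length E' = length E \<and> length F = length E \<and> length bs = Suc (length E) \<and>
     (\<forall>k \<le> length E. \<exists>D. is_biproduct C (seq_objs C E ! k) (seq_objs C E' ! k) D (bs ! k)) \<and>
     (\<forall>k < length E. F ! k = biprod_map C (bs ! k) (bs ! Suc k) (E ! k) (E' ! k))"

text \<open>The Baer sum \<open>\<nabla>(\<gamma> \<oplus> \<gamma>')\<Delta>\<close>.\<close>

definition baer_sum ::
    "('o, 'm) add_cat \<Rightarrow> 'o set \<Rightarrow> 'm list set \<Rightarrow> 'm list set \<Rightarrow> 'm list set" where
  "baer_sum C S \<gamma> \<gamma>' = {G. \<exists>E \<in> \<gamma>. \<exists>E' \<in> \<gamma>'. \<exists>bs F. direct_sum_seq C bs E E' F \<and>
     G \<in> ext_push C S (codiagonal C (hd bs))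
           (ext_pull C S (yoneda_eq C S `` {F}) (diagonal C (last bs)))}"

definition ext_zero ::
    "('o, 'm) add_cat \<Rightarrow> 'o set \<Rightarrow> nat \<Rightarrow> 'o \<Rightarrow> 'o \<Rightarrow> 'm list set" where
  "ext_zero C S t A B =
     (THE \<zeta>. \<zeta> \<in> Ext C S t A B \<and> (\<forall>\<gamma> \<in> Ext C S t A B. baer_sum C S \<zeta> \<gamma> = \<gamma>))"

definition Ext_group ::
    "('o, 'm) add_cat \<Rightarrow> 'o set \<Rightarrow> nat \<Rightarrow> 'o \<Rightarrow> 'o \<Rightarrow> 'm list set monoid" where
  "Ext_group C S t A B =
     \<lparr>carrier = Ext C S t A B, mult = baer_sum C S, one = ext_zero C S t A B\<rparr>"


section \<open>\<open>n\<close>-Frobenius categories\<close>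

definition n_projective :: "('o, 'm) add_cat \<Rightarrow> 'o set \<Rightarrow> nat \<Rightarrow> 'o \<Rightarrow> bool" where
  "n_projective C S n P \<longleftrightarrow>
     P \<in> S \<and> (\<forall>i > n. \<forall>Y \<in> S. Ext C S i P Y = {ext_zero C S i P Y})"

definition n_injective :: "('o, 'm) add_cat \<Rightarrow> 'o set \<Rightarrow> nat \<Rightarrow> 'o \<Rightarrow> bool" where
  "n_injective C S n P \<longleftrightarrow>
     P \<in> S \<and> (\<forall>i > n. \<forall>Y \<in> S. Ext C S i Y P = {ext_zero C S i Y P})"

locale n_Frobenius_category = extension_closed_subcategory +
  fixes n :: nat
  assumes enough_n_projectives:
      "A \<in> S \<Longrightarrow> \<exists>p. deflation C S p \<and> n_projective C S n (Src C p) \<and> Tgt C p = A"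
    and enough_n_injectives:
      "A \<in> S \<Longrightarrow> \<exists>i. inflation C S i \<and> Src C i = A \<and> n_injective C S n (Tgt C i)"
    and n_projective_iff_n_injective: "n_projective C S n P \<longleftrightarrow> n_injective C S n P"

definition proj_part ::
    "('o, 'm) add_cat \<Rightarrow> 'o set \<Rightarrow> nat \<Rightarrow> 'o \<Rightarrow> 'o \<Rightarrow> 'm list set set" where
  "proj_part C S n X Y = {ext_pull C S \<eta> h | \<eta> h P.
     n_projective C S n P \<and> h \<in> Hom C X P \<and> \<eta> \<in> Ext C S n P Y}"

definition ext_bar ::
    "('o, 'm) add_cat \<Rightarrow> 'o set \<Rightarrow> nat \<Rightarrow> 'o \<Rightarrow> 'o \<Rightarrow> 'm list set \<Rightarrow> 'm list set set" where
  "ext_bar C S n X Y \<gamma> = proj_part C S n X Y #>\<^bsub>Ext_group C S n X Y\<^esub> \<gamma>"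

text \<open>The elements of \<open>Ext\<^sup>n(A, B)\<close> represented by sequences
  \<open>B \<rightarrow> P\<^sub>n\<^sub>-\<^sub>1 \<rightarrow> \<dots> \<rightarrow> P\<^sub>0 \<rightarrow> A\<close> with all \<open>P\<^sub>i\<close> \<open>n\<close>-projective; the \<open>P\<^sub>i\<close> are the
  targets of all maps but the last.\<close>

definition unit_conflations ::
    "('o, 'm) add_cat \<Rightarrow> 'o set \<Rightarrow> nat \<Rightarrow> 'o \<Rightarrow> 'o \<Rightarrow> 'm list set set" where
  "unit_conflations C S n A B = {\<delta> \<in> Ext C S n A B.
     \<exists>E \<in> \<delta>. \<forall>d \<in> set (butlast E). n_projective C S n (Tgt C d)}"

definition quasi_invertible :: "('o, 'm) add_cat \<Rightarrow> 'o set \<Rightarrow> nat \<Rightarrow> 'm \<Rightarrow> bool" where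
  "quasi_invertible C S n f \<longleftrightarrow> f \<in> Arr C \<and> Src C f \<in> S \<and> Tgt C f \<in> S \<and>
     (\<forall>X \<in> S. ext_push C S f \<in>
        iso (Ext_group C S (n + 1) X (Src C f)) (Ext_group C S (n + 1) X (Tgt C f)))"

text \<open>Here \<open>\<delta> \<in> Ext\<^sup>n(A, B)\<close> and \<open>\<delta>' \<in> Ext\<^sup>n(A', B)\<close> are unit conflations.\<close>

definition co_angled_pair :: "('o, 'm) add_cat \<Rightarrow> 'o set \<Rightarrow> nat \<Rightarrow> 'o \<Rightarrow> 'o \<Rightarrow> 'o \<Rightarrow>
    'm list set \<Rightarrow> 'm \<Rightarrow> 'm list set \<Rightarrow> 'm \<Rightarrow> bool" where
  "co_angled_pair C S n A A' B \<delta> a \<delta>' b \<longleftrightarrow>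
     Src C a = Src C b \<and> Tgt C a = A \<and> Tgt C b = A' \<and>
     deflation C S a \<and> quasi_invertible C S n a \<and>
     deflation C S b \<and> quasi_invertible C S n b \<and>
     ext_pull C S \<delta> a = ext_pull C S \<delta>' b \<and>
     ext_pull C S \<delta> a \<in> unit_conflations C S n (Src C a) B"

text \<open>The elements \<open>\<gamma>'\<close> which \<open>\<gamma>b\<^sup>-\<^sup>1\<close> may denote, for \<open>\<gamma> \<in> Ext\<^sup>n(X, Y)\<close> and \<open>b : X \<rightarrow> X'\<close>.\<close>

definition ext_pull_inv :: "('o, 'm) add_cat \<Rightarrow> 'o set \<Rightarrow> nat \<Rightarrow> 'o \<Rightarrow>
    'm list set \<Rightarrow> 'm \<Rightarrow> 'm list set set" where
  "ext_pull_inv C S n Y \<gamma> b = (let G = Ext_group C S n (Src C b) Y in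
     {\<gamma>' \<in> Ext C S n (Tgt C b) Y.
        \<gamma> \<otimes>\<^bsub>G\<^esub> inv\<^bsub>G\<^esub> (ext_pull C S \<gamma>' b) \<in> proj_part C S n (Src C b) Y})"

text \<open>\<open>B\<close> plays the role of \<open>\<Omega>\<^sup>nM\<close>. The product of two classes modulo \<open>proj_part\<close> is the union
  of the classes arising from all admissible choices; that these agree is the
  well-definedness of the product.\<close>

definition ext_circ :: "('o, 'm) add_cat \<Rightarrow> 'o set \<Rightarrow> nat \<Rightarrow> 'o \<Rightarrow> 'o \<Rightarrow> 'm list set \<Rightarrow>
    'm list set set \<Rightarrow> 'm list set set \<Rightarrow> 'm list set set" where
  "ext_circ C S n M B \<delta>\<^sub>M x y = \<Union>{ext_bar C S n M B (ext_pull C S \<epsilon> f) | \<epsilon> f \<beta> \<gamma> A \<delta> a b.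
     \<beta> \<in> x \<and> \<gamma> \<in> y \<and>
     \<delta> \<in> unit_conflations C S n A B \<and> f \<in> Hom C M A \<and> \<gamma> = ext_pull C S \<delta> f \<and>
     co_angled_pair C S n M A B \<delta>\<^sub>M a \<delta> b \<and>
     \<epsilon> \<in> ext_pull_inv C S n B (ext_pull C S \<beta> a) b}"

definition stable_ring :: "('o, 'm) add_cat \<Rightarrow> 'o set \<Rightarrow> nat \<Rightarrow> 'o \<Rightarrow> 'o \<Rightarrow> 'm list set \<Rightarrow>
    'm list set set ring" where
  "stable_ring C S n M B \<delta>\<^sub>M = (let Q = Ext_group C S n M B Mod proj_part C S n M B in
     \<lparr>carrier = carrier Q, mult = ext_circ C S n M B \<delta>\<^sub>M, one = ext_bar C S n M B \<delta>\<^sub>M,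
      zero = one Q, add = mult Q\<rparr>)"

end

theory Submission
  imports Defs
begin

text \<open>In positive degrees, Yoneda products with a unit conflation \<open>\<delta> \<in> Ext\<^sup>n(A, B)\<close> behave as products
  with an invertible element: \<open>\<gamma> \<mapsto> \<delta> \<star> \<gamma>\<close> and \<open>\<gamma> \<mapsto> \<gamma> \<star> \<delta>\<close> are injective in degrees above \<open>n\<close> and
  surjective from degree \<open>n\<close> on, by the long exact sequences, and their kernels in degree \<open>n\<close> are the
  groups \<open>proj_part\<close>. Fix a unit conflation \<open>\<tau>\<close> beginning with \<open>M\<close>. Then
  \<open>\<gamma> \<star> \<tau> = \<delta>\<^sub>M \<star> g\<close> and \<open>\<epsilon> \<star> \<tau> = \<beta> \<star> g\<close> for some \<open>g\<close> determine \<open>\<epsilon>\<close> modulo \<open>proj_part\<close>, and this \<open>\<epsilon>\<close>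
  represents the product of \<open>\<beta>\<close> and \<open>\<gamma>\<close>, whichever unit factorization and co-angled pair compute it.
  With this description the ring axioms follow from associativity and biadditivity of the Yoneda
  product.

  Exactness of the sequences in higher degrees rests on one fact: if \<open>\<omega> \<star> \<gamma> = 0\<close> with \<open>\<omega>\<close> of degree
  1, then \<open>\<gamma>\<close> is a push-out along some \<open>\<beta>\<close> with \<open>\<omega>\<beta> = 0\<close>. This property of a spliced sequence is
  invariant under the morphisms which generate Yoneda equivalence, and it holds for a sequence that
  represents 0. Statements about pull-backs are those about push-outs in the opposite category.\<close>

section \<open>Arrows in additive and abelian categories\<close>

text \<open>Two obstacles shape the development. Operations on classes are unions over all
  representatives and all choices of (co)limits, and equivalence is a zigzag of morphisms without a
  normal form. Each construction is therefore first treated as a relation between a sequence and a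
  value, and \<open>yoneda_eq_invariant\<close> carries the value along a zigzag as soon as single
  morphisms respect it. The second obstacle is the degree: cancellation of a unit conflation is
  exact only above n, while the ring lives in degree n, where division is possible but its result is
  determined only up to \<open>proj_part\<close>. Multiplication with \<tau> turns equality of
  cosets into equality in degree 2n, and equations there are checked after multiplication with one
  more unit conflation. The group laws of Ext come from those of Hom: any two classes in Ext(A, B)
  are push-outs of a single class along two morphisms, and their Baer sum is its push-out along the
  sum of these morphisms.\<close>

context category
begin

lemma comp_simps [simp]:
  assumes "f \<in> Arr C" "g \<in> Arr C" "Tgt C f = Src C g"
  shows "g \<cdot> f \<in> Arr C" "Src C (g \<cdot> f) = Src C f" "Tgt C (g \<cdot> f) = Tgt C g"
  using Comp_closed[of f "Src C f" "Tgt C f" g "Tgt C g"] assms by (auto simp: Hom_def)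

lemma comp_assoc [simp]:
  assumes "f \<in> Arr C" "g \<in> Arr C" "h \<in> Arr C" "Tgt C f = Src C g" "Tgt C g = Src C h"
  shows "(h \<cdot> g) \<cdot> f = h \<cdot> (g \<cdot> f)"
  using Comp_assoc[of f "Src C f" "Tgt C f" g "Tgt C g" h "Tgt C h"] assms by (auto simp: Hom_def)

text \<open>The simplifier nests composites to the right, where an equation for
  \<open>h \<cdot> g\<close> no longer matches; this is its form with a trailing factor.\<close>

lemma comp_eq:
  assumes "h \<cdot> g = k" "f \<in> Arr C" "g \<in> Arr C" "h \<in> Arr C" "Tgt C f = Src C g" "Tgt C g = Src C h"
  shows "h \<cdot> (g \<cdot> f) = k \<cdot> f"
  using comp_assoc[of f g h] assms by simp

lemma Idt_simps [simp]:
  assumes "A \<in> Obj C"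
  shows "Idt C A \<in> Arr C" "Src C (Idt C A) = A" "Tgt C (Idt C A) = A"
  using Idt_closed[OF assms] by (auto simp: Hom_def)

lemma comp_Idt [simp]: "f \<in> Arr C \<Longrightarrow> Src C f = A \<Longrightarrow> f \<cdot> Idt C A = f"
  using Comp_Idt[of f A "Tgt C f"] by (auto simp: Hom_def)

lemma Idt_comp [simp]: "f \<in> Arr C \<Longrightarrow> Tgt C f = A \<Longrightarrow> Idt C A \<cdot> f = f"
  using Idt_Comp[of f "Src C f" A] by (auto simp: Hom_def)

lemma Hom_obj: "f \<in> Hom C A B \<Longrightarrow> A \<in> Obj C \<and> B \<in> Obj C"
  using Src_closed Tgt_closed by (auto simp: Hom_def)

end

declare (in category) Src_closed [simp] Tgt_closed [simp]

text \<open>The hom-group is read off the source and target of the argument, so that negatives can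
  be written without naming objects.\<close>

definition hneg :: "('o, 'm) add_cat \<Rightarrow> 'm \<Rightarrow> 'm" where
  "hneg C f = inv\<^bsub>hom_group C (Src C f) (Tgt C f)\<^esub> f"

section \<open>Arithmetic in hom-groups\<close>

context preadditive_category
begin

abbreviation hadd :: "'b \<Rightarrow> 'b \<Rightarrow> 'b" (infixl "\<boxplus>" 65) where
  "f \<boxplus> g \<equiv> HAdd C f g"

lemma hom_comm_group:
  assumes "f \<in> Arr C" shows "comm_group (hom_group C (Src C f) (Tgt C f))"
  using Hom_comm_group assms by simp

lemma hadd_simps [simp]:
  assumes "f \<in> Arr C" "g \<in> Arr C" "Src C f = Src C g" "Tgt C f = Tgt C g"
  shows "f \<boxplus> g \<in> Arr C" "Src C (f \<boxplus> g) = Src C g" "Tgt C (f \<boxplus> g) = Tgt C g"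
proof -
  interpret G: comm_group "hom_group C (Src C f) (Tgt C f)" using assms hom_comm_group by simp
  show "f \<boxplus> g \<in> Arr C" "Src C (f \<boxplus> g) = Src C g" "Tgt C (f \<boxplus> g) = Tgt C g"
    using G.m_closed[of f g] assms by (auto simp: hom_group_def Hom_def)
qed

lemma hadd_assoc:
  assumes "f \<in> Arr C" "g \<in> Arr C" "h \<in> Arr C" "Src C f = Src C g" "Tgt C f = Tgt C g"
    "Src C g = Src C h" "Tgt C g = Tgt C h"
  shows "f \<boxplus> g \<boxplus> h = f \<boxplus> (g \<boxplus> h)"
proof -
  interpret G: comm_group "hom_group C (Src C f) (Tgt C f)" using assms hom_comm_group by simp
  show ?thesis
    using G.m_assoc[of f g h] assms by (auto simp: hom_group_def Hom_def)
qed

lemma hadd_commute: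
  assumes "f \<in> Arr C" "g \<in> Arr C" "Src C f = Src C g" "Tgt C f = Tgt C g"
  shows "f \<boxplus> g = g \<boxplus> f"
proof -
  interpret G: comm_group "hom_group C (Src C f) (Tgt C f)" using assms hom_comm_group by simp
  show ?thesis
    using G.m_comm[of f g] assms by (auto simp: hom_group_def Hom_def)
qed

lemma hzero_simps [simp]:
  assumes "A \<in> Obj C" "B \<in> Obj C"
  shows "HZero C A B \<in> Arr C" "Src C (HZero C A B) = A" "Tgt C (HZero C A B) = B"
proof -
  interpret G: comm_group "hom_group C A B" using assms Hom_comm_group by simp
  show "HZero C A B \<in> Arr C" "Src C (HZero C A B) = A" "Tgt C (HZero C A B) = B"
    using G.one_closed by (auto simp: hom_group_def Hom_def)
qed

lemma hadd_zero [simp]: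
  assumes "f \<in> Arr C" "Src C f = A" "Tgt C f = B"
  shows "f \<boxplus> HZero C A B = f" "HZero C A B \<boxplus> f = f"
proof -
  interpret G: comm_group "hom_group C A B" using assms hom_comm_group by auto
  show "f \<boxplus> HZero C A B = f" "HZero C A B \<boxplus> f = f"
    using G.r_one[of f] G.l_one[of f] assms by (auto simp: hom_group_def Hom_def)
qed

lemma hneg_simps [simp]:
  assumes "f \<in> Arr C"
  shows "hneg C f \<in> Arr C" "Src C (hneg C f) = Src C f" "Tgt C (hneg C f) = Tgt C f"
    "f \<boxplus> hneg C f = HZero C (Src C f) (Tgt C f)" "hneg C f \<boxplus> f = HZero C (Src C f) (Tgt C f)"
proof -
  interpret G: comm_group "hom_group C (Src C f) (Tgt C f)" using assms hom_comm_group by auto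
  have "f \<in> carrier (hom_group C (Src C f) (Tgt C f))"
    using assms by (auto simp: hom_group_def Hom_def)
  from G.inv_closed[OF this] G.r_inv[OF this] G.l_inv[OF this]
  show "hneg C f \<in> Arr C" "Src C (hneg C f) = Src C f" "Tgt C (hneg C f) = Tgt C f"
    "f \<boxplus> hneg C f = HZero C (Src C f) (Tgt C f)" "hneg C f \<boxplus> f = HZero C (Src C f) (Tgt C f)"
    unfolding hneg_def by (auto simp: hom_group_def Hom_def)
qed

lemma hadd_cancel:
  assumes "f \<boxplus> g = f \<boxplus> h" "f \<in> Arr C" "g \<in> Arr C" "h \<in> Arr C"
    "Src C f = Src C g" "Tgt C f = Tgt C g" "Src C g = Src C h" "Tgt C g = Tgt C h"
  shows "g = h"
proof -
  have "hneg C f \<boxplus> f \<boxplus> g = hneg C f \<boxplus> f \<boxplus> h"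
    using assms by (simp add: hadd_assoc del: hneg_simps(4,5))
  then show ?thesis using assms(2-) by simp
qed

lemma eq_hneg:
  assumes "f \<boxplus> g = HZero C A B" "f \<in> Arr C" "g \<in> Arr C"
    "Src C f = A" "Tgt C f = B" "Src C g = A" "Tgt C g = B"
  shows "g = hneg C f"
  by (rule hadd_cancel[of f]) (use assms in auto)

lemma hneg_hneg [simp]: "f \<in> Arr C \<Longrightarrow> hneg C (hneg C f) = f"
  by (rule eq_hneg[symmetric]) auto

lemma comp_hadd:
  assumes "f \<in> Arr C" "g \<in> Arr C" "h \<in> Arr C" "Src C f = Src C g" "Tgt C f = Tgt C g" "Src C h = Tgt C g"
  shows "h \<cdot> (f \<boxplus> g) = h \<cdot> f \<boxplus> h \<cdot> g"
  using Comp_HAdd[of f "Src C f" "Tgt C f" g h "Tgt C h"] assms by (auto simp: Hom_def)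

lemma hadd_comp:
  assumes "f \<in> Arr C" "g \<in> Arr C" "h \<in> Arr C" "Src C f = Src C g" "Tgt C f = Tgt C g" "Tgt C h = Src C g"
  shows "(f \<boxplus> g) \<cdot> h = f \<cdot> h \<boxplus> g \<cdot> h"
  using HAdd_Comp[of h "Src C h" "Tgt C h" f "Tgt C f" g] assms by (auto simp: Hom_def)

text \<open>Biadditivity gives h0 + h0 = h0, and h0 cancels.\<close>

lemma comp_zero [simp]:
  assumes "h \<in> Arr C" "Src C h = B" "A \<in> Obj C"
  shows "h \<cdot> HZero C A B = HZero C A (Tgt C h)"
proof -
  have "h \<cdot> HZero C A B \<boxplus> h \<cdot> HZero C A B = h \<cdot> HZero C A B \<boxplus> HZero C A (Tgt C h)"
    using assms by (subst comp_hadd[symmetric]) auto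
  then show ?thesis by (rule hadd_cancel) (use assms in auto)
qed

lemma zero_comp [simp]:
  assumes "h \<in> Arr C" "Tgt C h = A" "B \<in> Obj C"
  shows "HZero C A B \<cdot> h = HZero C (Src C h) B"
proof -
  have "HZero C A B \<cdot> h \<boxplus> HZero C A B \<cdot> h = HZero C A B \<cdot> h \<boxplus> HZero C (Src C h) B"
    using assms by (subst hadd_comp[symmetric]) auto
  then show ?thesis by (rule hadd_cancel) (use assms in auto)
qed

lemma comp_hneg [simp]:
  assumes "f \<in> Arr C" "h \<in> Arr C" "Src C h = Tgt C f"
  shows "h \<cdot> hneg C f = hneg C (h \<cdot> f)"
  by (rule eq_hneg) (use assms in \<open>auto simp flip: comp_hadd\<close>)

lemma hneg_comp [simp]:
  assumes "f \<in> Arr C" "h \<in> Arr C" "Src C h = Tgt C f"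
  shows "hneg C h \<cdot> f = hneg C (h \<cdot> f)"
  by (rule eq_hneg) (use assms in \<open>auto simp flip: hadd_comp\<close>)

lemma hneg_zero [simp]: "A \<in> Obj C \<Longrightarrow> B \<in> Obj C \<Longrightarrow> hneg C (HZero C A B) = HZero C A B"
  by (rule eq_hneg[symmetric]) auto

lemma diff_zero:
  assumes "f \<boxplus> hneg C g = HZero C A B" "f \<in> Arr C" "g \<in> Arr C"
    "Src C f = A" "Tgt C f = B" "Src C g = A" "Tgt C g = B"
  shows "f = g"
proof -
  have "hneg C g = hneg C f" by (rule eq_hneg) (use assms in auto)
  then show ?thesis using assms(2,3) hneg_hneg by metis
qed

end

section \<open>The opposite category\<close>

definition opp :: "('o, 'm) add_cat \<Rightarrow> ('o, 'm) add_cat" where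
  "opp C = \<lparr>Obj = Obj C, Arr = Arr C, Src = Tgt C, Tgt = Src C, Idt = Idt C,
     Comp = (\<lambda>g f. Comp C f g), HAdd = HAdd C, HZero = (\<lambda>A B. HZero C B A)\<rparr>"

text \<open>The opposite of the opposite is the same record, so a lemma proved in a locale yields
  its dual by interpreting the locale at \<open>opp C\<close> and simplifying.\<close>

lemma opp_simps [simp]:
  "Obj (opp C) = Obj C" "Arr (opp C) = Arr C" "Src (opp C) = Tgt C" "Tgt (opp C) = Src C"
  "Idt (opp C) = Idt C" "g \<cdot>\<^bsub>opp C\<^esub> f = f \<cdot>\<^bsub>C\<^esub> g" "HAdd (opp C) = HAdd C"
  "HZero (opp C) A B = HZero C B A" "opp (opp C) = C" "Hom (opp C) A B = Hom C B A"
  "hom_group (opp C) A B = hom_group C B A"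
  by (auto simp: opp_def Hom_def hom_group_def)

lemma hneg_opp [simp]: "hneg (opp C) = hneg C"
  by (auto simp: hneg_def fun_eq_iff)

lemma is_zero_obj_opp [simp]: "is_zero_obj (opp C) Z = is_zero_obj C Z"
  by (auto simp: is_zero_obj_def)

lemma is_kernel_opp [simp]: "is_kernel (opp C) f k = is_cokernel C f k"
  by (auto simp: is_kernel_def is_cokernel_def)

lemma is_cokernel_opp [simp]: "is_cokernel (opp C) f k = is_kernel C f k"
  by (auto simp: is_kernel_def is_cokernel_def)

lemma is_mono_opp [simp]: "is_mono (opp C) f = is_epi C f"
  by (auto simp: is_mono_def is_epi_def)

lemma is_epi_opp [simp]: "is_epi (opp C) f = is_mono C f"
  by (auto simp: is_mono_def is_epi_def)

lemma short_exact_opp [simp]: "short_exact (opp C) p i = short_exact C i p"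
  by (auto simp: short_exact_def)

lemma is_pushout_opp [simp]: "is_pushout (opp C) p h p' h' = is_pullback C p h p' h'"
  unfolding is_pushout_def is_pullback_def by auto

lemma is_pullback_opp [simp]: "is_pullback (opp C) p h p' h' = is_pushout C p h p' h'"
  unfolding is_pushout_def is_pullback_def by auto

lemma is_biproduct_opp [simp]:
  "is_biproduct (opp C) A B D (p, q, i, j) = is_biproduct C A B D (i, j, p, q)"
  by auto

lemma (in category) category_opp: "category (opp C)"
  by unfold_locales (auto simp: Hom_def)

lemma (in preadditive_category) preadditive_category_opp: "preadditive_category (opp C)"
proof -
  interpret o: category "opp C" by (rule category_opp)
  show ?thesis
    by (intro preadditive_category.intro preadditive_category_axioms.intro o.category_axioms)
      (auto simp: Hom_def Hom_comm_group hadd_comp comp_hadd)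
qed

lemma (in abelian_category) abelian_category_opp: "abelian_category (opp C)"
proof -
  interpret o: preadditive_category "opp C" by (rule preadditive_category_opp)
  have "\<exists>D b. is_biproduct (opp C) A B D b" if "A \<in> Obj C" "B \<in> Obj C" for A B
    using biproduct_exists[OF that] is_biproduct_opp by (metis prod_cases4)
  then show ?thesis
    by (intro abelian_category.intro abelian_category_axioms.intro o.preadditive_category_axioms)
      (auto simp: zero_obj_exists kernel_exists cokernel_exists mono_normal epi_normal)
qed

section \<open>Monos and epis, kernels, push-outs and biproducts\<close>

context category
begin

lemma mono_cancel:
  assumes "is_mono C f" "f \<cdot> g = f \<cdot> h" "g \<in> Arr C" "h \<in> Arr C" "Tgt C g = Src C f" "Tgt C h = Src C f"
    "Src C g = Src C h"
  shows "g = h"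
  using assms unfolding is_mono_def by blast

lemma epi_cancel:
  assumes "is_epi C f" "g \<cdot> f = h \<cdot> f" "g \<in> Arr C" "h \<in> Arr C" "Src C g = Tgt C f" "Src C h = Tgt C f"
    "Tgt C g = Tgt C h"
  shows "g = h"
  using assms unfolding is_epi_def by blast

lemma mono_comp:
  assumes f: "is_mono C f" and g: "is_mono C g" and "Tgt C g = Src C f"
  shows "is_mono C (f \<cdot> g)"
proof -
  have *: "f \<in> Arr C" "g \<in> Arr C" using f g by (auto simp: is_mono_def)
  show ?thesis
    unfolding is_mono_def
  proof (intro conjI ballI impI)
    show "f \<cdot> g \<in> Arr C" using * assms by simp
    fix h k
    assume "h \<in> Arr C" "k \<in> Arr C" "Tgt C h = Src C (f \<cdot> g) \<and> Tgt C k = Src C (f \<cdot> g) \<and>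
      Src C h = Src C k \<and> (f \<cdot> g) \<cdot> h = (f \<cdot> g) \<cdot> k"
    with * assms have h: "h \<in> Arr C" "k \<in> Arr C" "Tgt C h = Src C g" "Tgt C k = Src C g"
      "Src C h = Src C k" "f \<cdot> (g \<cdot> h) = f \<cdot> (g \<cdot> k)" by auto
    have "g \<cdot> h = g \<cdot> k" by - (rule mono_cancel[OF f]; use h * assms in simp)
    then show "h = k" by - (rule mono_cancel[OF g]; use h * assms in simp)
  qed
qed

lemma kernelD:
  assumes "is_kernel C f k"
  shows "f \<in> Arr C" "k \<in> Arr C" "Tgt C k = Src C f" "f \<cdot> k = HZero C (Src C k) (Tgt C f)"
  using assms unfolding is_kernel_def by blast+

lemma cokernelD:
  assumes "is_cokernel C f k"
  shows "f \<in> Arr C" "k \<in> Arr C" "Src C k = Tgt C f" "k \<cdot> f = HZero C (Src C f) (Tgt C k)"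
  using assms unfolding is_cokernel_def by blast+

lemma kernel_factor:
  assumes "is_kernel C f k" "g \<in> Arr C" "Tgt C g = Src C f" "f \<cdot> g = HZero C (Src C g) (Tgt C f)"
  obtains u where "u \<in> Arr C" "Src C u = Src C g" "Tgt C u = Src C k" "k \<cdot> u = g"
  using assms unfolding is_kernel_def Hom_def by blast

lemma cokernel_factor:
  assumes "is_cokernel C f c" "g \<in> Arr C" "Src C g = Tgt C f" "g \<cdot> f = HZero C (Src C f) (Tgt C g)"
  obtains u where "u \<in> Arr C" "Tgt C u = Tgt C g" "Src C u = Tgt C c" "u \<cdot> c = g"
  using assms unfolding is_cokernel_def Hom_def by blast

lemma short_exactD:
  assumes "short_exact C i p"
  shows "is_kernel C p i" "is_cokernel C i p" "i \<in> Arr C" "p \<in> Arr C" "Tgt C i = Src C p"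
    "p \<cdot> i = HZero C (Src C i) (Tgt C p)"
  using assms unfolding short_exact_def is_kernel_def by blast+

lemma pushoutD:
  assumes "is_pushout C i g i' g'"
  shows "i \<in> Arr C" "g \<in> Arr C" "i' \<in> Arr C" "g' \<in> Arr C"
     "Src C i = Src C g" "Src C i' = Tgt C g" "Src C g' = Tgt C i" "Tgt C i' = Tgt C g'"
     "i' \<cdot> g = g' \<cdot> i"
  using assms unfolding is_pushout_def by blast+

lemma pushout_unique:
  assumes "is_pushout C i g i' g'" "u \<in> Arr C" "v \<in> Arr C" "Src C u = Tgt C i" "Src C v = Tgt C g"
    "Tgt C u = Tgt C v" "u \<cdot> i = v \<cdot> g"
  shows "\<exists>!w. w \<in> Hom C (Tgt C i') (Tgt C u) \<and> w \<cdot> g' = u \<and> w \<cdot> i' = v"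
  using assms unfolding is_pushout_def by blast

lemma pushout_factor:
  assumes "is_pushout C i g i' g'" "u \<in> Arr C" "v \<in> Arr C" "Src C u = Tgt C i" "Src C v = Tgt C g"
    "Tgt C u = Tgt C v" "u \<cdot> i = v \<cdot> g"
  obtains w where "w \<in> Arr C" "Src C w = Tgt C g'" "Tgt C w = Tgt C u" "w \<cdot> g' = u" "w \<cdot> i' = v"
proof -
  obtain w where "w \<in> Hom C (Tgt C i') (Tgt C u) \<and> w \<cdot> g' = u \<and> w \<cdot> i' = v"
    using ex1_implies_ex[OF pushout_unique[OF assms]] by blast
  then show ?thesis
    using pushoutD(8)[OF assms(1)] by (intro that[of w]) (simp_all add: Hom_def)
qed

lemma pushout_eq:
  assumes po: "is_pushout C i g i' g'" and w: "w \<in> Arr C" "w' \<in> Arr C" "Src C w = Tgt C g'"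
    "Src C w' = Tgt C g'" "Tgt C w = Tgt C w'" "w \<cdot> g' = w' \<cdot> g'" "w \<cdot> i' = w' \<cdot> i'"
  shows "w = w'"
proof -
  note [simp] = pushoutD(1-8)[OF po] w(1-5)
  have "(w \<cdot> g') \<cdot> i = (w \<cdot> i') \<cdot> g" by (simp add: pushoutD(9)[OF po])
  then have "\<exists>!x. x \<in> Hom C (Tgt C i') (Tgt C (w \<cdot> g')) \<and> x \<cdot> g' = w \<cdot> g' \<and> x \<cdot> i' = w \<cdot> i'"
    by (intro pushout_unique[OF po]) auto
  moreover have "w \<in> Hom C (Tgt C i') (Tgt C (w \<cdot> g'))" "w' \<in> Hom C (Tgt C i') (Tgt C (w \<cdot> g'))"
    by (simp_all add: Hom_def)
  ultimately show ?thesis using w(6,7) by metis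
qed

lemma biproductD:
  assumes "is_biproduct C A B D (i, j, p, q)"
  shows "A \<in> Obj C" "B \<in> Obj C" "D \<in> Obj C"
    "i \<in> Arr C" "Src C i = A" "Tgt C i = D" "j \<in> Arr C" "Src C j = B" "Tgt C j = D"
    "p \<in> Arr C" "Src C p = D" "Tgt C p = A" "q \<in> Arr C" "Src C q = D" "Tgt C q = B"
    "p \<cdot> i = Idt C A" "q \<cdot> j = Idt C B" "p \<cdot> j = HZero C B A" "q \<cdot> i = HZero C A B"
    "HAdd C (i \<cdot> p) (j \<cdot> q) = Idt C D"
  using assms by (simp_all add: Hom_def)

lemma biproduct_comps:
  assumes "is_biproduct C A B D (i, j, p, q)" "f \<in> Arr C"
  shows "Tgt C f = A \<Longrightarrow> p \<cdot> (i \<cdot> f) = f" "Tgt C f = B \<Longrightarrow> q \<cdot> (j \<cdot> f) = f"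
    "Tgt C f = B \<Longrightarrow> p \<cdot> (j \<cdot> f) = HZero C B A \<cdot> f" "Tgt C f = A \<Longrightarrow> q \<cdot> (i \<cdot> f) = HZero C A B \<cdot> f"
  using biproductD[OF assms(1)] assms(2) comp_eq by auto

end

context preadditive_category
begin

lemma monoI:
  assumes "f \<in> Arr C"
    "\<And>g. g \<in> Arr C \<Longrightarrow> Tgt C g = Src C f \<Longrightarrow> f \<cdot> g = HZero C (Src C g) (Tgt C f) \<Longrightarrow>
      g = HZero C (Src C g) (Src C f)"
  shows "is_mono C f"
  unfolding is_mono_def
proof (intro conjI ballI impI)
  fix g h
  assume g: "g \<in> Arr C" and h: "h \<in> Arr C"
    and gh: "Tgt C g = Src C f \<and> Tgt C h = Src C f \<and> Src C g = Src C h \<and> f \<cdot> g = f \<cdot> h"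
  have "f \<cdot> (g \<boxplus> hneg C h) = HZero C (Src C (g \<boxplus> hneg C h)) (Tgt C f)"
    using g h gh assms(1) by (simp add: comp_hadd)
  from assms(2)[OF _ _ this] g h gh have "g \<boxplus> hneg C h = HZero C (Src C g) (Src C f)" by simp
  then show "g = h" by (rule diff_zero) (use g h gh in simp_all)
qed (rule assms)

lemma kernel_mono:
  assumes "is_kernel C f k" shows "is_mono C k"
proof -
  note [simp] = kernelD[OF assms]
  show ?thesis
    unfolding is_mono_def
  proof (intro conjI ballI impI)
    fix g h
    assume g: "g \<in> Arr C" and h: "h \<in> Arr C"
      and gh: "Tgt C g = Src C k \<and> Tgt C h = Src C k \<and> Src C g = Src C h \<and> k \<cdot> g = k \<cdot> h"
    have "f \<cdot> (k \<cdot> g) = HZero C (Src C k) (Tgt C f) \<cdot> g"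
      by (rule comp_eq) (use g gh in simp_all)
    also have "\<dots> = HZero C (Src C (k \<cdot> g)) (Tgt C f)" using g h gh by simp
    finally have "f \<cdot> (k \<cdot> g) = HZero C (Src C (k \<cdot> g)) (Tgt C f)" .
    moreover have "k \<cdot> g \<in> Arr C \<and> Tgt C (k \<cdot> g) = Src C f" using g h gh by simp
    ultimately have "\<exists>!u. u \<in> Hom C (Src C (k \<cdot> g)) (Src C k) \<and> k \<cdot> u = k \<cdot> g"
      using assms unfolding is_kernel_def by blast
    moreover have "g \<in> Hom C (Src C (k \<cdot> g)) (Src C k)" "h \<in> Hom C (Src C (k \<cdot> g)) (Src C k)"
      using g h gh by (simp_all add: Hom_def)
    ultimately show "g = h" using gh by metis
  qed simp
qed

lemma cokernel_epi:
  assumes "is_cokernel C f k" shows "is_epi C k"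
proof -
  interpret o: preadditive_category "opp C" by (rule preadditive_category_opp)
  show ?thesis using o.kernel_mono[of f k] assms by simp
qed

lemma kernelI:
  assumes "is_mono C k" "f \<in> Arr C" "Tgt C k = Src C f" "f \<cdot> k = HZero C (Src C k) (Tgt C f)"
    "\<And>g. g \<in> Arr C \<Longrightarrow> Tgt C g = Src C f \<Longrightarrow> f \<cdot> g = HZero C (Src C g) (Tgt C f) \<Longrightarrow>
      \<exists>u. u \<in> Arr C \<and> Src C u = Src C g \<and> Tgt C u = Src C k \<and> k \<cdot> u = g"
  shows "is_kernel C f k"
proof -
  have k: "k \<in> Arr C" using assms(1) by (simp add: is_mono_def)
  show ?thesis
    unfolding is_kernel_def
  proof (intro conjI ballI impI)
    fix g assume g: "g \<in> Arr C" "Tgt C g = Src C f \<and> f \<cdot> g = HZero C (Src C g) (Tgt C f)"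
    then obtain u where u: "u \<in> Arr C" "Src C u = Src C g" "Tgt C u = Src C k" "k \<cdot> u = g"
      using assms(5) by blast
    show "\<exists>!u. u \<in> Hom C (Src C g) (Src C k) \<and> k \<cdot> u = g"
    proof (rule ex1I[of _ u])
      fix v assume "v \<in> Hom C (Src C g) (Src C k) \<and> k \<cdot> v = g"
      then show "v = u" by - (rule mono_cancel[OF assms(1)]; use u in \<open>simp add: Hom_def\<close>)
    qed (use u in \<open>simp_all add: Hom_def\<close>)
  qed (use assms(2-4) k in simp_all)
qed

lemma cokernelI:
  assumes "is_epi C k" "f \<in> Arr C" "Src C k = Tgt C f" "k \<cdot> f = HZero C (Src C f) (Tgt C k)"
    "\<And>g. g \<in> Arr C \<Longrightarrow> Src C g = Tgt C f \<Longrightarrow> g \<cdot> f = HZero C (Src C f) (Tgt C g) \<Longrightarrow>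
      \<exists>u. u \<in> Arr C \<and> Tgt C u = Tgt C g \<and> Src C u = Tgt C k \<and> u \<cdot> k = g"
  shows "is_cokernel C f k"
proof -
  interpret o: preadditive_category "opp C" by (rule preadditive_category_opp)
  show ?thesis using o.kernelI[of k f] assms by simp
qed

lemma biproduct_ext:
  assumes "is_biproduct C A B D (i, j, p, q)" "f \<in> Arr C" "g \<in> Arr C" "Tgt C f = D" "Tgt C g = D"
    "Src C f = Src C g" "p \<cdot> f = p \<cdot> g" "q \<cdot> f = q \<cdot> g"
  shows "f = g"
proof -
  note [simp] = biproductD[OF assms(1)]
  have "(i \<cdot> p \<boxplus> j \<cdot> q) \<cdot> f = (i \<cdot> p \<boxplus> j \<cdot> q) \<cdot> g"
    using assms(2-) by (simp add: hadd_comp del: biproductD(20)[OF assms(1)])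
  then show ?thesis using assms(2-) by simp
qed

lemma biproduct_coext:
  assumes "is_biproduct C A B D (i, j, p, q)" "f \<in> Arr C" "g \<in> Arr C" "Src C f = D" "Src C g = D"
    "Tgt C f = Tgt C g" "f \<cdot> i = g \<cdot> i" "f \<cdot> j = g \<cdot> j"
  shows "f = g"
proof -
  interpret o: preadditive_category "opp C" by (rule preadditive_category_opp)
  show ?thesis
    using o.biproduct_ext[of A B D p q i j f g] assms by (simp del: is_biproduct.simps)
qed

end

section \<open>Short exact sequences and push-outs in an abelian category\<close>

context abelian_category
begin

text \<open>The mono i is a kernel of some g. As g factors through the cokernel p of i, everything
  annihilated by p is annihilated by g and so factors through i.\<close>

lemma mono_short_exact:
  assumes i: "is_mono C i" and p: "is_cokernel C i p"
  shows "short_exact C i p"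
proof -
  obtain g where g: "is_kernel C g i" using mono_normal[OF i] by blast
  note [simp] = kernelD[OF g] cokernelD[OF p]
  obtain u where u: "u \<in> Arr C" "Tgt C u = Tgt C g" "Src C u = Tgt C p" "u \<cdot> p = g"
    using cokernel_factor[OF p, of g] by auto
  have "is_kernel C p i"
  proof (rule kernelI[OF i])
    fix h assume h: "h \<in> Arr C" "Tgt C h = Src C p" "p \<cdot> h = HZero C (Src C h) (Tgt C p)"
    have "g \<cdot> h = u \<cdot> (p \<cdot> h)" using h(1,2) u by (metis comp_eq kernelD(1,3) cokernelD(2,3) g p)
    then have "g \<cdot> h = HZero C (Src C h) (Tgt C g)" using h u by simp
    then show "\<exists>u. u \<in> Arr C \<and> Src C u = Src C h \<and> Tgt C u = Src C i \<and> i \<cdot> u = h"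
      using kernel_factor[OF g h(1)] h by (metis kernelD(3) cokernelD(3) g p)
  qed auto
  then show ?thesis using p by (simp add: short_exact_def)
qed

lemma epi_short_exact:
  assumes "is_epi C p" "is_kernel C p i" shows "short_exact C i p"
proof -
  interpret o: abelian_category "opp C" by (rule abelian_category_opp)
  show ?thesis using o.mono_short_exact[of p i] assms by simp
qed

text \<open>A map out of the biproduct that annihilates (i, -g) is a pair (u, v) with ui = vg, so
  the universal property of this cokernel is that of a push-out.\<close>

lemma cokernel_pushout:
  assumes b: "is_biproduct C (Tgt C i) (Tgt C g) D (i1, i2, p1, p2)"
    and ig: "i \<in> Arr C" "g \<in> Arr C" "Src C i = Src C g"
    and c: "is_cokernel C (i1 \<cdot> i \<boxplus> hneg C (i2 \<cdot> g)) c"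
  shows "is_pushout C i g (c \<cdot> i2) (c \<cdot> i1)"
proof -
  note [simp] = biproductD[OF b] cokernelD(1-3)[OF c] ig
  have [simp]: "Src C c = D" using cokernelD(3)[OF c] by simp
  note bc = biproduct_comps[OF b] biproductD(16-19)[OF b]
  have z: "x \<cdot> (i1 \<cdot> i \<boxplus> hneg C (i2 \<cdot> g)) = (x \<cdot> i1) \<cdot> i \<boxplus> hneg C ((x \<cdot> i2) \<cdot> g)"
    if "x \<in> Arr C" "Src C x = D" for x using that by (simp add: comp_hadd)
  have "c \<cdot> (i1 \<cdot> i \<boxplus> hneg C (i2 \<cdot> g)) = HZero C (Src C i) (Tgt C c)"
    using cokernelD(4)[OF c] by simp
  then have "c \<cdot> i1 \<cdot> i \<boxplus> hneg C (c \<cdot> i2 \<cdot> g) = HZero C (Src C i) (Tgt C c)"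
    by (simp add: comp_hadd)
  then have comm: "c \<cdot> i1 \<cdot> i = c \<cdot> i2 \<cdot> g" by (rule diff_zero) auto
  show ?thesis
    unfolding is_pushout_def
  proof (intro conjI ballI impI)
    fix u v assume uv: "u \<in> Arr C" "v \<in> Arr C" "Src C u = Tgt C i \<and> Src C v = Tgt C g \<and>
      Tgt C u = Tgt C v \<and> u \<cdot> i = v \<cdot> g"
    have e: "(u \<cdot> p1 \<boxplus> v \<cdot> p2) \<cdot> i1 = u" "(u \<cdot> p1 \<boxplus> v \<cdot> p2) \<cdot> i2 = v"
      using uv by (simp_all add: hadd_comp)
    have "(u \<cdot> p1 \<boxplus> v \<cdot> p2) \<cdot> (i1 \<cdot> i \<boxplus> hneg C (i2 \<cdot> g)) = u \<cdot> i \<boxplus> hneg C (v \<cdot> g)"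
      by (subst z) (simp_all only: e, use uv in simp_all)
    then have "(u \<cdot> p1 \<boxplus> v \<cdot> p2) \<cdot> (i1 \<cdot> i \<boxplus> hneg C (i2 \<cdot> g)) = HZero C (Src C i) (Tgt C u)"
      using uv by simp
    then obtain w where w: "w \<in> Arr C" "Tgt C w = Tgt C u" "Src C w = Tgt C c"
      "w \<cdot> c = u \<cdot> p1 \<boxplus> v \<cdot> p2"
      using cokernel_factor[OF c, of "u \<cdot> p1 \<boxplus> v \<cdot> p2"] uv by auto
    have wu: "w \<cdot> c \<cdot> i1 = u" "w \<cdot> c \<cdot> i2 = v"
      using e uv comp_eq[OF w(4), of i1] comp_eq[OF w(4), of i2] w by auto
    show "\<exists>!w. w \<in> Hom C (Tgt C (c \<cdot> i2)) (Tgt C u) \<and> w \<cdot> c \<cdot> i1 = u \<and> w \<cdot> c \<cdot> i2 = v"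
    proof (rule ex1I[of _ w])
      fix x assume "x \<in> Hom C (Tgt C (c \<cdot> i2)) (Tgt C u) \<and> x \<cdot> c \<cdot> i1 = u \<and> x \<cdot> c \<cdot> i2 = v"
      then have x: "x \<in> Arr C" "Src C x = Tgt C c" "Tgt C x = Tgt C u"
        "x \<cdot> c \<cdot> i1 = u" "x \<cdot> c \<cdot> i2 = v" by (simp_all add: Hom_def)
      have "x \<cdot> c = w \<cdot> c" by (rule biproduct_coext[OF b]) (simp_all only: comp_simps comp_assoc cokernelD(1,2)[OF c] x wu w(1-3) biproductD[OF b] \<open>Src C c = D\<close>)
      then show "x = w" by - (rule epi_cancel[OF cokernel_epi[OF c]]; use x w in simp)
    qed (use w wu in \<open>simp_all add: Hom_def\<close>)
  qed (use comm in simp_all)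
qed

lemma pushout_exists:
  assumes "i \<in> Arr C" "g \<in> Arr C" "Src C i = Src C g"
  obtains i' g' where "is_pushout C i g i' g'"
proof -
  obtain D b where b: "is_biproduct C (Tgt C i) (Tgt C g) D b"
    using biproduct_exists[of "Tgt C i" "Tgt C g"] assms by auto
  obtain i1 i2 p1 p2 where "b = (i1, i2, p1, p2)" by (cases b)
  with b have b: "is_biproduct C (Tgt C i) (Tgt C g) D (i1, i2, p1, p2)" by simp
  note [simp] = biproductD[OF b]
  obtain c where "is_cokernel C (i1 \<cdot> i \<boxplus> hneg C (i2 \<cdot> g)) c"
    using cokernel_exists[of "i1 \<cdot> i \<boxplus> hneg C (i2 \<cdot> g)"] assms by auto
  from cokernel_pushout[OF b assms this] that show ?thesis by blast
qed

text \<open>The push-outs in \<open>pushout_seq\<close> are arbitrary ones, not those constructed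
  from a cokernel. They are cokernels all the same, since maps out of a push-out are determined by
  their two legs.\<close>

lemma pushout_cokernel_sum:
  assumes b: "is_biproduct C (Tgt C i) (Tgt C g) D (i1, i2, p1, p2)"
    and po: "is_pushout C i g i' g'"
  shows "is_cokernel C (i1 \<cdot> i \<boxplus> hneg C (i2 \<cdot> g)) (g' \<cdot> p1 \<boxplus> i' \<cdot> p2)"
proof -
  note [simp] = biproductD[OF b] pushoutD(1-8)[OF po]
  let ?c = "g' \<cdot> p1 \<boxplus> i' \<cdot> p2"
  have e: "?c \<cdot> i1 = g'" "?c \<cdot> i2 = i'" by (simp_all add: hadd_comp)
  have z: "x \<cdot> (i1 \<cdot> i \<boxplus> hneg C (i2 \<cdot> g)) = (x \<cdot> i1) \<cdot> i \<boxplus> hneg C ((x \<cdot> i2) \<cdot> g)"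
    if "x \<in> Arr C" "Src C x = D" for x using that by (simp add: comp_hadd)
  show ?thesis
  proof (rule cokernelI)
    show "is_epi C ?c"
      unfolding is_epi_def
    proof (intro conjI ballI impI)
      fix x y assume xy: "x \<in> Arr C" "y \<in> Arr C" "Src C x = Tgt C ?c \<and> Src C y = Tgt C ?c \<and>
        Tgt C x = Tgt C y \<and> x \<cdot> ?c = y \<cdot> ?c"
      have "x \<cdot> g' = y \<cdot> g'" "x \<cdot> i' = y \<cdot> i'" using xy e comp_assoc[of i1 ?c x] comp_assoc[of i1 ?c y]
          comp_assoc[of i2 ?c x] comp_assoc[of i2 ?c y] by auto
      then show "x = y" by - (rule pushout_eq[OF po]; use xy in simp)
    qed auto
    show "?c \<cdot> (i1 \<cdot> i \<boxplus> hneg C (i2 \<cdot> g)) =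
      HZero C (Src C (i1 \<cdot> i \<boxplus> hneg C (i2 \<cdot> g))) (Tgt C ?c)"
      using pushoutD(9)[OF po] by (subst z) (simp_all only: e, simp_all)
    fix x assume x: "x \<in> Arr C" "Src C x = Tgt C (i1 \<cdot> i \<boxplus> hneg C (i2 \<cdot> g))"
      "x \<cdot> (i1 \<cdot> i \<boxplus> hneg C (i2 \<cdot> g)) = HZero C (Src C (i1 \<cdot> i \<boxplus> hneg C (i2 \<cdot> g))) (Tgt C x)"
    then have "(x \<cdot> i1) \<cdot> i \<boxplus> hneg C ((x \<cdot> i2) \<cdot> g) = HZero C (Src C g) (Tgt C x)"
      by (subst z[symmetric]) auto
    then have "(x \<cdot> i1) \<cdot> i = (x \<cdot> i2) \<cdot> g" by (rule diff_zero) (use x in simp_all)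
    then obtain w where w: "w \<in> Arr C" "Src C w = Tgt C g'" "Tgt C w = Tgt C x"
      "w \<cdot> g' = x \<cdot> i1" "w \<cdot> i' = x \<cdot> i2"
      using pushout_factor[OF po, of "x \<cdot> i1" "x \<cdot> i2"] x by auto
    have "w \<cdot> ?c = x" by - (rule biproduct_coext[OF b]; use w x e in simp)
    with w show "\<exists>u. u \<in> Arr C \<and> Tgt C u = Tgt C x \<and> Src C u = Tgt C ?c \<and> u \<cdot> ?c = x"
      by auto
  qed auto
qed

text \<open>The first projection of (i, -g) is i, so whatever (i, -g) annihilates is annihilated by
  the mono i.\<close>

lemma mono_pair:
  assumes b: "is_biproduct C (Tgt C i) (Tgt C g) D (i1, i2, p1, p2)"
    and "is_mono C i" "g \<in> Arr C" "Src C i = Src C g"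
  shows "is_mono C (i1 \<cdot> i \<boxplus> hneg C (i2 \<cdot> g))"
proof (rule monoI)
  have [simp]: "i \<in> Arr C" using assms by (simp add: is_mono_def)
  note [simp] = biproductD[OF b] assms(3,4)
  show "i1 \<cdot> i \<boxplus> hneg C (i2 \<cdot> g) \<in> Arr C" by simp
  fix t assume t: "t \<in> Arr C" "Tgt C t = Src C (i1 \<cdot> i \<boxplus> hneg C (i2 \<cdot> g))"
    "(i1 \<cdot> i \<boxplus> hneg C (i2 \<cdot> g)) \<cdot> t = HZero C (Src C t) (Tgt C (i1 \<cdot> i \<boxplus> hneg C (i2 \<cdot> g)))"
  have "p1 \<cdot> (i1 \<cdot> i \<boxplus> hneg C (i2 \<cdot> g)) = i"
    by (simp add: comp_hadd biproduct_comps[OF b])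
  from comp_eq[OF this, of t] have "i \<cdot> t = HZero C (Src C t) (Tgt C i)" using t by simp
  then have "t = HZero C (Src C t) (Src C i)" by - (rule mono_cancel[OF assms(2)]; use t in simp)
  then show "t = HZero C (Src C t) (Src C (i1 \<cdot> i \<boxplus> hneg C (i2 \<cdot> g)))" by simp
qed

text \<open>The mono (i, -g) is the kernel of the map from the biproduct to the push-out. If i'k =
  0, then (0, k) lies in that kernel, so (0, k) = (it, -gt) for some t; from it = 0 follow t = 0 and
  k = 0.\<close>

lemma pushout_mono:
  assumes po: "is_pushout C i g i' g'" and i: "is_mono C i"
  shows "is_mono C i'"
proof -
  note [simp] = pushoutD(1-8)[OF po]
  obtain D b where b: "is_biproduct C (Tgt C i) (Tgt C g) D b"
    using biproduct_exists[of "Tgt C i" "Tgt C g"] by auto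
  obtain i1 i2 p1 p2 where "b = (i1, i2, p1, p2)" by (cases b)
  with b have b: "is_biproduct C (Tgt C i) (Tgt C g) D (i1, i2, p1, p2)" by simp
  note [simp] = biproductD[OF b]
  let ?m = "i1 \<cdot> i \<boxplus> hneg C (i2 \<cdot> g)" and ?c = "g' \<cdot> p1 \<boxplus> i' \<cdot> p2"
  have m: "is_mono C ?m" using mono_pair[OF b i] by simp
  have se: "short_exact C ?m ?c" using mono_short_exact[OF m pushout_cokernel_sum[OF b po]] .
  show ?thesis
  proof (rule monoI)
    fix k assume k: "k \<in> Arr C" "Tgt C k = Src C i'" "i' \<cdot> k = HZero C (Src C k) (Tgt C i')"
    have "?c \<cdot> i2 = i'" by (simp add: hadd_comp)
    from comp_eq[OF this, of k] have "?c \<cdot> (i2 \<cdot> k) = HZero C (Src C (i2 \<cdot> k)) (Tgt C ?c)" using k by simp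
    then obtain t where t: "t \<in> Arr C" "Src C t = Src C k" "Tgt C t = Src C ?m" "?m \<cdot> t = i2 \<cdot> k"
      using kernel_factor[OF short_exactD(1)[OF se], of "i2 \<cdot> k"] k by auto
    have "p1 \<cdot> (i1 \<cdot> i \<boxplus> hneg C (i2 \<cdot> g)) = i"
      by (simp add: comp_hadd biproduct_comps[OF b])
    from comp_eq[OF this, of t] have "i \<cdot> t = HZero C (Src C t) (Tgt C i)"
      using t k by (simp add: biproduct_comps[OF b])
    then have "t = HZero C (Src C t) (Src C i)" by - (rule mono_cancel[OF i]; use t k in simp)
    moreover have "?m \<cdot> HZero C (Src C t) (Src C i) = HZero C (Src C t) D" using t k by simp
    ultimately have "i2 \<cdot> k = HZero C (Src C k) D" using t by metis
    then have "q \<cdot> (i2 \<cdot> k) = q \<cdot> HZero C (Src C k) D" for q by simp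
    from this[of p2] show "k = HZero C (Src C k) (Src C i')"
      using k by (simp add: biproduct_comps[OF b])
  qed auto
qed

text \<open>The maps p and 0 induce p'. A map u annihilating i' restricts along g' to one
  annihilating i, hence ug' factors through p, and uniqueness on the push-out turns this into a
  factorization of u through p'.\<close>

lemma pushout_short_exact:
  assumes se: "short_exact C i p" and po: "is_pushout C i g i' g'"
  obtains p' where "short_exact C i' p'" "p' \<cdot> g' = p" "Tgt C p' = Tgt C p"
proof -
  note [simp] = pushoutD(1-8)[OF po] short_exactD(3-6)[OF se]
  note [simp] = short_exactD(5)[OF se, symmetric]
  note [simp del] = short_exactD(5)[OF se]
  obtain p' where p': "p' \<in> Arr C" "Src C p' = Tgt C g'" "Tgt C p' = Tgt C p" "p' \<cdot> g' = p"
    "p' \<cdot> i' = HZero C (Tgt C g) (Tgt C p)"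
    using pushout_factor[OF po, of p "HZero C (Tgt C g) (Tgt C p)"] by auto
  have epi: "is_epi C p" using short_exactD(2)[OF se] by (rule cokernel_epi)
  have "is_epi C p'"
    unfolding is_epi_def
  proof (intro conjI ballI impI)
    fix x y assume xy: "x \<in> Arr C" "y \<in> Arr C" "Src C x = Tgt C p' \<and> Src C y = Tgt C p' \<and>
        Tgt C x = Tgt C y \<and> x \<cdot> p' = y \<cdot> p'"
    have "x \<cdot> p = y \<cdot> p"
      using xy p' comp_assoc[of g' p' x] comp_assoc[of g' p' y] by auto
    then show "x = y" by - (rule epi_cancel[OF epi]; use xy p' in simp)
  qed (use p' in simp_all)
  then have "is_cokernel C i' p'"
  proof (rule cokernelI)
    fix u assume u: "u \<in> Arr C" "Src C u = Tgt C i'" "u \<cdot> i' = HZero C (Src C i') (Tgt C u)"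
    have "(u \<cdot> g') \<cdot> i = u \<cdot> (i' \<cdot> g)" using u pushoutD(9)[OF po] by simp
    also have "\<dots> = (u \<cdot> i') \<cdot> g" using u(1,2) by simp
    finally have "(u \<cdot> g') \<cdot> i = HZero C (Src C i) (Tgt C (u \<cdot> g'))" using u by simp
    then obtain v where v: "v \<in> Arr C" "Tgt C v = Tgt C u" "Src C v = Tgt C p" "v \<cdot> p = u \<cdot> g'"
      using cokernel_factor[OF short_exactD(2)[OF se], of "u \<cdot> g'"] u by auto
    have "v \<cdot> p' = u" by - (rule pushout_eq[OF po]; use v p' u in simp)
    with v p' show "\<exists>v. v \<in> Arr C \<and> Tgt C v = Tgt C u \<and> Src C v = Tgt C p' \<and> v \<cdot> p' = u" by auto
  qed (use p' in simp_all)
  moreover have "is_mono C i'" using pushout_mono[OF po] kernel_mono short_exactD(1)[OF se] by blast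
  ultimately show ?thesis using mono_short_exact that p' by blast
qed

text \<open>If u annihilates ek, then ue factors through p, and u together with this factor induces
  a map on the push-out. With e a second inflation, this identifies the cokernel of a composite of
  inflations.\<close>

lemma pushout_cokernel:
  assumes k: "is_cokernel C k p" and po: "is_pushout C e p e' p'"
  shows "is_cokernel C (e \<cdot> k) p'"
proof -
  note [simp] = pushoutD(1-4,6-8)[OF po] cokernelD[OF k]
  have ke [simp]: "Tgt C k = Src C e" using cokernelD(3)[OF k] pushoutD(5)[OF po] by simp
  note comm = pushoutD(9)[OF po]
  have epi: "is_epi C p" using k by (rule cokernel_epi)
  show ?thesis
  proof (rule cokernelI)
    show "is_epi C p'"
      unfolding is_epi_def
    proof (intro conjI ballI impI)
      fix x y assume xy: "x \<in> Arr C" "y \<in> Arr C" "Src C x = Tgt C p' \<and> Src C y = Tgt C p' \<and>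
        Tgt C x = Tgt C y \<and> x \<cdot> p' = y \<cdot> p'"
      then have t: "Src C x = Tgt C p'" "Src C y = Tgt C p'" by simp_all
      have "(x \<cdot> e') \<cdot> p = (x \<cdot> p') \<cdot> e" using xy(1) t comm by simp
      also have "\<dots> = (y \<cdot> p') \<cdot> e" using xy by (simp only:)
      also have "\<dots> = (y \<cdot> e') \<cdot> p" using xy(2) t comm by simp
      finally have "(x \<cdot> e') \<cdot> p = (y \<cdot> e') \<cdot> p" .
      then have "x \<cdot> e' = y \<cdot> e'" by - (rule epi_cancel[OF epi]; use xy in simp)
      then show "x = y" by - (rule pushout_eq[OF po]; use xy in simp)
    qed auto
    have "p' \<cdot> (e \<cdot> k) = (p' \<cdot> e) \<cdot> k" by simp
    also have "\<dots> = (e' \<cdot> p) \<cdot> k" by (simp only: comm)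
    also have "\<dots> = HZero C (Src C (e \<cdot> k)) (Tgt C p')" by simp
    finally show "p' \<cdot> (e \<cdot> k) = HZero C (Src C (e \<cdot> k)) (Tgt C p')" .
    fix u assume u: "u \<in> Arr C" "Src C u = Tgt C (e \<cdot> k)" "u \<cdot> (e \<cdot> k) = HZero C (Src C (e \<cdot> k)) (Tgt C u)"
    then obtain v where v: "v \<in> Arr C" "Tgt C v = Tgt C u" "Src C v = Tgt C p" "v \<cdot> p = u \<cdot> e"
      using cokernel_factor[OF k, of "u \<cdot> e"] by auto
    then obtain w where "w \<in> Arr C" "Src C w = Tgt C p'" "Tgt C w = Tgt C u" "w \<cdot> p' = u"
      using pushout_factor[OF po, of u v] u by auto
    then show "\<exists>w. w \<in> Arr C \<and> Tgt C w = Tgt C u \<and> Src C w = Tgt C p' \<and> w \<cdot> p' = u" by auto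
  qed auto
qed

text \<open>The map 1 - sp is annihilated by p, hence equals ir for some r; then iri = i, and i
  cancels.\<close>

lemma retraction_of_section:
  assumes se: "short_exact C i p" and s: "s \<in> Arr C" "Src C s = Tgt C p" "Tgt C s = Src C p"
    "p \<cdot> s = Idt C (Tgt C p)"
  obtains r where "r \<in> Arr C" "Src C r = Tgt C i" "Tgt C r = Src C i" "r \<cdot> i = Idt C (Src C i)"
proof -
  note [simp] = short_exactD(3-6)[OF se] s(1-3)
  let ?e = "Idt C (Src C p) \<boxplus> hneg C (s \<cdot> p)"
  have "p \<cdot> (s \<cdot> p) = p" using comp_eq[OF s(4), of p] by simp
  then have "p \<cdot> ?e = HZero C (Src C ?e) (Tgt C p)" by (simp add: comp_hadd)
  then obtain r where r: "r \<in> Arr C" "Src C r = Src C p" "Tgt C r = Src C i" "i \<cdot> r = ?e"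
    using kernel_factor[OF short_exactD(1)[OF se], of ?e] by auto
  have "i \<cdot> (r \<cdot> i) = ?e \<cdot> i" using comp_eq[OF r(4), of i] r by simp
  also have "\<dots> = i" by (simp add: hadd_comp)
  finally have "r \<cdot> i = Idt C (Src C i)"
    by - (rule mono_cancel[OF kernel_mono[OF short_exactD(1)[OF se]]]; use r in simp)
  with r that show ?thesis by simp
qed

lemma section_of_retraction:
  assumes "short_exact C i p" "r \<in> Arr C" "Src C r = Tgt C i" "Tgt C r = Src C i"
    "r \<cdot> i = Idt C (Src C i)"
  obtains s where "s \<in> Arr C" "Src C s = Tgt C p" "Tgt C s = Src C p" "p \<cdot> s = Idt C (Tgt C p)"
proof -
  interpret o: abelian_category "opp C" by (rule abelian_category_opp)
  show ?thesis using o.retraction_of_section[of p i r] assms that by auto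
qed

lemma cokernel_map:
  assumes "short_exact C i p" "short_exact C i' p'" "f \<in> Arr C" "Src C f = Src C i" "Tgt C f = Src C i'"
    "m \<in> Arr C" "Src C m = Tgt C i" "Tgt C m = Tgt C i'" "m \<cdot> i = i' \<cdot> f"
  obtains h where "h \<in> Arr C" "Src C h = Tgt C p" "Tgt C h = Tgt C p'" "h \<cdot> p = p' \<cdot> m"
proof -
  note [simp] = short_exactD(3-6)[OF assms(1)] short_exactD(3-6)[OF assms(2)] assms(3-8)
  have "(p' \<cdot> m) \<cdot> i = (p' \<cdot> i') \<cdot> f" using assms(9) by (simp del: short_exactD(6)[OF assms(2)])
  then have "(p' \<cdot> m) \<cdot> i = HZero C (Src C i) (Tgt C (p' \<cdot> m))" by simp
  then show ?thesis using cokernel_factor[OF short_exactD(2)[OF assms(1)], of "p' \<cdot> m"] that by auto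
qed

lemma biproduct_short_exact:
  assumes b: "is_biproduct C A B D (i, j, p, q)"
  shows "short_exact C i q"
proof -
  note [simp] = biproductD[OF b] biproduct_comps[OF b]
  have "is_mono C i"
  proof (rule monoI)
    fix g assume g: "g \<in> Arr C" "Tgt C g = Src C i" "i \<cdot> g = HZero C (Src C g) (Tgt C i)"
    have "g = p \<cdot> (i \<cdot> g)" using g(1,2) by simp
    also have "\<dots> = HZero C (Src C g) (Src C i)" unfolding g(3) using g(1) by simp
    finally show "g = HZero C (Src C g) (Src C i)" .
  qed simp
  then have k: "is_kernel C q i"
  proof (rule kernelI)
    fix g assume g: "g \<in> Arr C" "Tgt C g = Src C q" "q \<cdot> g = HZero C (Src C g) (Tgt C q)"
    have "i \<cdot> (p \<cdot> g) = g" by - (rule biproduct_ext[OF b]; use g in simp)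
    then show "\<exists>u. u \<in> Arr C \<and> Src C u = Src C g \<and> Tgt C u = Src C i \<and> i \<cdot> u = g"
      using g by (intro exI[of _ "p \<cdot> g"]) auto
  qed auto
  have "is_epi C q"
    unfolding is_epi_def
  proof (intro conjI ballI impI)
    fix x y assume xy: "x \<in> Arr C" "y \<in> Arr C" "Src C x = Tgt C q \<and> Src C y = Tgt C q \<and>
        Tgt C x = Tgt C y \<and> x \<cdot> q = y \<cdot> q"
    then have t: "Src C x = Tgt C q" "Src C y = Tgt C q" by simp_all
    have "x = (x \<cdot> q) \<cdot> j" using xy(1) t by simp
    also have "\<dots> = (y \<cdot> q) \<cdot> j" using xy by (simp only:)
    also have "\<dots> = y" using xy(2) t by simp
    finally show "x = y" .
  qed auto
  then show ?thesis using k by (rule epi_short_exact)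
qed

end

section \<open>Direct sums of short exact sequences\<close>

context preadditive_category
begin

lemma biprod_map_simps:
  assumes b: "is_biproduct C A B D (i, j, p, q)" and b': "is_biproduct C A' B' D' (i', j', p', q')"
    and f: "f \<in> Arr C" "Src C f = A" "Tgt C f = A'" and g: "g \<in> Arr C" "Src C g = B" "Tgt C g = B'"
  defines "m \<equiv> biprod_map C (i, j, p, q) (i', j', p', q') f g"
  shows "m \<in> Arr C" "Src C m = D" "Tgt C m = D'" "p' \<cdot> m = f \<cdot> p" "q' \<cdot> m = g \<cdot> q"
    "m \<cdot> i = i' \<cdot> f" "m \<cdot> j = j' \<cdot> g"
proof -
  note [simp] = biproductD[OF b] biproductD[OF b'] f g biproduct_comps[OF b] biproduct_comps[OF b']
  show "m \<in> Arr C" "Src C m = D" "Tgt C m = D'" "p' \<cdot> m = f \<cdot> p" "q' \<cdot> m = g \<cdot> q"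
    "m \<cdot> i = i' \<cdot> f" "m \<cdot> j = j' \<cdot> g"
    by (simp_all add: m_def comp_hadd hadd_comp)
qed

lemma biproduct_kernel:
  assumes k: "is_kernel C p i" and k': "is_kernel C p' i'"
    and b1: "is_biproduct C (Src C i) (Src C i') D1 b1"
    and b2: "is_biproduct C (Tgt C i) (Tgt C i') D2 b2"
    and b3: "is_biproduct C (Tgt C p) (Tgt C p') D3 b3"
  shows "is_kernel C (biprod_map C b2 b3 p p') (biprod_map C b1 b2 i i')"
proof -
  obtain i1 j1 p1 q1 where b1_eq: "b1 = (i1, j1, p1, q1)" by (cases b1)
  obtain i2 j2 p2 q2 where b2_eq: "b2 = (i2, j2, p2, q2)" by (cases b2)
  obtain i3 j3 p3 q3 where b3_eq: "b3 = (i3, j3, p3, q3)" by (cases b3)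
  note b1 = b1[unfolded b1_eq] and b2 = b2[unfolded b2_eq] and b3 = b3[unfolded b3_eq]
  note K = kernelD[OF k] kernelD[OF k']
  note [simp] = K(1,2,5,6) K(3,7)[symmetric]
  define m1 where "m1 = biprod_map C b1 b2 i i'"
  define m2 where "m2 = biprod_map C b2 b3 p p'"
  note M1 = biprod_map_simps[OF b1 b2, of i i', folded b1_eq b2_eq, folded m1_def, simplified]
  note M2 = biprod_map_simps[OF b2 b3, of p p', folded b2_eq b3_eq, folded m2_def, simplified]
  note [simp] = M1(1-3) M2(1-3) biproductD(1-15)[OF b1] biproductD(1-15)[OF b2] biproductD(1-15)[OF b3]
  have c1: "p2 \<cdot> (m1 \<cdot> t) = i \<cdot> (p1 \<cdot> t)" "q2 \<cdot> (m1 \<cdot> t) = i' \<cdot> (q1 \<cdot> t)"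
    if "t \<in> Arr C" "Tgt C t = D1" for t
    using that comp_eq[OF M1(4), of t] comp_eq[OF M1(5), of t] by simp_all
  have c2: "p3 \<cdot> (m2 \<cdot> t) = p \<cdot> (p2 \<cdot> t)" "q3 \<cdot> (m2 \<cdot> t) = p' \<cdot> (q2 \<cdot> t)"
    if "t \<in> Arr C" "Tgt C t = D2" for t
    using that comp_eq[OF M2(4), of t] comp_eq[OF M2(5), of t] by simp_all
  have z: "p \<cdot> (i \<cdot> t) = HZero C (Src C t) (Tgt C p)" if "t \<in> Arr C" "Tgt C t = Src C i" for t
    using that comp_eq[OF K(4), of t] by simp
  have z': "p' \<cdot> (i' \<cdot> t) = HZero C (Src C t) (Tgt C p')" if "t \<in> Arr C" "Tgt C t = Src C i'" for t
    using that comp_eq[OF K(8), of t] by simp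
  have "is_mono C m1"
  proof (rule monoI)
    fix t assume t: "t \<in> Arr C" "Tgt C t = Src C m1" "m1 \<cdot> t = HZero C (Src C t) (Tgt C m1)"
    have t': "Tgt C t = D1" using t by simp
    have "i \<cdot> (p1 \<cdot> t) = i \<cdot> HZero C (Src C t) (Src C i)"
      unfolding c1(1)[OF t(1) t', symmetric] t(3) using t(1) by simp
    then have 1: "p1 \<cdot> t = HZero C (Src C t) (Src C i)"
      by - (rule mono_cancel[OF kernel_mono[OF k]]; use t t' in simp)
    have "i' \<cdot> (q1 \<cdot> t) = i' \<cdot> HZero C (Src C t) (Src C i')"
      unfolding c1(2)[OF t(1) t', symmetric] t(3) using t(1) by simp
    then have 2: "q1 \<cdot> t = HZero C (Src C t) (Src C i')"
      by - (rule mono_cancel[OF kernel_mono[OF k']]; use t t' in simp)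
    show "t = HZero C (Src C t) (Src C m1)"
      by (rule biproduct_ext[OF b1]) (use t(1) t' in \<open>simp_all add: 1 2\<close>)
  qed simp
  then show ?thesis
    unfolding m1_def[symmetric] m2_def[symmetric]
  proof (rule kernelI)
    show "m2 \<cdot> m1 = HZero C (Src C m1) (Tgt C m2)"
      by (rule biproduct_ext[OF b3]) (simp_all add: c2 M1 z z')
    fix g assume g: "g \<in> Arr C" "Tgt C g = Src C m2" "m2 \<cdot> g = HZero C (Src C g) (Tgt C m2)"
    have g': "Tgt C g = D2" using g by simp
    have "p \<cdot> (p2 \<cdot> g) = HZero C (Src C g) (Tgt C p)"
      unfolding c2(1)[OF g(1) g', symmetric] g(3) using g(1) by simp
    then obtain u where u: "u \<in> Arr C" "Src C u = Src C g" "Tgt C u = Src C i" "i \<cdot> u = p2 \<cdot> g"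
      using kernel_factor[OF k, of "p2 \<cdot> g"] g(1) g' by auto
    have "p' \<cdot> (q2 \<cdot> g) = HZero C (Src C g) (Tgt C p')"
      unfolding c2(2)[OF g(1) g', symmetric] g(3) using g(1) by simp
    then obtain v where v: "v \<in> Arr C" "Src C v = Src C g" "Tgt C v = Src C i'" "i' \<cdot> v = q2 \<cdot> g"
      using kernel_factor[OF k', of "q2 \<cdot> g"] g(1) g' by auto
    define w where "w = i1 \<cdot> u \<boxplus> j1 \<cdot> v"
    have w: "w \<in> Arr C" "Src C w = Src C g" "Tgt C w = D1"
      using u v by (simp_all add: w_def)
    have pw: "p1 \<cdot> w = u" "q1 \<cdot> w = v"
      using u(1-3) v(1-3) g(1) biproduct_comps[OF b1] by (simp_all add: w_def comp_hadd)
    have "m1 \<cdot> w = g"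
      by (rule biproduct_ext[OF b2]) (use w g' g(1) in \<open>simp_all add: c1 pw u(4) v(4)\<close>)
    with w show "\<exists>u. u \<in> Arr C \<and> Src C u = Src C g \<and> Tgt C u = Src C m1 \<and> m1 \<cdot> u = g"
      by auto
  qed simp_all
qed

end

fun swap_biproduct :: "'m \<times> 'm \<times> 'm \<times> 'm \<Rightarrow> 'm \<times> 'm \<times> 'm \<times> 'm" where
  "swap_biproduct (i, j, p, q) = (p, q, i, j)"

lemma is_biproduct_swap:
  "is_biproduct C A B D b \<Longrightarrow> is_biproduct (opp C) A B D (swap_biproduct b)"
  by (cases b) auto

text \<open>Both sides are the sum of i'fp and j'gq, up to associativity; with this, statements on
  direct sums of kernels dualise to cokernels.\<close>

lemma (in preadditive_category) biprod_map_swap: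
  assumes "is_biproduct C A B D b" "is_biproduct C A' B' D' b'"
    "f \<in> Arr C" "Src C f = A" "Tgt C f = A'" "g \<in> Arr C" "Src C g = B" "Tgt C g = B'"
  shows "biprod_map (opp C) (swap_biproduct b') (swap_biproduct b) f g = biprod_map C b b' f g"
proof -
  obtain i j p q where b: "b = (i, j, p, q)" by (cases b)
  obtain i' j' p' q' where b': "b' = (i', j', p', q')" by (cases b')
  show ?thesis
    using biproductD[OF assms(1)[unfolded b]] biproductD[OF assms(2)[unfolded b']] assms(3-)
    by (simp add: b b')
qed

lemma (in preadditive_category) biproduct_cokernel:
  assumes k: "is_cokernel C i p" and k': "is_cokernel C i' p'"
    and b1: "is_biproduct C (Src C i) (Src C i') D1 b1"
    and b2: "is_biproduct C (Tgt C i) (Tgt C i') D2 b2"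
    and b3: "is_biproduct C (Tgt C p) (Tgt C p') D3 b3"
  shows "is_cokernel C (biprod_map C b1 b2 i i') (biprod_map C b2 b3 p p')"
proof -
  interpret o: preadditive_category "opp C" by (rule preadditive_category_opp)
  note K = cokernelD[OF k] cokernelD[OF k']
  have "is_kernel (opp C) (biprod_map (opp C) (swap_biproduct b2) (swap_biproduct b1) i i')
    (biprod_map (opp C) (swap_biproduct b3) (swap_biproduct b2) p p')"
    by (rule o.biproduct_kernel) (use K k k' is_biproduct_swap[OF b1] is_biproduct_swap[OF b2] is_biproduct_swap[OF b3] in auto)
  then show ?thesis
    using biprod_map_swap[OF b1 b2, of i i'] biprod_map_swap[OF b2 b3, of p p'] K by simp
qed

lemma (in preadditive_category) biproduct_short_exact_map:
  assumes "short_exact C i p" "short_exact C i' p'" "is_biproduct C (Src C i) (Src C i') D1 b1"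
    "is_biproduct C (Tgt C i) (Tgt C i') D2 b2" "is_biproduct C (Tgt C p) (Tgt C p') D3 b3"
  shows "short_exact C (biprod_map C b1 b2 i i') (biprod_map C b2 b3 p p')"
  using biproduct_kernel[of p i p' i'] biproduct_cokernel[of i p i' p'] assms
  unfolding short_exact_def by blast

section \<open>Conflations\<close>

lemma short_exact_tgt: "short_exact C i p \<Longrightarrow> Tgt C i = Src C p"
  by (auto simp: short_exact_def is_kernel_def)

lemma conflation_opp [simp]: "conflation (opp C) S p i = conflation C S i p"
  unfolding conflation_def by (auto dest: short_exact_tgt)

context extension_closed_subcategory
begin

lemma extension_closed_subcategory_opp: "extension_closed_subcategory (opp C) S"
proof -
  interpret o: abelian_category "opp C" by (rule abelian_category_opp)
  have "\<exists>D\<in>S. \<exists>b. is_biproduct (opp C) A B D b" if AB: "A \<in> S" "B \<in> S" for A B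
  proof -
    obtain D b where "D \<in> S" "is_biproduct C A B D b" using S_biproduct[OF AB] by blast
    then show ?thesis using is_biproduct_swap[of C A B D b] by blast
  qed
  moreover have "Src C i \<in> S" if "short_exact C p i" "Tgt C i \<in> S" "Src C p \<in> S" for i p
    using S_extension[of p i] short_exact_tgt[OF that(1)] that by simp
  ultimately show ?thesis
    by (intro extension_closed_subcategory.intro extension_closed_subcategory_axioms.intro
      o.abelian_category_axioms) (simp_all add: S_zero S_subset del: is_biproduct.simps)
qed

lemma S_obj [simp]: "A \<in> S \<Longrightarrow> A \<in> Obj C"
  using S_subset by blast

lemma conflationD:
  assumes "conflation C S i p"
  shows "short_exact C i p" "i \<in> Arr C" "p \<in> Arr C" "Src C p = Tgt C i"
    "p \<cdot> i = HZero C (Src C i) (Tgt C p)" "Src C i \<in> S" "Tgt C i \<in> S" "Tgt C p \<in> S"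
  using assms short_exactD[of i p] unfolding conflation_def by auto

text \<open>The pushed-out sequence is short exact with outer terms in \<open>S\<close>, and
  extension closure puts its middle term into \<open>S\<close>.\<close>

lemma conflation_pushout:
  assumes c: "conflation C S i p" and po: "is_pushout C i g i' g'" and "Tgt C g \<in> S"
  obtains p' where "conflation C S i' p'" "p' \<cdot> g' = p" "Tgt C p' = Tgt C p"
proof -
  obtain p' where "short_exact C i' p'" "p' \<cdot> g' = p" "Tgt C p' = Tgt C p"
    using pushout_short_exact[OF conflationD(1)[OF c] po] .
  then show ?thesis
    using that[of p'] S_extension[of i' p'] pushoutD[OF po] assms conflationD[OF c]
    by (simp add: conflation_def)
qed

text \<open>By \<open>pushout_cokernel\<close> the cokernel of ji is the push-out p' of p along j.
  Its target is the middle term of the conflation that arises from j by push-out along p, and hence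
  lies in \<open>S\<close>.\<close>

lemma conflation_comp:
  assumes c: "conflation C S i p" and d: "conflation C S j q" and ij: "Src C j = Tgt C i"
  obtains r where "conflation C S (j \<cdot> i) r"
proof -
  note [simp] = conflationD(2-8)[OF c] conflationD(2-8)[OF d] ij
  obtain j' p' where po: "is_pushout C j p j' p'" using pushout_exists[of j p] by auto
  obtain q' where q': "conflation C S j' q'" using conflation_pushout[OF d po] by auto
  have "is_cokernel C (j \<cdot> i) p'"
    using pushout_cokernel[OF _ po] conflationD(1)[OF c] by (auto simp: short_exact_def)
  moreover have "is_mono C (j \<cdot> i)"
    using conflationD(1)[OF c] conflationD(1)[OF d]
    by (intro mono_comp) (auto simp: short_exact_def intro: kernel_mono)
  ultimately have "short_exact C (j \<cdot> i) p'" by (rule mono_short_exact[rotated])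
  moreover have "Tgt C p' \<in> S" using conflationD(7)[OF q'] pushoutD[OF po] by simp
  ultimately show ?thesis using that[of p'] by (simp add: conflation_def)
qed

text \<open>\<open>S_biproduct\<close> supplies one biproduct in \<open>S\<close>; an arbitrary one
  is an extension of its summands.\<close>

lemma biproduct_S:
  assumes b: "is_biproduct C A B D b" and "A \<in> S" "B \<in> S" shows "D \<in> S"
proof -
  obtain i j p q where "b = (i, j, p, q)" by (cases b)
  with b have b: "is_biproduct C A B D (i, j, p, q)" by simp
  then show ?thesis
    using S_extension[OF biproduct_short_exact[OF b]] biproductD[OF b] assms by simp
qed

lemma biproduct_conflation:
  assumes b: "is_biproduct C A B D (i, j, p, q)" and "A \<in> S" "B \<in> S"
  shows "conflation C S i q"
  using biproduct_short_exact[OF b] biproductD[OF b] biproduct_S[OF b] assms by (simp add: conflation_def)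

lemma conflation_biproduct:
  assumes "conflation C S i p" "conflation C S i' p'" "is_biproduct C (Src C i) (Src C i') D1 b1"
    "is_biproduct C (Tgt C i) (Tgt C i') D2 b2" "is_biproduct C (Tgt C p) (Tgt C p') D3 b3"
  shows "conflation C S (biprod_map C b1 b2 i i') (biprod_map C b2 b3 p p')"
proof -
  obtain i1 j1 p1 q1 where b1_eq: "b1 = (i1, j1, p1, q1)" by (cases b1)
  obtain i2 j2 p2 q2 where b2_eq: "b2 = (i2, j2, p2, q2)" by (cases b2)
  obtain i3 j3 p3 q3 where b3_eq: "b3 = (i3, j3, p3, q3)" by (cases b3)
  note [simp] = conflationD(2-8)[OF assms(1)] conflationD(2-8)[OF assms(2)]
  have "short_exact C (biprod_map C b1 b2 i i') (biprod_map C b2 b3 p p')"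
    using assms conflationD(1) by (intro biproduct_short_exact_map) auto
  moreover have "D1 \<in> S" "D2 \<in> S" "D3 \<in> S"
    using biproduct_S[OF assms(3)] biproduct_S[OF assms(4)] biproduct_S[OF assms(5)] by auto
  moreover have "Src C (biprod_map C b1 b2 i i') = D1" "Tgt C (biprod_map C b1 b2 i i') = D2"
    "Tgt C (biprod_map C b2 b3 p p') = D3"
    using biprod_map_simps[OF assms(3)[unfolded b1_eq] assms(4)[unfolded b2_eq], of i i']
      biprod_map_simps[OF assms(4)[unfolded b2_eq] assms(5)[unfolded b3_eq], of p p']
    unfolding b1_eq b2_eq b3_eq by simp_all
  ultimately show ?thesis by (simp add: conflation_def)
qed

end

section \<open>Exact sequences and their morphisms\<close>

text \<open>\<open>mor C f E E' h\<close>: some morphism of sequences from \<open>E\<close> to \<open>E'\<close> has first component \<open>f\<close> and last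
  component \<open>h\<close>.\<close>

fun mor :: "('o, 'm) add_cat \<Rightarrow> 'm \<Rightarrow> 'm list \<Rightarrow> 'm list \<Rightarrow> 'm \<Rightarrow> bool" where
  "mor C f [] [] h \<longleftrightarrow> f = h"
| "mor C f (d # E) (d' # E') h \<longleftrightarrow> f \<in> Hom C (Src C d) (Src C d') \<and>
     (\<exists>g \<in> Hom C (Tgt C d) (Tgt C d'). g \<cdot>\<^bsub>C\<^esub> d = d' \<cdot>\<^bsub>C\<^esub> f \<and> mor C g E E' h)"
| "mor C f _ _ h \<longleftrightarrow> False"

fun path :: "('o, 'm) add_cat \<Rightarrow> 'o \<Rightarrow> 'm list \<Rightarrow> 'o \<Rightarrow> bool" where
  "path C A [] B \<longleftrightarrow> A = B \<and> A \<in> Obj C"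
| "path C A (d # E) B \<longleftrightarrow> d \<in> Arr C \<and> Src C d = A \<and> path C (Tgt C d) E B"

definition splice :: "('o, 'm) add_cat \<Rightarrow> 'm list \<Rightarrow> 'm list \<Rightarrow> 'm list" where
  "splice C E E' = butlast E @ (hd E' \<cdot>\<^bsub>C\<^esub> last E) # tl E'"

lemma splice_Cons: "splice C (X @ [x]) (z # Z) = X @ (z \<cdot>\<^bsub>C\<^esub> x) # Z"
  by (simp add: splice_def)

lemma mor_length: "mor C f E E' h \<Longrightarrow> length E = length E'"
  by (induction C f E E' h rule: mor.induct) auto

lemma mor_append:
  "length E1 = length E1' \<Longrightarrow>
    mor C f (E1 @ E2) (E1' @ E2') h \<longleftrightarrow> (\<exists>g. mor C f E1 E1' g \<and> mor C g E2 E2' h)"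
  by (induction E1 E1' arbitrary: f rule: list_induct2) auto

lemma mor_opp: "mor (opp C) h (rev E') (rev E) f \<longleftrightarrow> mor C f E E' h"
proof (cases "length E = length E'")
  case True
  then show ?thesis
  proof (induction E E' arbitrary: f rule: list_induct2)
    case Nil show ?case by auto
  next
    case (Cons d E d' E')
    then show ?case by (auto simp: mor_append)
  qed
next
  case False
  then show ?thesis using mor_length by fastforce
qed

lemma splice_opp:
  assumes "E \<noteq> []" "E' \<noteq> []"
  shows "splice (opp C) (rev E') (rev E) = rev (splice C E E')"
proof -
  obtain X x where X: "E = X @ [x]" using assms by (metis rev_exhaust)
  obtain z Z where Z: "E' = z # Z" using assms by (cases E') auto
  show ?thesis by (simp add: X Z splice_Cons splice_def)
qed

text \<open>A middle list of at least two maps keeps the two junctions apart, so this is an identity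
  of lists which holds without associativity of composition.\<close>

lemma splice_assoc:
  assumes "E1 \<noteq> []" "length E2 \<ge> 2" "E3 \<noteq> []"
  shows "splice C (splice C E1 E2) E3 = splice C E1 (splice C E2 E3)"
proof -
  obtain X x where X: "E1 = X @ [x]" using assms by (metis rev_exhaust)
  obtain z Z where Z: "E3 = z # Z" using assms by (cases E3) auto
  obtain a M where "E2 = a # M" "M \<noteq> []" using assms(2) by (cases E2) (auto simp: Suc_le_eq)
  then obtain M b where M: "E2 = a # M @ [b]" by (metis rev_exhaust)
  show ?thesis by (simp add: X Z M splice_def butlast_append)
qed

context category
begin

lemma path_obj: "path C A E B \<Longrightarrow> A \<in> Obj C \<and> B \<in> Obj C"
  by (induction E arbitrary: A) auto

lemma path_append: "path C A (E @ E') B \<longleftrightarrow> (\<exists>D. path C A E D \<and> path C D E' B)"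
  by (induction E arbitrary: A) (auto dest: path_obj)

lemma mor_id: "path C A E B \<Longrightarrow> mor C (Idt C A) E E (Idt C B)"
proof (induction E arbitrary: A)
  case (Cons d E)
  then show ?case by (auto simp: Hom_def intro!: exI[of _ "Idt C (Tgt C d)"])
qed simp

lemma mor_comp:
  assumes "mor C f E E' h" "mor C f' E' E'' h'" "path C A E B" "path C A' E' B'" "path C A'' E'' B''"
  shows "mor C (f' \<cdot> f) E E'' (h' \<cdot> h)"
  using assms
proof (induction E arbitrary: E' E'' f f' A A' A'')
  case Nil
  then have "E' = []" "E'' = []" using mor_length[OF Nil.prems(1)] mor_length[OF Nil.prems(2)] by auto
  then show ?case using Nil by simp
next
  case (Cons d E)
  obtain d' F where E': "E' = d' # F" using mor_length[OF Cons.prems(1)] by (cases E') auto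
  obtain d'' G where E'': "E'' = d'' # G" using mor_length[OF Cons.prems(2)] E' by (cases E'') auto
  obtain g where g: "f \<in> Hom C (Src C d) (Src C d')" "g \<in> Hom C (Tgt C d) (Tgt C d')"
    "g \<cdot> d = d' \<cdot> f" "mor C g E F h" using Cons.prems(1) by (auto simp: E')
  obtain g' where g': "f' \<in> Hom C (Src C d') (Src C d'')" "g' \<in> Hom C (Tgt C d') (Tgt C d'')"
    "g' \<cdot> d' = d'' \<cdot> f'" "mor C g' F G h'" using Cons.prems(2) by (auto simp: E' E'')
  have d: "d \<in> Arr C" "d' \<in> Arr C" "d'' \<in> Arr C" using Cons.prems by (auto simp: E' E'')
  note T = g(1,2)[unfolded Hom_def, simplified] g'(1,2)[unfolded Hom_def, simplified]
  have "(g' \<cdot> g) \<cdot> d = g' \<cdot> (d' \<cdot> f)" using T d by (simp add: g(3))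
  also have "\<dots> = (g' \<cdot> d') \<cdot> f" using T d by simp
  also have "\<dots> = d'' \<cdot> (f' \<cdot> f)" unfolding g'(3) using T d by simp
  finally have "(g' \<cdot> g) \<cdot> d = d'' \<cdot> (f' \<cdot> f)" .
  moreover have "mor C (g' \<cdot> g) E G (h' \<cdot> h)"
    using Cons.IH[OF g(4) g'(4)] Cons.prems(3-5) by (auto simp: E' E'')
  ultimately show ?case
    using Comp_closed[OF g(1) g'(1)] Comp_closed[OF g(2) g'(2)] unfolding E'' by auto
qed

lemma mor_Hom:
  assumes "mor C f E E' h" "path C A E B" "path C A' E' B'" "E \<noteq> []"
  shows "f \<in> Hom C A A'" "h \<in> Hom C B B'"
proof -
  have "f \<in> Hom C A A' \<and> h \<in> Hom C B B'"
    using assms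
  proof (induction E arbitrary: E' f A A')
    case (Cons d E)
    obtain d' F where E': "E' = d' # F" using mor_length[OF Cons.prems(1)] by (cases E') auto
    obtain g where g: "f \<in> Hom C (Src C d) (Src C d')" "g \<in> Hom C (Tgt C d) (Tgt C d')" "mor C g E F h"
      using Cons.prems(1) by (auto simp: E')
    show ?case
    proof (cases E)
      case Nil
      then show ?thesis using g Cons.prems mor_length[OF g(3)] by (auto simp: E')
    next
      case (Cons e G)
      then show ?thesis using Cons.IH[OF g(3)] g Cons.prems by (auto simp: E')
    qed
  qed simp
  then show "f \<in> Hom C A A'" "h \<in> Hom C B B'" by auto
qed

lemma mor_splice:
  assumes "mor C f E1 E2 g" "mor C g E1' E2' h" "E1 \<noteq> []" "E1' \<noteq> []"
    "path C A1 E1 B1" "path C B1 E1' D1" "path C A2 E2 B2" "path C B2 E2' D2"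
  shows "mor C f (splice C E1 E1') (splice C E2 E2') h"
proof -
  obtain X x where X: "E1 = X @ [x]" using assms(3) by (metis rev_exhaust)
  obtain Y y where Y: "E2 = Y @ [y]" using assms(1,3) mor_length[OF assms(1)]
    by (metis length_0_conv rev_exhaust)
  obtain z Z where Z: "E1' = z # Z" using assms(4) by (cases E1') auto
  obtain w W where W: "E2' = w # W" using assms(4) mor_length[OF assms(2)] by (cases E2') auto
  have len: "length X = length Y" using mor_length[OF assms(1)] by (simp add: X Y)
  from assms(1) len obtain m where m: "mor C f X Y m" "m \<in> Hom C (Src C x) (Src C y)"
    "g \<in> Hom C (Tgt C x) (Tgt C y)" "g \<cdot> x = y \<cdot> m" by (auto simp: X Y mor_append)
  from assms(2) obtain k where k: "g \<in> Hom C (Src C z) (Src C w)" "k \<in> Hom C (Tgt C z) (Tgt C w)"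
    "k \<cdot> z = w \<cdot> g" "mor C k Z W h" by (auto simp: Z W)
  have T: "x \<in> Arr C" "y \<in> Arr C" "z \<in> Arr C" "w \<in> Arr C" "Tgt C x = Src C z" "Tgt C y = Src C w"
    using assms(5-8) by (auto simp: X Y Z W path_append)
  note T' = m(2,3)[unfolded Hom_def, simplified] k(1,2)[unfolded Hom_def, simplified]
  have "k \<cdot> (z \<cdot> x) = (k \<cdot> z) \<cdot> x" using T T' by simp
  also have "\<dots> = w \<cdot> (g \<cdot> x)" unfolding k(3) using T T' by simp
  also have "\<dots> = (w \<cdot> y) \<cdot> m" unfolding m(4) using T T' by simp
  finally have "k \<cdot> (z \<cdot> x) = (w \<cdot> y) \<cdot> m" .
  then show ?thesis
    using len m k T unfolding X Y Z W splice_Cons by (auto simp: mor_append)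
qed

end

text \<open>These morphisms between arbitrary sequences make the zero class independent of the class
  from which it is computed.\<close>

lemma (in preadditive_category) mor_zero:
  assumes "path C A E B" "path C A' E' B'" "length E = length E'"
  shows "mor C (HZero C A A') E E' (HZero C B B')"
  using assms
proof (induction E arbitrary: A A' E')
  case (Cons d E)
  then obtain d' F where E': "E' = d' # F" by (cases E') auto
  show ?case using Cons path_obj[of A' E' B']
    by (auto simp: E' Hom_def intro!: exI[of _ "HZero C (Tgt C d) (Tgt C d')"])
qed simp

lemma all_le_Suc: "(\<forall>k\<le>Suc n. P k) \<longleftrightarrow> P 0 \<and> (\<forall>k\<le>n. P (Suc k))"
  by (metis Suc_le_mono le0 not0_implies_Suc)

lemma seq_morphism_Cons:
  assumes "E \<noteq> []" "E' \<noteq> []" "Src C (hd E) = Tgt C d" "Src C (hd E') = Tgt C d'"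
  shows "seq_morphism C (d # E) (d' # E') (f # \<phi>) \<longleftrightarrow> f \<in> Hom C (Src C d) (Src C d') \<and>
    hd \<phi> \<cdot>\<^bsub>C\<^esub> d = d' \<cdot>\<^bsub>C\<^esub> f \<and> seq_morphism C E E' \<phi>"
proof -
  have "seq_objs C (d # E) = Src C d # seq_objs C E" "seq_objs C (d' # E') = Src C d' # seq_objs C E'"
    using assms by (auto simp: seq_objs_def)
  moreover have "hd \<phi> = \<phi> ! 0" if "length \<phi> = Suc (length E)" using that by (cases \<phi>) auto
  ultimately show ?thesis
    unfolding seq_morphism_def by (auto simp: all_le_Suc All_less_Suc2)
qed

lemma seq_morphism_single:
  "seq_morphism C [d] [d'] \<phi> \<longleftrightarrow> (\<exists>f g. \<phi> = [f, g] \<and> f \<in> Hom C (Src C d) (Src C d') \<and>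
    g \<in> Hom C (Tgt C d) (Tgt C d') \<and> g \<cdot>\<^bsub>C\<^esub> d = d' \<cdot>\<^bsub>C\<^esub> f)"
  by (auto simp: seq_morphism_def seq_objs_def all_le_Suc length_Suc_conv)

text \<open>Connects the indexed description of morphisms with the recursive one, which suits
  inductions over the list of maps.\<close>

lemma seq_morphism_mor:
  assumes "path C A E B" "path C A' E' B'" "E \<noteq> []"
  shows "(\<exists>\<phi>. seq_morphism C E E' \<phi> \<and> hd \<phi> = f \<and> last \<phi> = h) \<longleftrightarrow> mor C f E E' h"
proof (cases "length E = length E'")
  case False
  then show ?thesis using mor_length by (metis seq_morphism_def)
next
  case True
  from True assms show ?thesis
  proof (induction E E' arbitrary: A A' f rule: list_induct2)
    case (Cons d E d' E')
    show ?case
    proof (cases "E = []")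
      case True
      with Cons.hyps have "E' = []" by simp
      with True show ?thesis by (force simp: seq_morphism_single)
    next
      case False
      with Cons.hyps have E': "E' \<noteq> []" by auto
      have hds: "Src C (hd E) = Tgt C d" "Src C (hd E') = Tgt C d'"
        using Cons.prems False E' by (cases E; cases E'; auto)+
      note sm = seq_morphism_Cons[OF False E' hds]
      have IH: "(\<exists>\<phi>. seq_morphism C E E' \<phi> \<and> hd \<phi> = g \<and> last \<phi> = h) \<longleftrightarrow> mor C g E E' h" for g
        using Cons.IH[of "Tgt C d" "Tgt C d'" g] Cons.prems False by simp
      show ?thesis
      proof
        assume "\<exists>\<phi>. seq_morphism C (d # E) (d' # E') \<phi> \<and> hd \<phi> = f \<and> last \<phi> = h"
        then obtain \<phi> where \<phi>: "seq_morphism C (d # E) (d' # E') \<phi>" "hd \<phi> = f" "last \<phi> = h" by blast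
        then obtain \<psi> where \<psi>: "\<phi> = f # \<psi>" by (cases \<phi>) (auto simp: seq_morphism_def)
        with \<phi> sm have s: "f \<in> Hom C (Src C d) (Src C d')" "hd \<psi> \<cdot>\<^bsub>C\<^esub> d = d' \<cdot>\<^bsub>C\<^esub> f"
          "seq_morphism C E E' \<psi>" by auto
        have ne: "\<psi> \<noteq> []" using s(3) by (auto simp: seq_morphism_def)
        then have "hd \<psi> \<in> Hom C (Tgt C d) (Tgt C d')"
          using s(3) hds by (auto simp: seq_morphism_def seq_objs_def hd_conv_nth)
        moreover have "mor C (hd \<psi>) E E' h" using IH s(3) \<phi>(3) \<psi> ne by auto
        ultimately show "mor C f (d # E) (d' # E') h" using s by auto
      next
        assume "mor C f (d # E) (d' # E') h"
        then obtain g where g: "f \<in> Hom C (Src C d) (Src C d')" "g \<cdot>\<^bsub>C\<^esub> d = d' \<cdot>\<^bsub>C\<^esub> f" "mor C g E E' h"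
          by auto
        then obtain \<psi> where \<psi>: "seq_morphism C E E' \<psi>" "hd \<psi> = g" "last \<psi> = h" using IH by blast
        moreover have "\<psi> \<noteq> []" using \<psi>(1) by (auto simp: seq_morphism_def)
        ultimately show "\<exists>\<phi>. seq_morphism C (d # E) (d' # E') \<phi> \<and> hd \<phi> = f \<and> last \<phi> = h"
          using sm g by (intro exI[of _ "f # \<psi>"]) auto
      qed
    qed
  qed simp
qed

section \<open>Sequences spliced from conflations and their push-outs\<close>

context extension_closed_subcategory
begin

lemma ext_seq_path:
  "ext_seq C S t A B E \<Longrightarrow> path C B E A \<and> length E = Suc t \<and> 1 \<le> t \<and> A \<in> S \<and> B \<in> S"
proof (induction rule: ext_seq.induct)
  case (single i p)
  then show ?case using conflationD[OF single] by simp
next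
  case (splice i p t A j ds)
  then show ?case using conflationD[OF splice(1)] by auto
qed

text \<open>The outer objects and the length can be read off the list; so the t, A, B hidden in the
  definition of \<open>yoneda_step\<close> are the expected ones.\<close>

lemma ext_seq_unique:
  assumes "ext_seq C S t A B E" "ext_seq C S t' A' B' E"
  shows "t = t'" "A = A'" "B = B'"
proof -
  have "path C B E A \<Longrightarrow> path C B E A' \<Longrightarrow> A = A'" for B E
    by (induction E arbitrary: B) auto
  then show "t = t'" "A = A'" "B = B'"
    using ext_seq_path[OF assms(1)] ext_seq_path[OF assms(2)] by (cases E; auto)+
qed

lemma ext_seq_single: "conflation C S i p \<Longrightarrow> Tgt C p = A \<Longrightarrow> Src C i = B \<Longrightarrow> ext_seq C S 1 A B [i, p]"
  using ext_seq.single by metis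

lemma ext_seq_splice_conflation:
  assumes "conflation C S i p" "ext_seq C S t A (Tgt C p) E"
  shows "ext_seq C S (Suc t) A (Src C i) (splice C [i, p] E)"
proof -
  obtain j ds where "E = j # ds" using ext_seq_path[OF assms(2)] by (cases E) auto
  then show ?thesis using ext_seq.splice[OF assms(1)] assms(2) by (simp add: splice_def)
qed

lemma ext_seq_cases:
  assumes "ext_seq C S t A B E"
  obtains (single) i p where "conflation C S i p" "E = [i, p]" "t = 1" "A = Tgt C p" "B = Src C i"
  | (splice) i p t' j ds where "conflation C S i p" "ext_seq C S t' A (Tgt C p) (j # ds)"
      "E = i # (j \<cdot> p) # ds" "E = splice C [i, p] (j # ds)" "t = Suc t'" "B = Src C i" "ds \<noteq> []"
  using assms
proof (cases rule: ext_seq.cases)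
  case (splice i p t j ds)
  then have "ds \<noteq> []" using ext_seq_path[OF splice(5)] by auto
  with splice that(2) show ?thesis by (simp add: splice_def)
qed (use that(1) in auto)

lemma ext_seq_splice:
  assumes "ext_seq C S s A B E" "ext_seq C S t X A E'"
  shows "ext_seq C S (s + t) X B (splice C E E')"
  using assms
proof (induction rule: ext_seq.induct)
  case (single i p)
  then show ?case using ext_seq_splice_conflation by simp
next
  case (splice i p s A j ds)
  have "ds \<noteq> []" using ext_seq_path[OF splice(2)] by auto
  then have "splice C (i # (j \<cdot> p) # ds) E' = splice C [i, p] (splice C (j # ds) E')"
    by (simp add: splice_def)
  then show ?case using ext_seq_splice_conflation[OF splice(1) splice.IH] splice(4) by simp
qed

text \<open>The inductive definition adds conflations at the beginning, but in the opposite category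
  they arrive at the end; \<open>ext_seq_splice\<close> bridges the difference.\<close>

lemma ext_seq_opp:
  assumes "ext_seq C S t A B E" shows "ext_seq (opp C) S t B A (rev E)"
proof -
  interpret o: extension_closed_subcategory "opp C" S by (rule extension_closed_subcategory_opp)
  show ?thesis
    using assms
  proof (induction rule: ext_seq.induct)
    case (single i p)
    then show ?case using o.ext_seq_single[of p i] by simp
  next
    case (splice i p t A j ds)
    have "ext_seq (opp C) S 1 (Src C i) (Tgt C p) (rev [i, p])"
      using splice(1) o.ext_seq_single[of p i] by simp
    from o.ext_seq_splice[OF splice.IH this]
    show ?case using splice_opp[of "[i, p]" "j # ds" C] by (simp add: splice_def)
  qed
qed

lemma ext_seq_complex:
  assumes "ext_seq C S t A B (i # d # ds)"
  shows "d \<cdot> i = HZero C (Src C i) (Tgt C d)"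
  using assms
proof (cases rule: ext_seq_cases)
  case (splice i' p t' j ds)
  have "path C (Tgt C p) (j # ds) A" using ext_seq_path[OF splice(2)] by simp
  then show ?thesis using splice conflationD[OF splice(1)] by auto
qed (use conflationD in auto)

lemma pushout_seq_exists:
  assumes E: "ext_seq C S t A B E" and g: "g \<in> Hom C B B'"
  obtains F where "pushout_seq C g E F"
proof -
  obtain i d ds where E_eq: "E = i # d # ds"
    using ext_seq_path[OF E] by (cases E rule: list.exhaust[case_names Nil Cons]; cases "tl E") auto
  have T: "i \<in> Arr C" "d \<in> Arr C" "Src C i = B" "Tgt C i = Src C d"
    using ext_seq_path[OF E] E_eq by auto
  note g = g[unfolded Hom_def, simplified]
  obtain i' g' where po: "is_pushout C i g i' g'" using pushout_exists[of i g] T g by auto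
  have "d \<cdot> i = HZero C B' (Tgt C d) \<cdot> g"
    using ext_seq_complex[of t A B i d ds] E E_eq T g by auto
  then obtain d' where "d' \<in> Arr C" "Src C d' = Tgt C g'" "Tgt C d' = Tgt C d" "d' \<cdot> g' = d"
    "d' \<cdot> i' = HZero C B' (Tgt C d)"
    using pushout_factor[OF po, of d "HZero C B' (Tgt C d)"] T g
    by (metis Tgt_closed hzero_simps(1,2,3))
  then have "pushout_seq C g (i # d # ds) (i' # d' # ds)"
    using pushoutD[OF po] g by (intro pushout_seq.intros[OF po]) (auto simp: Hom_def)
  then show ?thesis using that E_eq by simp
qed

text \<open>The new second map d' is pinned down by its restrictions to the two legs of the
  push-out. They show that d' is the new deflation p', or its composite with the inflation j of the
  next conflation, so the spliced shape persists.\<close>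

lemma pushout_seq_ext_seq:
  assumes E: "ext_seq C S t A B E" and g: "g \<in> Hom C B B'" "B' \<in> S" and po: "pushout_seq C g E F"
  shows "ext_seq C S t A B' F" "mor C g E F (Idt C A)"
proof -
  note g' = g(1)[unfolded Hom_def, simplified]
  from po obtain i i' h d d' ds where sq: "is_pushout C i g i' h" and d': "d' \<in> Hom C (Tgt C i') (Tgt C d)"
    "d' \<cdot> h = d" "d' \<cdot> i' = HZero C (Src C i') (Tgt C d)" and EF: "E = i # d # ds" "F = i' # d' # ds"
    by (auto elim: pushout_seq.cases)
  note P = pushoutD[OF sq]
  note d = d'(1)[unfolded Hom_def, simplified]
  have path: "path C B E A" using ext_seq_path[OF E] by simp
  show "ext_seq C S t A B' F"
    using E
  proof (cases rule: ext_seq_cases)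
    case (single i0 p)
    then have i: "i0 = i" "p = d" "ds = []" using EF by auto
    obtain p' where p': "conflation C S i' p'" "p' \<cdot> h = d" "Tgt C p' = Tgt C d"
      using conflation_pushout[OF single(1)[unfolded i] sq] g' g by auto
    have "p' = d'" by (rule pushout_eq[OF sq]) (use d d' P p' conflationD[OF p'(1)] in simp_all)
    then show ?thesis using ext_seq_single[OF p'(1)] p' single EF i P g' by simp
  next
    case (splice i0 p t' j ds')
    then have i: "i0 = i" "d = j \<cdot> p" "ds' = ds" using EF by auto
    obtain p' where p': "conflation C S i' p'" "p' \<cdot> h = p" "Tgt C p' = Tgt C p"
      using conflation_pushout[OF splice(1)[unfolded i] sq] g' g by auto
    note c = conflationD[OF splice(1)] conflationD[OF p'(1)]
    have j: "j \<in> Arr C" "Src C j = Tgt C p" using ext_seq_path[OF splice(2)] by auto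
    have "d' = j \<cdot> p'"
      by (rule pushout_eq[OF sq]) (use d d' P p'(2,3) c j i in simp_all)
    then show ?thesis
      using splice ext_seq.splice[OF p'(1), of t' A j ds] EF i P g' p'(3) by simp
  qed
  have "mor C (Idt C (Tgt C d)) ds ds (Idt C A)"
    using mor_id path unfolding EF by simp
  moreover have "g \<in> Hom C (Src C i) (Src C i')" "h \<in> Hom C (Tgt C i) (Tgt C i')"
    "h \<in> Hom C (Src C d) (Src C d')" "Idt C (Tgt C d) \<in> Hom C (Tgt C d) (Tgt C d')"
    using P d g' path unfolding EF by (simp_all add: Hom_def)
  moreover have "Idt C (Tgt C d) \<cdot> d = d' \<cdot> h"
    using path d'(2) unfolding EF by simp
  ultimately show "mor C g E F (Idt C A)"
    unfolding EF mor.simps using P(9) by metis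
qed

text \<open>Only the first two maps of the sequence change. The push-out provides the component w at
  the new middle term; the square behind it is tested on the two legs, and on \<open>i'\<close> both
  of its sides vanish.\<close>

lemma pushout_seq_factor:
  assumes E: "ext_seq C S t A B E" and g: "g \<in> Hom C B B'" and po: "pushout_seq C g E F"
    and G: "ext_seq C S t A' D G" and f: "f \<in> Hom C B' D" and mor: "mor C (f \<cdot> g) E G h"
  shows "mor C f F G h"
proof -
  from po obtain i i' k d d' ds where sq: "is_pushout C i g i' k" and d': "d' \<in> Hom C (Tgt C i') (Tgt C d)"
    "d' \<cdot> k = d" "d' \<cdot> i' = HZero C (Src C i') (Tgt C d)" and EF: "E = i # d # ds" "F = i' # d' # ds"
    by (auto elim: pushout_seq.cases)
  note P = pushoutD[OF sq]
  note d = d'(1)[unfolded Hom_def, simplified] and g' = g[unfolded Hom_def, simplified]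
    and f' = f[unfolded Hom_def, simplified]
  obtain j e es where G_eq: "G = j # e # es"
    using ext_seq_path[OF G] ext_seq_path[OF E] EF by (cases G; cases "tl G") auto
  from mor obtain w1 w2 where w: "w1 \<in> Hom C (Tgt C i) (Tgt C j)" "w1 \<cdot> i = j \<cdot> (f \<cdot> g)"
    "w2 \<in> Hom C (Tgt C d) (Tgt C e)" "w2 \<cdot> d = e \<cdot> w1" "mor C w2 ds es h"
    unfolding EF G_eq by auto
  note w' = w(1,3)[unfolded Hom_def, simplified]
  have je: "j \<in> Arr C" "e \<in> Arr C" "Src C j = D" "Tgt C j = Src C e" "d \<in> Arr C" "Src C d = Tgt C i"
    using ext_seq_path[OF G] ext_seq_path[OF E] EF G_eq by auto
  have "w1 \<cdot> i = (j \<cdot> f) \<cdot> g" using w(2) je f' g' by simp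
  then obtain w where w0: "w \<in> Arr C" "Src C w = Tgt C k" "Tgt C w = Tgt C w1" "w \<cdot> k = w1" "w \<cdot> i' = j \<cdot> f"
    using pushout_factor[OF sq, of w1 "j \<cdot> f"] w' je f' g' by auto
  have "w2 \<cdot> d' = e \<cdot> w"
  proof (rule pushout_eq[OF sq])
    show "(w2 \<cdot> d') \<cdot> k = (e \<cdot> w) \<cdot> k" using d d' P w' w(4) w0 je by simp
    have "(w2 \<cdot> d') \<cdot> i' = HZero C B' (Tgt C e)" using d d'(3) P w' g' Hom_obj[OF g] by simp
    moreover have "(e \<cdot> w) \<cdot> i' = (e \<cdot> j) \<cdot> f" using w0 w' P je f' by simp
    moreover have "\<dots> = HZero C B' (Tgt C e)"
      using ext_seq_complex[OF G[unfolded G_eq]] je f' w' by simp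
    ultimately show "(w2 \<cdot> d') \<cdot> i' = (e \<cdot> w) \<cdot> i'" by simp
  qed (use w0 w' d P je in simp_all)
  then show ?thesis
    using w0 w' d P f' g' je w(5) unfolding EF G_eq by (auto simp: Hom_def)
qed

end

section \<open>Extension classes\<close>

text \<open>Like \<open>ext_push\<close>, this is a union over all representatives, which
  \<open>yprod_cl\<close> shows to be a single class.\<close>

definition yprod :: "('o, 'm) add_cat \<Rightarrow> 'o set \<Rightarrow> 'm list set \<Rightarrow> 'm list set \<Rightarrow> 'm list set" where
  "yprod C S \<gamma> \<gamma>' = {G. \<exists>E \<in> \<gamma>. \<exists>E' \<in> \<gamma>'. (splice C E E', G) \<in> yoneda_eq C S}"

lemma mem_image_rev: "E \<in> rev ` X \<longleftrightarrow> rev E \<in> X"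
  by (metis image_iff rev_rev_ident)

lemma yoneda_eq_sym: "(E, E') \<in> yoneda_eq C S \<Longrightarrow> (E', E) \<in> yoneda_eq C S"
  unfolding yoneda_eq_def by (metis converse_Un converse_converse sup_commute trancl_converseI converseD converseI)

lemma yoneda_eq_trans: "(E, E') \<in> yoneda_eq C S \<Longrightarrow> (E', E'') \<in> yoneda_eq C S \<Longrightarrow> (E, E'') \<in> yoneda_eq C S"
  unfolding yoneda_eq_def by (rule trancl_trans)

context extension_closed_subcategory
begin

abbreviation push (infixr "\<triangleright>" 75) where
  "g \<triangleright> \<gamma> \<equiv> ext_push C S g \<gamma>"

abbreviation pull (infixl "\<triangleleft>" 74) where
  "\<gamma> \<triangleleft> h \<equiv> ext_pull C S \<gamma> h"

abbreviation yoneda_prod (infixr "\<star>" 73) where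
  "\<gamma> \<star> \<gamma>' \<equiv> yprod C S \<gamma> \<gamma>'"

definition cl where
  "cl E = yoneda_eq C S `` {E}"

lemma yoneda_step_iff:
  "(E, E') \<in> yoneda_step C S \<longleftrightarrow> (\<exists>t A B. ext_seq C S t A B E \<and> ext_seq C S t A B E' \<and>
     mor C (Idt C B) E E' (Idt C A))"
proof -
  have "(\<exists>\<phi>. seq_morphism C E E' \<phi> \<and> hd \<phi> = Idt C B \<and> last \<phi> = Idt C A) \<longleftrightarrow>
      mor C (Idt C B) E E' (Idt C A)"
    if "ext_seq C S t A B E" "ext_seq C S t A B E'" for t A B
    by (rule seq_morphism_mor) (use ext_seq_path[OF that(1)] ext_seq_path[OF that(2)] in auto)
  then show ?thesis unfolding yoneda_step_def by blast
qed

lemma yoneda_eq_ext_seq: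
  assumes "(E, E') \<in> yoneda_eq C S" "ext_seq C S t A B E" shows "ext_seq C S t A B E'"
  using assms unfolding yoneda_eq_def
proof (induction rule: trancl_induct)
  case (base F)
  then show ?case using yoneda_step_iff ext_seq_unique by (metis UnE converseD)
next
  case (step F G)
  then show ?case using yoneda_step_iff ext_seq_unique by (metis UnE converseD)
qed

text \<open>P relates a sequence to the values that some choices produce. If every sequence has a
  value and a single morphism forces the values at its ends to agree, agreement passes along chains
  in both directions; truth values are allowed as well. The case E = E' says that the choices do not
  matter.\<close>

lemma yoneda_eq_invariant:
  assumes EE': "(E, E') \<in> yoneda_eq C S" and E: "ext_seq C S t A B E"
    and step: "\<And>E E' x x'. (E, E') \<in> yoneda_step C S \<Longrightarrow> ext_seq C S t A B E \<Longrightarrow>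
      ext_seq C S t A B E' \<Longrightarrow> P E x \<Longrightarrow> P E' x' \<Longrightarrow> x = x'"
    and ex: "\<And>E. ext_seq C S t A B E \<Longrightarrow> \<exists>x. P E x"
    and x: "P E x" "P E' x'"
  shows "x = x'"
  using EE' x(2) unfolding yoneda_eq_def
proof (induction arbitrary: x' rule: trancl_induct)
  case (base F)
  then have "(E, F) \<in> yoneda_eq C S" unfolding yoneda_eq_def by blast
  then have "ext_seq C S t A B F" using yoneda_eq_ext_seq E by blast
  then show ?case using base step x(1) E by blast
next
  case (step F G)
  then have "(E, F) \<in> yoneda_eq C S" "(E, G) \<in> yoneda_eq C S"
    unfolding yoneda_eq_def by (blast intro: trancl_into_trancl)+
  then have FG: "ext_seq C S t A B F" "ext_seq C S t A B G" using yoneda_eq_ext_seq E by blast+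
  then obtain y where y: "P F y" using ex by blast
  then have "x = y" using step.IH by blast
  also have "y = x'" using step.hyps(2) y step.prems FG assms(3) by blast
  finally show ?case .
qed

lemma yoneda_eq_refl: "ext_seq C S t A B E \<Longrightarrow> (E, E) \<in> yoneda_eq C S"
  unfolding yoneda_eq_def using yoneda_step_iff mor_id ext_seq_path by blast

lemma cl_eq_iff: "ext_seq C S t A B E \<Longrightarrow> cl E = cl E' \<longleftrightarrow> (E, E') \<in> yoneda_eq C S"
proof
  assume E: "ext_seq C S t A B E" and "cl E = cl E'"
  then have "E \<in> cl E'" using yoneda_eq_refl[OF E] by (auto simp: cl_def)
  then show "(E, E') \<in> yoneda_eq C S" by (auto simp: cl_def yoneda_eq_sym)
next
  assume "(E, E') \<in> yoneda_eq C S"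
  then show "cl E = cl E'"
    unfolding cl_def using yoneda_eq_sym yoneda_eq_trans by blast
qed

lemma mem_cl_iff: "F \<in> cl E \<longleftrightarrow> (E, F) \<in> yoneda_eq C S"
  by (simp add: cl_def)

lemma cl_eqI:
  "ext_seq C S t A B E \<Longrightarrow> ext_seq C S t A B E' \<Longrightarrow> mor C (Idt C B) E E' (Idt C A) \<Longrightarrow> cl E = cl E'"
  using cl_eq_iff yoneda_step_iff unfolding yoneda_eq_def by blast

lemma Ext_iff: "\<gamma> \<in> Ext C S t A B \<longleftrightarrow> (\<exists>E. ext_seq C S t A B E \<and> \<gamma> = cl E)"
  unfolding Ext_def quotient_def cl_def by auto

lemma ExtE:
  assumes "\<gamma> \<in> Ext C S t A B" obtains E where "ext_seq C S t A B E" "\<gamma> = cl E"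
  using assms Ext_iff by blast

lemma cl_Ext: "ext_seq C S t A B E \<Longrightarrow> cl E \<in> Ext C S t A B"
  using Ext_iff by blast

lemma mem_Ext:
  assumes "\<gamma> \<in> Ext C S t A B" "E \<in> \<gamma>" shows "ext_seq C S t A B E" "\<gamma> = cl E"
  using assms yoneda_eq_ext_seq cl_eq_iff unfolding Ext_iff mem_cl_iff by (metis mem_cl_iff)+

lemma Ext_S: "\<gamma> \<in> Ext C S t A B \<Longrightarrow> A \<in> S \<and> B \<in> S \<and> 1 \<le> t"
  using ext_seq_path by (auto simp: Ext_iff)

text \<open>Reversal turns the direction of a step around, which the generated equivalence does not
  see.\<close>

lemma yoneda_step_opp:
  assumes "(E, E') \<in> yoneda_step C S" shows "(rev E', rev E) \<in> yoneda_step (opp C) S"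
proof -
  interpret o: extension_closed_subcategory "opp C" S by (rule extension_closed_subcategory_opp)
  show ?thesis
    using assms ext_seq_opp unfolding yoneda_step_iff o.yoneda_step_iff mor_opp by fastforce
qed

lemma yoneda_eq_opp': "(E, E') \<in> yoneda_eq C S \<Longrightarrow> (rev E, rev E') \<in> yoneda_eq (opp C) S"
  unfolding yoneda_eq_def
  by (induction rule: trancl_induct) (auto dest: yoneda_step_opp intro: trancl_into_trancl)

lemma yoneda_eq_opp [simp]: "(rev E, rev E') \<in> yoneda_eq (opp C) S \<longleftrightarrow> (E, E') \<in> yoneda_eq C S"
proof -
  interpret o: extension_closed_subcategory "opp C" S by (rule extension_closed_subcategory_opp)
  show ?thesis using yoneda_eq_opp' o.yoneda_eq_opp' by fastforce
qed

lemma ext_seq_opp_iff [simp]: "ext_seq (opp C) S t B A (rev E) \<longleftrightarrow> ext_seq C S t A B E"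
proof -
  interpret o: extension_closed_subcategory "opp C" S by (rule extension_closed_subcategory_opp)
  show ?thesis using ext_seq_opp o.ext_seq_opp by fastforce
qed

lemma cl_opp: "extension_closed_subcategory.cl (opp C) S (rev E) = rev ` cl E"
proof -
  interpret o: extension_closed_subcategory "opp C" S by (rule extension_closed_subcategory_opp)
  show ?thesis
    unfolding o.cl_def cl_def using yoneda_eq_opp by (auto simp: mem_image_rev) (metis rev_rev_ident yoneda_eq_opp)+
qed

lemma Ext_opp [simp]: "rev ` \<gamma> \<in> Ext (opp C) S t B A \<longleftrightarrow> \<gamma> \<in> Ext C S t A B"
proof -
  interpret o: extension_closed_subcategory "opp C" S by (rule extension_closed_subcategory_opp)
  have "rev ` \<gamma> \<in> Ext (opp C) S t B A \<longleftrightarrow> (\<exists>E. ext_seq (opp C) S t B A (rev E) \<and> rev ` \<gamma> = o.cl (rev E))"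
    unfolding o.Ext_iff by (metis rev_rev_ident)
  then show ?thesis unfolding Ext_iff by (simp add: cl_opp inj_image_eq_iff)
qed

end

lemma pullback_seq_opp: "pullback_seq C h E F \<longleftrightarrow> pushout_seq (opp C) h (rev E) (rev F)"
proof
  show "pullback_seq C h E F \<Longrightarrow> pushout_seq (opp C) h (rev E) (rev F)"
    by (induction rule: pullback_seq.induct) (auto intro!: pushout_seq.intros)
  assume "pushout_seq (opp C) h (rev E) (rev F)"
  then obtain p p' h' d d' ds where "is_pushout (opp C) p h p' h'"
    "d' \<in> Hom (opp C) (Tgt (opp C) p') (Tgt (opp C) d)" "d' \<cdot>\<^bsub>opp C\<^esub> h' = d"
    "d' \<cdot>\<^bsub>opp C\<^esub> p' = HZero (opp C) (Src (opp C) p') (Tgt (opp C) d)"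
    "rev E = p # d # ds" "rev F = p' # d' # ds"
    by (auto elim: pushout_seq.cases)
  moreover from this(5,6) have "E = rev ds @ [d, p]" "F = rev ds @ [d', p']"
    by (metis append.assoc append_Cons append_Nil rev.simps(2) rev_rev_ident)+
  ultimately show "pullback_seq C h E F" by (auto intro!: pullback_seq.intros)
qed

section \<open>Push-out, pull-back and Yoneda product of classes\<close>

context extension_closed_subcategory
begin

lemma ext_push_opp: "ext_push (opp C) S h (rev ` \<gamma>) = rev ` (\<gamma> \<triangleleft> h)"
proof (rule Set.set_eqI)
  fix G
  have "G \<in> ext_push (opp C) S h (rev ` \<gamma>) \<longleftrightarrow>
      (\<exists>E \<in> \<gamma>. \<exists>F. pushout_seq (opp C) h (rev E) F \<and> (F, G) \<in> yoneda_eq (opp C) S)"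
    by (simp add: ext_push_def)
  also have "\<dots> \<longleftrightarrow> (\<exists>E \<in> \<gamma>. \<exists>F. pushout_seq (opp C) h (rev E) (rev F) \<and> (rev F, rev (rev G)) \<in> yoneda_eq (opp C) S)"
    by (metis rev_rev_ident)
  also have "\<dots> \<longleftrightarrow> G \<in> rev ` (\<gamma> \<triangleleft> h)"
    unfolding mem_image_rev yoneda_eq_opp by (simp add: ext_pull_def pullback_seq_opp)
  finally show "G \<in> ext_push (opp C) S h (rev ` \<gamma>) \<longleftrightarrow> G \<in> rev ` (\<gamma> \<triangleleft> h)" .
qed

lemma yprod_opp:
  assumes "\<gamma> \<in> Ext C S s A B" "\<gamma>' \<in> Ext C S t D A"
  shows "yprod (opp C) S (rev ` \<gamma>') (rev ` \<gamma>) = rev ` (\<gamma> \<star> \<gamma>')"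
proof (rule Set.set_eqI)
  fix G
  have ne: "E \<noteq> []" "E' \<noteq> []" if "E \<in> \<gamma>" "E' \<in> \<gamma>'" for E E'
    using ext_seq_path[OF mem_Ext(1)[OF assms(1) that(1)]] ext_seq_path[OF mem_Ext(1)[OF assms(2) that(2)]]
    by auto
  have sp: "splice (opp C) (rev E') (rev E) = rev (splice C E E')" if "E \<in> \<gamma>" "E' \<in> \<gamma>'" for E E'
    using splice_opp[OF ne[OF that]] .
  have "G \<in> yprod (opp C) S (rev ` \<gamma>') (rev ` \<gamma>) \<longleftrightarrow>
      (\<exists>E \<in> \<gamma>. \<exists>E' \<in> \<gamma>'. (rev (splice C E E'), rev (rev G)) \<in> yoneda_eq (opp C) S)"
    unfolding yprod_def using sp by (auto; metis)
  also have "\<dots> \<longleftrightarrow> G \<in> rev ` (\<gamma> \<star> \<gamma>')"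
    unfolding mem_image_rev yoneda_eq_opp by (simp add: yprod_def)
  finally show "G \<in> yprod (opp C) S (rev ` \<gamma>') (rev ` \<gamma>) \<longleftrightarrow> G \<in> rev ` (\<gamma> \<star> \<gamma>')" .
qed

text \<open>A step G -> G' followed by G' -> F' has first component g, so it factors through the
  push-out F of G; the factor is a step F -> F'. With identity steps the same argument compares two
  push-outs of one sequence.\<close>

lemma push_cl:
  assumes E: "ext_seq C S t A B E" and g: "g \<in> Hom C B B'" "B' \<in> S" and F: "pushout_seq C g E F"
  shows "g \<triangleright> cl E = cl F"
proof -
  have inv: "cl F1 = cl F2" if "E2 \<in> cl E" "pushout_seq C g E F1" "pushout_seq C g E2 F2" for E2 F1 F2
  proof (rule yoneda_eq_invariant[OF _ E, of E2 "\<lambda>E x. \<exists>F. pushout_seq C g E F \<and> x = cl F"])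
    show "(E, E2) \<in> yoneda_eq C S" using that(1) by (simp add: mem_cl_iff)
    fix G G' x x'
    assume *: "(G, G') \<in> yoneda_step C S" "ext_seq C S t A B G" "ext_seq C S t A B G'"
      "\<exists>F. pushout_seq C g G F \<and> x = cl F" "\<exists>F. pushout_seq C g G' F \<and> x' = cl F"
    then obtain F F' where F: "pushout_seq C g G F" "x = cl F" "pushout_seq C g G' F'" "x' = cl F'"
      by blast
    note P = pushout_seq_ext_seq[OF *(2) g F(1)] and P' = pushout_seq_ext_seq[OF *(3) g F(3)]
    have "mor C (Idt C B) G G' (Idt C A)"
      using *(1) unfolding yoneda_step_iff using ext_seq_unique[OF _ *(2)] by blast
    from mor_comp[OF this P'(2)] have "mor C (g \<cdot> Idt C B) G F' (Idt C A \<cdot> Idt C A)"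
      using ext_seq_path[OF *(2)] ext_seq_path[OF *(3)] ext_seq_path[OF P'(1)] by blast
    then have "mor C (Idt C B' \<cdot> g) G F' (Idt C A)"
      using g ext_seq_path[OF E] by (simp add: Hom_def)
    then have "mor C (Idt C B') F F' (Idt C A)"
      using pushout_seq_factor[OF *(2) g(1) F(1) P'(1) Idt_closed] g by simp
    then show "x = x'" using cl_eqI[OF P(1) P'(1)] F by simp
  next
    show "\<exists>x F. pushout_seq C g G F \<and> x = cl F" if "ext_seq C S t A B G" for G
      using pushout_seq_exists[OF that g(1)] by metis
  qed (use that in auto)
  have EE: "E \<in> cl E" using yoneda_eq_refl[OF E] by (simp add: mem_cl_iff)
  have "g \<triangleright> cl E = (\<Union>{cl F2 | E2 F2. E2 \<in> cl E \<and> pushout_seq C g E2 F2})"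
    unfolding ext_push_def cl_def by blast
  also have "\<dots> = cl F" using inv[OF _ F] EE F by blast
  finally show ?thesis .
qed

lemma push_Ext [simp]:
  assumes "\<gamma> \<in> Ext C S t A B" "g \<in> Hom C B B'" "B' \<in> S" shows "g \<triangleright> \<gamma> \<in> Ext C S t A B'"
proof -
  obtain E where E: "ext_seq C S t A B E" "\<gamma> = cl E" using assms(1) by (rule ExtE)
  obtain F where F: "pushout_seq C g E F" using pushout_seq_exists[OF E(1) assms(2)] .
  show ?thesis using push_cl[OF E(1) assms(2,3) F] pushout_seq_ext_seq[OF E(1) assms(2,3) F] E cl_Ext by simp
qed

lemma pull_Ext [simp]:
  assumes "\<gamma> \<in> Ext C S t A B" "h \<in> Hom C A' A" "A' \<in> S" shows "\<gamma> \<triangleleft> h \<in> Ext C S t A' B"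
proof -
  interpret o: extension_closed_subcategory "opp C" S by (rule extension_closed_subcategory_opp)
  show ?thesis using o.push_Ext[of "rev ` \<gamma>" t B A h A'] assms by (simp add: ext_push_opp)
qed

lemma push_mor:
  assumes E: "ext_seq C S t A B E" and E': "ext_seq C S t A B' E'" and mor: "mor C g E E' (Idt C A)"
  shows "g \<triangleright> cl E = cl E'"
proof -
  have P: "path C B E A" "path C B' E' A" "E \<noteq> []" "B' \<in> S"
    using ext_seq_path[OF E] ext_seq_path[OF E'] by auto
  have g: "g \<in> Hom C B B'" using mor_Hom[OF mor P(1-3)] by simp
  obtain F where F: "pushout_seq C g E F" using pushout_seq_exists[OF E g] .
  note PF = pushout_seq_ext_seq[OF E g P(4) F]
  have "mor C (Idt C B') F E' (Idt C A)"
    by (rule pushout_seq_factor[OF E g F E']) (use P mor g in \<open>simp_all add: Hom_def\<close>)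
  then show ?thesis using push_cl[OF E g P(4) F] cl_eqI[OF PF(1) E'] by simp
qed

lemma pull_mor:
  assumes E: "ext_seq C S t A B E" and E': "ext_seq C S t A' B E'" and mor: "mor C (Idt C B) E' E h"
  shows "cl E \<triangleleft> h = cl E'"
proof -
  interpret o: extension_closed_subcategory "opp C" S by (rule extension_closed_subcategory_opp)
  have "ext_push (opp C) S h (o.cl (rev E)) = o.cl (rev E')"
    using assms by (intro o.push_mor) (simp_all add: mor_opp)
  then show ?thesis by (simp add: cl_opp ext_push_opp inj_image_eq_iff)
qed

text \<open>A morphism of sequences factors through the push-out of its source along its first
  component.\<close>

lemma push_pull_mor:
  assumes E: "ext_seq C S t A B E" and E': "ext_seq C S t A' B' E'" and mor: "mor C g E E' h"
  shows "g \<triangleright> cl E = cl E' \<triangleleft> h"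
proof -
  have P: "path C B E A" "path C B' E' A'" "E \<noteq> []" "B' \<in> S"
    using ext_seq_path[OF E] ext_seq_path[OF E'] by auto
  have g: "g \<in> Hom C B B'" using mor_Hom[OF mor P(1-3)] by simp
  obtain F where F: "pushout_seq C g E F" using pushout_seq_exists[OF E g] .
  note PF = pushout_seq_ext_seq[OF E g P(4) F]
  have "mor C (Idt C B') F E' h"
    by (rule pushout_seq_factor[OF E g F E']) (use P mor g in \<open>simp_all add: Hom_def\<close>)
  then show ?thesis using push_cl[OF E g P(4) F] pull_mor[OF E' PF(1)] by simp
qed

lemma push_rep:
  assumes E: "ext_seq C S t A B E" and g: "g \<in> Hom C B B'" "B' \<in> S"
  obtains F where "ext_seq C S t A B' F" "mor C g E F (Idt C A)" "g \<triangleright> cl E = cl F"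
proof -
  obtain F where F: "pushout_seq C g E F" using pushout_seq_exists[OF E g(1)] .
  show ?thesis using that pushout_seq_ext_seq[OF E g F] push_cl[OF E g F] by blast
qed

lemma pull_rep:
  assumes E: "ext_seq C S t A B E" and h: "h \<in> Hom C A' A" "A' \<in> S"
  obtains F where "ext_seq C S t A' B F" "mor C (Idt C B) F E h" "cl E \<triangleleft> h = cl F"
proof -
  interpret o: extension_closed_subcategory "opp C" S by (rule extension_closed_subcategory_opp)
  obtain F' where F': "ext_seq (opp C) S t B A' F'" "mor (opp C) h (rev E) F' (Idt C B)"
    "ext_push (opp C) S h (o.cl (rev E)) = o.cl F'"
    using o.push_rep[of t B A "rev E" h A'] E h by auto
  define F where "F = rev F'"
  have "F' = rev F" by (simp add: F_def)
  with F' that[of F] show ?thesis by (simp add: mor_opp cl_opp ext_push_opp inj_image_eq_iff)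
qed

lemma push_push:
  assumes \<gamma>: "\<gamma> \<in> Ext C S t A B" and g: "g \<in> Hom C B B'" "B' \<in> S" and f: "f \<in> Hom C B' B''" "B'' \<in> S"
  shows "f \<triangleright> g \<triangleright> \<gamma> = (f \<cdot> g) \<triangleright> \<gamma>"
proof -
  obtain E where E: "ext_seq C S t A B E" "\<gamma> = cl E" using \<gamma> by (rule ExtE)
  obtain F where F: "ext_seq C S t A B' F" "mor C g E F (Idt C A)" "g \<triangleright> cl E = cl F"
    using push_rep[OF E(1) g] .
  obtain G where G: "ext_seq C S t A B'' G" "mor C f F G (Idt C A)" "f \<triangleright> cl F = cl G"
    using push_rep[OF F(1) f] .
  have P: "path C B E A" "path C B' F A" "path C B'' G A" "A \<in> S"
    using ext_seq_path[OF E(1)] ext_seq_path[OF F(1)] ext_seq_path[OF G(1)] by auto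
  have "mor C (f \<cdot> g) E G (Idt C A)" using mor_comp[OF F(2) G(2) P(1-3)] P(4) by simp
  then show ?thesis using push_mor[OF E(1) G(1)] E F G by simp
qed

lemma pull_pull:
  assumes "\<gamma> \<in> Ext C S t A B" "g \<in> Hom C A' A" "A' \<in> S" "f \<in> Hom C A'' A'" "A'' \<in> S"
  shows "\<gamma> \<triangleleft> g \<triangleleft> f = \<gamma> \<triangleleft> (g \<cdot> f)"
proof -
  interpret o: extension_closed_subcategory "opp C" S by (rule extension_closed_subcategory_opp)
  show ?thesis using o.push_push[of "rev ` \<gamma>" t B A g A' f A''] assms
    by (simp add: ext_push_opp inj_image_eq_iff)
qed

lemma push_id [simp]: "\<gamma> \<in> Ext C S t A B \<Longrightarrow> Idt C B \<triangleright> \<gamma> = \<gamma>"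
  by (metis ExtE ext_seq_path mor_id push_mor)

lemma pull_id [simp]: "\<gamma> \<in> Ext C S t A B \<Longrightarrow> \<gamma> \<triangleleft> Idt C A = \<gamma>"
  by (metis ExtE ext_seq_path mor_id pull_mor)

text \<open>The morphisms F -> E -> G compose to one with first component g and last component h, to
  which \<open>push_pull_mor\<close> applies.\<close>

lemma push_pull:
  assumes \<gamma>: "\<gamma> \<in> Ext C S t A B" and g: "g \<in> Hom C B B'" "B' \<in> S" and h: "h \<in> Hom C A' A" "A' \<in> S"
  shows "g \<triangleright> (\<gamma> \<triangleleft> h) = (g \<triangleright> \<gamma>) \<triangleleft> h"
proof -
  obtain E where E: "ext_seq C S t A B E" "\<gamma> = cl E" using \<gamma> by (rule ExtE)
  obtain F where F: "ext_seq C S t A' B F" "mor C (Idt C B) F E h" "cl E \<triangleleft> h = cl F"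
    using pull_rep[OF E(1) h] .
  obtain G where G: "ext_seq C S t A B' G" "mor C g E G (Idt C A)" "g \<triangleright> cl E = cl G"
    using push_rep[OF E(1) g] .
  have P: "path C B E A" "path C B F A'" "path C B' G A"
    using ext_seq_path[OF E(1)] ext_seq_path[OF F(1)] ext_seq_path[OF G(1)] by auto
  have "mor C g F G h" using mor_comp[OF F(2) G(2) P(2,1,3)] g h by (simp add: Hom_def)
  then show ?thesis using push_pull_mor[OF F(1) G(1)] E F G by simp
qed

text \<open>A step in one factor, spliced with the identity of the other, is a step of the spliced
  sequences; so the factors can be changed one after the other.\<close>

lemma yprod_cl:
  assumes E: "ext_seq C S s A B E" and E': "ext_seq C S t D A E'"
  shows "cl E \<star> cl E' = cl (splice C E E')"
proof -
  have 1: "cl (splice C G G') = cl (splice C H G')"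
    if "(G, H) \<in> yoneda_step C S" "ext_seq C S s A B G" "ext_seq C S s A B H" "ext_seq C S t D A G'" for G G' H
  proof (rule cl_eqI[OF ext_seq_splice[OF that(2,4)] ext_seq_splice[OF that(3,4)]])
    have "mor C (Idt C B) G H (Idt C A)"
      using that(1) unfolding yoneda_step_iff using ext_seq_unique[OF _ that(2)] by blast
    then show "mor C (Idt C B) (splice C G G') (splice C H G') (Idt C D)"
      using mor_splice[of "Idt C B" G H "Idt C A" G' G' "Idt C D" B A D B A D]
        mor_id[of A G' D] ext_seq_path[OF that(2)] ext_seq_path[OF that(3)] ext_seq_path[OF that(4)]
      by (metis Suc_neq_Zero list.size(3))
  qed
  have 2: "cl (splice C G G') = cl (splice C G H')"
    if "(G', H') \<in> yoneda_step C S" "ext_seq C S s A B G" "ext_seq C S t D A G'" "ext_seq C S t D A H'" for G G' H'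
  proof (rule cl_eqI[OF ext_seq_splice[OF that(2,3)] ext_seq_splice[OF that(2,4)]])
    have "mor C (Idt C A) G' H' (Idt C D)"
      using that(1) unfolding yoneda_step_iff using ext_seq_unique[OF _ that(3)] by blast
    then show "mor C (Idt C B) (splice C G G') (splice C G H') (Idt C D)"
      using mor_splice[of "Idt C B" G G "Idt C A" G' H' "Idt C D" B A D B A D]
        mor_id[of B G A] ext_seq_path[OF that(2)] ext_seq_path[OF that(3)] ext_seq_path[OF that(4)]
      by (metis Suc_neq_Zero list.size(3))
  qed
  have eq: "cl (splice C G G') = cl (splice C E E')" if G: "G \<in> cl E" and G': "G' \<in> cl E'" for G G'
  proof -
    have "(E, G) \<in> yoneda_eq C S" "(E', G') \<in> yoneda_eq C S" using G G' by (auto simp: mem_cl_iff)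
    note e = this yoneda_eq_ext_seq[OF this(1) E]
    have "cl (splice C E E') = cl (splice C G E')"
      by (rule yoneda_eq_invariant[OF e(1) E, of "\<lambda>G x. x = cl (splice C G E')"]) (use 1 E' in auto)
    also have "\<dots> = cl (splice C G G')"
      by (rule yoneda_eq_invariant[OF e(2) E', of "\<lambda>G' x. x = cl (splice C G G')"]) (use 2 e(3) in auto)
    finally show ?thesis by simp
  qed
  have EE: "E \<in> cl E" "E' \<in> cl E'" using yoneda_eq_refl E E' by (auto simp: mem_cl_iff)
  have "cl E \<star> cl E' = (\<Union>{cl (splice C G G') | G G'. G \<in> cl E \<and> G' \<in> cl E'})"
    unfolding yprod_def cl_def by blast
  also have "\<dots> = cl (splice C E E')" using eq EE by blast
  finally show ?thesis .
qed

lemma yprod_Ext [simp]: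
  "\<gamma> \<in> Ext C S s A B \<Longrightarrow> \<gamma>' \<in> Ext C S t D A \<Longrightarrow> \<gamma> \<star> \<gamma>' \<in> Ext C S (s + t) D B"
  by (elim ExtE) (simp add: yprod_cl cl_Ext ext_seq_splice)

lemma yprod_assoc:
  assumes "\<alpha> \<in> Ext C S r A B" "\<beta> \<in> Ext C S s D A" "\<gamma> \<in> Ext C S t F D"
  shows "(\<alpha> \<star> \<beta>) \<star> \<gamma> = \<alpha> \<star> \<beta> \<star> \<gamma>"
proof -
  obtain E1 E2 E3 where E: "ext_seq C S r A B E1" "ext_seq C S s D A E2" "ext_seq C S t F D E3"
    "\<alpha> = cl E1" "\<beta> = cl E2" "\<gamma> = cl E3" using assms unfolding Ext_iff by blast
  have "splice C (splice C E1 E2) E3 = splice C E1 (splice C E2 E3)"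
    using ext_seq_path[OF E(1)] ext_seq_path[OF E(2)] ext_seq_path[OF E(3)] by (intro splice_assoc) auto
  then show ?thesis
    unfolding E(4-6) yprod_cl[OF E(1,2)] yprod_cl[OF E(2,3)]
      yprod_cl[OF ext_seq_splice[OF E(1,2)] E(3)] yprod_cl[OF E(1) ext_seq_splice[OF E(2,3)]] by simp
qed

lemma push_yprod:
  assumes \<gamma>: "\<gamma> \<in> Ext C S s A B" and \<gamma>': "\<gamma>' \<in> Ext C S t D A" and g: "g \<in> Hom C B B'" "B' \<in> S"
  shows "g \<triangleright> (\<gamma> \<star> \<gamma>') = (g \<triangleright> \<gamma>) \<star> \<gamma>'"
proof -
  obtain E where E: "ext_seq C S s A B E" "\<gamma> = cl E" using \<gamma> by (rule ExtE)
  obtain E' where E': "ext_seq C S t D A E'" "\<gamma>' = cl E'" using \<gamma>' by (rule ExtE)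
  obtain F where F: "ext_seq C S s A B' F" "mor C g E F (Idt C A)" "g \<triangleright> cl E = cl F"
    using push_rep[OF E(1) g] .
  have P: "path C B E A" "path C A E' D" "path C B' F A" "E \<noteq> []" "E' \<noteq> []"
    using ext_seq_path[OF E(1)] ext_seq_path[OF E'(1)] ext_seq_path[OF F(1)] by auto
  have "mor C g (splice C E E') (splice C F E') (Idt C D)"
    using mor_splice[OF F(2) mor_id[OF P(2)] P(4,5,1,2,3,2)] .
  then show ?thesis
    using push_mor[OF ext_seq_splice[OF E(1) E'(1)] ext_seq_splice[OF F(1) E'(1)]]
      yprod_cl[OF E(1) E'(1)] yprod_cl[OF F(1) E'(1)] E E' F by simp
qed

lemma yprod_pull:
  assumes \<gamma>: "\<gamma> \<in> Ext C S s A B" and \<gamma>': "\<gamma>' \<in> Ext C S t D A" and h: "h \<in> Hom C D' D" "D' \<in> S"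
  shows "(\<gamma> \<star> \<gamma>') \<triangleleft> h = \<gamma> \<star> (\<gamma>' \<triangleleft> h)"
proof -
  interpret o: extension_closed_subcategory "opp C" S by (rule extension_closed_subcategory_opp)
  show ?thesis
    using o.push_yprod[of "rev ` \<gamma>'" t A D "rev ` \<gamma>" s B h D'] assms
    by (simp add: ext_push_opp yprod_opp[OF \<gamma> \<gamma>'] yprod_opp[OF \<gamma> pull_Ext[OF \<gamma>' h]] inj_image_eq_iff)
qed

text \<open>F -> E ends with h and E' -> G begins with h, so the two morphisms glue to one step
  between the spliced sequences. Most later computations with products use this exchange
  law.\<close>

lemma yprod_pull_push:
  assumes \<gamma>: "\<gamma> \<in> Ext C S s A B" and \<gamma>': "\<gamma>' \<in> Ext C S t D A'" and h: "h \<in> Hom C A' A"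
  shows "(\<gamma> \<triangleleft> h) \<star> \<gamma>' = \<gamma> \<star> (h \<triangleright> \<gamma>')"
proof -
  have S: "A \<in> S" "A' \<in> S" using Ext_S \<gamma> \<gamma>' by auto
  obtain E where E: "ext_seq C S s A B E" "\<gamma> = cl E" using \<gamma> by (rule ExtE)
  obtain E' where E': "ext_seq C S t D A' E'" "\<gamma>' = cl E'" using \<gamma>' by (rule ExtE)
  obtain F where F: "ext_seq C S s A' B F" "mor C (Idt C B) F E h" "cl E \<triangleleft> h = cl F"
    using pull_rep[OF E(1) h S(2)] .
  obtain G where G: "ext_seq C S t D A G" "mor C h E' G (Idt C D)" "h \<triangleright> cl E' = cl G"
    using push_rep[OF E'(1) h S(1)] .
  have P: "path C B E A" "path C A' E' D" "path C B F A'" "path C A G D" "F \<noteq> []" "E' \<noteq> []"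
    using ext_seq_path[OF E(1)] ext_seq_path[OF E'(1)] ext_seq_path[OF F(1)] ext_seq_path[OF G(1)] by auto
  have "mor C (Idt C B) (splice C F E') (splice C E G) (Idt C D)"
    using mor_splice[OF F(2) G(2) P(5,6,3,2,1,4)] .
  then show ?thesis
    using cl_eqI[OF ext_seq_splice[OF F(1) E'(1)] ext_seq_splice[OF E(1) G(1)]]
      yprod_cl[OF F(1) E'(1)] yprod_cl[OF E(1) G(1)] E E' F G by simp
qed

lemma yprod_decomp:
  assumes "\<gamma> \<in> Ext C S (Suc t) A B" "1 \<le> t"
  obtains Z \<omega> \<gamma>' where "\<omega> \<in> Ext C S 1 Z B" "\<gamma>' \<in> Ext C S t A Z" "\<gamma> = \<omega> \<star> \<gamma>'"
proof -
  obtain E where E: "ext_seq C S (Suc t) A B E" "\<gamma> = cl E" using assms(1) by (rule ExtE)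
  show ?thesis
    using E(1)
  proof (cases rule: ext_seq_cases)
    case (splice i p t' j ds)
    have 1: "ext_seq C S 1 (Tgt C p) (Src C i) [i, p]" using splice(1) by (rule ext_seq.single)
    show ?thesis
      using that[of "cl [i, p]" "Tgt C p" "cl (j # ds)"] cl_Ext[OF 1] cl_Ext[OF splice(2)]
        yprod_cl[OF 1 splice(2)] splice E(2) by simp
  qed (use assms in simp)
qed

end

section \<open>The Baer sum\<close>

fun bfst :: "'m \<times> 'm \<times> 'm \<times> 'm \<Rightarrow> 'm" where "bfst (i, j, p, q) = p"

fun bsnd :: "'m \<times> 'm \<times> 'm \<times> 'm \<Rightarrow> 'm" where "bsnd (i, j, p, q) = q"

fun bpair :: "('o, 'm) add_cat \<Rightarrow> 'm \<times> 'm \<times> 'm \<times> 'm \<Rightarrow> 'm \<Rightarrow> 'm \<Rightarrow> 'm" where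
  "bpair C (i, j, p, q) f g = HAdd C (i \<cdot>\<^bsub>C\<^esub> f) (j \<cdot>\<^bsub>C\<^esub> g)"

text \<open>\<open>dsum C b E E' F b'\<close>: \<open>F\<close> is a termwise direct sum of \<open>E\<close> and \<open>E'\<close> for some biproducts of which \<open>b\<close>
  is the first and \<open>b'\<close> the last.\<close>

fun dsum :: "('o, 'm) add_cat \<Rightarrow> 'm \<times> 'm \<times> 'm \<times> 'm \<Rightarrow> 'm list \<Rightarrow> 'm list \<Rightarrow> 'm list \<Rightarrow>
    'm \<times> 'm \<times> 'm \<times> 'm \<Rightarrow> bool" where
  "dsum C b [] [] [] b' \<longleftrightarrow> b = b'"
| "dsum C b (e # E) (e' # E') (f # F) b' \<longleftrightarrow> (\<exists>D. is_biproduct C (Src C e) (Src C e') D b) \<and>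
     (\<exists>c. (\<exists>D. is_biproduct C (Tgt C e) (Tgt C e') D c) \<and> f = biprod_map C b c e e' \<and>
       dsum C c E E' F b')"
| "dsum C b _ _ _ b' \<longleftrightarrow> False"

lemma dsum_length: "dsum C b E E' F b' \<Longrightarrow> length E = length E' \<and> length F = length E'"
  by (induction C b E E' F b' rule: dsum.induct) auto

lemma direct_sum_seq_Cons:
  assumes "E \<noteq> []" "E' \<noteq> []" "Src C (hd E) = Tgt C e" "Src C (hd E') = Tgt C e'"
  shows "direct_sum_seq C (b # bs) (e # E) (e' # E') (f # F) \<longleftrightarrow>
    (\<exists>D. is_biproduct C (Src C e) (Src C e') D b) \<and> f = biprod_map C b (hd bs) e e' \<and>
    direct_sum_seq C bs E E' F"
proof -
  have "seq_objs C (e # E) = Src C e # seq_objs C E" "seq_objs C (e' # E') = Src C e' # seq_objs C E'"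
    using assms by (auto simp: seq_objs_def)
  moreover have "hd bs = bs ! 0" if "length bs = Suc (length E)" using that by (cases bs) auto
  ultimately show ?thesis
    unfolding direct_sum_seq_def by (auto simp: all_le_Suc All_less_Suc2 simp del: is_biproduct.simps)
qed

lemma direct_sum_seq_single:
  "direct_sum_seq C bs [e] [e'] F \<longleftrightarrow> (\<exists>b c. bs = [b, c] \<and> F = [biprod_map C b c e e'] \<and>
    (\<exists>D. is_biproduct C (Src C e) (Src C e') D b) \<and> (\<exists>D. is_biproduct C (Tgt C e) (Tgt C e') D c))"
  by (auto simp: direct_sum_seq_def seq_objs_def all_le_Suc length_Suc_conv simp del: is_biproduct.simps)

text \<open>As for \<open>mor\<close>, a recursive description that keeps only the outer biproducts
  replaces the indexed one.\<close>

lemma direct_sum_seq_dsum: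
  assumes "path C A E B" "path C A' E' B'" "E \<noteq> []"
  shows "(\<exists>bs. direct_sum_seq C bs E E' F \<and> hd bs = b \<and> last bs = b') \<longleftrightarrow> dsum C b E E' F b'"
proof (cases "length E = length E' \<and> length E' = length F")
  case False
  then show ?thesis using dsum_length by (metis direct_sum_seq_def)
next
  case True
  then have "length E = length E'" "length E' = length F" by auto
  from this assms show ?thesis
  proof (induction E E' F arbitrary: A A' b rule: list_induct3)
    case (Cons e E e' E' f F)
    show ?case
    proof (cases "E = []")
      case True
      with Cons.hyps have E'F: "E' = []" "F = []" by auto
      show ?thesis
        unfolding True E'F direct_sum_seq_single dsum.simps
        by (auto simp del: is_biproduct.simps biprod_map.simps split_paired_Ex intro!: exI[of _ "[b, b']"])
    next
      case False
      with Cons.hyps have E': "E' \<noteq> []" by auto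
      have hds: "Src C (hd E) = Tgt C e" "Src C (hd E') = Tgt C e'"
        using Cons.prems False E' by (cases E; cases E'; auto)+
      note sm = direct_sum_seq_Cons[OF False E' hds]
      have IH: "(\<exists>bs. direct_sum_seq C bs E E' F \<and> hd bs = c \<and> last bs = b') \<longleftrightarrow> dsum C c E E' F b'" for c
        using Cons.IH[of "Tgt C e" "Tgt C e'" c] Cons.prems False by simp
      show ?thesis
      proof
        assume "\<exists>bs. direct_sum_seq C bs (e # E) (e' # E') (f # F) \<and> hd bs = b \<and> last bs = b'"
        then obtain bs where bs: "direct_sum_seq C bs (e # E) (e' # E') (f # F)" "hd bs = b" "last bs = b'" by blast
        then obtain cs where cs: "bs = b # cs" by (cases bs) (auto simp: direct_sum_seq_def)
        with bs sm have s: "\<exists>D. is_biproduct C (Src C e) (Src C e') D b" "f = biprod_map C b (hd cs) e e'"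
          "direct_sum_seq C cs E E' F" by auto
        have ne: "cs \<noteq> []" using s(3) by (auto simp: direct_sum_seq_def)
        then have "\<exists>D. is_biproduct C (Tgt C e) (Tgt C e') D (hd cs)"
          using s(3) hds False E' unfolding direct_sum_seq_def seq_objs_def
          by (metis hd_conv_nth nth_Cons_0 zero_le)
        moreover have "dsum C (hd cs) E E' F b'" using IH[of "hd cs"] s(3) bs(3) cs ne by (metis last_ConsR)
        ultimately show "dsum C b (e # E) (e' # E') (f # F) b'" using s unfolding dsum.simps by blast
      next
        assume "dsum C b (e # E) (e' # E') (f # F) b'"
        then obtain c where g: "\<exists>D. is_biproduct C (Src C e) (Src C e') D b" "f = biprod_map C b c e e'"
          "dsum C c E E' F b'"
          unfolding dsum.simps by blast
        then obtain cs where \<psi>: "direct_sum_seq C cs E E' F" "hd cs = c" "last cs = b'" using IH by blast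
        moreover have "cs \<noteq> []" using \<psi>(1) by (auto simp: direct_sum_seq_def)
        ultimately show "\<exists>bs. direct_sum_seq C bs (e # E) (e' # E') (f # F) \<and> hd bs = b \<and> last bs = b'"
          using sm g by (intro exI[of _ "b # cs"]) (simp del: is_biproduct.simps)
      qed
    qed
  qed simp
qed

section \<open>Pairings, codiagonals and direct sums of sequences\<close>

context preadditive_category
begin

lemma biproduct_Hom:
  assumes "is_biproduct C A B D b"
  shows "bfst b \<in> Hom C D A" "bsnd b \<in> Hom C D B"
  using assms by (cases b; auto)+

lemma bpair_simps:
  assumes b: "is_biproduct C A B D b" and f: "f \<in> Hom C X A" and g: "g \<in> Hom C X B"
  shows "bpair C b f g \<in> Hom C X D" "bfst b \<cdot> bpair C b f g = f" "bsnd b \<cdot> bpair C b f g = g"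
proof -
  obtain i j p q where b_eq: "b = (i, j, p, q)" by (cases b)
  note B = b[unfolded b_eq]
  show "bpair C b f g \<in> Hom C X D" "bfst b \<cdot> bpair C b f g = f" "bsnd b \<cdot> bpair C b f g = g"
    using biproductD[OF B] biproduct_comps[OF B] f g unfolding b_eq
    by (auto simp: Hom_def comp_hadd)
qed

lemma bpair_ext:
  assumes b: "is_biproduct C A B D b" and "f \<in> Hom C X D" "g \<in> Hom C X D"
    "bfst b \<cdot> f = bfst b \<cdot> g" "bsnd b \<cdot> f = bsnd b \<cdot> g"
  shows "f = g"
proof -
  obtain i j p q where b_eq: "b = (i, j, p, q)" by (cases b)
  show ?thesis
    by (rule biproduct_ext[OF b[unfolded b_eq]]) (use assms in \<open>auto simp: b_eq Hom_def\<close>)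
qed

lemma biprod_map_bpair: "biprod_map C b b' f g = bpair C b' (f \<cdot> bfst b) (g \<cdot> bsnd b)"
  by (cases b; cases b') simp

lemma biprod_map_Hom:
  assumes b: "is_biproduct C A B D b" and b': "is_biproduct C A' B' D' b'"
    and f: "f \<in> Hom C A A'" and g: "g \<in> Hom C B B'"
  shows "biprod_map C b b' f g \<in> Hom C D D'"
    "bfst b' \<cdot> biprod_map C b b' f g = f \<cdot> bfst b" "bsnd b' \<cdot> biprod_map C b b' f g = g \<cdot> bsnd b"
  using bpair_simps[OF b' Comp_closed[OF biproduct_Hom(1)[OF b] f] Comp_closed[OF biproduct_Hom(2)[OF b] g]]
  unfolding biprod_map_bpair by auto

lemma biprod_map_comp:
  assumes b: "is_biproduct C A B D b" and b': "is_biproduct C A' B' D' b'" and b'': "is_biproduct C A'' B'' D'' b''"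
    and f: "f \<in> Hom C A A'" and g: "g \<in> Hom C B B'" and f': "f' \<in> Hom C A' A''" and g': "g' \<in> Hom C B' B''"
  shows "biprod_map C b' b'' f' g' \<cdot> biprod_map C b b' f g = biprod_map C b b'' (f' \<cdot> f) (g' \<cdot> g)"
proof -
  note m = biprod_map_Hom[OF b b' f g] and m' = biprod_map_Hom[OF b' b'' f' g']
    and m'' = biprod_map_Hom[OF b b'' Comp_closed[OF f f'] Comp_closed[OF g g']]
    and pr = biproduct_Hom[OF b] biproduct_Hom[OF b'] biproduct_Hom[OF b'']
  show ?thesis
  proof (rule bpair_ext[OF b'' Comp_closed[OF m(1) m'(1)] m''(1)])
    show "bfst b'' \<cdot> biprod_map C b' b'' f' g' \<cdot> biprod_map C b b' f g =
        bfst b'' \<cdot> biprod_map C b b'' (f' \<cdot> f) (g' \<cdot> g)"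
      using Comp_assoc[OF m(1) m'(1) pr(5)] Comp_assoc[OF m(1) pr(3) f'] Comp_assoc[OF pr(1) f f']
      by (simp add: m(2) m'(2) m''(2))
    show "bsnd b'' \<cdot> biprod_map C b' b'' f' g' \<cdot> biprod_map C b b' f g =
        bsnd b'' \<cdot> biprod_map C b b'' (f' \<cdot> f) (g' \<cdot> g)"
      using Comp_assoc[OF m(1) m'(1) pr(6)] Comp_assoc[OF m(1) pr(4) g'] Comp_assoc[OF pr(2) g g']
      by (simp add: m(3) m'(3) m''(3))
  qed
qed

lemma codiagonal_Hom:
  assumes "is_biproduct C A A D b"
  shows "codiagonal C b = bfst b \<boxplus> bsnd b" "codiagonal C b \<in> Hom C D A" "diagonal C b = bpair C b (Idt C A) (Idt C A)"
  using assms by (cases b; auto simp: Hom_def)+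

lemma dsum_Cons:
  assumes "dsum C b (e # E) E' F b'"
  obtains e' E1 f F1 c D where "E' = e' # E1" "F = f # F1" "is_biproduct C (Tgt C e) (Tgt C e') D c"
    "f = biprod_map C b c e e'" "dsum C c E E1 F1 b'"
proof -
  obtain e' E1 where E': "E' = e' # E1" using dsum_length[OF assms] by (cases E') auto
  obtain f F1 where F: "F = f # F1" using dsum_length[OF assms] E' by (cases F) auto
  show ?thesis using assms that unfolding E' F dsum.simps by blast
qed

lemma arr_Hom: "f \<in> Arr C \<Longrightarrow> f \<in> Hom C (Src C f) (Tgt C f)"
  by (simp add: Hom_def)

lemma dsum_path:
  assumes "dsum C b E E' F b'" "path C A E B" "path C A' E' B'" "is_biproduct C A A' D b"
  shows "\<exists>D'. is_biproduct C B B' D' b' \<and> path C D F D'"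
  using assms
proof (induction E arbitrary: b E' F A A' D)
  case Nil
  then show ?case using dsum_length[OF Nil(1)] by (cases b) auto
next
  case (Cons e E)
  from Cons.prems(1) obtain e' E1 f F1 c D' where c: "E' = e' # E1" "F = f # F1" "is_biproduct C (Tgt C e) (Tgt C e') D' c"
    "f = biprod_map C b c e e'" "dsum C c E E1 F1 b'" by (rule dsum_Cons)
  from Cons.prems have e: "e \<in> Arr C" "e' \<in> Arr C" and b: "is_biproduct C (Src C e) (Src C e') D b"
    by (auto simp: c(1) simp del: is_biproduct.simps)
  obtain D'' where D'': "is_biproduct C B B' D'' b'" "path C D' F1 D''"
    using Cons.IH[OF c(5) _ _ c(3)] Cons.prems by (auto simp: c(1))
  have "f \<in> Hom C D D'"
    unfolding c(4) using biprod_map_Hom(1)[OF b c(3)] arr_Hom e by blast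
  then show ?case using D'' by (auto simp: c(2) Hom_def simp del: is_biproduct.simps)
qed

lemma dsum_exists:
  assumes "path C A E B" "path C A' E' B'" "length E = length E'" "is_biproduct C A A' D b"
    and ex: "\<And>X Y. X \<in> Obj C \<Longrightarrow> Y \<in> Obj C \<Longrightarrow> \<exists>D b. is_biproduct C X Y D b"
  shows "\<exists>F b'. dsum C b E E' F b'"
  using assms(1-4)
proof (induction E arbitrary: b E' A A' D)
  case Nil
  then show ?case by (metis dsum.simps(1) length_0_conv)
next
  case (Cons e E)
  obtain e' E1 where E': "E' = e' # E1" using Cons.prems(3) by (cases E') auto
  obtain D' c where c: "is_biproduct C (Tgt C e) (Tgt C e') D' c"
    using ex[of "Tgt C e" "Tgt C e'"] Cons.prems by (auto simp: E' simp del: is_biproduct.simps)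
  obtain F b' where "dsum C c E E1 F b'"
    using Cons.IH[of "Tgt C e" "Tgt C e'" E1 D' c] Cons.prems c by (auto simp: E' simp del: is_biproduct.simps)
  then have "dsum C b (e # E) E' (biprod_map C b c e e' # F) b'"
    using Cons.prems c unfolding E' dsum.simps path.simps by metis
  then show ?case by blast
qed

lemma bpair_biprod_map:
  assumes b: "is_biproduct C A B D b" and c: "is_biproduct C A' B' D' c"
    and f: "f \<in> Hom C X A" and g: "g \<in> Hom C X B" and h: "h \<in> Hom C A A'" and k: "k \<in> Hom C B B'"
  shows "biprod_map C b c h k \<cdot> bpair C b f g = bpair C c (h \<cdot> f) (k \<cdot> g)"
proof -
  note m = biprod_map_Hom[OF b c h k] and p = bpair_simps[OF b f g]
    and q = bpair_simps[OF c Comp_closed[OF f h] Comp_closed[OF g k]]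
    and pr = biproduct_Hom[OF b] biproduct_Hom[OF c]
  show ?thesis
  proof (rule bpair_ext[OF c Comp_closed[OF p(1) m(1)] q(1)])
    show "bfst c \<cdot> biprod_map C b c h k \<cdot> bpair C b f g = bfst c \<cdot> bpair C c (h \<cdot> f) (k \<cdot> g)"
      by (simp only: Comp_assoc[OF p(1) m(1) pr(3), symmetric] Comp_assoc[OF p(1) pr(1) h] m(2,3) p(2,3) q(2,3))
    show "bsnd c \<cdot> biprod_map C b c h k \<cdot> bpair C b f g = bsnd c \<cdot> bpair C c (h \<cdot> f) (k \<cdot> g)"
      by (simp only: Comp_assoc[OF p(1) m(1) pr(4), symmetric] Comp_assoc[OF p(1) pr(2) k] m(2,3) p(2,3) q(2,3))
  qed
qed

lemma bpair_comp:
  assumes b: "is_biproduct C A B D b" and f: "f \<in> Hom C X A" and g: "g \<in> Hom C X B" and h: "h \<in> Hom C Y X"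
  shows "bpair C b f g \<cdot> h = bpair C b (f \<cdot> h) (g \<cdot> h)"
proof -
  note p = bpair_simps[OF b f g] and q = bpair_simps[OF b Comp_closed[OF h f] Comp_closed[OF h g]]
    and pr = biproduct_Hom[OF b]
  show ?thesis
  proof (rule bpair_ext[OF b Comp_closed[OF h p(1)] q(1)])
    show "bfst b \<cdot> bpair C b f g \<cdot> h = bfst b \<cdot> bpair C b (f \<cdot> h) (g \<cdot> h)"
      by (simp only: Comp_assoc[OF h p(1) pr(1), symmetric] p(2,3) q(2,3))
    show "bsnd b \<cdot> bpair C b f g \<cdot> h = bsnd b \<cdot> bpair C b (f \<cdot> h) (g \<cdot> h)"
      by (simp only: Comp_assoc[OF h p(1) pr(2), symmetric] p(2,3) q(2,3))
  qed
qed

lemma dsum_mor_pair: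
  assumes "mor C f G E h" "mor C f' G E' h'" "dsum C b E E' F b'" "path C X G Y" "path C A E B" "path C A' E' B'"
    "is_biproduct C A A' D b"
  shows "mor C (bpair C b f f') G F (bpair C b' h h')"
  using assms
proof (induction G arbitrary: b E E' F A A' D X f f')
  case Nil
  then show ?case using mor_length[OF Nil(1)] mor_length[OF Nil(2)] dsum_length[OF Nil(3)] by simp
next
  case (Cons d G)
  obtain e E0 where E: "E = e # E0" using mor_length[OF Cons.prems(1)] by (cases E) auto
  from Cons.prems(3)[unfolded E] obtain e' E1 k F1 c D' where c: "E' = e' # E1" "F = k # F1" "is_biproduct C (Tgt C e) (Tgt C e') D' c"
    "k = biprod_map C b c e e'" "dsum C c E0 E1 F1 b'" by (rule dsum_Cons)
  from Cons.prems have e: "e \<in> Hom C A (Tgt C e)" "e' \<in> Hom C A' (Tgt C e')" and d: "d \<in> Hom C (Src C d) (Tgt C d)"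
    and b: "is_biproduct C A A' D b" by (auto simp: E c(1) Hom_def simp del: is_biproduct.simps)
  have A: "Src C e = A" "Src C e' = A'" using Cons.prems by (auto simp: E c(1))
  obtain g where g: "f \<in> Hom C (Src C d) A" "g \<in> Hom C (Tgt C d) (Tgt C e)" "g \<cdot> d = e \<cdot> f" "mor C g G E0 h"
    using Cons.prems(1) by (auto simp: E A)
  obtain g' where g': "f' \<in> Hom C (Src C d) A'" "g' \<in> Hom C (Tgt C d) (Tgt C e')" "g' \<cdot> d = e' \<cdot> f'" "mor C g' G E1 h'"
    using Cons.prems(2) by (auto simp: c(1) A)
  have "mor C (bpair C c g g') G F1 (bpair C b' h h')"
    using Cons.IH[OF g(4) g'(4) c(5) _ _ _ c(3)] Cons.prems by (auto simp: E c(1))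
  moreover have "bpair C c g g' \<cdot> d = k \<cdot> bpair C b f f'"
    unfolding c(4) bpair_comp[OF c(3) g(2) g'(2) d] bpair_biprod_map[OF b c(3) g(1) g'(1) e] g(3) g'(3) ..
  moreover have "bpair C c g g' \<in> Hom C (Tgt C d) (Tgt C k)" "bpair C b f f' \<in> Hom C (Src C d) (Src C k)"
    using bpair_simps(1)[OF c(3) g(2) g'(2)] bpair_simps(1)[OF b g(1) g'(1)]
      biprod_map_Hom(1)[OF b c(3) e] unfolding c(4) by (auto simp: Hom_def)
  ultimately show ?case unfolding c(2) mor.simps by metis
qed

lemma dsum_mor_fst:
  assumes "dsum C b E E' F b'" "path C A E B" "path C A' E' B'" "is_biproduct C A A' D b"
  shows "mor C (bfst b) F E (bfst b')" "mor C (bsnd b) F E' (bsnd b')"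
proof -
  have "mor C (bfst b) F E (bfst b') \<and> mor C (bsnd b) F E' (bsnd b')"
    using assms
  proof (induction E arbitrary: b E' F A A' D)
    case Nil
    then show ?case using dsum_length[OF Nil(1)] by auto
  next
    case (Cons e E)
    from Cons.prems(1) obtain e' E1 k F1 c D' where c: "E' = e' # E1" "F = k # F1" "is_biproduct C (Tgt C e) (Tgt C e') D' c"
      "k = biprod_map C b c e e'" "dsum C c E E1 F1 b'" by (rule dsum_Cons)
    from Cons.prems have e: "e \<in> Hom C A (Tgt C e)" "e' \<in> Hom C A' (Tgt C e')"
      and b: "is_biproduct C A A' D b" by (auto simp: c(1) Hom_def simp del: is_biproduct.simps)
    have A: "Src C e = A" "Src C e' = A'" using Cons.prems by (auto simp: c(1))
    note m = biprod_map_Hom[OF b c(3) e, folded c(4)]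
    have "mor C (bfst c) F1 E (bfst b') \<and> mor C (bsnd c) F1 E1 (bsnd b')"
      using Cons.IH[OF c(5) _ _ c(3)] Cons.prems by (auto simp: c(1))
    then show ?case
      using m biproduct_Hom[OF b] biproduct_Hom[OF c(3)] unfolding c(1,2) mor.simps A by (auto simp: Hom_def)
  qed
  then show "mor C (bfst b) F E (bfst b')" "mor C (bsnd b) F E' (bsnd b')" by auto
qed

lemma codiagonal_natural:
  assumes b: "is_biproduct C A A D b" and c: "is_biproduct C B B D' c" and e: "e \<in> Hom C A B"
  shows "codiagonal C c \<cdot> biprod_map C b c e e = e \<cdot> codiagonal C b"
proof -
  note m = biprod_map_Hom[OF b c e e]
  have "codiagonal C c \<cdot> biprod_map C b c e e = e \<cdot> bfst b \<boxplus> e \<cdot> bsnd b"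
    unfolding codiagonal_Hom(1)[OF c] m(2,3)[symmetric]
    using HAdd_Comp[OF m(1) biproduct_Hom[OF c]] .
  also have "\<dots> = e \<cdot> codiagonal C b"
    unfolding codiagonal_Hom(1)[OF b] using Comp_HAdd[OF biproduct_Hom[OF b] e] by simp
  finally show ?thesis .
qed

lemma dsum_mor_codiagonal:
  assumes "dsum C b E E F b'" "path C A E B" "is_biproduct C A A D b"
  shows "mor C (codiagonal C b) F E (codiagonal C b')"
  using assms
proof (induction E arbitrary: b F A D)
  case Nil
  then show ?case using dsum_length[OF Nil(1)] by simp
next
  case (Cons e E)
  from Cons.prems(1) obtain e' E1 k F1 c D' where c: "e # E = e' # E1" "F = k # F1" "is_biproduct C (Tgt C e) (Tgt C e') D' c"
    "k = biprod_map C b c e e'" "dsum C c E E1 F1 b'" by (rule dsum_Cons)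
  have e': "e' = e" "E1 = E" using c(1) by auto
  from Cons.prems have e: "e \<in> Hom C A (Tgt C e)"
    and b: "is_biproduct C A A D b" by (auto simp: Hom_def simp del: is_biproduct.simps)
  have A: "Src C e = A" using Cons.prems by auto
  note c = c[unfolded e']
  note m = biprod_map_Hom[OF b c(3) e e, folded c(4)]
  have "mor C (codiagonal C c) F1 E (codiagonal C b')"
    using Cons.IH[OF c(5) _ c(3)] Cons.prems by auto
  then show ?case
    using m codiagonal_Hom(2)[OF b] codiagonal_Hom(2)[OF c(3)] codiagonal_natural[OF b c(3) e, folded c(4)]
    unfolding c(2) mor.simps A by (auto simp: Hom_def)
qed

lemma dsum_mor:
  assumes f: "mor C f E G h" and f': "mor C f' E' G' h'" and F: "dsum C b E E' F b'" and H: "dsum C c G G' H c'"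
    and P: "path C A E B" "path C A' E' B'" "path C X G Y" "path C X' G' Y'"
    and b: "is_biproduct C A A' D b" and c: "is_biproduct C X X' D' c"
  shows "mor C (biprod_map C b c f f') F H (biprod_map C b' c' h h')"
proof -
  obtain D1 where D1: "path C D F D1" using dsum_path[OF F P(1,2) b] by blast
  note fs = dsum_mor_fst[OF F P(1,2) b]
  show ?thesis
    unfolding biprod_map_bpair
    by (rule dsum_mor_pair[OF mor_comp[OF fs(1) f D1 P(1,3)] mor_comp[OF fs(2) f' D1 P(2,4)] H D1 P(3,4) c])
qed

end

declare is_biproduct.simps [simp del] biprod_map.simps [simp del] split_paired_Ex [simp del]

lemma (in preadditive_category) dsum_Cons2:
  assumes "dsum C b (e # E) (e' # E') F b'"
  obtains f F1 c D where "F = f # F1" "is_biproduct C (Tgt C e) (Tgt C e') D c"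
    "f = biprod_map C b c e e'" "dsum C c E E' F1 b'"
proof -
  obtain e0 E1 f F1 c D where "e' # E' = e0 # E1" "F = f # F1" "is_biproduct C (Tgt C e) (Tgt C e0) D c"
    "f = biprod_map C b c e e0" "dsum C c E E1 F1 b'" by (rule dsum_Cons[OF assms])
  then show ?thesis using that by simp
qed

section \<open>The Baer sum on classes\<close>

context extension_closed_subcategory
begin

abbreviation baer (infixl "\<uplus>" 70) where
  "\<gamma> \<uplus> \<gamma>' \<equiv> baer_sum C S \<gamma> \<gamma>'"

text \<open>Conflations add up to conflations; the work is to cut the direct sum of two spliced
  sequences at the right objects.\<close>

lemma dsum_ext_seq:
  assumes "ext_seq C S t A B E" "ext_seq C S t A' B' E'" "dsum C b E E' F b'"
    "is_biproduct C B B' D b" "is_biproduct C A A' D' b'"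
  shows "ext_seq C S t D' D F"
  using assms
proof (induction t arbitrary: B B' E E' b F D)
  case 0
  then show ?case using ext_seq_path by fastforce
next
  case (Suc t)
  from Suc.prems(1) show ?case
  proof (cases rule: ext_seq_cases)
    case (single i p)
    note E = single
    from Suc.prems(2) obtain i' p' where E': "conflation C S i' p'" "E' = [i', p']" "A' = Tgt C p'" "B' = Src C i'"
      using E(3) by (cases rule: ext_seq_cases) (auto dest: ext_seq_path)
    note c = conflationD[OF E(1)] conflationD[OF E'(1)]
    obtain f F1 e D1 where F: "F = f # F1" "is_biproduct C (Tgt C i) (Tgt C i') D1 e" "f = biprod_map C b e i i'"
      "dsum C e [p] [p'] F1 b'"
      using Suc.prems(3)[unfolded E(2) E'(2)] by (rule dsum_Cons2)
    then have F1: "F1 = [biprod_map C e b' p p']" using dsum_length by (elim dsum_Cons2) fastforce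
    note m = biprod_map_Hom(1)[OF Suc.prems(4) F(2), of i i'] biprod_map_Hom(1)[OF F(2) Suc.prems(5), of p p']
    have "conflation C S (biprod_map C b e i i') (biprod_map C e b' p p')"
      using conflation_biproduct[OF E(1) E'(1)] F(2) Suc.prems(4,5) E E' by blast
    from ext_seq_single[OF this, of D' D] show ?thesis
      using m c E E' F F1 by (simp add: Hom_def)
  next
    case (splice i p t' j ds)
    note E = splice
    have t': "t' = t" "t \<noteq> 0" using E ext_seq_path[OF E(2)] by auto
    from Suc.prems(2) obtain i' p' j' ds' where E': "conflation C S i' p'" "ext_seq C S t A' (Tgt C p') (j' # ds')"
      "E' = i' # (j' \<cdot> p') # ds'" "B' = Src C i'"
      using t'(2) by (cases rule: ext_seq_cases) auto
    note c = conflationD[OF E(1)] conflationD[OF E'(1)]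
    have j: "j \<in> Hom C (Tgt C p) (Tgt C j)" "j' \<in> Hom C (Tgt C p') (Tgt C j')"
      using ext_seq_path[OF E(2)] ext_seq_path[OF E'(2)] by (auto simp: Hom_def)
    have p: "p \<in> Hom C (Tgt C i) (Tgt C p)" "p' \<in> Hom C (Tgt C i') (Tgt C p')"
      "i \<in> Hom C B (Tgt C i)" "i' \<in> Hom C B' (Tgt C i')"
      using c E E' by (auto simp: Hom_def)
    obtain f F1 e D1 where F: "F = f # F1" "is_biproduct C (Tgt C i) (Tgt C i') D1 e" "f = biprod_map C b e i i'"
      "dsum C e ((j \<cdot> p) # ds) ((j' \<cdot> p') # ds') F1 b'"
      using Suc.prems(3)[unfolded E(3) E'(3)] by (rule dsum_Cons2)
    have jp: "Tgt C (j \<cdot> p) = Tgt C j" "Tgt C (j' \<cdot> p') = Tgt C j'" using j p by (auto simp: Hom_def)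
    obtain g F2 k D2 where F1: "F1 = g # F2" "is_biproduct C (Tgt C j) (Tgt C j') D2 k"
      "g = biprod_map C e k (j \<cdot> p) (j' \<cdot> p')" "dsum C k ds ds' F2 b'"
      using F(4) by (rule dsum_Cons2) (auto simp: jp)
    \<comment> \<open>A direct sum of sequences carries no biproduct at the splicing objects. One is
      chosen, and the map g is factored through it.\<close>
    obtain D3 l where l: "is_biproduct C (Tgt C p) (Tgt C p') D3 l"
      using biproduct_exists[of "Tgt C p" "Tgt C p'"] c by (auto simp del: is_biproduct.simps)
    have g: "g = biprod_map C l k j j' \<cdot> biprod_map C e l p p'"
      unfolding F1(3) using biprod_map_comp[OF F(2) l F1(2) p(1,2) j] by simp
    have "dsum C l (j # ds) (j' # ds') (biprod_map C l k j j' # F2) b'"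
      using l F1 j unfolding dsum.simps Hom_def by auto
    from Suc.IH[OF E(2)[unfolded t'] E'(2) this l Suc.prems(5)]
    have IH: "ext_seq C S t D' D3 (biprod_map C l k j j' # F2)" .
    note m = biprod_map_Hom(1)[OF Suc.prems(4) F(2) p(3,4)] biprod_map_Hom(1)[OF F(2) l p(1,2)]
    have "conflation C S (biprod_map C b e i i') (biprod_map C e l p p')"
      using conflation_biproduct[OF E(1) E'(1)] F(2) Suc.prems(4) l E E' by blast
    from ext_seq.splice[OF this, of t D' "biprod_map C l k j j'" F2] IH m
    show ?thesis unfolding F(1) F1(1) g F(3) by (simp add: Hom_def)
  qed
qed

lemma diagonal_Hom:
  assumes b: "is_biproduct C A A D b" shows "diagonal C b \<in> Hom C A D"
proof -
  have "Idt C A \<in> Hom C A A" using b Idt_closed by (cases b) (simp add: is_biproduct.simps)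
  then show ?thesis unfolding codiagonal_Hom(3)[OF b] using bpair_simps(1)[OF b] by blast
qed

text \<open>The maps induced by identities compare the outer biproducts and respect diagonal and
  codiagonal. Together with the given morphisms they form a morphism F1 -> F2; so a change of
  biproducts and a step in either summand are settled at once.\<close>

lemma dsum_value_unique:
  assumes E: "ext_seq C S t A B E1" "ext_seq C S t A B E2" "mor C (Idt C B) E1 E2 (Idt C A)"
    and E': "ext_seq C S t A B E1'" "ext_seq C S t A B E2'" "mor C (Idt C B) E1' E2' (Idt C A)"
    and F1: "dsum C b E1 E1' F1 b'" and b: "is_biproduct C B B D1 b" and b': "is_biproduct C A A D1' b'"
    and F2: "dsum C c E2 E2' F2 c'" and c: "is_biproduct C B B D2 c" and c': "is_biproduct C A A D2' c'"
  shows "codiagonal C b \<triangleright> (cl F1 \<triangleleft> diagonal C b') = codiagonal C c \<triangleright> (cl F2 \<triangleleft> diagonal C c')"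
proof -
  let ?\<theta> = "biprod_map C b c (Idt C B) (Idt C B)" and ?\<theta>' = "biprod_map C b' c' (Idt C A) (Idt C A)"
  have S: "A \<in> S" "B \<in> S" "D1 \<in> S" "D2 \<in> S" "D1' \<in> S" "D2' \<in> S"
    using ext_seq_path[OF E(1)] biproduct_S[OF b] biproduct_S[OF b'] biproduct_S[OF c] biproduct_S[OF c'] by auto
  have id: "Idt C A \<in> Hom C A A" "Idt C B \<in> Hom C B B" using S Idt_closed by auto
  have P: "path C B E1 A" "path C B E2 A" "path C B E1' A" "path C B E2' A"
    using ext_seq_path[OF E(1)] ext_seq_path[OF E(2)] ext_seq_path[OF E'(1)] ext_seq_path[OF E'(2)] by auto
  have s1: "ext_seq C S t D1' D1 F1" using dsum_ext_seq[OF E(1) E'(1) F1 b b'] .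
  have s2: "ext_seq C S t D2' D2 F2" using dsum_ext_seq[OF E(2) E'(2) F2 c c'] .
  note \<theta> = biprod_map_Hom[OF b c id(2,2)] and \<theta>' = biprod_map_Hom[OF b' c' id(1,1)]
  have eq: "?\<theta> \<triangleright> cl F1 = cl F2 \<triangleleft> ?\<theta>'"
    by (rule push_pull_mor[OF s1 s2 dsum_mor[OF E(3) E'(3) F1 F2 P(1,3,2,4) b c]])
  note d = diagonal_Hom[OF b'] diagonal_Hom[OF c'] codiagonal_Hom(2)[OF b] codiagonal_Hom(2)[OF c]
  have cb: "codiagonal C c \<cdot> ?\<theta> = codiagonal C b"
    using codiagonal_natural[OF b c id(2)] d(3) by (simp add: Hom_def)
  have "?\<theta>' \<cdot> diagonal C b' = bpair C c' (Idt C A \<cdot> Idt C A) (Idt C A \<cdot> Idt C A)"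
    unfolding codiagonal_Hom(3)[OF b'] by (rule bpair_biprod_map[OF b' c' id(1,1,1,1)])
  then have db: "?\<theta>' \<cdot> diagonal C b' = diagonal C c'"
    unfolding codiagonal_Hom(3)[OF c'] using S by simp
  have "codiagonal C b \<triangleright> (cl F1 \<triangleleft> diagonal C b') = codiagonal C c \<triangleright> ?\<theta> \<triangleright> (cl F1 \<triangleleft> diagonal C b')"
    using push_push[OF pull_Ext[OF cl_Ext[OF s1] d(1) S(1)] \<theta>(1) S(4) d(4) S(2)] cb by simp
  also have "?\<theta> \<triangleright> (cl F1 \<triangleleft> diagonal C b') = (?\<theta> \<triangleright> cl F1) \<triangleleft> diagonal C b'"
    using push_pull[OF cl_Ext[OF s1] \<theta>(1) S(4) d(1) S(1)] .
  also have "\<dots> = cl F2 \<triangleleft> diagonal C c'"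
    unfolding eq using pull_pull[OF cl_Ext[OF s2] \<theta>'(1) S(5) d(1) S(1)] db by simp
  finally show ?thesis .
qed

lemma dsum_of_exists:
  assumes "ext_seq C S t A B E" "ext_seq C S t A' B' E'" "is_biproduct C B B' D b"
  obtains F D' b' where "dsum C b E E' F b'" "is_biproduct C A A' D' b'"
    "ext_seq C S t D' D F"
proof -
  have P: "path C B E A" "path C B' E' A'" "length E = length E'"
    using ext_seq_path[OF assms(1)] ext_seq_path[OF assms(2)] by auto
  obtain F b' where F: "dsum C b E E' F b'" using dsum_exists[OF P assms(3) biproduct_exists] by blast
  obtain D' where D': "is_biproduct C A A' D' b'" using dsum_path[OF F P(1,2) assms(3)] by blast
  then show ?thesis using that[OF F D' dsum_ext_seq[OF assms(1,2) F assms(3) D']] by blast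
qed

text \<open>Reduces the union over all representatives, biproducts and direct sums to one arbitrary
  choice.\<close>

lemma baer_cl:
  assumes E: "ext_seq C S t A B E" and E': "ext_seq C S t A B E'"
    and F: "dsum C b E E' F b'" and b: "is_biproduct C B B D b" and b': "is_biproduct C A A D' b'"
  shows "cl E \<uplus> cl E' = codiagonal C b \<triangleright> (cl F \<triangleleft> diagonal C b')"
proof -
  \<comment> \<open>\<open>V E E' x\<close>: some choice of biproducts evaluates the Baer sum of
    these two representatives to x.\<close>
  define V where "V = (\<lambda>E E' x. \<exists>b F b' D D'. dsum C b E E' F b' \<and> is_biproduct C B B D b \<and>
    is_biproduct C A A D' b' \<and> x = codiagonal C b \<triangleright> (cl F \<triangleleft> diagonal C b'))"
  have S: "B \<in> S" "A \<in> S" using ext_seq_path[OF E] by auto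
  have ex: "\<exists>x. V G G' x" if G: "ext_seq C S t A B G" "ext_seq C S t A B G'" for G G'
  proof -
    obtain D b where "is_biproduct C B B D b" using biproduct_exists[of B B] S by auto
    with dsum_of_exists[OF G this] show ?thesis unfolding V_def by metis
  qed
  have step: "x = x'" if "ext_seq C S t A B E1" "ext_seq C S t A B E2" "ext_seq C S t A B E1'"
    "ext_seq C S t A B E2'" "mor C (Idt C B) E1 E2 (Idt C A)" "mor C (Idt C B) E1' E2' (Idt C A)"
    "V E1 E1' x" "V E2 E2' x'" for E1 E2 E1' E2' x x'
    using that(7,8) unfolding V_def using dsum_value_unique[OF that(1,2,5) that(3,4,6)] by metis
  have idm: "mor C (Idt C B) G G (Idt C A)" if "ext_seq C S t A B G" for G
    using mor_id ext_seq_path[OF that] by blast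
  have stepm: "mor C (Idt C B) G H (Idt C A)" if "(G, H) \<in> yoneda_step C S" "ext_seq C S t A B G" for G H
    using that(1) unfolding yoneda_step_iff using ext_seq_unique[OF _ that(2)] by blast
  have V: "V E E' (codiagonal C b \<triangleright> (cl F \<triangleleft> diagonal C b'))" unfolding V_def using F b b' by blast
  have inv: "x = codiagonal C b \<triangleright> (cl F \<triangleleft> diagonal C b')"
    if G: "G \<in> cl E" and G': "G' \<in> cl E'" and x: "V G G' x" for G G' x
  proof -
    have e: "(E, G) \<in> yoneda_eq C S" "(E', G') \<in> yoneda_eq C S" using G G' by (auto simp: mem_cl_iff)
    have g: "ext_seq C S t A B G" "ext_seq C S t A B G'" using yoneda_eq_ext_seq e E E' by blast+
    \<comment> \<open>The zigzag from E to G is followed with E' fixed, then the one from E' to G'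
      with G fixed; y is the value in between.\<close>
    obtain y where y: "V G E' y" using ex[OF g(1) E'] by blast
    have "codiagonal C b \<triangleright> (cl F \<triangleleft> diagonal C b') = y"
      by (rule yoneda_eq_invariant[OF e(1) E, of "\<lambda>G. V G E'"])
        (use step[OF _ _ E' E' _ idm[OF E']] stepm ex[OF _ E'] V y in blast)+
    also have "y = x"
      by (rule yoneda_eq_invariant[OF e(2) E', of "\<lambda>G'. V G G'"])
        (use step[OF g(1,1) _ _ idm[OF g(1)]] stepm ex[OF g(1)] x y in blast)+
    finally show ?thesis by simp
  qed
  have EE: "E \<in> cl E" "E' \<in> cl E'" using yoneda_eq_refl E E' by (auto simp: mem_cl_iff)
  have dsV: "codiagonal C (hd bs) \<triangleright> (cl H \<triangleleft> diagonal C (last bs)) = codiagonal C b \<triangleright> (cl F \<triangleleft> diagonal C b')"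
    if G: "G \<in> cl E" "G' \<in> cl E'" and H: "direct_sum_seq C bs G G' H" for G G' bs H
  proof -
    have g: "ext_seq C S t A B G" "ext_seq C S t A B G'"
      using yoneda_eq_ext_seq E E' G by (auto simp: mem_cl_iff)
    have P: "path C B G A" "path C B G' A" "G \<noteq> []" using ext_seq_path[OF g(1)] ext_seq_path[OF g(2)] by auto
    have d: "dsum C (hd bs) G G' H (last bs)" using direct_sum_seq_dsum[OF P] H by blast
    obtain g1 G1 where "G = g1 # G1" using P(3) by (cases G) auto
    moreover obtain g1' G1' where "G' = g1' # G1'" using P(3) dsum_length[OF d] by (cases G') auto
    ultimately obtain D1 where "is_biproduct C B B D1 (hd bs)"
      using d P dsum_length[OF d] by (cases H) (auto simp del: is_biproduct.simps)
    moreover from dsum_path[OF d P(1,2) this] obtain D2 where "is_biproduct C A A D2 (last bs)" by blast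
    ultimately have "V G G' (codiagonal C (hd bs) \<triangleright> (cl H \<triangleleft> diagonal C (last bs)))"
      unfolding V_def using d by blast
    then show ?thesis using inv[OF G] by blast
  qed
  have "\<exists>bs. direct_sum_seq C bs E E' F \<and> hd bs = b \<and> last bs = b'"
    using direct_sum_seq_dsum[of C B E A B E' A F b b'] ext_seq_path[OF E] ext_seq_path[OF E'] F by fastforce
  then obtain bs where bs: "direct_sum_seq C bs E E' F" by blast
  show ?thesis
    unfolding baer_sum_def
  proof (rule Set.set_eqI, unfold mem_Collect_eq cl_def[symmetric], rule iffI)
    fix G
    assume "\<exists>E1\<in>cl E. \<exists>E1'\<in>cl E'. \<exists>bs F1. direct_sum_seq C bs E1 E1' F1 \<and>
      G \<in> codiagonal C (hd bs) \<triangleright> (cl F1 \<triangleleft> diagonal C (last bs))"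
    then show "G \<in> codiagonal C b \<triangleright> (cl F \<triangleleft> diagonal C b')" using dsV by metis
  next
    fix G assume "G \<in> codiagonal C b \<triangleright> (cl F \<triangleleft> diagonal C b')"
    then show "\<exists>E1\<in>cl E. \<exists>E1'\<in>cl E'. \<exists>bs F1. direct_sum_seq C bs E1 E1' F1 \<and>
      G \<in> codiagonal C (hd bs) \<triangleright> (cl F1 \<triangleleft> diagonal C (last bs))"
      using dsV[OF EE bs] EE bs by metis
  qed
qed

text \<open>The pair (f, g) is the first component of a morphism from E to the direct sum of the two
  push-outs whose last component is the diagonal. Hence pulling the sum back along the diagonal is
  pushing E out along (f, g), and the codiagonal after (f, g) is f + g.\<close>

lemma hadd_push:
  assumes \<gamma>: "\<gamma> \<in> Ext C S t A Z" and f: "f \<in> Hom C Z B" and g: "g \<in> Hom C Z B" and B: "B \<in> S"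
  shows "(f \<boxplus> g) \<triangleright> \<gamma> = (f \<triangleright> \<gamma>) \<uplus> (g \<triangleright> \<gamma>)"
proof -
  obtain E where E: "ext_seq C S t A Z E" "\<gamma> = cl E" using \<gamma> by (rule ExtE)
  obtain F where F: "ext_seq C S t A B F" "mor C f E F (Idt C A)" "f \<triangleright> cl E = cl F"
    using push_rep[OF E(1) f B] .
  obtain G where G: "ext_seq C S t A B G" "mor C g E G (Idt C A)" "g \<triangleright> cl E = cl G"
    using push_rep[OF E(1) g B] .
  obtain D b where b: "is_biproduct C B B D b" using biproduct_exists[of B B] B by auto
  obtain H D' b' where H: "dsum C b F G H b'" "is_biproduct C A A D' b'" "ext_seq C S t D' D H"
    using dsum_of_exists[OF F(1) G(1) b] .
  have P: "path C Z E A" "path C B F A" "path C B G A" "A \<in> S"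
    using ext_seq_path[OF E(1)] ext_seq_path[OF F(1)] ext_seq_path[OF G(1)] by auto
  have "mor C (bpair C b f g) E H (diagonal C b')"
    using dsum_mor_pair[OF F(2) G(2) H(1) P(1-3) b] codiagonal_Hom(3)[OF H(2)] by simp
  then have "bpair C b f g \<triangleright> cl E = cl H \<triangleleft> diagonal C b'" by (rule push_pull_mor[OF E(1) H(3)])
  then have "cl F \<uplus> cl G = codiagonal C b \<triangleright> bpair C b f g \<triangleright> cl E"
    using baer_cl[OF F(1) G(1) H(1) b H(2)] by simp
  also have "\<dots> = (codiagonal C b \<cdot> bpair C b f g) \<triangleright> cl E"
    using push_push[OF cl_Ext[OF E(1)] bpair_simps(1)[OF b f g] biproduct_S[OF b B B] codiagonal_Hom(2)[OF b] B] .
  also have "codiagonal C b \<cdot> bpair C b f g = f \<boxplus> g"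
    unfolding codiagonal_Hom(1)[OF b] using HAdd_Comp[OF bpair_simps(1)[OF b f g] biproduct_Hom[OF b]]
    by (simp add: bpair_simps(2,3)[OF b f g])
  finally show ?thesis using E F G by simp
qed

text \<open>The direct sum pulled back along the diagonal has both classes as push-outs along the
  projections. Thus Baer sums can be computed as push-outs along sums of morphisms.\<close>

lemma Ext_pair:
  assumes \<gamma>: "\<gamma> \<in> Ext C S t A B" and \<gamma>': "\<gamma>' \<in> Ext C S t A B'" and b: "is_biproduct C B B' D b"
  obtains \<eta> where "\<eta> \<in> Ext C S t A D" "bfst b \<triangleright> \<eta> = \<gamma>" "bsnd b \<triangleright> \<eta> = \<gamma>'"
proof -
  obtain E where E: "ext_seq C S t A B E" "\<gamma> = cl E" using \<gamma> by (rule ExtE)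
  obtain E' where E': "ext_seq C S t A B' E'" "\<gamma>' = cl E'" using \<gamma>' by (rule ExtE)
  obtain F D' b' where F: "dsum C b E E' F b'" "is_biproduct C A A D' b'" "ext_seq C S t D' D F"
    using dsum_of_exists[OF E(1) E'(1) b] .
  have P: "path C B E A" "path C B' E' A" and S: "A \<in> S" "B \<in> S" "B' \<in> S"
    using ext_seq_path[OF E(1)] ext_seq_path[OF E'(1)] by auto
  have id: "Idt C A \<in> Hom C A A" using S Idt_closed by auto
  note d = diagonal_Hom[OF F(2)] and S' = biproduct_S[OF F(2) S(1,1)] and pr = biproduct_Hom[OF b] biproduct_Hom[OF F(2)]
    and bp = bpair_simps[OF F(2) id id, folded codiagonal_Hom(3)[OF F(2)]]
  note m = dsum_mor_fst[OF F(1) P b]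
  have "bfst b \<triangleright> (cl F \<triangleleft> diagonal C b') = cl E"
    using push_pull[OF cl_Ext[OF F(3)] pr(1) S(2) d S(1)] push_pull_mor[OF F(3) E(1) m(1)]
      pull_pull[OF cl_Ext[OF E(1)] pr(3) S' d S(1)] bp(2) pull_id[OF cl_Ext[OF E(1)]] by simp
  moreover have "bsnd b \<triangleright> (cl F \<triangleleft> diagonal C b') = cl E'"
    using push_pull[OF cl_Ext[OF F(3)] pr(2) S(3) d S(1)] push_pull_mor[OF F(3) E'(1) m(2)]
      pull_pull[OF cl_Ext[OF E'(1)] pr(4) S' d S(1)] bp(3) pull_id[OF cl_Ext[OF E'(1)]] by simp
  ultimately show ?thesis using that[OF pull_Ext[OF cl_Ext[OF F(3)] d S(1)]] E E' by blast
qed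

text \<open>The codiagonal is a morphism from E \<oplus> E to E, so pulling back along it is pushing
  the direct sum out along it. The remaining pull-back \<eta> along (f, g) has the components
  \<gamma>f and \<gamma>g, and \<open>hadd_push\<close> adds them.\<close>

lemma pull_hadd:
  assumes \<gamma>: "\<gamma> \<in> Ext C S t A B" and f: "f \<in> Hom C X A" and g: "g \<in> Hom C X A" and X: "X \<in> S"
  shows "\<gamma> \<triangleleft> (f \<boxplus> g) = (\<gamma> \<triangleleft> f) \<uplus> (\<gamma> \<triangleleft> g)"
proof -
  obtain E where E: "ext_seq C S t A B E" "\<gamma> = cl E" using \<gamma> by (rule ExtE)
  have P: "path C B E A" and S: "A \<in> S" "B \<in> S" using ext_seq_path[OF E(1)] by auto
  obtain D b where b: "is_biproduct C B B D b" using biproduct_exists[of B B] S by auto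
  obtain F D' b' where F: "dsum C b E E F b'" "is_biproduct C A A D' b'" "ext_seq C S t D' D F"
    using dsum_of_exists[OF E(1) E(1) b] .
  note p = bpair_simps[OF F(2) f g]
  note S' = biproduct_S[OF F(2) S(1,1)] biproduct_S[OF b S(2,2)]
    and pr = biproduct_Hom[OF b] biproduct_Hom[OF F(2)] and cd = codiagonal_Hom[OF b] codiagonal_Hom[OF F(2)]
  note m = dsum_mor_fst[OF F(1) P P b]
  let ?\<eta> = "cl F \<triangleleft> bpair C b' f g"
  have \<eta>: "?\<eta> \<in> Ext C S t X D" using pull_Ext[OF cl_Ext[OF F(3)] p(1) X] .
  have 1: "bfst b \<triangleright> ?\<eta> = \<gamma> \<triangleleft> f"
    using push_pull[OF cl_Ext[OF F(3)] pr(1) S(2) p(1) X] push_pull_mor[OF F(3) E(1) m(1)]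
      pull_pull[OF cl_Ext[OF E(1)] pr(3) S'(1) p(1) X] p(2) E(2) by simp
  have 2: "bsnd b \<triangleright> ?\<eta> = \<gamma> \<triangleleft> g"
    using push_pull[OF cl_Ext[OF F(3)] pr(2) S(2) p(1) X] push_pull_mor[OF F(3) E(1) m(2)]
      pull_pull[OF cl_Ext[OF E(1)] pr(4) S'(1) p(1) X] p(3) E(2) by simp
  have "f \<boxplus> g = codiagonal C b' \<cdot> bpair C b' f g"
    unfolding cd(4) using HAdd_Comp[OF p(1) pr(3,4)] by (simp add: p)
  then have "\<gamma> \<triangleleft> (f \<boxplus> g) = (\<gamma> \<triangleleft> codiagonal C b') \<triangleleft> bpair C b' f g"
    using pull_pull[OF cl_Ext[OF E(1)] cd(5) S'(1) p(1) X] E(2) by simp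
  also have "\<gamma> \<triangleleft> codiagonal C b' = codiagonal C b \<triangleright> cl F"
    using push_pull_mor[OF F(3) E(1) dsum_mor_codiagonal[OF F(1) P b]] E(2) by simp
  also have "\<dots> \<triangleleft> bpair C b' f g = codiagonal C b \<triangleright> ?\<eta>"
    using push_pull[OF cl_Ext[OF F(3)] cd(2) S(2) p(1) X] by simp
  also have "\<dots> = (\<gamma> \<triangleleft> f) \<uplus> (\<gamma> \<triangleleft> g)"
    unfolding cd(1) using hadd_push[OF \<eta> pr(1,2) S(2)] 1 2 by simp
  finally show ?thesis .
qed

section \<open>The zero class and the group structure\<close>

abbreviation ozero where "ozero \<equiv> ext_zero C S"

lemma biproduct_split_conflation:
  assumes "A \<in> S" "B \<in> S"
  obtains D i j p q where "is_biproduct C B A D (i, j, p, q)" "conflation C S i q" "ext_seq C S 1 A B [i, q]"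
proof -
  obtain D b where b: "is_biproduct C B A D b" using biproduct_exists[of B A] assms by auto
  obtain i j p q where "b = (i, j, p, q)" by (cases b)
  with b have b: "is_biproduct C B A D (i, j, p, q)" by simp
  have c: "conflation C S i q" using biproduct_conflation[OF b] assms by simp
  have "Tgt C q = A" "Src C i = B" using biproductD[OF b] by auto
  then show ?thesis using that[OF b c ext_seq_single[OF c]] by simp
qed

text \<open>The zero class is obtained below from an arbitrary class, so there has to be one; a
  split conflation can be spliced as often as required.\<close>

lemma Ext_nonempty:
  assumes "A \<in> S" "B \<in> S" "1 \<le> t" shows "\<exists>\<gamma>. \<gamma> \<in> Ext C S t A B"
proof -
  have 1: "\<exists>\<gamma>. \<gamma> \<in> Ext C S 1 A B" if "B \<in> S" for B
    using biproduct_split_conflation[OF assms(1) that] cl_Ext by metis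
  have "\<exists>\<gamma>. \<gamma> \<in> Ext C S (Suc k) A B" if "B \<in> S" for k B
    using that
  proof (induction k arbitrary: B)
    case (Suc k)
    obtain \<gamma> \<gamma>' where "\<gamma> \<in> Ext C S 1 A B" "\<gamma>' \<in> Ext C S (Suc k) A A"
      using 1[OF Suc.prems] Suc.IH[OF assms(1)] by blast
    then have "\<gamma> \<star> \<gamma>' \<in> Ext C S (1 + Suc k) A B" by (rule yprod_Ext)
    then show ?case by auto
  qed (use 1 in simp)
  then show ?thesis using assms by (cases t) auto
qed

lemma zero_Hom: "A \<in> S \<Longrightarrow> B \<in> S \<Longrightarrow> HZero C A B \<in> Hom C A B"
  by (simp add: Hom_def)

lemma zero_push_pull:
  assumes "\<gamma> \<in> Ext C S t A Z" "\<gamma>' \<in> Ext C S t A' B"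
  shows "HZero C Z B \<triangleright> \<gamma> = \<gamma>' \<triangleleft> HZero C A A'"
proof -
  obtain E where E: "ext_seq C S t A Z E" "\<gamma> = cl E" using assms(1) by (rule ExtE)
  obtain E' where E': "ext_seq C S t A' B E'" "\<gamma>' = cl E'" using assms(2) by (rule ExtE)
  have "mor C (HZero C Z B) E E' (HZero C A A')"
    using mor_zero ext_seq_path[OF E(1)] ext_seq_path[OF E'(1)] by simp
  then show ?thesis using push_pull_mor[OF E(1) E'(1)] E E' by simp
qed

text \<open>Brings two classes over one \<eta>, so that the laws of the Baer sum follow from those
  for the addition of p and q.\<close>

lemma baer_cases:
  assumes "\<gamma> \<in> Ext C S t A B" "\<gamma>' \<in> Ext C S t A B"
  obtains D p q \<eta> where "p \<in> Hom C D B" "q \<in> Hom C D B" "\<eta> \<in> Ext C S t A D" "D \<in> S"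
    "\<gamma> = p \<triangleright> \<eta>" "\<gamma>' = q \<triangleright> \<eta>" "\<gamma> \<uplus> \<gamma>' = (p \<boxplus> q) \<triangleright> \<eta>"
proof -
  have S: "B \<in> S" using Ext_S[OF assms(1)] by simp
  obtain D b where b: "is_biproduct C B B D b" using biproduct_exists[of B B] S by auto
  obtain \<eta> where \<eta>: "\<eta> \<in> Ext C S t A D" "bfst b \<triangleright> \<eta> = \<gamma>" "bsnd b \<triangleright> \<eta> = \<gamma>'"
    using Ext_pair[OF assms b] .
  then show ?thesis
    using that[OF biproduct_Hom[OF b] \<eta>(1) biproduct_S[OF b S S]] hadd_push[OF \<eta>(1) biproduct_Hom[OF b] S] by simp
qed

lemma hadd_Hom: "f \<in> Hom C A B \<Longrightarrow> g \<in> Hom C A B \<Longrightarrow> f \<boxplus> g \<in> Hom C A B"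
  by (simp add: Hom_def)

lemma hneg_Hom: "f \<in> Hom C A B \<Longrightarrow> hneg C f \<in> Hom C A B"
  by (simp add: Hom_def)

lemma baer_Ext [simp]: "\<gamma> \<in> Ext C S t A B \<Longrightarrow> \<gamma>' \<in> Ext C S t A B \<Longrightarrow> \<gamma> \<uplus> \<gamma>' \<in> Ext C S t A B"
  by (elim baer_cases[of \<gamma> t A B \<gamma>']) (auto simp: hadd_Hom dest: Ext_S)

lemma baer_commute:
  assumes "\<gamma> \<in> Ext C S t A B" "\<gamma>' \<in> Ext C S t A B" shows "\<gamma> \<uplus> \<gamma>' = \<gamma>' \<uplus> \<gamma>"
proof -
  obtain D p q \<eta> where *: "p \<in> Hom C D B" "q \<in> Hom C D B" "\<eta> \<in> Ext C S t A D" "D \<in> S"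
    "\<gamma> = p \<triangleright> \<eta>" "\<gamma>' = q \<triangleright> \<eta>" "\<gamma> \<uplus> \<gamma>' = (p \<boxplus> q) \<triangleright> \<eta>" using baer_cases[OF assms] .
  have "p \<boxplus> q = q \<boxplus> p" using hadd_commute *(1,2) by (simp add: Hom_def)
  then show ?thesis using * hadd_push[OF *(3,2,1)] Ext_S[OF assms(1)] by simp
qed

lemma baer_assoc:
  assumes "\<alpha> \<in> Ext C S t A B" "\<beta> \<in> Ext C S t A B" "\<gamma> \<in> Ext C S t A B"
  shows "\<alpha> \<uplus> \<beta> \<uplus> \<gamma> = \<alpha> \<uplus> (\<beta> \<uplus> \<gamma>)"
proof -
  have S: "B \<in> S" using Ext_S[OF assms(1)] by simp
  obtain D p q \<eta> where *: "p \<in> Hom C D B" "q \<in> Hom C D B" "\<eta> \<in> Ext C S t A D" "D \<in> S"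
    "\<alpha> = p \<triangleright> \<eta>" "\<beta> = q \<triangleright> \<eta>" "\<alpha> \<uplus> \<beta> = (p \<boxplus> q) \<triangleright> \<eta>" using baer_cases[OF assms(1,2)] .
  obtain D' b where b: "is_biproduct C D B D' b" using biproduct_exists[of D B] S *(4) by auto
  obtain \<zeta> where \<zeta>: "\<zeta> \<in> Ext C S t A D'" "bfst b \<triangleright> \<zeta> = \<eta>" "bsnd b \<triangleright> \<zeta> = \<gamma>"
    using Ext_pair[OF *(3) assms(3) b] .
  note pr = biproduct_Hom[OF b]
  note h = Comp_closed[OF pr(1) *(1)] Comp_closed[OF pr(1) *(2)] pr(2)
  have e: "\<alpha> = (p \<cdot> bfst b) \<triangleright> \<zeta>" "\<beta> = (q \<cdot> bfst b) \<triangleright> \<zeta>" "\<gamma> = bsnd b \<triangleright> \<zeta>"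
    using push_push[OF \<zeta>(1) pr(1) *(4) *(1) S] push_push[OF \<zeta>(1) pr(1) *(4) *(2) S] * \<zeta> by simp_all
  have "\<alpha> \<uplus> \<beta> \<uplus> \<gamma> = (p \<cdot> bfst b \<boxplus> q \<cdot> bfst b \<boxplus> bsnd b) \<triangleright> \<zeta>"
    unfolding e by (simp add: hadd_push[OF \<zeta>(1) _ _ S] h hadd_Hom)
  also have "p \<cdot> bfst b \<boxplus> q \<cdot> bfst b \<boxplus> bsnd b = p \<cdot> bfst b \<boxplus> (q \<cdot> bfst b \<boxplus> bsnd b)"
    by (rule hadd_assoc) (use h in \<open>simp_all add: Hom_def\<close>)
  also have "\<dots> \<triangleright> \<zeta> = \<alpha> \<uplus> (\<beta> \<uplus> \<gamma>)"
    unfolding e by (simp add: hadd_push[OF \<zeta>(1) _ _ S] h hadd_Hom)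
  finally show ?thesis .
qed

text \<open>By \<open>zero_push_pull\<close> the push-out along zero is the same for every class, in
  particular for the summand \<beta> itself, and (0 + 1) \<triangleright> \<beta> = \<beta>. A
  second neutral element agrees with it by commutativity.\<close>

lemma ozero_eq:
  assumes "\<gamma> \<in> Ext C S t A Z" "B \<in> S"
  shows "HZero C Z B \<triangleright> \<gamma> = ozero t A B"
proof -
  have S: "Z \<in> S" using Ext_S[OF assms(1)] by simp
  let ?z = "HZero C Z B \<triangleright> \<gamma>"
  have z: "?z \<in> Ext C S t A B" using push_Ext[OF assms(1) zero_Hom[OF S assms(2)] assms(2)] .
  have neutral: "?z \<uplus> \<beta> = \<beta>" if \<beta>: "\<beta> \<in> Ext C S t A B" for \<beta>
  proof -
    have id: "Idt C B \<in> Hom C B B" "HZero C B B \<in> Hom C B B" using assms Idt_closed zero_Hom by auto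
    have "?z = HZero C B B \<triangleright> \<beta>" using zero_push_pull[OF assms(1) z] zero_push_pull[OF \<beta> z] by simp
    then have "?z \<uplus> \<beta> = (HZero C B B \<boxplus> Idt C B) \<triangleright> \<beta>"
      using hadd_push[OF \<beta> id(2,1) assms(2)] \<beta> by simp
    also have "HZero C B B \<boxplus> Idt C B = Idt C B" using assms by simp
    finally show ?thesis using \<beta> by simp
  qed
  show ?thesis
    unfolding ext_zero_def
  proof (rule the_equality[symmetric])
    fix \<zeta> assume \<zeta>: "\<zeta> \<in> Ext C S t A B \<and> (\<forall>\<gamma>\<in>Ext C S t A B. \<zeta> \<uplus> \<gamma> = \<gamma>)"
    then have "\<zeta> = ?z \<uplus> \<zeta>" using neutral by simp
    also have "\<dots> = ?z" using baer_commute[of ?z t A B \<zeta>] \<zeta> z by simp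
    finally show "\<zeta> = ?z" .
  qed (use z neutral in blast)
qed

lemma ozero_eq_pull:
  assumes "\<gamma> \<in> Ext C S t Z B" "A \<in> S"
  shows "\<gamma> \<triangleleft> HZero C A Z = ozero t A B"
proof -
  have S: "Z \<in> S" "B \<in> S" "1 \<le> t" using Ext_S[OF assms(1)] by auto
  obtain \<delta> where \<delta>: "\<delta> \<in> Ext C S t A B" using Ext_nonempty[OF assms(2) S(2,3)] by blast
  show ?thesis using zero_push_pull[OF \<delta> assms(1)] ozero_eq[OF \<delta> S(2)] by simp
qed

lemma ozero_Ext [simp]:
  assumes "A \<in> S" "B \<in> S" "1 \<le> t" shows "ozero t A B \<in> Ext C S t A B"
proof -
  obtain \<delta> where \<delta>: "\<delta> \<in> Ext C S t A B" using Ext_nonempty[OF assms] by blast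
  show ?thesis using push_Ext[OF \<delta> zero_Hom[OF assms(2,2)] assms(2)] ozero_eq[OF \<delta> assms(2)] by simp
qed

lemma ozero_baer [simp]:
  assumes "\<gamma> \<in> Ext C S t A B" shows "ozero t A B \<uplus> \<gamma> = \<gamma>" "\<gamma> \<uplus> ozero t A B = \<gamma>"
proof -
  have S: "A \<in> S" "B \<in> S" "1 \<le> t" using Ext_S[OF assms] by auto
  have id: "Idt C B \<in> Hom C B B" "HZero C B B \<in> Hom C B B" using S Idt_closed zero_Hom by auto
  show "ozero t A B \<uplus> \<gamma> = \<gamma>"
    using hadd_push[OF assms id(2,1) S(2)] ozero_eq[OF assms S(2)] assms S by simp
  then show "\<gamma> \<uplus> ozero t A B = \<gamma>" using baer_commute[OF assms ozero_Ext[OF S]] by simp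
qed

lemma hneg_baer:
  assumes "\<gamma> \<in> Ext C S t A B" shows "(hneg C (Idt C B) \<triangleright> \<gamma>) \<uplus> \<gamma> = ozero t A B"
proof -
  have S: "A \<in> S" "B \<in> S" "1 \<le> t" using Ext_S[OF assms] by auto
  have id: "Idt C B \<in> Hom C B B" using S Idt_closed by auto
  show ?thesis using hadd_push[OF assms hneg_Hom[OF id] id S(2)] ozero_eq[OF assms S(2)] assms S by simp
qed

lemma Ext_comm_group:
  assumes "A \<in> S" "B \<in> S" "1 \<le> t" shows "comm_group (Ext_group C S t A B)"
proof (rule comm_groupI)
  fix x assume "x \<in> carrier (Ext_group C S t A B)"
  then have x: "x \<in> Ext C S t A B" by (simp add: Ext_group_def)
  have "hneg C (Idt C B) \<triangleright> x \<in> Ext C S t A B"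
    using push_Ext[OF x hneg_Hom[OF Idt_closed]] assms by simp
  then show "\<exists>y\<in>carrier (Ext_group C S t A B). y \<otimes>\<^bsub>Ext_group C S t A B\<^esub> x = \<one>\<^bsub>Ext_group C S t A B\<^esub>"
    using hneg_baer[OF x] by (auto simp: Ext_group_def)
qed (use assms in \<open>auto simp: Ext_group_def baer_assoc baer_commute\<close>)

lemma push_baer:
  assumes "\<gamma> \<in> Ext C S t A B" "\<gamma>' \<in> Ext C S t A B" and f: "f \<in> Hom C B B'" "B' \<in> S"
  shows "f \<triangleright> (\<gamma> \<uplus> \<gamma>') = (f \<triangleright> \<gamma>) \<uplus> (f \<triangleright> \<gamma>')"
proof -
  have S: "B \<in> S" using Ext_S[OF assms(1)] by simp
  obtain D p q \<eta> where *: "p \<in> Hom C D B" "q \<in> Hom C D B" "\<eta> \<in> Ext C S t A D" "D \<in> S"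
    "\<gamma> = p \<triangleright> \<eta>" "\<gamma>' = q \<triangleright> \<eta>" "\<gamma> \<uplus> \<gamma>' = (p \<boxplus> q) \<triangleright> \<eta>" using baer_cases[OF assms(1,2)] .
  have "f \<triangleright> (\<gamma> \<uplus> \<gamma>') = (f \<cdot> (p \<boxplus> q)) \<triangleright> \<eta>"
    unfolding *(7) using push_push[OF *(3) hadd_Hom[OF *(1,2)] S f] .
  also have "\<dots> = (f \<triangleright> \<gamma>) \<uplus> (f \<triangleright> \<gamma>')"
    unfolding Comp_HAdd[OF *(1,2) f(1)] *(5,6)
    using hadd_push[OF *(3) Comp_closed[OF *(1) f(1)] Comp_closed[OF *(2) f(1)] f(2)]
      push_push[OF *(3) *(1) S f] push_push[OF *(3) *(2) S f] by simp
  finally show ?thesis .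
qed

lemma baer_yprod:
  assumes "\<gamma> \<in> Ext C S s A B" "\<gamma>' \<in> Ext C S s A B" and \<beta>: "\<beta> \<in> Ext C S t D A"
  shows "(\<gamma> \<uplus> \<gamma>') \<star> \<beta> = (\<gamma> \<star> \<beta>) \<uplus> (\<gamma>' \<star> \<beta>)"
proof -
  have S: "B \<in> S" using Ext_S[OF assms(1)] by simp
  obtain D p q \<eta> where *: "p \<in> Hom C D B" "q \<in> Hom C D B" "\<eta> \<in> Ext C S s A D" "D \<in> S"
    "\<gamma> = p \<triangleright> \<eta>" "\<gamma>' = q \<triangleright> \<eta>" "\<gamma> \<uplus> \<gamma>' = (p \<boxplus> q) \<triangleright> \<eta>" using baer_cases[OF assms(1,2)] .
  show ?thesis
    unfolding *(7) unfolding *(5,6)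
    using push_yprod[OF *(3) \<beta> *(1) S] push_yprod[OF *(3) \<beta> *(2) S] push_yprod[OF *(3) \<beta> hadd_Hom[OF *(1,2)] S]
      hadd_push[OF yprod_Ext[OF *(3) \<beta>] *(1,2) S] by simp
qed

lemma yprod_baer:
  assumes \<beta>: "\<beta> \<in> Ext C S s B X" and "\<gamma> \<in> Ext C S t A B" "\<gamma>' \<in> Ext C S t A B"
  shows "\<beta> \<star> (\<gamma> \<uplus> \<gamma>') = (\<beta> \<star> \<gamma>) \<uplus> (\<beta> \<star> \<gamma>')"
proof -
  obtain D p q \<eta> where *: "p \<in> Hom C D B" "q \<in> Hom C D B" "\<eta> \<in> Ext C S t A D" "D \<in> S"
    "\<gamma> = p \<triangleright> \<eta>" "\<gamma>' = q \<triangleright> \<eta>" "\<gamma> \<uplus> \<gamma>' = (p \<boxplus> q) \<triangleright> \<eta>" using baer_cases[OF assms(2,3)] .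
  have "\<beta> \<star> (\<gamma> \<uplus> \<gamma>') = (\<beta> \<triangleleft> (p \<boxplus> q)) \<star> \<eta>"
    unfolding *(7) using yprod_pull_push[OF \<beta> *(3) hadd_Hom[OF *(1,2)]] by simp
  also have "\<dots> = ((\<beta> \<triangleleft> p) \<star> \<eta>) \<uplus> ((\<beta> \<triangleleft> q) \<star> \<eta>)"
    unfolding pull_hadd[OF \<beta> *(1,2,4)]
    using baer_yprod[OF pull_Ext[OF \<beta> *(1,4)] pull_Ext[OF \<beta> *(2,4)] *(3)] .
  finally show ?thesis
    unfolding *(5,6) using yprod_pull_push[OF \<beta> *(3) *(1)] yprod_pull_push[OF \<beta> *(3) *(2)] by simp
qed

lemma ozero_yprod [simp]:
  assumes "\<gamma> \<in> Ext C S t D A" "B \<in> S" "1 \<le> s" shows "ozero s A B \<star> \<gamma> = ozero (s + t) D B"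
proof -
  have S: "A \<in> S" using Ext_S[OF assms(1)] by simp
  note z = ozero_Ext[OF S assms(2,3)]
  have "ozero s A B \<star> \<gamma> = HZero C B B \<triangleright> (ozero s A B \<star> \<gamma>)"
    using push_yprod[OF z assms(1) zero_Hom[OF assms(2,2)] assms(2)] ozero_eq[OF z assms(2)] by simp
  then show ?thesis using ozero_eq[OF yprod_Ext[OF z assms(1)] assms(2)] by simp
qed

lemma yprod_ozero [simp]:
  assumes "\<gamma> \<in> Ext C S s A B" "D \<in> S" "1 \<le> t" shows "\<gamma> \<star> ozero t D A = ozero (s + t) D B"
proof -
  have S: "A \<in> S" "B \<in> S" "1 \<le> s" using Ext_S[OF assms(1)] by auto
  note z = ozero_Ext[OF assms(2) S(1) assms(3)]
  have "\<gamma> \<star> ozero t D A = \<gamma> \<star> (HZero C A A \<triangleright> ozero t D A)"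
    using ozero_eq[OF z S(1)] by simp
  also have "\<dots> = ozero s A B \<star> ozero t D A"
    using yprod_pull_push[OF assms(1) z zero_Hom[OF S(1,1)]] ozero_eq_pull[OF assms(1) S(1)] by simp
  finally show ?thesis using z S by simp
qed

lemma push_ozero [simp]:
  assumes "f \<in> Hom C B B'" "A \<in> S" "B \<in> S" "B' \<in> S" "1 \<le> t" shows "f \<triangleright> ozero t A B = ozero t A B'"
proof -
  note z = ozero_Ext[OF assms(2,3,5)]
  have "f \<triangleright> ozero t A B = (f \<cdot> HZero C B B) \<triangleright> ozero t A B"
    using push_push[OF z zero_Hom[OF assms(3,3)] assms(3) assms(1,4)] ozero_eq[OF z assms(3)] by simp
  also have "f \<cdot> HZero C B B = HZero C B B'" using assms by (simp add: Hom_def)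
  finally show ?thesis using ozero_eq[OF z assms(4)] by simp
qed

lemma ozero_pull [simp]:
  assumes "h \<in> Hom C A' A" "A \<in> S" "A' \<in> S" "B \<in> S" "1 \<le> t" shows "ozero t A B \<triangleleft> h = ozero t A' B"
proof -
  note z = ozero_Ext[OF assms(2,4,5)]
  have "ozero t A B \<triangleleft> h = ozero t A B \<triangleleft> (HZero C A A \<cdot> h)"
    using pull_pull[OF z zero_Hom[OF assms(2,2)] assms(2) assms(1,3)] ozero_eq_pull[OF z assms(2)] by simp
  also have "HZero C A A \<cdot> h = HZero C A' A" using assms by (simp add: Hom_def)
  finally show ?thesis using ozero_eq_pull[OF z assms(3)] by simp
qed

lemma ozero_opp:
  assumes "A \<in> S" "B \<in> S" "1 \<le> t" shows "ext_zero (opp C) S t B A = rev ` ozero t A B"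
proof -
  interpret o: extension_closed_subcategory "opp C" S by (rule extension_closed_subcategory_opp)
  note z = ozero_Ext[OF assms]
  have "rev ` ozero t A B \<in> Ext (opp C) S t B A" using z by simp
  from o.ozero_eq[OF this assms(1)] show ?thesis
    using ozero_eq_pull[OF z assms(1)] by (simp add: ext_push_opp)
qed

section \<open>Long exact sequences\<close>

lemma mor_pairI:
  assumes "f \<in> Hom C (Src C i) (Src C i')" "g \<in> Hom C (Tgt C i) (Tgt C i')" "h \<in> Hom C (Tgt C p) (Tgt C p')"
    "g \<cdot> i = i' \<cdot> f" "h \<cdot> p = p' \<cdot> g" "Src C p = Tgt C i" "Src C p' = Tgt C i'"
  shows "mor C f [i, p] [i', p'] h"
  using assms by auto

lemma mor_pairD:
  assumes "mor C f [i, p] [i', p'] h"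
  obtains g where "g \<in> Hom C (Tgt C i) (Tgt C i')" "g \<cdot> i = i' \<cdot> f" "h \<cdot> p = p' \<cdot> g"
  using assms by auto

lemma ext_seq_pair:
  assumes "ext_seq C S 1 A B E" obtains i p where "E = [i, p]" "conflation C S i p" "Tgt C p = A" "Src C i = B"
  using assms by (cases rule: ext_seq_cases) (auto dest: ext_seq_path)

text \<open>Sections go forward along a step: compose with its middle map. Backward, a section of p'
  becomes a retraction of i', then a retraction of i, and finally a section of p.\<close>

lemma split_invariant:
  assumes EE': "(E, E') \<in> yoneda_eq C S" and E: "ext_seq C S 1 A B E"
  shows "(\<exists>s \<in> Hom C A (Src C (last E)). last E \<cdot> s = Idt C A) \<longleftrightarrow>
    (\<exists>s \<in> Hom C A (Src C (last E')). last E' \<cdot> s = Idt C A)"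
proof (rule yoneda_eq_invariant[OF EE' E, of "\<lambda>E x. x \<longleftrightarrow> (\<exists>s \<in> Hom C A (Src C (last E)). last E \<cdot> s = Idt C A)"])
  fix F F' x x'
  assume FF': "(F, F') \<in> yoneda_step C S" and F: "ext_seq C S 1 A B F" and F': "ext_seq C S 1 A B F'"
    and x: "x \<longleftrightarrow> (\<exists>s \<in> Hom C A (Src C (last F)). last F \<cdot> s = Idt C A)"
      "x' \<longleftrightarrow> (\<exists>s \<in> Hom C A (Src C (last F')). last F' \<cdot> s = Idt C A)"
  obtain i p where ip: "F = [i, p]" "conflation C S i p" "Tgt C p = A" "Src C i = B" using F by (rule ext_seq_pair)
  obtain i' p' where ip': "F' = [i', p']" "conflation C S i' p'" "Tgt C p' = A" "Src C i' = B" using F' by (rule ext_seq_pair)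
  have "mor C (Idt C B) F F' (Idt C A)"
    using FF' unfolding yoneda_step_iff using ext_seq_unique[OF _ F] by blast
  then obtain g where g: "g \<in> Hom C (Tgt C i) (Tgt C i')" "g \<cdot> i = i' \<cdot> Idt C B" "Idt C A \<cdot> p = p' \<cdot> g"
    unfolding ip(1) ip'(1) by (rule mor_pairD)
  note c = conflationD[OF ip(2)] conflationD[OF ip'(2)]
  have g': "g \<in> Arr C" "Src C g = Tgt C i" "Tgt C g = Tgt C i'" using g(1) by (auto simp: Hom_def)
  have gi: "g \<cdot> i = i'" and pg: "p' \<cdot> g = p" using g(2,3) c ip ip' by auto
  have "x \<longleftrightarrow> x'"
  proof
    assume x
    then obtain s where s: "s \<in> Hom C A (Src C p)" "p \<cdot> s = Idt C A" using x ip by auto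
    have s': "s \<in> Arr C" "Src C s = A" "Tgt C s = Src C p" using s(1) by (auto simp: Hom_def)
    have "p' \<cdot> (g \<cdot> s) = Idt C A" using comp_eq[OF pg, of s] s' g' c s(2) by simp
    then show x' using x(2) ip' g' s' c by (auto simp: Hom_def intro!: bexI[of _ "g \<cdot> s"])
  next
    assume x'
    then obtain s where s: "s \<in> Hom C A (Src C p')" "p' \<cdot> s = Idt C A" using x ip' by auto
    then obtain r where r: "r \<in> Arr C" "Src C r = Tgt C i'" "Tgt C r = Src C i'" "r \<cdot> i' = Idt C (Src C i')"
      using retraction_of_section[OF c(9), of s] ip'(3) by (auto simp: Hom_def)
    have "(r \<cdot> g) \<cdot> i = Idt C (Src C i)" using r g' c gi ip ip' by simp
    then obtain s where "s \<in> Arr C" "Src C s = Tgt C p" "Tgt C s = Src C p" "p \<cdot> s = Idt C (Tgt C p)"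
      using section_of_retraction[OF c(1), of "r \<cdot> g"] r g' c ip ip' by auto
    then show x using x(1) ip by (auto simp: Hom_def intro!: bexI[of _ s])
  qed
  then show "x = x'" .
qed auto

text \<open>A section s makes sp the middle map of an endomorphism that is zero at the beginning and
  the identity at the end; so the class is its own push-out along zero.\<close>

lemma cl_split:
  assumes c: "conflation C S i p" and A: "Tgt C p = A" and B: "Src C i = B"
    and s: "s \<in> Hom C A (Src C p)" "p \<cdot> s = Idt C A"
  shows "cl [i, p] = ozero 1 A B"
proof -
  note [simp] = conflationD(2-5)[OF c] A B
  note cD = conflationD[OF c]
  have S: "A \<in> S" "B \<in> S" using cD by auto
  have s': "s \<in> Arr C" "Src C s = A" "Tgt C s = Tgt C i" using s(1) by (auto simp: Hom_def)
  have E: "ext_seq C S 1 A B [i, p]" using ext_seq_single[OF c] by simp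
  have "mor C (HZero C B B) [i, p] [i, p] (Idt C A)"
    by (rule mor_pairI[of _ _ _ "s \<cdot> p"])
      (use s' S comp_eq[OF s(2), of p] in \<open>simp_all add: Hom_def\<close>)
  then have "HZero C B B \<triangleright> cl [i, p] = cl [i, p]" by (rule push_mor[OF E E])
  then show ?thesis using ozero_eq[OF cl_Ext[OF E] S(2)] by simp
qed

text \<open>The zero class is represented by a biproduct, which splits, and splitting is invariant
  under equivalence.\<close>

lemma ozero_split:
  assumes c: "conflation C S i p" and A: "Tgt C p = A" and B: "Src C i = B" and z: "cl [i, p] = ozero 1 A B"
  obtains s where "s \<in> Hom C A (Src C p)" "p \<cdot> s = Idt C A"
proof -
  note cD = conflationD[OF c]
  have S: "A \<in> S" "B \<in> S" using cD A B by auto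
  obtain D i0 j p0 q where b: "is_biproduct C B A D (i0, j, p0, q)" "conflation C S i0 q" "ext_seq C S 1 A B [i0, q]"
    using biproduct_split_conflation[OF S] .
  note bD = biproductD[OF b(1)]
  have j: "j \<in> Hom C A (Src C q)" "q \<cdot> j = Idt C A" using bD by (auto simp: Hom_def)
  then have "cl [i0, q] = cl [i, p]" using cl_split[OF b(2) _ _ j] bD z by simp
  then have "([i0, q], [i, p]) \<in> yoneda_eq C S" using cl_eq_iff[OF b(3)] by simp
  from split_invariant[OF this b(3)] j that show ?thesis by auto
qed

lemma pull_conflation_eq_ozero:
  assumes c: "conflation C S i p" and B: "Src C i = B"
  shows "cl [i, p] \<triangleleft> p = ozero 1 (Src C p) B"
proof -
  note [simp] = conflationD(2-5)[OF c] B
  note cD = conflationD[OF c]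
  have S: "Src C p \<in> S" "B \<in> S" using cD by auto
  have E: "ext_seq C S 1 (Tgt C p) B [i, p]" using ext_seq_single[OF c] by simp
  obtain D i0 j p0 q where b: "is_biproduct C B (Src C p) D (i0, j, p0, q)" "conflation C S i0 q"
    "ext_seq C S 1 (Src C p) B [i0, q]"
    using biproduct_split_conflation[OF S] .
  note bD = biproductD[OF b(1)]
  have j: "j \<in> Hom C (Src C p) (Src C q)" "q \<cdot> j = Idt C (Src C p)" using bD by (auto simp: Hom_def)
  note bc = biproduct_comps[OF b(1)]
  have pi: "p \<cdot> (i \<cdot> f) = HZero C (Src C f) (Tgt C p)" if "f \<in> Arr C" "Tgt C f = B" for f
    using comp_eq[OF cD(5), of f] that by simp
  have "mor C (Idt C B) [i0, q] [i, p] p"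
    \<comment> \<open>The middle map is i on the summand B and the identity on the summand
      \<open>Src C p\<close>.\<close>
    by (rule mor_pairI[of _ _ _ "i \<cdot> p0 \<boxplus> q"]) (use S bD bc pi in \<open>simp_all add: Hom_def comp_hadd hadd_comp\<close>)
  from pull_mor[OF E b(3) this] show ?thesis using cl_split[OF b(2) _ _ j] bD by simp
qed

text \<open>The pull-back along \<beta> splits; its section, followed by the comparison map to the
  middle term of the conflation, lifts \<beta>.\<close>

lemma pull_eq_ozero_lift:
  assumes c: "conflation C S i p" and A: "Tgt C p = A" and B: "Src C i = B" and \<beta>: "\<beta> \<in> Hom C Z A" and Z: "Z \<in> S"
    and z: "cl [i, p] \<triangleleft> \<beta> = ozero 1 Z B"
  obtains \<mu> where "\<mu> \<in> Hom C Z (Src C p)" "p \<cdot> \<mu> = \<beta>"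
proof -
  note cD = conflationD[OF c]
  have E: "ext_seq C S 1 A B [i, p]" using ext_seq_single[OF c A B] .
  obtain F where F: "ext_seq C S 1 Z B F" "mor C (Idt C B) F [i, p] \<beta>" "cl [i, p] \<triangleleft> \<beta> = cl F"
    using pull_rep[OF E \<beta> Z] .
  obtain u v where uv: "F = [u, v]" "conflation C S u v" "Tgt C v = Z" "Src C u = B" using F(1) by (rule ext_seq_pair)
  note cD' = conflationD[OF uv(2)]
  obtain s where s: "s \<in> Hom C Z (Src C v)" "v \<cdot> s = Idt C Z"
    using ozero_split[OF uv(2-4)] F(3) z uv(1) by auto
  obtain g where g: "g \<in> Hom C (Tgt C u) (Tgt C i)" "g \<cdot> u = i \<cdot> Idt C B" "\<beta> \<cdot> v = p \<cdot> g"
    using F(2) unfolding uv(1) by (rule mor_pairD)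
  have gs: "g \<cdot> s \<in> Hom C Z (Src C p)" using g(1) s(1) cD cD' by (auto simp: Hom_def)
  have "p \<cdot> (g \<cdot> s) = (p \<cdot> g) \<cdot> s" using g(1) s(1) cD cD' by (simp add: Hom_def)
  also have "\<dots> = \<beta> \<cdot> (v \<cdot> s)" unfolding g(3)[symmetric] using \<beta> s(1) cD' uv by (simp add: Hom_def)
  also have "\<dots> = \<beta>" unfolding s(2) using \<beta> by (simp add: Hom_def)
  finally show ?thesis using that[OF gs] by simp
qed

text \<open>The push-out of \<omega> along i splits, and its retraction extends i over the middle
  term of \<omega>. The extension is a morphism of conflations beginning with the identity of B; its
  last component is \<beta>.\<close>

lemma push_eq_ozero_pull:
  assumes c: "conflation C S i p" and A: "Tgt C p = A" and B: "Src C i = B" and \<omega>: "\<omega> \<in> Ext C S 1 Z B"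
    and z: "i \<triangleright> \<omega> = ozero 1 Z (Tgt C i)"
  obtains \<beta> where "\<beta> \<in> Hom C Z A" "\<omega> = cl [i, p] \<triangleleft> \<beta>"
proof -
  note cD = conflationD[OF c]
  have i: "i \<in> Hom C B (Tgt C i)" using cD B by (simp add: Hom_def)
  have E: "ext_seq C S 1 A B [i, p]" using ext_seq_single[OF c A B] .
  obtain G where G: "ext_seq C S 1 Z B G" "\<omega> = cl G" using \<omega> by (rule ExtE)
  obtain u v where uv: "G = [u, v]" "conflation C S u v" "Tgt C v = Z" "Src C u = B" using G(1) by (rule ext_seq_pair)
  note cD' = conflationD[OF uv(2)]
  obtain F where F: "ext_seq C S 1 Z (Tgt C i) F" "mor C i G F (Idt C Z)" "i \<triangleright> cl G = cl F"
    using push_rep[OF G(1) i cD(7)] .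
  obtain u' v' where uv': "F = [u', v']" "conflation C S u' v'" "Tgt C v' = Z" "Src C u' = Tgt C i" using F(1) by (rule ext_seq_pair)
  note cD'' = conflationD[OF uv'(2)]
  obtain s where s: "s \<in> Hom C Z (Src C v')" "v' \<cdot> s = Idt C Z"
    using ozero_split[OF uv'(2-4)] F(3) G(2) z uv'(1) by auto
  then obtain r where r: "r \<in> Arr C" "Src C r = Tgt C u'" "Tgt C r = Src C u'" "r \<cdot> u' = Idt C (Src C u')"
    using retraction_of_section[OF cD''(1), of s] uv' by (auto simp: Hom_def)
  obtain g where g: "g \<in> Hom C (Tgt C u) (Tgt C u')" "g \<cdot> u = u' \<cdot> i"
    using F(2) unfolding uv(1) uv'(1) by (rule mor_pairD)
  have g': "g \<in> Arr C" "Src C g = Tgt C u" "Tgt C g = Tgt C u'" using g(1) by (auto simp: Hom_def)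
  have "(r \<cdot> g) \<cdot> u = (r \<cdot> u') \<cdot> i" using r(1-3) g(2) g' cD cD' cD'' B uv uv' by simp
  then have ru: "(r \<cdot> g) \<cdot> u = i" unfolding r(4) using uv' cD by simp
  have id: "Idt C B \<in> Hom C B B" using Idt_closed cD B by auto
  obtain \<beta> where \<beta>: "\<beta> \<in> Arr C" "Src C \<beta> = Tgt C v" "Tgt C \<beta> = Tgt C p" "\<beta> \<cdot> v = p \<cdot> (r \<cdot> g)"
    using cokernel_map[OF cD'(1) cD(1), of "Idt C B" "r \<cdot> g"] ru r(1-3) g' cD cD' cD'' B uv uv' by auto
  have "mor C (Idt C B) [u, v] [i, p] \<beta>"
    by (rule mor_pairI[of _ _ _ "r \<cdot> g"])
      (use ru \<beta> r(1-3) g' cD cD' cD'' B A uv uv' id in \<open>simp_all add: Hom_def\<close>)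
  then have "cl [i, p] \<triangleleft> \<beta> = \<omega>" using pull_mor[OF E] G uv by simp
  then show ?thesis using that[of \<beta>] \<beta> uv A by (auto simp: Hom_def)
qed

text \<open>Let \<gamma> be the class of (e, q). By \<open>pushout_cokernel\<close> the push-out p'
  of p along e is the cokernel of ek, so (ek, p') is a conflation. The push-out of \<gamma> along p
  ends in the target of p' and has a section s; pulling (ek, p') back along s gives the required
  class.\<close>

lemma Ext1_exact_middle:
  assumes c: "conflation C S k p" and \<gamma>: "\<gamma> \<in> Ext C S 1 X (Tgt C k)"
    and z: "p \<triangleright> \<gamma> = ozero 1 X (Tgt C p)"
  obtains \<gamma>' where "\<gamma>' \<in> Ext C S 1 X (Src C k)" "\<gamma> = k \<triangleright> \<gamma>'"
proof -
  note cD = conflationD[OF c]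
  have p: "p \<in> Hom C (Tgt C k) (Tgt C p)" using cD by (simp add: Hom_def)
  obtain G where G: "ext_seq C S 1 X (Tgt C k) G" "\<gamma> = cl G" using \<gamma> by (rule ExtE)
  obtain e q where eq: "G = [e, q]" "conflation C S e q" "Tgt C q = X" "Src C e = Tgt C k" using G(1) by (rule ext_seq_pair)
  note cD' = conflationD[OF eq(2)]
  obtain F where F: "pushout_seq C p G F" using pushout_seq_exists[OF G(1) p] .
  from F obtain e' p' q' where po: "is_pushout C e p e' p'" and q': "q' \<cdot> p' = q" "F = [e', q']"
    unfolding eq(1) by (auto elim: pushout_seq.cases)
  note P = pushoutD[OF po]
  have Fs: "ext_seq C S 1 X (Tgt C p) F" "p \<triangleright> \<gamma> = cl F"
    using pushout_seq_ext_seq[OF G(1) p cD(8) F] push_cl[OF G(1) p cD(8) F] G(2) by auto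
  have c': "conflation C S e' q'" "Tgt C q' = X" "Src C e' = Tgt C p"
    by (rule ext_seq_pair[OF Fs(1)[unfolded q'(2)]]; simp)+
  note cD'' = conflationD[OF c'(1)]
  obtain s where s: "s \<in> Hom C X (Src C q')" "q' \<cdot> s = Idt C X"
    using ozero_split[OF c'] Fs q' z by auto
  have "is_cokernel C (e \<cdot> k) p'"
    using pushout_cokernel[OF _ po] cD(1) by (auto simp: short_exact_def)
  moreover have "is_mono C (e \<cdot> k)"
    using cD(1) cD'(1) eq(4) by (intro mono_comp) (auto simp: short_exact_def intro: kernel_mono)
  ultimately have "short_exact C (e \<cdot> k) p'" by (rule mono_short_exact[rotated])
  then have c2: "conflation C S (e \<cdot> k) p'"
    using cD cD' cD'' eq P by (simp add: conflation_def)
  have E2: "ext_seq C S 1 (Tgt C p') (Src C k) [e \<cdot> k, p']"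
    using ext_seq_single[OF c2] cD cD' eq by simp
  have s2: "s \<in> Hom C X (Tgt C p')" using s(1) cD'' P by (simp add: Hom_def)
  have X: "X \<in> S" using cD' eq by simp
  obtain H where H: "ext_seq C S 1 X (Src C k) H" "mor C (Idt C (Src C k)) H [e \<cdot> k, p'] s"
    using pull_rep[OF E2 s2 X] by metis
  obtain u v where uv: "H = [u, v]" "conflation C S u v" "Tgt C v = X" "Src C u = Src C k" using H(1) by (rule ext_seq_pair)
  note cH = conflationD[OF uv(2)]
  obtain g where g: "g \<in> Hom C (Tgt C u) (Tgt C (e \<cdot> k))" "g \<cdot> u = (e \<cdot> k) \<cdot> Idt C (Src C k)" "s \<cdot> v = p' \<cdot> g"
    using H(2) unfolding uv(1) by (rule mor_pairD)
  have g': "g \<in> Hom C (Tgt C u) (Tgt C e)" using g(1) cD cD' eq by simp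
  have gu: "g \<cdot> u = e \<cdot> k" using g(2) cD cD' eq by simp
  have "q \<cdot> g = q' \<cdot> (p' \<cdot> g)" using q' g' cD' cD'' P by (auto simp: Hom_def)
  also have "\<dots> = (q' \<cdot> s) \<cdot> v" unfolding g(3)[symmetric] using s(1) cH cD'' uv by (simp add: Hom_def)
  also have "\<dots> = v" unfolding s(2) using uv cH by simp
  finally have qg: "q \<cdot> g = v" .
  have "mor C k [u, v] [e, q] (Idt C X)"
    by (rule mor_pairI[OF _ g']) (use gu qg cD cD' cH eq uv X in \<open>simp_all add: Hom_def\<close>)
  then have "k \<triangleright> cl H = cl G" using push_mor[OF H(1) G(1)] eq uv by simp
  then show ?thesis using that[of "cl H"] cl_Ext[OF H(1)] G(2) by simp
qed

section \<open>Vanishing products and exactness in higher degrees\<close>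

definition zero_factor where
  "zero_factor t X A B \<omega> \<gamma> \<longleftrightarrow> (\<exists>Z \<beta> \<gamma>'. Z \<in> S \<and> \<beta> \<in> Hom C Z A \<and> \<gamma>' \<in> Ext C S t X Z \<and>
     \<gamma> = \<beta> \<triangleright> \<gamma>' \<and> \<omega> \<triangleleft> \<beta> = ozero 1 Z B)"

text \<open>Isolated as a property of t because the argument alternates: exactness in degree t
  yields \<open>yprod_ozero_factor\<close> in degree t, which in turn yields exactness in degree t +
  1.\<close>

definition middle_exact where
  "middle_exact t \<longleftrightarrow> (\<forall>k p X \<gamma>. conflation C S k p \<longrightarrow> \<gamma> \<in> Ext C S t X (Tgt C k) \<longrightarrow>
     p \<triangleright> \<gamma> = ozero t X (Tgt C p) \<longrightarrow> (\<exists>\<gamma>' \<in> Ext C S t X (Src C k). \<gamma> = k \<triangleright> \<gamma>'))"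

text \<open>A step between spliced sequences has no component at the splicing objects. The first
  square induces one on cokernels, and the square after it commutes since p is epi.\<close>

lemma yoneda_step_splice:
  assumes step: "(splice C [i, p] E, splice C [i', p'] E') \<in> yoneda_step C S"
    and c: "conflation C S i p" and c': "conflation C S i' p'"
    and E: "ext_seq C S t X (Tgt C p) E" and E': "ext_seq C S t X (Tgt C p') E'"
    and B: "Src C i = B" "Src C i' = B"
  obtains \<beta> where "\<beta> \<in> Hom C (Tgt C p) (Tgt C p')" "cl [i, p] = cl [i', p'] \<triangleleft> \<beta>" "\<beta> \<triangleright> cl E = cl E'"
proof -
  note cD = conflationD[OF c] conflationD[OF c']
  obtain j ds where j: "E = j # ds" using ext_seq_path[OF E] by (cases E) auto
  obtain j' ds' where j': "E' = j' # ds'" using ext_seq_path[OF E'] by (cases E') auto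
  have jD: "j \<in> Arr C" "Src C j = Tgt C p" "j' \<in> Arr C" "Src C j' = Tgt C p'"
    using ext_seq_path[OF E] ext_seq_path[OF E'] unfolding j j' by auto
  have F: "ext_seq C S (Suc t) X B (splice C [i, p] E)"
    using ext_seq_splice_conflation[OF c E] B by simp
  have "mor C (Idt C B) (splice C [i, p] E) (splice C [i', p'] E') (Idt C X)"
    using step unfolding yoneda_step_iff using ext_seq_unique[OF _ F] by blast
  then obtain g h where g: "g \<in> Hom C (Tgt C i) (Tgt C i')" "g \<cdot> i = i' \<cdot> Idt C B"
    and h: "h \<in> Hom C (Tgt C j) (Tgt C j')" "h \<cdot> (j \<cdot> p) = (j' \<cdot> p') \<cdot> g" "mor C h ds ds' (Idt C X)"
    using cD jD unfolding j j' splice_def by auto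
  have g': "g \<in> Arr C" "Src C g = Tgt C i" "Tgt C g = Tgt C i'" and gi: "g \<cdot> i = i'"
    using g cD B by (auto simp: Hom_def)
  have h': "h \<in> Arr C" "Src C h = Tgt C j" "Tgt C h = Tgt C j'" using h(1) by (auto simp: Hom_def)
  have id: "Idt C B \<in> Hom C B B" using Idt_closed cD B by auto
  obtain \<beta> where \<beta>: "\<beta> \<in> Arr C" "Src C \<beta> = Tgt C p" "Tgt C \<beta> = Tgt C p'" "\<beta> \<cdot> p = p' \<cdot> g"
    using cokernel_map[OF cD(1) cD(9), of "Idt C B" g] gi g' cD B by auto
  have \<beta>': "\<beta> \<in> Hom C (Tgt C p) (Tgt C p')" using \<beta> by (simp add: Hom_def)
  have epi: "is_epi C p" using cD(1) cokernel_epi by (auto simp: short_exact_def)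
  have "(h \<cdot> j) \<cdot> p = j' \<cdot> (p' \<cdot> g)" using h(2) h' g' jD cD by simp
  also have "\<dots> = (j' \<cdot> \<beta>) \<cdot> p" unfolding \<beta>(4)[symmetric] using \<beta>(1-3) jD cD by simp
  finally have "h \<cdot> j = j' \<cdot> \<beta>" by (rule epi_cancel[OF epi]) (use \<beta>(1-3) jD cD h' in simp_all)
  then have "mor C \<beta> E E' (Idt C X)" unfolding j j' using \<beta>' h jD by auto
  then have 1: "\<beta> \<triangleright> cl E = cl E'" by (rule push_mor[OF E E'])
  have "mor C (Idt C B) [i, p] [i', p'] \<beta>"
    by (rule mor_pairI[OF _ g(1) \<beta>']) (use gi g' cD B id \<beta> in simp_all)
  then have "cl [i', p'] \<triangleleft> \<beta> = cl [i, p]"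
    using pull_mor[OF ext_seq_single[OF c' refl B(2)] ext_seq_single[OF c refl B(1)]] by simp
  with 1 \<beta>' that show ?thesis by simp
qed

text \<open>The pull-back of p and \<beta> is presented as the kernel of (p, -\<beta>) on the
  biproduct, the form to which \<open>middle_exact\<close> applies. K lies in \<open>S\<close> as
  the middle term of the pulled-back conflation.\<close>

lemma pullback_conflation:
  assumes c: "conflation C S i p" and \<beta>: "\<beta> \<in> Hom C A (Tgt C p)" "A \<in> S"
    and b: "is_biproduct C (Src C p) A D (i1, i2, p1, p2)"
  obtains K \<phi> \<psi> where "K \<in> S" "\<phi> \<in> Hom C K (Src C p)" "\<psi> \<in> Hom C K A" "p \<cdot> \<phi> = \<beta> \<cdot> \<psi>"
    "conflation C S (i1 \<cdot> \<phi> \<boxplus> i2 \<cdot> \<psi>) (p \<cdot> p1 \<boxplus> hneg C (\<beta> \<cdot> p2))"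
    "Src C (i1 \<cdot> \<phi> \<boxplus> i2 \<cdot> \<psi>) = K" "Tgt C (i1 \<cdot> \<phi> \<boxplus> i2 \<cdot> \<psi>) = D"
    "Tgt C (p \<cdot> p1 \<boxplus> hneg C (\<beta> \<cdot> p2)) = Tgt C p"
proof -
  interpret o: extension_closed_subcategory "opp C" S by (rule extension_closed_subcategory_opp)
  note cD = conflationD[OF c] and bD = biproductD[OF b]
  have \<beta>': "\<beta> \<in> Arr C" "Src C \<beta> = A" "Tgt C \<beta> = Tgt C p" using \<beta> by (auto simp: Hom_def)
  obtain \<psi> \<phi> where po: "is_pushout (opp C) p \<beta> \<psi> \<phi>"
    using o.pushout_exists[of p \<beta>] cD \<beta>' by auto
  note P = o.pushoutD[OF po, simplified]
  obtain q where "conflation (opp C) S \<psi> q"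
    by (rule o.conflation_pushout[OF _ po, of i]) (use c \<beta> \<beta>' in auto)
  then have K: "Src C \<psi> \<in> S" by (auto simp: conflation_def)
  have b': "is_biproduct (opp C) (Tgt (opp C) p) (Tgt (opp C) \<beta>) D (p1, p2, i1, i2)"
    using b \<beta>' by simp
  let ?\<kappa> = "i1 \<cdot> \<phi> \<boxplus> i2 \<cdot> \<psi>" and ?\<rho> = "p \<cdot> p1 \<boxplus> hneg C (\<beta> \<cdot> p2)"
  have "is_epi C p" using cD(1) cokernel_epi by (auto simp: short_exact_def)
  then have "is_epi C ?\<rho>" using o.mono_pair[OF b'] cD \<beta>' by simp
  moreover have "is_kernel C ?\<rho> ?\<kappa>" using o.pushout_cokernel_sum[OF b' po] by simp
  ultimately have se: "short_exact C ?\<kappa> ?\<rho>" by (rule epi_short_exact)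
  have t: "Src C ?\<kappa> = Src C \<psi>" "Tgt C ?\<kappa> = D" "Tgt C ?\<rho> = Tgt C p"
    using P bD cD \<beta>' by simp_all
  have "D \<in> S" using biproduct_S[OF b] cD \<beta> by simp
  then have "conflation C S ?\<kappa> ?\<rho>" using se t K cD by (simp add: conflation_def)
  then show ?thesis using that[OF K _ _ _ _ t] P \<beta>' cD by (simp add: Hom_def)
qed

text \<open>The backward direction along a step. Lift \<beta>1 through p to l. The class \<eta> over
  \<open>Src C p\<close> \<oplus> A with components l \<triangleright> \<gamma>1 and \<gamma> is
  annihilated by (p, -\<beta>), because pl = \<beta>1 and \<beta>1 \<triangleright> \<gamma>1 =
  \<beta> \<triangleright> \<gamma>. Hence \<eta> comes from a class over the pull-back K, of which
  \<gamma> is the push-out along \<psi>; and \<omega>\<beta>\<psi> = \<omega>p\<phi> = 0.\<close>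

lemma zero_factor_pull:
  assumes me: "middle_exact t" and c: "conflation C S i p" and B: "Src C i = B"
    and \<beta>: "\<beta> \<in> Hom C A (Tgt C p)" and \<gamma>: "\<gamma> \<in> Ext C S t X A"
    and z: "zero_factor t X (Tgt C p) B (cl [i, p]) (\<beta> \<triangleright> \<gamma>)"
  shows "zero_factor t X A B (cl [i, p] \<triangleleft> \<beta>) \<gamma>"
proof -
  note cD = conflationD[OF c]
  have S: "A \<in> S" "X \<in> S" "1 \<le> t" "B \<in> S" using Ext_S[OF \<gamma>] cD B by auto
  let ?\<omega> = "cl [i, p]"
  have \<omega>: "?\<omega> \<in> Ext C S 1 (Tgt C p) B" using cl_Ext[OF ext_seq_single[OF c refl B]] .
  obtain Z \<beta>1 \<gamma>1 where Z: "Z \<in> S" "\<beta>1 \<in> Hom C Z (Tgt C p)" "\<gamma>1 \<in> Ext C S t X Z" "\<beta> \<triangleright> \<gamma> = \<beta>1 \<triangleright> \<gamma>1"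
    "?\<omega> \<triangleleft> \<beta>1 = ozero 1 Z B" using z unfolding zero_factor_def by blast
  obtain l where l: "l \<in> Hom C Z (Src C p)" "p \<cdot> l = \<beta>1"
    using pull_eq_ozero_lift[OF c refl B Z(2,1,5)] .
  have PS: "Src C p \<in> S" using cD by simp
  have p: "p \<in> Hom C (Src C p) (Tgt C p)" using cD by (simp add: Hom_def)
  obtain D b where "is_biproduct C (Src C p) A D b" using biproduct_exists[of "Src C p" A] S PS by auto
  moreover obtain i1 i2 p1 p2 where b_eq: "b = (i1, i2, p1, p2)" by (cases b)
  ultimately have b: "is_biproduct C (Src C p) A D (i1, i2, p1, p2)" by simp
  note bD = biproductD[OF b] and DS = biproduct_S[OF b PS S(1)]
  have pr: "p1 \<in> Hom C D (Src C p)" "p2 \<in> Hom C D A" using bD by (auto simp: Hom_def)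
  obtain K \<phi> \<psi> where K: "K \<in> S" "\<phi> \<in> Hom C K (Src C p)" "\<psi> \<in> Hom C K A" "p \<cdot> \<phi> = \<beta> \<cdot> \<psi>"
    "conflation C S (i1 \<cdot> \<phi> \<boxplus> i2 \<cdot> \<psi>) (p \<cdot> p1 \<boxplus> hneg C (\<beta> \<cdot> p2))"
    "Src C (i1 \<cdot> \<phi> \<boxplus> i2 \<cdot> \<psi>) = K" "Tgt C (i1 \<cdot> \<phi> \<boxplus> i2 \<cdot> \<psi>) = D"
    "Tgt C (p \<cdot> p1 \<boxplus> hneg C (\<beta> \<cdot> p2)) = Tgt C p"
    using pullback_conflation[OF c \<beta> S(1) b] .
  note lz = push_Ext[OF Z(3) l(1) PS]
  obtain \<eta> where \<eta>: "\<eta> \<in> Ext C S t X D" "p1 \<triangleright> \<eta> = l \<triangleright> \<gamma>1" "p2 \<triangleright> \<eta> = \<gamma>"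
    using Ext_pair[OF lz \<gamma> b] by (auto simp: b_eq)
  have \<beta>p2: "\<beta> \<cdot> p2 \<in> Hom C D (Tgt C p)" using Comp_closed[OF pr(2) \<beta>] .
  have pp1: "p \<cdot> p1 \<in> Hom C D (Tgt C p)" using Comp_closed[OF pr(1) p] .
  have "(p \<cdot> p1) \<triangleright> \<eta> = \<beta> \<triangleright> \<gamma>"
    using push_push[OF \<eta>(1) pr(1) PS p cD(8)] push_push[OF Z(3) l(1) PS p cD(8)] \<eta>(2) l(2) Z(4) by simp
  also have "\<dots> = (\<beta> \<cdot> p2) \<triangleright> \<eta>"
    using push_push[OF \<eta>(1) pr(2) S(1) \<beta> cD(8)] \<eta>(3) by simp
  finally have "(p \<cdot> p1 \<boxplus> hneg C (\<beta> \<cdot> p2)) \<triangleright> \<eta> = ((\<beta> \<cdot> p2) \<triangleright> \<eta>) \<uplus> (hneg C (\<beta> \<cdot> p2) \<triangleright> \<eta>)"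
    using hadd_push[OF \<eta>(1) pp1 hneg_Hom[OF \<beta>p2] cD(8)] by simp
  also have "\<dots> = (\<beta> \<cdot> p2 \<boxplus> hneg C (\<beta> \<cdot> p2)) \<triangleright> \<eta>"
    using hadd_push[OF \<eta>(1) \<beta>p2 hneg_Hom[OF \<beta>p2] cD(8)] by simp
  also have "\<beta> \<cdot> p2 \<boxplus> hneg C (\<beta> \<cdot> p2) = HZero C D (Tgt C p)" using \<beta>p2 by (simp add: Hom_def)
  also have "\<dots> \<triangleright> \<eta> = ozero t X (Tgt C p)" using ozero_eq[OF \<eta>(1) cD(8)] .
  finally have "(p \<cdot> p1 \<boxplus> hneg C (\<beta> \<cdot> p2)) \<triangleright> \<eta> = ozero t X (Tgt C p)" .
  then obtain \<eta>' where \<eta>': "\<eta>' \<in> Ext C S t X K" "\<eta> = (i1 \<cdot> \<phi> \<boxplus> i2 \<cdot> \<psi>) \<triangleright> \<eta>'"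
    using me K(5-8) \<eta>(1) unfolding middle_exact_def by metis
  have \<kappa>: "i1 \<cdot> \<phi> \<boxplus> i2 \<cdot> \<psi> \<in> Hom C K D" using K(5-7) conflationD(2) by (simp add: Hom_def)
  have "p2 \<cdot> (i1 \<cdot> \<phi> \<boxplus> i2 \<cdot> \<psi>) = \<psi>"
    using bD biproduct_comps[OF b] K(2,3) by (simp add: Hom_def comp_hadd)
  then have "\<gamma> = \<psi> \<triangleright> \<eta>'" using push_push[OF \<eta>'(1) \<kappa> DS pr(2) S(1)] \<eta>'(2) \<eta>(3) by simp
  moreover have "(?\<omega> \<triangleleft> \<beta>) \<triangleleft> \<psi> = (?\<omega> \<triangleleft> p) \<triangleleft> \<phi>"
    using pull_pull[OF \<omega> \<beta> S(1) K(3,1)] pull_pull[OF \<omega> p PS K(2,1)] K(4) by simp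
  moreover have "\<dots> = ozero 1 K B"
    unfolding pull_conflation_eq_ozero[OF c B] using ozero_pull[OF K(2) PS K(1) S(4)] by simp
  ultimately show ?thesis unfolding zero_factor_def using K(1,3) \<eta>'(1) by metis
qed

text \<open>Pushing \<omega> out along zero gives E0. Its splice with G also represents 0, and there
  the identity of A is a factor that annihilates the class of E0. Along the zigzag to the splice of
  E and G, the property goes forward by composition with the induced \<beta> and backward by
  \<open>zero_factor_pull\<close>.\<close>

lemma yprod_ozero_factor:
  assumes me: "middle_exact t" and \<omega>: "\<omega> \<in> Ext C S 1 A B" and \<gamma>: "\<gamma> \<in> Ext C S t X A"
    and z: "\<omega> \<star> \<gamma> = ozero (Suc t) X B"
  shows "zero_factor t X A B \<omega> \<gamma>"
proof -
  have S: "A \<in> S" "B \<in> S" "X \<in> S" using Ext_S[OF \<omega>] Ext_S[OF \<gamma>] by auto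
  obtain E where E: "ext_seq C S 1 A B E" "\<omega> = cl E" using \<omega> by (rule ExtE)
  obtain i p where ip: "E = [i, p]" "conflation C S i p" "Tgt C p = A" "Src C i = B" using E(1) by (rule ext_seq_pair)
  obtain G where G: "ext_seq C S t X A G" "\<gamma> = cl G" using \<gamma> by (rule ExtE)
  obtain E0 where E0: "ext_seq C S 1 A B E0" "HZero C B B \<triangleright> \<omega> = cl E0"
    using push_Ext[OF \<omega> zero_Hom[OF S(2,2)] S(2)] by (rule ExtE)
  obtain i0 p0 where ip0: "E0 = [i0, p0]" "conflation C S i0 p0" "Tgt C p0 = A" "Src C i0 = B"
    using E0(1) by (rule ext_seq_pair)
  have s: "ext_seq C S (Suc t) X B (splice C E G)" "ext_seq C S (Suc t) X B (splice C E0 G)"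
    using ext_seq_splice[OF E(1) G(1)] ext_seq_splice[OF E0(1) G(1)] by simp_all
  have "cl (splice C E0 G) = HZero C B B \<triangleright> (\<omega> \<star> \<gamma>)"
    using push_yprod[OF \<omega> \<gamma> zero_Hom[OF S(2,2)] S(2)] E0 yprod_cl[OF E0(1) G(1)] G by simp
  also have "\<dots> = ozero (Suc t) X B"
    using ozero_eq[OF yprod_Ext[OF \<omega> \<gamma>] S(2)] by simp
  also have "\<dots> = cl (splice C E G)" using z yprod_cl[OF E(1) G(1)] E G by simp
  finally have eq: "(splice C E0 G, splice C E G) \<in> yoneda_eq C S" using cl_eq_iff[OF s(2)] by simp
  have "True \<longleftrightarrow> zero_factor t X A B \<omega> \<gamma>"
  \<comment> \<open>The value at a sequence F is the truth of \<open>zero_factor\<close> for F cut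
    after its first conflation.\<close>
  proof (rule yoneda_eq_invariant[OF eq s(2), of "\<lambda>F x. \<exists>i p F1. conflation C S i p \<and> Src C i = B \<and>
      ext_seq C S t X (Tgt C p) F1 \<and> F = splice C [i, p] F1 \<and>
      (x \<longleftrightarrow> zero_factor t X (Tgt C p) B (cl [i, p]) (cl F1))"])
    fix F F' x x'
    assume step: "(F, F') \<in> yoneda_step C S"
    assume "\<exists>i p F1. conflation C S i p \<and> Src C i = B \<and> ext_seq C S t X (Tgt C p) F1 \<and>
      F = splice C [i, p] F1 \<and> (x \<longleftrightarrow> zero_factor t X (Tgt C p) B (cl [i, p]) (cl F1))"
    then obtain i p F1 where F: "conflation C S i p" "Src C i = B" "ext_seq C S t X (Tgt C p) F1"
      "F = splice C [i, p] F1" "x \<longleftrightarrow> zero_factor t X (Tgt C p) B (cl [i, p]) (cl F1)" by blast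
    assume "\<exists>i p F1. conflation C S i p \<and> Src C i = B \<and> ext_seq C S t X (Tgt C p) F1 \<and>
      F' = splice C [i, p] F1 \<and> (x' \<longleftrightarrow> zero_factor t X (Tgt C p) B (cl [i, p]) (cl F1))"
    then obtain i' p' F1' where F': "conflation C S i' p'" "Src C i' = B" "ext_seq C S t X (Tgt C p') F1'"
      "F' = splice C [i', p'] F1'" "x' \<longleftrightarrow> zero_factor t X (Tgt C p') B (cl [i', p']) (cl F1')" by blast
    obtain \<beta> where \<beta>: "\<beta> \<in> Hom C (Tgt C p) (Tgt C p')" "cl [i, p] = cl [i', p'] \<triangleleft> \<beta>" "\<beta> \<triangleright> cl F1 = cl F1'"
      using yoneda_step_splice[OF step[unfolded F(4) F'(4)] F(1) F'(1) F(3) F'(3) F(2) F'(2)] .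
    have "x \<longleftrightarrow> x'"
    proof
      assume x'
      then have "zero_factor t X (Tgt C p') B (cl [i', p']) (\<beta> \<triangleright> cl F1)" using F'(5) \<beta>(3) by simp
      from zero_factor_pull[OF me F'(1,2) \<beta>(1) cl_Ext[OF F(3)] this]
      show x using F(5) \<beta>(2) by simp
    next
      assume x
      then obtain Z \<beta>1 \<gamma>1 where Z: "Z \<in> S" "\<beta>1 \<in> Hom C Z (Tgt C p)" "\<gamma>1 \<in> Ext C S t X Z" "cl F1 = \<beta>1 \<triangleright> \<gamma>1"
        "cl [i, p] \<triangleleft> \<beta>1 = ozero 1 Z B" using F(5) unfolding zero_factor_def by blast
      have T: "Tgt C p \<in> S" "Tgt C p' \<in> S" using conflationD(8) F(1) F'(1) by blast+
      have "cl F1' = (\<beta> \<cdot> \<beta>1) \<triangleright> \<gamma>1" using push_push[OF Z(3,2) T(1) \<beta>(1) T(2)] \<beta>(3) Z(4) by simp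
      moreover have "cl [i', p'] \<triangleleft> (\<beta> \<cdot> \<beta>1) = ozero 1 Z B"
        using pull_pull[OF cl_Ext[OF ext_seq_single[OF F'(1) refl F'(2)]] \<beta>(1) T(1) Z(2,1)] \<beta>(2) Z(5) by simp
      ultimately show x' using F'(5) Z(1,3) Comp_closed[OF Z(2) \<beta>(1)] unfolding zero_factor_def by blast
    qed
    then show "x = x'" .
  next
    fix F assume F: "ext_seq C S (Suc t) X B F"
    show "\<exists>x i p F1. conflation C S i p \<and> Src C i = B \<and> ext_seq C S t X (Tgt C p) F1 \<and>
      F = splice C [i, p] F1 \<and> (x \<longleftrightarrow> zero_factor t X (Tgt C p) B (cl [i, p]) (cl F1))"
      using F
    proof (cases rule: ext_seq_cases)
      case (single i p)
      then show ?thesis using Ext_S[OF \<gamma>] by simp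
    next
      case (splice i p t' j ds)
      then show ?thesis by blast
    qed
  next
    have id: "Idt C A \<in> Hom C A A" using Idt_closed S by simp
    have "zero_factor t X A B (cl E0) \<gamma>"
      unfolding zero_factor_def using S \<gamma> id ozero_eq[OF \<omega> S(2)] ozero_pull[OF id S(1,1,2)] E0
      by (intro exI[of _ A] exI[of _ "Idt C A"] exI[of _ \<gamma>]) simp
    then show "\<exists>i p F1. conflation C S i p \<and> Src C i = B \<and> ext_seq C S t X (Tgt C p) F1 \<and>
      splice C E0 G = splice C [i, p] F1 \<and> (True \<longleftrightarrow> zero_factor t X (Tgt C p) B (cl [i, p]) (cl F1))"
      using ip0 G by blast
    show "\<exists>i p F1. conflation C S i p \<and> Src C i = B \<and> ext_seq C S t X (Tgt C p) F1 \<and>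
      splice C E G = splice C [i, p] F1 \<and> (zero_factor t X A B \<omega> \<gamma> \<longleftrightarrow> zero_factor t X (Tgt C p) B (cl [i, p]) (cl F1))"
      using ip G E by blast
  qed
  then show ?thesis by simp
qed

text \<open>Write \<gamma> = \<omega> \<star> \<gamma>1 with \<omega> of degree 1. As (p
  \<triangleright> \<omega>) \<star> \<gamma>1 = 0, there is \<beta> with \<gamma>1 = \<beta>
  \<triangleright> \<gamma>2 that annihilates p \<triangleright> \<omega>; exactness in degree 1
  then lifts \<omega> \<triangleleft> \<beta> along k.\<close>

lemma middle_exact:
  assumes "1 \<le> t" shows "middle_exact t"
  using assms
proof (induction t rule: dec_induct)
  case base
  show ?case unfolding middle_exact_def using Ext1_exact_middle by metis
next
  case (step t)
  show ?case
    unfolding middle_exact_def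
  proof (intro allI impI)
    fix k p X \<gamma>
    assume c: "conflation C S k p" and \<gamma>: "\<gamma> \<in> Ext C S (Suc t) X (Tgt C k)" and z: "p \<triangleright> \<gamma> = ozero (Suc t) X (Tgt C p)"
    note cD = conflationD[OF c]
    have p: "p \<in> Hom C (Tgt C k) (Tgt C p)" and k: "k \<in> Hom C (Src C k) (Tgt C k)" using cD by (auto simp: Hom_def)
    obtain Z \<omega> \<gamma>1 where d: "\<omega> \<in> Ext C S 1 Z (Tgt C k)" "\<gamma>1 \<in> Ext C S t X Z" "\<gamma> = \<omega> \<star> \<gamma>1"
      using yprod_decomp[OF \<gamma> step(1)] .
    have "(p \<triangleright> \<omega>) \<star> \<gamma>1 = ozero (Suc t) X (Tgt C p)" using push_yprod[OF d(1,2) p cD(8)] z d(3) by simp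
    from yprod_ozero_factor[OF step(3) push_Ext[OF d(1) p cD(8)] d(2) this]
    obtain Y \<beta> \<gamma>2 where Y: "Y \<in> S" "\<beta> \<in> Hom C Y Z" "\<gamma>2 \<in> Ext C S t X Y" "\<gamma>1 = \<beta> \<triangleright> \<gamma>2"
      "(p \<triangleright> \<omega>) \<triangleleft> \<beta> = ozero 1 Y (Tgt C p)" unfolding zero_factor_def by blast
    have "p \<triangleright> (\<omega> \<triangleleft> \<beta>) = ozero 1 Y (Tgt C p)" using push_pull[OF d(1) p cD(8) Y(2,1)] Y(5) by simp
    then obtain \<omega>2 where \<omega>2: "\<omega>2 \<in> Ext C S 1 Y (Src C k)" "\<omega> \<triangleleft> \<beta> = k \<triangleright> \<omega>2"
      using Ext1_exact_middle[OF c pull_Ext[OF d(1) Y(2,1)]] by metis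
    have "\<gamma> = k \<triangleright> (\<omega>2 \<star> \<gamma>2)"
      using d(3) Y(4) yprod_pull_push[OF d(1) Y(3,2)] \<omega>2(2) push_yprod[OF \<omega>2(1) Y(3) k cD(7)] by simp
    moreover have "\<omega>2 \<star> \<gamma>2 \<in> Ext C S (Suc t) X (Src C k)" using yprod_Ext[OF \<omega>2(1) Y(3)] by simp
    ultimately show "\<exists>\<gamma>'\<in>Ext C S (Suc t) X (Src C k). \<gamma> = k \<triangleright> \<gamma>'" by blast
  qed
qed

text \<open>\<open>zero_factor\<close> writes \<gamma> as a push-out along a \<beta> that
  annihilates the class of the conflation, and such a \<beta> lifts through p.\<close>

lemma conflation_yprod_eq_ozero:
  assumes c: "conflation C S i p" and AB: "Tgt C p = A" "Src C i = B" "Tgt C i = P"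
    and \<gamma>: "\<gamma> \<in> Ext C S t X A" and z: "cl [i, p] \<star> \<gamma> = ozero (Suc t) X B"
  obtains \<gamma>' where "\<gamma>' \<in> Ext C S t X P" "\<gamma> = p \<triangleright> \<gamma>'"
proof -
  note cD = conflationD[OF c]
  have p: "p \<in> Hom C P A" and PA: "P \<in> S" "A \<in> S" using cD AB by (auto simp: Hom_def)
  have \<omega>: "cl [i, p] \<in> Ext C S 1 A B" using cl_Ext[OF ext_seq_single[OF c AB(1,2)]] .
  have "zero_factor t X A B (cl [i, p]) \<gamma>"
    using yprod_ozero_factor[OF middle_exact \<omega> \<gamma> z] Ext_S[OF \<gamma>] by simp
  then obtain Z \<beta> \<gamma>1 where Z: "Z \<in> S" "\<beta> \<in> Hom C Z A" "\<gamma>1 \<in> Ext C S t X Z" "\<gamma> = \<beta> \<triangleright> \<gamma>1"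
    "cl [i, p] \<triangleleft> \<beta> = ozero 1 Z B" unfolding zero_factor_def by blast
  obtain l where l: "l \<in> Hom C Z (Src C p)" "p \<cdot> l = \<beta>"
    using pull_eq_ozero_lift[OF c AB(1,2) Z(2,1,5)] .
  have l': "l \<in> Hom C Z P" using l(1) cD AB by simp
  show ?thesis
    using that[OF push_Ext[OF Z(3) l' PA(1)]] push_push[OF Z(3) l' PA(1) p PA(2)] l(2) Z(4) by simp
qed

text \<open>Split off a first factor \<omega>1 of degree 1. By \<open>zero_factor\<close> it can be
  replaced by \<omega>1 \<triangleleft> \<beta>, whose push-out along i vanishes; in degree 1 this
  makes it a pull-back of the given conflation.\<close>

lemma inflation_push_eq_ozero:
  assumes c: "conflation C S i p" and AB: "Tgt C p = A" "Src C i = B" "Tgt C i = P" and t: "1 \<le> t"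
    and \<gamma>: "\<gamma> \<in> Ext C S (Suc t) X B" and z: "i \<triangleright> \<gamma> = ozero (Suc t) X P"
  obtains \<gamma>' where "\<gamma>' \<in> Ext C S t X A" "\<gamma> = cl [i, p] \<star> \<gamma>'"
proof -
  note cD = conflationD[OF c]
  have i: "i \<in> Hom C B P" and PA: "P \<in> S" "A \<in> S" using cD AB by (auto simp: Hom_def)
  have \<omega>: "cl [i, p] \<in> Ext C S 1 A B" using cl_Ext[OF ext_seq_single[OF c AB(1,2)]] .
  obtain Z \<omega>1 \<gamma>1 where d: "\<omega>1 \<in> Ext C S 1 Z B" "\<gamma>1 \<in> Ext C S t X Z" "\<gamma> = \<omega>1 \<star> \<gamma>1"
    using yprod_decomp[OF \<gamma> t] .
  have "(i \<triangleright> \<omega>1) \<star> \<gamma>1 = ozero (Suc t) X P" using push_yprod[OF d(1,2) i PA(1)] z d(3) by simp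
  from yprod_ozero_factor[OF middle_exact[OF t] push_Ext[OF d(1) i PA(1)] d(2) this]
  obtain Y \<beta> \<gamma>2 where Y: "Y \<in> S" "\<beta> \<in> Hom C Y Z" "\<gamma>2 \<in> Ext C S t X Y" "\<gamma>1 = \<beta> \<triangleright> \<gamma>2"
    "(i \<triangleright> \<omega>1) \<triangleleft> \<beta> = ozero 1 Y P" unfolding zero_factor_def by blast
  have "i \<triangleright> (\<omega>1 \<triangleleft> \<beta>) = ozero 1 Y (Tgt C i)" using push_pull[OF d(1) i PA(1) Y(2,1)] Y(5) AB by simp
  then obtain \<beta>' where \<beta>': "\<beta>' \<in> Hom C Y A" "\<omega>1 \<triangleleft> \<beta> = cl [i, p] \<triangleleft> \<beta>'"
    using push_eq_ozero_pull[OF c AB(1,2) pull_Ext[OF d(1) Y(2,1)]] by metis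
  have "\<gamma> = cl [i, p] \<star> (\<beta>' \<triangleright> \<gamma>2)"
    using d(3) Y(4) yprod_pull_push[OF d(1) Y(3,2)] \<beta>'(2) yprod_pull_push[OF \<omega> Y(3) \<beta>'(1)] by simp
  then show ?thesis using that[OF push_Ext[OF Y(3) \<beta>'(1) PA(2)]] by simp
qed

lemma yprod_conflation_eq_ozero:
  assumes c: "conflation C S i p" and AB: "Tgt C p = A" "Src C i = B" "Tgt C i = P"
    and \<gamma>: "\<gamma> \<in> Ext C S t B Y" and z: "\<gamma> \<star> cl [i, p] = ozero (Suc t) A Y"
  obtains \<gamma>' where "\<gamma>' \<in> Ext C S t P Y" "\<gamma> = \<gamma>' \<triangleleft> i"
proof -
  interpret o: extension_closed_subcategory "opp C" S by (rule extension_closed_subcategory_opp)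
  note cD = conflationD[OF c]
  have S: "A \<in> S" "B \<in> S" "P \<in> S" "Y \<in> S" "1 \<le> t" using cD AB Ext_S[OF \<gamma>] by auto
  have \<omega>: "cl [i, p] \<in> Ext C S 1 A B" using cl_Ext[OF ext_seq_single[OF c AB(1,2)]] .
  have cl': "o.cl [p, i] = rev ` cl [i, p]" using cl_opp[of "[i, p]"] by simp
  have "yprod (opp C) S (o.cl [p, i]) (rev ` \<gamma>) = ext_zero (opp C) S (Suc t) Y A"
    using yprod_opp[OF \<gamma> \<omega>] cl' z ozero_opp[OF S(1,4), of "Suc t"] by simp
  then obtain \<gamma>' where \<gamma>': "\<gamma>' \<in> Ext (opp C) S t Y P" "rev ` \<gamma> = ext_push (opp C) S i \<gamma>'"
    using o.conflation_yprod_eq_ozero[of p i B A P "rev ` \<gamma>" t Y] c AB \<gamma> cD by auto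
  define \<gamma>'' where "\<gamma>'' = rev ` \<gamma>'"
  have "\<gamma>' = rev ` \<gamma>''" by (simp add: \<gamma>''_def image_image)
  with \<gamma>' that[of \<gamma>''] show ?thesis by (simp add: ext_push_opp inj_image_eq_iff)
qed

lemma deflation_pull_eq_ozero:
  assumes c: "conflation C S i p" and AB: "Tgt C p = A" "Src C i = B" "Tgt C i = P" and t: "1 \<le> t"
    and \<gamma>: "\<gamma> \<in> Ext C S (Suc t) A Y" and z: "\<gamma> \<triangleleft> p = ozero (Suc t) P Y"
  obtains \<gamma>' where "\<gamma>' \<in> Ext C S t B Y" "\<gamma> = \<gamma>' \<star> cl [i, p]"
proof -
  interpret o: extension_closed_subcategory "opp C" S by (rule extension_closed_subcategory_opp)
  note cD = conflationD[OF c]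
  have S: "A \<in> S" "B \<in> S" "P \<in> S" "Y \<in> S" using cD AB Ext_S[OF \<gamma>] by auto
  have \<omega>: "cl [i, p] \<in> Ext C S 1 A B" using cl_Ext[OF ext_seq_single[OF c AB(1,2)]] .
  have cl': "o.cl [p, i] = rev ` cl [i, p]" using cl_opp[of "[i, p]"] by simp
  have "ext_push (opp C) S p (rev ` \<gamma>) = ext_zero (opp C) S (Suc t) Y P"
    using z ozero_opp[OF S(3,4), of "Suc t"] by (simp add: ext_push_opp)
  then obtain \<gamma>' where \<gamma>': "\<gamma>' \<in> Ext (opp C) S t Y B" "rev ` \<gamma> = yprod (opp C) S (o.cl [p, i]) \<gamma>'"
    using o.inflation_push_eq_ozero[of p i B A P t "rev ` \<gamma>" Y] c AB \<gamma> cD t by auto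
  define \<gamma>'' where "\<gamma>'' = rev ` \<gamma>'"
  have "\<gamma>' = rev ` \<gamma>''" by (simp add: \<gamma>''_def image_image)
  moreover from this \<gamma>'(1) have "\<gamma>'' \<in> Ext C S t B Y" by simp
  ultimately show ?thesis using \<gamma>'(2) that[of \<gamma>''] yprod_opp[OF _ \<omega>] cl' by (simp add: inj_image_eq_iff)
qed

section \<open>Unit conflations in an n-Frobenius category\<close>

text \<open>The last conclusion has the form in which \<open>ext_pull_inv\<close> writes a
  difference.\<close>

lemma baer_diff:
  assumes "\<gamma> \<in> Ext C S t A B" "\<gamma>' \<in> Ext C S t A B"
  obtains \<epsilon> where "\<epsilon> \<in> Ext C S t A B" "\<gamma> = \<epsilon> \<uplus> \<gamma>'" "\<epsilon> = \<gamma> \<otimes>\<^bsub>Ext_group C S t A B\<^esub> inv\<^bsub>Ext_group C S t A B\<^esub> \<gamma>'"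
proof -
  interpret G: comm_group "Ext_group C S t A B" using Ext_comm_group Ext_S[OF assms(1)] by simp
  let ?e = "\<gamma> \<otimes>\<^bsub>Ext_group C S t A B\<^esub> inv\<^bsub>Ext_group C S t A B\<^esub> \<gamma>'"
  have c: "\<gamma> \<in> carrier (Ext_group C S t A B)" "\<gamma>' \<in> carrier (Ext_group C S t A B)"
    using assms by (simp_all add: Ext_group_def)
  have "?e \<in> carrier (Ext_group C S t A B)" "?e \<otimes>\<^bsub>Ext_group C S t A B\<^esub> \<gamma>' = \<gamma>"
    using c by (simp_all add: G.m_assoc)
  then show ?thesis using that[of ?e] by (simp add: Ext_group_def)
qed

lemma baer_cancel:
  assumes "\<epsilon> \<in> Ext C S t A B" "\<gamma> \<in> Ext C S t A B" "\<epsilon> \<uplus> \<gamma> = \<gamma>" shows "\<epsilon> = ozero t A B"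
proof -
  interpret G: comm_group "Ext_group C S t A B" using Ext_comm_group Ext_S[OF assms(1)] by simp
  have "\<epsilon> \<in> carrier (Ext_group C S t A B)" "\<gamma> \<in> carrier (Ext_group C S t A B)"
    "\<epsilon> \<otimes>\<^bsub>Ext_group C S t A B\<^esub> \<gamma> = \<gamma>"
    using assms by (simp_all add: Ext_group_def)
  then have "\<epsilon> = \<one>\<^bsub>Ext_group C S t A B\<^esub>" using G.r_cancel_one by auto
  then show ?thesis by (simp add: Ext_group_def)
qed

text \<open>The difference of two factors with equal products is annihilated by \<alpha>. Q is
  whatever is known of annihilated elements: vanishing above degree n, membership in
  \<open>proj_part\<close> in degree n.\<close>

lemma yprod_left_cancel:
  assumes "\<alpha> \<in> Ext C S s A B" "\<beta> \<in> Ext C S t D A" "\<gamma> \<in> Ext C S t D A" "\<alpha> \<star> \<beta> = \<alpha> \<star> \<gamma>"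
    and "\<And>\<epsilon>. \<epsilon> \<in> Ext C S t D A \<Longrightarrow> \<alpha> \<star> \<epsilon> = ozero (s + t) D B \<Longrightarrow> Q \<epsilon>"
  obtains \<epsilon> where "\<epsilon> \<in> Ext C S t D A" "\<beta> = \<epsilon> \<uplus> \<gamma>" "Q \<epsilon>"
    "\<epsilon> = \<beta> \<otimes>\<^bsub>Ext_group C S t D A\<^esub> inv\<^bsub>Ext_group C S t D A\<^esub> \<gamma>"
proof -
  obtain \<epsilon> where \<epsilon>: "\<epsilon> \<in> Ext C S t D A" "\<beta> = \<epsilon> \<uplus> \<gamma>"
    "\<epsilon> = \<beta> \<otimes>\<^bsub>Ext_group C S t D A\<^esub> inv\<^bsub>Ext_group C S t D A\<^esub> \<gamma>" using baer_diff[OF assms(2,3)] .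
  have "(\<alpha> \<star> \<epsilon>) \<uplus> (\<alpha> \<star> \<gamma>) = \<alpha> \<star> \<gamma>" using yprod_baer[OF assms(1) \<epsilon>(1) assms(3)] \<epsilon>(2) assms(4) by simp
  then have "\<alpha> \<star> \<epsilon> = ozero (s + t) D B"
    by (rule baer_cancel[OF yprod_Ext[OF assms(1) \<epsilon>(1)] yprod_Ext[OF assms(1,3)]])
  then show ?thesis using that \<epsilon> assms(5) by blast
qed

lemma yprod_right_cancel:
  assumes "\<alpha> \<in> Ext C S t D A" "\<beta> \<in> Ext C S s A B" "\<gamma> \<in> Ext C S s A B" "\<beta> \<star> \<alpha> = \<gamma> \<star> \<alpha>"
    and "\<And>\<epsilon>. \<epsilon> \<in> Ext C S s A B \<Longrightarrow> \<epsilon> \<star> \<alpha> = ozero (s + t) D B \<Longrightarrow> Q \<epsilon>"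
  obtains \<epsilon> where "\<epsilon> \<in> Ext C S s A B" "\<beta> = \<epsilon> \<uplus> \<gamma>" "Q \<epsilon>"
    "\<epsilon> = \<beta> \<otimes>\<^bsub>Ext_group C S s A B\<^esub> inv\<^bsub>Ext_group C S s A B\<^esub> \<gamma>"
proof -
  obtain \<epsilon> where \<epsilon>: "\<epsilon> \<in> Ext C S s A B" "\<beta> = \<epsilon> \<uplus> \<gamma>"
    "\<epsilon> = \<beta> \<otimes>\<^bsub>Ext_group C S s A B\<^esub> inv\<^bsub>Ext_group C S s A B\<^esub> \<gamma>" using baer_diff[OF assms(2,3)] .
  have "(\<epsilon> \<star> \<alpha>) \<uplus> (\<gamma> \<star> \<alpha>) = \<gamma> \<star> \<alpha>" using baer_yprod[OF \<epsilon>(1) assms(3,1)] \<epsilon>(2) assms(4) by simp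
  then have "\<epsilon> \<star> \<alpha> = ozero (s + t) D B"
    by (rule baer_cancel[OF yprod_Ext[OF \<epsilon>(1) assms(1)] yprod_Ext[OF assms(3,1)]])
  then show ?thesis using that \<epsilon> assms(5) by blast
qed

text \<open>In \<open>conflation_lift\<close> the large push-out ends a conflation beginning in Y,
  while the right-hand square makes the same object the middle term of a conflation ending in
  \<open>Tgt C p\<close>.\<close>

lemma pushout_paste:
  assumes po: "is_pushout C k e g d" and po': "is_pushout C i g i' h" and ei: "Tgt C e = Src C i"
  shows "is_pushout C k (i \<cdot> e) h (i' \<cdot> d)"
proof -
  note P = pushoutD[OF po] and P' = pushoutD[OF po']
  note [simp] = P(1-5,7) P(8)[symmetric] P'(1,3,4,6-8) ei P'(5)[symmetric]
  have c1: "h \<cdot> (i \<cdot> e) = i' \<cdot> (g \<cdot> e)"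
    using comp_eq[OF P'(9)[symmetric], of e] by simp
  have comm: "h \<cdot> (i \<cdot> e) = (i' \<cdot> d) \<cdot> k" unfolding c1 P(9) by simp
  show ?thesis
    unfolding is_pushout_def
  proof (intro conjI ballI impI)
    fix u v assume uv: "u \<in> Arr C" "v \<in> Arr C" "Src C u = Tgt C k \<and> Src C v = Tgt C (i \<cdot> e) \<and>
      Tgt C u = Tgt C v \<and> u \<cdot> k = v \<cdot> (i \<cdot> e)"
    then have t: "Src C u = Tgt C k" "Src C v = Tgt C i" "Tgt C u = Tgt C v" by simp_all
    have "u \<cdot> k = (v \<cdot> i) \<cdot> e" using uv t(2) by simp
    then obtain w where w: "w \<in> Arr C" "Src C w = Tgt C d" "Tgt C w = Tgt C u" "w \<cdot> d = u" "w \<cdot> g = v \<cdot> i"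
      using pushout_factor[OF po, of u "v \<cdot> i"] uv(1,2) t by auto
    then obtain x where x: "x \<in> Arr C" "Src C x = Tgt C h" "Tgt C x = Tgt C v" "x \<cdot> h = v" "x \<cdot> i' = w"
      using pushout_factor[OF po', of v w] uv(1,2) t by auto
    show "\<exists>!w. w \<in> Hom C (Tgt C h) (Tgt C u) \<and> w \<cdot> i' \<cdot> d = u \<and> w \<cdot> h = v"
    proof (rule ex1I[of _ x])
      show "x \<in> Hom C (Tgt C h) (Tgt C u) \<and> x \<cdot> i' \<cdot> d = u \<and> x \<cdot> h = v"
        using x w t comp_eq[OF x(5), of d] by (simp add: Hom_def)
      fix y assume "y \<in> Hom C (Tgt C h) (Tgt C u) \<and> y \<cdot> i' \<cdot> d = u \<and> y \<cdot> h = v"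
      then have y: "y \<in> Arr C" "Src C y = Tgt C h" "Tgt C y = Tgt C u" "y \<cdot> i' \<cdot> d = u" "y \<cdot> h = v"
        by (auto simp: Hom_def)
      have "(y \<cdot> i') \<cdot> g = (y \<cdot> h) \<cdot> i" using y(1-3) P'(9) by simp
      then have "y \<cdot> i' = w"
        by - (rule pushout_eq[OF po]; use y w in simp)
      then show "y = x" by - (rule pushout_eq[OF po']; use x y t in simp)
    qed
  qed (use comm in simp_all)
qed

end

section \<open>Products with unit conflations\<close>

context n_Frobenius_category
begin

lemma n_projective_S: "n_projective C S n P \<Longrightarrow> P \<in> S"
  by (simp add: n_projective_def)

lemma Ext_from_n_projective: "n_projective C S n P \<Longrightarrow> n < t \<Longrightarrow> \<gamma> \<in> Ext C S t P Y \<Longrightarrow> \<gamma> = ozero t P Y"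
  using Ext_S unfolding n_projective_def by blast

lemma Ext_to_n_projective: "n_projective C S n P \<Longrightarrow> n < t \<Longrightarrow> \<gamma> \<in> Ext C S t Y P \<Longrightarrow> \<gamma> = ozero t Y P"
  using Ext_S unfolding n_projective_iff_n_injective n_injective_def by blast

text \<open>On the injective side a class \<gamma> is the sum of its push-outs along ip and jq, each
  of which passes through a vanishing group.\<close>

lemma n_projective_biproduct:
  assumes "n_projective C S n P" "n_projective C S n Q" and b: "is_biproduct C P Q D b"
  shows "n_projective C S n D"
  unfolding n_projective_iff_n_injective n_injective_def
proof (intro conjI allI impI ballI)
  have PS: "P \<in> S" "Q \<in> S" using assms n_projective_S by auto
  show DS: "D \<in> S" using biproduct_S[OF b PS] .
  fix t Y assume t: "n < t" and Y: "Y \<in> S"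
  obtain i j p q where b_eq: "b = (i, j, p, q)" by (cases b)
  note bD = biproductD[OF b[unfolded b_eq]]
  have h: "i \<in> Hom C P D" "j \<in> Hom C Q D" "p \<in> Hom C D P" "q \<in> Hom C D Q" using bD by (auto simp: Hom_def)
  have "\<gamma> = ozero t Y D" if \<gamma>: "\<gamma> \<in> Ext C S t Y D" for \<gamma>
  proof -
    have "p \<triangleright> \<gamma> = ozero t Y P" "q \<triangleright> \<gamma> = ozero t Y Q"
      using Ext_to_n_projective[OF assms(1) t push_Ext[OF \<gamma> h(3) PS(1)]]
        Ext_to_n_projective[OF assms(2) t push_Ext[OF \<gamma> h(4) PS(2)]] by auto
    then have "(i \<cdot> p) \<triangleright> \<gamma> = ozero t Y D" "(j \<cdot> q) \<triangleright> \<gamma> = ozero t Y D"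
      using push_push[OF \<gamma> h(3) PS(1) h(1) DS] push_push[OF \<gamma> h(4) PS(2) h(2) DS]
        push_ozero[OF h(1) Y PS(1) DS] push_ozero[OF h(2) Y PS(2) DS] t by auto
    moreover have "\<gamma> = (i \<cdot> p \<boxplus> j \<cdot> q) \<triangleright> \<gamma>" using bD(20) \<gamma> by simp
    ultimately show ?thesis
      using hadd_push[OF \<gamma> Comp_closed[OF h(3,1)] Comp_closed[OF h(4,2)] DS] Y DS t by simp
  qed
  moreover have "ozero t Y D \<in> Ext C S t Y D" using Y DS t by simp
  ultimately show "Ext C S t Y D = {ozero t Y D}" by blast
qed

text \<open>The annihilated \<gamma> is a push-out along p of a class ending the middle term's way,
  that is, of an element of Ext(X, P) in degree t; this group vanishes for t > n since P is also
  n-injective.\<close>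

lemma conflation_left_injective:
  assumes c: "conflation C S i p" "n_projective C S n (Tgt C i)" "n < t" "\<gamma> \<in> Ext C S t X (Tgt C p)"
    "cl [i, p] \<star> \<gamma> = ozero (Suc t) X (Src C i)"
  shows "\<gamma> = ozero t X (Tgt C p)"
proof -
  note cD = conflationD[OF c(1)]
  obtain \<gamma>' where \<gamma>': "\<gamma>' \<in> Ext C S t X (Tgt C i)" "\<gamma> = p \<triangleright> \<gamma>'"
    using conflation_yprod_eq_ozero[OF c(1) refl refl refl c(4,5)] .
  have "p \<in> Hom C (Tgt C i) (Tgt C p)" using cD by (simp add: Hom_def)
  then show ?thesis using Ext_to_n_projective[OF c(2,3) \<gamma>'(1)] \<gamma>'(2) cD Ext_S[OF c(4)] by simp
qed

text \<open>The obstruction i \<triangleright> \<gamma> has degree t + 1, so that t = n already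
  suffices, one degree less than for injectivity.\<close>

lemma conflation_left_surjective:
  assumes c: "conflation C S i p" "n_projective C S n (Tgt C i)" "n \<le> t" "1 \<le> t" "\<gamma> \<in> Ext C S (Suc t) X (Src C i)"
  obtains \<gamma>' where "\<gamma>' \<in> Ext C S t X (Tgt C p)" "\<gamma> = cl [i, p] \<star> \<gamma>'"
proof -
  note cD = conflationD[OF c(1)]
  have i: "i \<in> Hom C (Src C i) (Tgt C i)" using cD by (simp add: Hom_def)
  have "i \<triangleright> \<gamma> = ozero (Suc t) X (Tgt C i)"
    using Ext_to_n_projective[OF c(2) _ push_Ext[OF c(5) i cD(7)]] c(3) by simp
  then show ?thesis using inflation_push_eq_ozero[OF c(1) refl refl refl c(4,5)] that by blast
qed

lemma conflation_right_injective:
  assumes c: "conflation C S i p" "n_projective C S n (Tgt C i)" "n < t" "\<gamma> \<in> Ext C S t (Src C i) Y"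
    "\<gamma> \<star> cl [i, p] = ozero (Suc t) (Tgt C p) Y"
  shows "\<gamma> = ozero t (Src C i) Y"
proof -
  note cD = conflationD[OF c(1)]
  obtain \<gamma>' where \<gamma>': "\<gamma>' \<in> Ext C S t (Tgt C i) Y" "\<gamma> = \<gamma>' \<triangleleft> i"
    using yprod_conflation_eq_ozero[OF c(1) refl refl refl c(4,5)] .
  have "i \<in> Hom C (Src C i) (Tgt C i)" using cD by (simp add: Hom_def)
  then show ?thesis using Ext_from_n_projective[OF c(2,3) \<gamma>'(1)] \<gamma>'(2) cD Ext_S[OF c(4)] by simp
qed

lemma conflation_right_surjective:
  assumes c: "conflation C S i p" "n_projective C S n (Tgt C i)" "n \<le> t" "1 \<le> t" "\<gamma> \<in> Ext C S (Suc t) (Tgt C p) Y"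
  obtains \<gamma>' where "\<gamma>' \<in> Ext C S t (Src C i) Y" "\<gamma> = \<gamma>' \<star> cl [i, p]"
proof -
  note cD = conflationD[OF c(1)]
  have p: "p \<in> Hom C (Tgt C i) (Tgt C p)" using cD by (simp add: Hom_def)
  have "\<gamma> \<triangleleft> p = ozero (Suc t) (Tgt C i) Y"
    using Ext_from_n_projective[OF c(2) _ pull_Ext[OF c(5) p cD(7)]] c(3) by simp
  then show ?thesis using deflation_pull_eq_ozero[OF c(1) refl refl refl c(4,5)] that by blast
qed

text \<open>Representatives of arbitrary length t, so that conflations can be removed one at a time
  from a unit conflation of length n.\<close>

definition unit_seq where
  "unit_seq t A B E \<longleftrightarrow> ext_seq C S t A B E \<and> (\<forall>d \<in> set (butlast E). n_projective C S n (Tgt C d))"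

lemma unit_conflations_iff:
  "\<delta> \<in> unit_conflations C S n A B \<longleftrightarrow> (\<exists>E. unit_seq n A B E \<and> \<delta> = cl E)"
proof
  assume "\<delta> \<in> unit_conflations C S n A B"
  then obtain E where E: "\<delta> \<in> Ext C S n A B" "E \<in> \<delta>" "\<forall>d \<in> set (butlast E). n_projective C S n (Tgt C d)"
    unfolding unit_conflations_def by blast
  then show "\<exists>E. unit_seq n A B E \<and> \<delta> = cl E" using mem_Ext[OF E(1,2)] unfolding unit_seq_def by blast
next
  assume "\<exists>E. unit_seq n A B E \<and> \<delta> = cl E"
  then obtain E where E: "ext_seq C S n A B E" "\<forall>d \<in> set (butlast E). n_projective C S n (Tgt C d)" "\<delta> = cl E"
    unfolding unit_seq_def by blast
  moreover have "E \<in> cl E" using yoneda_eq_refl[OF E(1)] by (simp add: mem_cl_iff)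
  ultimately show "\<delta> \<in> unit_conflations C S n A B"
    unfolding unit_conflations_def using cl_Ext by blast
qed

lemma unit_seq_Ext: "unit_seq t A B E \<Longrightarrow> cl E \<in> Ext C S t A B"
  unfolding unit_seq_def using cl_Ext by blast

lemma unit_seq_single:
  "conflation C S i p \<Longrightarrow> n_projective C S n (Tgt C i) \<Longrightarrow> unit_seq 1 (Tgt C p) (Src C i) [i, p]"
  unfolding unit_seq_def by (simp add: ext_seq.single[simplified])

lemma unit_seq_splice:
  assumes "conflation C S i p" "n_projective C S n (Tgt C i)" "unit_seq t A (Tgt C p) E"
  shows "unit_seq (Suc t) A (Src C i) (splice C [i, p] E)"
proof -
  have E: "ext_seq C S t A (Tgt C p) E" using assms(3) by (simp add: unit_seq_def)
  obtain j d ds where j: "E = j # d # ds" using ext_seq_path[OF E] by (cases E; cases "tl E") auto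
  have "j \<in> Arr C" "Src C j = Tgt C p" using ext_seq_path[OF E] j by auto
  then show ?thesis
    using assms ext_seq_splice_conflation[OF assms(1) E] conflationD[OF assms(1)]
    unfolding unit_seq_def by (auto simp: splice_def j)
qed

lemma unit_seq_cases:
  assumes "unit_seq t A B E"
  obtains (single) i p where "conflation C S i p" "n_projective C S n (Tgt C i)" "E = [i, p]" "t = 1"
      "A = Tgt C p" "B = Src C i"
  | (splice) i p t' E' where "conflation C S i p" "n_projective C S n (Tgt C i)" "unit_seq t' A (Tgt C p) E'"
      "E = splice C [i, p] E'" "t = Suc t'" "1 \<le> t'" "B = Src C i" "cl E = cl [i, p] \<star> cl E'"
proof -
  have E: "ext_seq C S t A B E" "\<forall>d \<in> set (butlast E). n_projective C S n (Tgt C d)"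
    using assms by (auto simp: unit_seq_def)
  from E(1) show ?thesis
  proof (cases rule: ext_seq_cases)
    case (single i p)
    then show ?thesis using that(1) E(2) by simp
  next
    case (splice i p t' j ds)
    have j: "j \<in> Arr C" "Src C j = Tgt C p" "1 \<le> t'" using ext_seq_path[OF splice(2)] by auto
    note cD = conflationD[OF splice(1)]
    have "unit_seq t' A (Tgt C p) (j # ds)"
      unfolding unit_seq_def using splice(2) E(2) j cD splice(3,7) by auto
    moreover have "cl E = cl [i, p] \<star> cl (j # ds)"
      unfolding splice(4) using yprod_cl[OF ext_seq.single[OF splice(1)] splice(2)] by simp
    ultimately show ?thesis
      using that(2)[OF splice(1) _ _ splice(4,5) j(3) splice(6)] E(2) splice(3,7) by simp
  qed
qed

text \<open>After the first conflation is split off, the rest of the product has degree at least t,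
  hence above n, and the conflation can be cancelled.\<close>

lemma unit_left_injective:
  assumes "unit_seq s A B E" "n < t" "\<gamma> \<in> Ext C S t X A" "cl E \<star> \<gamma> = ozero (s + t) X B"
  shows "\<gamma> = ozero t X A"
  using assms
proof (induction s arbitrary: B E)
  case 0
  then show ?case using ext_seq_path unfolding unit_seq_def by fastforce
next
  case (Suc s)
  from Suc.prems(1) show ?case
  proof (cases rule: unit_seq_cases)
    case (single i p)
    then show ?thesis using conflation_left_injective[OF single(1,2) Suc.prems(2)] Suc.prems(3,4) by simp
  next
    case (splice i p t' E')
    then have [simp]: "t' = s" by simp
    note \<omega> = cl_Ext[OF ext_seq.single[OF splice(1)]] and E' = unit_seq_Ext[OF splice(3)]
    have "cl [i, p] \<star> cl E' \<star> \<gamma> = ozero (Suc (s + t)) X (Src C i)"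
      using Suc.prems(4) splice(8,7) yprod_assoc[OF \<omega> E' Suc.prems(3)] by simp
    then have "cl E' \<star> \<gamma> = ozero (s + t) X (Tgt C p)"
      by (rule conflation_left_injective[OF splice(1,2), rotated 2])
        (use Suc.prems(2,3) E' in auto)
    then show ?thesis using Suc.IH splice(3) Suc.prems(2,3) by simp
  qed
qed

lemma unit_left_surjective:
  assumes "unit_seq s A B E" "n \<le> t" "1 \<le> t" "\<gamma> \<in> Ext C S (s + t) X B"
  shows "\<exists>\<gamma>' \<in> Ext C S t X A. \<gamma> = cl E \<star> \<gamma>'"
  using assms
proof (induction s arbitrary: B E \<gamma>)
  case 0
  then show ?case using ext_seq_path unfolding unit_seq_def by fastforce
next
  case (Suc s)
  from Suc.prems(1) show ?case
  proof (cases rule: unit_seq_cases)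
    case (single i p)
    then show ?thesis using conflation_left_surjective[OF single(1,2) Suc.prems(2,3), of \<gamma> X] Suc.prems(4) by auto
  next
    case (splice i p t' E')
    then have [simp]: "t' = s" by simp
    note \<omega> = cl_Ext[OF ext_seq.single[OF splice(1)]] and E' = unit_seq_Ext[OF splice(3)]
    obtain \<gamma>1 where \<gamma>1: "\<gamma>1 \<in> Ext C S (s + t) X (Tgt C p)" "\<gamma> = cl [i, p] \<star> \<gamma>1"
      by (rule conflation_left_surjective[OF splice(1,2), of "s + t" \<gamma> X])
        (use Suc.prems(2-4) splice(7) in auto)
    obtain \<gamma>2 where \<gamma>2: "\<gamma>2 \<in> Ext C S t X A" "\<gamma>1 = cl E' \<star> \<gamma>2"
      using Suc.IH[OF splice(3)[simplified] Suc.prems(2,3) \<gamma>1(1)] by blast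
    then show ?thesis using \<gamma>1(2) splice(8) yprod_assoc[OF \<omega> E' \<gamma>2(1)] by auto
  qed
qed

text \<open>On this side the first conflation is absorbed into \<gamma> and raises its degree, so
  the induction runs over all t at once.\<close>

lemma unit_right_injective:
  assumes "unit_seq s A B E" "n < t" "\<gamma> \<in> Ext C S t B Y" "\<gamma> \<star> cl E = ozero (t + s) A Y"
  shows "\<gamma> = ozero t B Y"
  using assms
proof (induction s arbitrary: B E t \<gamma>)
  case 0
  then show ?case using ext_seq_path unfolding unit_seq_def by fastforce
next
  case (Suc s)
  from Suc.prems(1) show ?case
  proof (cases rule: unit_seq_cases)
    case (single i p)
    then show ?thesis using conflation_right_injective[OF single(1,2) Suc.prems(2)] Suc.prems(3,4) by simp
  next
    case (splice i p t' E')
    then have [simp]: "t' = s" by simp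
    note \<omega> = cl_Ext[OF ext_seq.single[OF splice(1)]] and E' = unit_seq_Ext[OF splice(3)]
    have \<gamma>: "\<gamma> \<in> Ext C S t (Src C i) Y" using Suc.prems(3) splice(7) by simp
    have "(\<gamma> \<star> cl [i, p]) \<star> cl E' = ozero (Suc t + s) A Y"
      using Suc.prems(4) splice(8) yprod_assoc[OF \<gamma> \<omega> E'] by simp
    from Suc.IH[OF splice(3)[simplified] _ _ this]
    have "\<gamma> \<star> cl [i, p] = ozero (Suc t) (Tgt C p) Y"
      using Suc.prems(2) yprod_Ext[OF \<gamma> \<omega>] by simp
    from conflation_right_injective[OF splice(1,2) Suc.prems(2) \<gamma> this] splice(7) show ?thesis by simp
  qed
qed

text \<open>Division goes from the right: first by the rest of the sequence, leaving degree t + 1,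
  then by the first conflation.\<close>

lemma unit_right_surjective:
  assumes "unit_seq s A B E" "n \<le> t" "1 \<le> t" "\<gamma> \<in> Ext C S (t + s) A Y"
  shows "\<exists>\<gamma>' \<in> Ext C S t B Y. \<gamma> = \<gamma>' \<star> cl E"
  using assms
proof (induction s arbitrary: B E t)
  case 0
  then show ?case using ext_seq_path unfolding unit_seq_def by fastforce
next
  case (Suc s)
  from Suc.prems(1) show ?case
  proof (cases rule: unit_seq_cases)
    case (single i p)
    then show ?thesis using conflation_right_surjective[OF single(1,2) Suc.prems(2,3), of \<gamma> Y] Suc.prems(4) by auto
  next
    case (splice i p t' E')
    then have [simp]: "t' = s" by simp
    note \<omega> = cl_Ext[OF ext_seq.single[OF splice(1)]] and E' = unit_seq_Ext[OF splice(3)]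
    obtain \<gamma>1 where \<gamma>1: "\<gamma>1 \<in> Ext C S (Suc t) (Tgt C p) Y" "\<gamma> = \<gamma>1 \<star> cl E'"
      using Suc.IH[OF splice(3)[simplified], of "Suc t"] Suc.prems(2-4) by auto
    obtain \<gamma>2 where \<gamma>2: "\<gamma>2 \<in> Ext C S t (Src C i) Y" "\<gamma>1 = \<gamma>2 \<star> cl [i, p]"
      by (rule conflation_right_surjective[OF splice(1,2) Suc.prems(2,3) \<gamma>1(1)])
    then show ?thesis using \<gamma>1(2) splice(7,8) yprod_assoc[OF \<gamma>2(1) \<omega> E'] by auto
  qed
qed

lemma enough_inflations:
  assumes "A \<in> S"
  obtains i p where "conflation C S i p" "Src C i = A" "n_projective C S n (Tgt C i)"
  using enough_n_injectives[OF assms] unfolding inflation_def n_projective_iff_n_injective by blast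

lemma enough_deflations:
  assumes "A \<in> S"
  obtains i p where "conflation C S i p" "Tgt C p = A" "n_projective C S n (Tgt C i)"
  using enough_n_projectives[OF assms] conflationD(4) unfolding deflation_def by metis

lemma unit_seq_from: "X \<in> S \<Longrightarrow> 1 \<le> t \<Longrightarrow> \<exists>A E. unit_seq t A X E"
proof (induction t arbitrary: X)
  case (Suc t)
  obtain i p where c: "conflation C S i p" "Src C i = X" "n_projective C S n (Tgt C i)"
    using enough_inflations[OF Suc.prems(1)] .
  show ?case
  proof (cases "t = 0")
    case True
    then show ?thesis using unit_seq_single[OF c(1,3)] c(2) by auto
  next
    case False
    then obtain A E where "unit_seq t A (Tgt C p) E" using Suc.IH[of "Tgt C p"] conflationD[OF c(1)] by auto
    then show ?thesis using unit_seq_splice[OF c(1,3)] c(2) by metis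
  qed
qed simp

lemma unit_seq_to: "A \<in> S \<Longrightarrow> 1 \<le> t \<Longrightarrow> \<exists>X E. unit_seq t A X E"
proof (induction t)
  case (Suc t)
  show ?case
  proof (cases "t = 0")
    case True
    then show ?thesis using enough_deflations[OF Suc.prems(1)] unit_seq_single by (metis One_nat_def)
  next
    case False
    then obtain X E where E: "unit_seq t A X E" using Suc by auto
    then have "X \<in> S" using ext_seq_path unfolding unit_seq_def by blast
    then obtain i p where c: "conflation C S i p" "Tgt C p = X" "n_projective C S n (Tgt C i)"
      by (rule enough_deflations)
    then show ?thesis using unit_seq_splice[OF c(1,3)] E by blast
  qed
qed simp

section \<open>Classes that factor through n-projectives\<close>

lemma proj_part_Ext: "\<gamma> \<in> proj_part C S n X Y \<Longrightarrow> X \<in> S \<Longrightarrow> \<gamma> \<in> Ext C S n X Y"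
  unfolding proj_part_def using pull_Ext by blast

text \<open>The obstruction to extending \<sigma> along an inflation of X into an n-projective is a
  class of degree n + 1 with second argument P, hence zero.\<close>

lemma n_projective_extend:
  assumes "n_projective C S n P" "\<sigma> \<in> Ext C S n X P"
  obtains J j \<zeta> where "n_projective C S n J" "j \<in> Hom C X J" "\<zeta> \<in> Ext C S n J P" "\<sigma> = \<zeta> \<triangleleft> j"
proof -
  have S: "X \<in> S" using Ext_S[OF assms(2)] by simp
  obtain j q where c: "conflation C S j q" "Src C j = X" "n_projective C S n (Tgt C j)"
    using enough_inflations[OF S] .
  note cD = conflationD[OF c(1)]
  have "\<sigma> \<star> cl [j, q] \<in> Ext C S (n + 1) (Tgt C q) P"
    using yprod_Ext[OF assms(2) cl_Ext[OF ext_seq_single[OF c(1) refl c(2)]]] .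
  then have "\<sigma> \<star> cl [j, q] = ozero (Suc n) (Tgt C q) P"
    using Ext_to_n_projective[OF assms(1)] by simp
  then obtain \<zeta> where "\<zeta> \<in> Ext C S n (Tgt C j) P" "\<sigma> = \<zeta> \<triangleleft> j"
    by (rule yprod_conflation_eq_ozero[OF c(1) refl c(2) refl assms(2)])
  moreover have "j \<in> Hom C X (Tgt C j)" using cD c(2) by (simp add: Hom_def)
  ultimately show ?thesis using that c(3) by blast
qed

text \<open>By exchange the product is \<eta> \<star> (h \<triangleright> \<tau>). For t > n the
  class h \<triangleright> \<tau> vanishes since P is n-injective. For t = n it may survive, but it
  is pulled back from some \<zeta> over an n-projective J, and \<eta> \<star> \<zeta> has degree 2n
  > n over J.\<close>

lemma proj_part_yprod:
  assumes \<gamma>: "\<gamma> \<in> proj_part C S n X Y" and \<tau>: "\<tau> \<in> Ext C S t A X" and t: "n \<le> t"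
  shows "\<gamma> \<star> \<tau> = ozero (n + t) A Y"
proof -
  obtain \<eta> h P where h: "\<gamma> = \<eta> \<triangleleft> h" "n_projective C S n P" "h \<in> Hom C X P" "\<eta> \<in> Ext C S n P Y"
    using \<gamma> unfolding proj_part_def by blast
  have S: "A \<in> S" "Y \<in> S" "P \<in> S" "1 \<le> n" "1 \<le> t"
    using Ext_S[OF \<tau>] Ext_S[OF h(4)] by auto
  note h\<tau> = push_Ext[OF \<tau> h(3) S(3)]
  have eq: "\<gamma> \<star> \<tau> = \<eta> \<star> (h \<triangleright> \<tau>)" unfolding h(1) using yprod_pull_push[OF h(4) \<tau> h(3)] .
  show ?thesis
  proof (cases "t = n")
    case True
    obtain J j \<zeta> where j: "n_projective C S n J" "j \<in> Hom C A J" "\<zeta> \<in> Ext C S n J P" "h \<triangleright> \<tau> = \<zeta> \<triangleleft> j"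
      using n_projective_extend[OF h(2)] h\<tau> True by metis
    have "\<eta> \<star> \<zeta> = ozero (n + n) J Y"
      using Ext_from_n_projective[OF j(1) _ yprod_Ext[OF h(4) j(3)]] S by simp
    then show ?thesis
      using eq j(4) yprod_pull[OF h(4) j(3,2) S(1)] ozero_pull[OF j(2) n_projective_S[OF j(1)] S(1,2)] S(4) True by simp
  next
    case False
    then have "h \<triangleright> \<tau> = ozero t A P" using Ext_to_n_projective[OF h(2) _ h\<tau>] t by simp
    then show ?thesis using eq yprod_ozero[OF h(4) S(1,5)] by simp
  qed
qed

text \<open>Here \<tau> \<star> \<eta> has n-projective first argument and degree t + n > n, so
  every positive t is allowed.\<close>

lemma yprod_proj_part:
  assumes \<gamma>: "\<gamma> \<in> proj_part C S n X Y" and \<tau>: "\<tau> \<in> Ext C S t Y Z" and X: "X \<in> S"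
  shows "\<tau> \<star> \<gamma> = ozero (t + n) X Z"
proof -
  obtain \<eta> h P where h: "\<gamma> = \<eta> \<triangleleft> h" "n_projective C S n P" "h \<in> Hom C X P" "\<eta> \<in> Ext C S n P Y"
    using \<gamma> unfolding proj_part_def by blast
  have S: "Y \<in> S" "P \<in> S" "1 \<le> n" "1 \<le> t" "Z \<in> S"
    using Ext_S[OF \<tau>] Ext_S[OF h(4)] by auto
  have "\<tau> \<star> \<eta> = ozero (t + n) P Z"
    using Ext_from_n_projective[OF h(2) _ yprod_Ext[OF \<tau> h(4)]] S by simp
  then show ?thesis
    using yprod_pull[OF \<tau> h(4,3) X] ozero_pull[OF h(3) S(2) X S(5)] S h(1) by simp
qed

text \<open>Behind the first conflation the degree exceeds n, so the rest of E cancels. What remains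
  shows that \<gamma> is pulled back along the first inflation, whose target is
  n-projective.\<close>

lemma proj_part_if_right:
  assumes "unit_seq s A X E" "\<gamma> \<in> Ext C S n X Y" "\<gamma> \<star> cl E = ozero (n + s) A Y"
  shows "\<gamma> \<in> proj_part C S n X Y"
proof -
  have *: "\<gamma> \<in> proj_part C S n X Y" if c: "conflation C S i p" "n_projective C S n (Tgt C i)" "X = Src C i"
    "\<gamma> \<star> cl [i, p] = ozero (Suc n) (Tgt C p) Y" for i p
  proof -
    obtain \<gamma>' where "\<gamma>' \<in> Ext C S n (Tgt C i) Y" "\<gamma> = \<gamma>' \<triangleleft> i"
      using yprod_conflation_eq_ozero[OF c(1) refl c(3)[symmetric] refl assms(2) c(4)] .
    moreover have "i \<in> Hom C X (Tgt C i)" using conflationD[OF c(1)] c(3) by (simp add: Hom_def)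
    ultimately show ?thesis unfolding proj_part_def using c(2) by blast
  qed
  from assms(1) show ?thesis
  proof (cases rule: unit_seq_cases)
    case (single i p)
    then show ?thesis using * assms(3) by simp
  next
    case (splice i p t' E')
    have \<gamma>: "\<gamma> \<in> Ext C S n (Src C i) Y" using assms(2) splice(7) by simp
    note \<omega> = cl_Ext[OF ext_seq.single[OF splice(1)]] and E' = unit_seq_Ext[OF splice(3)]
    have "(\<gamma> \<star> cl [i, p]) \<star> cl E' = ozero (Suc n + t') A Y"
      using yprod_assoc[OF \<gamma> \<omega> E'] splice(5,8) assms(3) by simp
    from unit_right_injective[OF splice(3) _ _ this]
    have "\<gamma> \<star> cl [i, p] = ozero (Suc n) (Tgt C p) Y" using yprod_Ext[OF \<gamma> \<omega>] by simp
    then show ?thesis using * splice(1,2,7) by blast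
  qed
qed

text \<open>All conflations but the last cancel. The last one gives \<gamma> = p \<triangleright>
  \<gamma>' with \<gamma>' in Ext(X, P), a factorization on the wrong side;
  \<open>n_projective_extend\<close> converts it into a pull-back from an n-projective.\<close>

lemma proj_part_if_left:
  assumes "unit_seq s Y Z E" "\<gamma> \<in> Ext C S n X Y" "cl E \<star> \<gamma> = ozero (s + n) X Z"
  shows "\<gamma> \<in> proj_part C S n X Y"
  using assms
proof (induction s arbitrary: Z E)
  case 0
  then show ?case using ext_seq_path unfolding unit_seq_def by fastforce
next
  case (Suc s)
  from Suc.prems(1) show ?case
  proof (cases rule: unit_seq_cases)
    case (single i p)
    obtain \<gamma>' where \<gamma>': "\<gamma>' \<in> Ext C S n X (Tgt C i)" "\<gamma> = p \<triangleright> \<gamma>'"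
      using conflation_yprod_eq_ozero[OF single(1) refl refl refl, of \<gamma> n X] Suc.prems(2,3) single by auto
    obtain J j \<zeta> where j: "n_projective C S n J" "j \<in> Hom C X J" "\<zeta> \<in> Ext C S n J (Tgt C i)" "\<gamma>' = \<zeta> \<triangleleft> j"
      using n_projective_extend[OF single(2) \<gamma>'(1)] .
    note cD = conflationD[OF single(1)]
    have p: "p \<in> Hom C (Tgt C i) Y" "Y \<in> S" using cD single by (auto simp: Hom_def)
    have "\<gamma> = (p \<triangleright> \<zeta>) \<triangleleft> j" using \<gamma>'(2) j(4) push_pull[OF j(3) p j(2)] Ext_S[OF \<gamma>'(1)] by simp
    moreover have "p \<triangleright> \<zeta> \<in> Ext C S n J Y" using push_Ext[OF j(3) p] .
    ultimately show ?thesis unfolding proj_part_def using j(1,2) by blast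
  next
    case (splice i p t' E')
    then have [simp]: "t' = s" by simp
    note \<omega> = cl_Ext[OF ext_seq.single[OF splice(1)]] and E' = unit_seq_Ext[OF splice(3)]
    have "cl [i, p] \<star> cl E' \<star> \<gamma> = ozero (Suc (s + n)) X (Src C i)"
      using Suc.prems(3) splice(8,7) yprod_assoc[OF \<omega> E' Suc.prems(2)] by simp
    then have "cl E' \<star> \<gamma> = ozero (s + n) X (Tgt C p)"
      by (rule conflation_left_injective[OF splice(1,2), rotated 2])
        (use Suc.prems(2) E' splice(6) in auto)
    then show ?thesis using Suc.IH splice(3) Suc.prems(2) by simp
  qed
qed

end

section \<open>Lifting and extending morphisms to unit conflations\<close>

context preadditive_category
begin

lemma dsum_butlast:
  assumes "dsum C b E E' F b'" "path C A E B" "path C A' E' B'" "d \<in> set (butlast F)"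
  shows "\<exists>e \<in> set (butlast E). \<exists>e' \<in> set (butlast E'). \<exists>c. is_biproduct C (Tgt C e) (Tgt C e') (Tgt C d) c"
  using assms
proof (induction E arbitrary: b E' F A A')
  case Nil
  then show ?case using dsum_length[OF Nil(1)] by auto
next
  case (Cons e E)
  from Cons.prems(1) obtain e' E1 f F1 c D where c: "E' = e' # E1" "F = f # F1" "is_biproduct C (Tgt C e) (Tgt C e') D c"
    "f = biprod_map C b c e e'" "dsum C c E E1 F1 b'" by (rule dsum_Cons)
  have len: "E = [] \<longleftrightarrow> F1 = []" "E1 = [] \<longleftrightarrow> F1 = []" using dsum_length[OF c(5)] by auto
  have e: "e \<in> Arr C" "e' \<in> Arr C" "path C (Tgt C e) E B" "path C (Tgt C e') E1 B'"
    using Cons.prems(2,3) unfolding c(1) by auto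
  show ?case
  proof (cases "d \<in> set (butlast F1)")
    case True
    then have "F1 \<noteq> []" by auto
    then show ?thesis using Cons.IH[OF c(5) e(3,4) True] len unfolding c(1,2) by auto
  next
    case False
    then have d: "d = f" "F1 \<noteq> []" using Cons.prems(4) unfolding c(2) by (auto split: if_splits)
    obtain D0 where b: "is_biproduct C (Src C e) (Src C e') D0 b"
      using Cons.prems(1) unfolding c(1,2) dsum.simps by blast
    have "Tgt C f = D"
      using biprod_map_Hom(1)[OF b c(3) arr_Hom[OF e(1)] arr_Hom[OF e(2)]]
      unfolding c(4) by (simp add: Hom_def)
    then show ?thesis using c(3) d len unfolding c(1) by auto
  qed
qed

end

context extension_closed_subcategory
begin

lemma deflation_comp:
  assumes "deflation C S p" "deflation C S q" "Src C p = Tgt C q"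
  shows "deflation C S (p \<cdot> q)"
proof -
  interpret o: extension_closed_subcategory "opp C" S by (rule extension_closed_subcategory_opp)
  obtain i j where c: "conflation C S i p" "conflation C S j q" using assms unfolding deflation_def by blast
  obtain r where "conflation (opp C) S (q \<cdot>\<^bsub>opp C\<^esub> p) r"
    by (rule o.conflation_comp[of p i q j]) (use c assms(3) in auto)
  then show ?thesis unfolding deflation_def by auto
qed

lemma biproduct_deflation:
  assumes "is_biproduct C A B D b" "A \<in> S" "B \<in> S" shows "deflation C S (bfst b)" "deflation C S (bsnd b)"
proof -
  obtain i j p q where b: "b = (i, j, p, q)" by (cases b)
  note bD = biproductD[OF assms(1)[unfolded b]]
  have "is_biproduct C B A D (j, i, q, p)"
    unfolding is_biproduct.simps using bD hadd_commute[of "j \<cdot> q" "i \<cdot> p"] by (simp add: Hom_def)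
  from biproduct_conflation[OF this assms(3,2)] biproduct_conflation[OF assms(1)[unfolded b] assms(2,3)]
  show "deflation C S (bfst b)" "deflation C S (bsnd b)" unfolding b deflation_def by auto
qed

text \<open>The target \<open>X\<close> of \<open>q\<close> is a push-out of \<open>i\<close> along the push-out \<open>B \<rightarrow> K'\<close> of the inflation
  \<open>\<kappa> : Y \<rightarrow> Q\<close>; so the kernel \<open>K'\<close> of \<open>X \<rightarrow> A\<close> lies in \<open>S\<close>, even if \<open>d\<close> is arbitrary.\<close>

lemma conflation_lift:
  assumes c: "conflation C S i p" and d: "d \<in> Hom C Y (Src C i)" and \<kappa>: "conflation C S \<kappa> \<kappa>'" "Src C \<kappa> = Y"
    and b: "is_biproduct C (Tgt C \<kappa>) (Tgt C i) D b"
  obtains j q a where "conflation C S j q" "Src C j = Y" "Tgt C j = D" "bsnd b \<cdot> j = i \<cdot> d"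
    "deflation C S a" "a \<in> Hom C (Tgt C q) (Tgt C p)" "a \<cdot> q = p \<cdot> bsnd b"
proof -
  note cD = conflationD[OF c] and kD = conflationD[OF \<kappa>(1)]
  have d': "d \<in> Arr C" "Src C d = Y" "Tgt C d = Src C i" using d by (auto simp: Hom_def)
  \<comment> \<open>\<open>pushout_cokernel_sum\<close> negates the second component, so starting
    from -d leaves id there.\<close>
  let ?e = "hneg C d"
  have e: "?e \<in> Arr C" "Src C ?e = Y" "Tgt C ?e = Src C i" using d' by simp_all
  obtain i1 i2 p1 p2 where b_eq: "b = (i1, i2, p1, p2)" by (cases b)
  note b1 = b[unfolded b_eq] and bD = biproductD[OF b[unfolded b_eq]]
  have DS: "D \<in> S" using biproduct_S[OF b] cD kD by simp
  obtain g h where po: "is_pushout C \<kappa> ?e g h" using pushout_exists[of \<kappa> ?e] kD \<kappa>(2) e by auto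
  note P = pushoutD[OF po]
  obtain g' where g': "conflation C S g g'" using conflation_pushout[OF \<kappa>(1) po] e cD by auto
  obtain i' h' where po': "is_pushout C i g i' h'" using pushout_exists[of i g] cD P e by auto
  note P' = pushoutD[OF po']
  obtain a where a: "conflation C S i' a" "a \<cdot> h' = p" "Tgt C a = Tgt C p"
    using conflation_pushout[OF c po'] conflationD[OF g'] by auto
  note aD = conflationD[OF a(1)]
  have po2: "is_pushout C \<kappa> (i \<cdot> ?e) h' (i' \<cdot> h)" by (rule pushout_paste[OF po po' e(3)])
  have b2: "is_biproduct C (Tgt C \<kappa>) (Tgt C (i \<cdot> ?e)) D (i1, i2, p1, p2)" using b1 e cD by simp
  let ?j = "i1 \<cdot> \<kappa> \<boxplus> hneg C (i2 \<cdot> (i \<cdot> ?e))" and ?q = "(i' \<cdot> h) \<cdot> p1 \<boxplus> h' \<cdot> p2"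
  have ck: "is_cokernel C ?j ?q" by (rule pushout_cokernel_sum[OF b2 po2])
  have mono: "is_mono C \<kappa>" using kD(1) kernel_mono by (auto simp: short_exact_def)
  have "is_mono C ?j" by (rule mono_pair[OF b2 mono]) (use e cD kD \<kappa>(2) in simp_all)
  then have se: "short_exact C ?j ?q" using ck by (rule mono_short_exact)
  have i'h: "i' \<in> Arr C" "h \<in> Arr C" "h' \<in> Arr C" "Tgt C h = Src C i'" "Src C h = Tgt C \<kappa>"
    "Src C h' = Tgt C i" "Tgt C i' = Tgt C h'" "Tgt C a = Tgt C p" "Src C a = Tgt C h'" "a \<in> Arr C"
    using P P' aD a by simp_all
  have t: "Src C ?j = Y" "Tgt C ?j = D" "Tgt C ?q = Tgt C h'" "?j \<in> Arr C" "?q \<in> Arr C" "Src C ?q = D"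
    using bD cD kD e \<kappa>(2) i'h by simp_all
  have X: "Tgt C h' \<in> S" using aD P' by simp
  have YS: "Y \<in> S" using kD \<kappa>(2) by simp
  have 1: "conflation C S ?j ?q" unfolding conflation_def using se t DS X YS by simp
  have 2: "bsnd b \<cdot> ?j = i \<cdot> d"
    unfolding b_eq using bD biproduct_comps[OF b1] d' cD kD \<kappa>(2) by (simp add: comp_hadd)
  have "a \<cdot> ((i' \<cdot> h) \<cdot> p1) = (a \<cdot> i') \<cdot> (h \<cdot> p1)" using i'h bD by simp
  also have "\<dots> = HZero C D (Tgt C p)" unfolding aD(5) using i'h bD aD cD by simp
  finally have 3: "a \<cdot> ((i' \<cdot> h) \<cdot> p1) = HZero C D (Tgt C p)" .
  have 4: "a \<cdot> (h' \<cdot> p2) = p \<cdot> p2" using comp_eq[OF a(2), of p2] i'h bD by simp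
  have "a \<cdot> ?q = a \<cdot> ((i' \<cdot> h) \<cdot> p1) \<boxplus> a \<cdot> (h' \<cdot> p2)"
    by (rule comp_hadd) (use i'h bD in simp_all)
  also have "\<dots> = p \<cdot> p2" unfolding 3 4 using bD cD by simp
  finally have 5: "a \<cdot> ?q = p \<cdot> bsnd b" unfolding b_eq by simp
  have 6: "deflation C S a" unfolding deflation_def using a(1) by blast
  have 7: "a \<in> Hom C (Tgt C ?q) (Tgt C p)" using i'h t by (simp add: Hom_def)
  show ?thesis using that[OF 1 t(1,2) 2 6 7 5] .
qed

lemma mor_splice_conflation:
  assumes c: "conflation C S i p" and c': "conflation C S i' p'"
    and E: "ext_seq C S t A (Tgt C p) E" and E': "ext_seq C S t A' (Tgt C p') E'"
    and m: "m \<in> Hom C (Tgt C i) (Tgt C i')" and d: "d \<in> Hom C (Src C i) (Src C i')" "m \<cdot> i = i' \<cdot> d"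
    and a: "a \<in> Hom C (Tgt C p) (Tgt C p')" "a \<cdot> p = p' \<cdot> m" and mor: "mor C a E E' h"
  shows "mor C d (splice C [i, p] E) (splice C [i', p'] E') h"
proof (rule mor_splice[OF _ mor])
  show "mor C d [i, p] [i', p'] a"
    by (rule mor_pairI[OF d(1) m a(1) d(2) a(2)]) (use conflationD[OF c] conflationD[OF c'] in simp_all)
  show "path C (Src C i) [i, p] (Tgt C p)" "path C (Src C i') [i', p'] (Tgt C p')"
    using conflationD[OF c] conflationD[OF c'] by simp_all
qed (use ext_seq_path[OF E] ext_seq_path[OF E'] in auto)

end

context n_Frobenius_category
begin

text \<open>Y is embedded into the biproduct of an n-projective with the middle term
  \<open>Tgt C i\<close>, instead of into the n-projective alone. The vertical map is then a
  projection, and by \<open>conflation_lift\<close> the induced map of end terms is a deflation; at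
  the last conflation this is a.\<close>

lemma unit_seq_lift:
  assumes "unit_seq t A B E" "Y \<in> S" "d \<in> Hom C Y B"
  shows "\<exists>X F a. unit_seq t X Y F \<and> mor C d F E a \<and> deflation C S a"
  using assms
proof (induction t arbitrary: B E Y d)
  case 0
  then show ?case using ext_seq_path unfolding unit_seq_def by fastforce
next
  case (Suc t)
  obtain \<kappa> \<kappa>' where \<kappa>: "conflation C S \<kappa> \<kappa>'" "Src C \<kappa> = Y" "n_projective C S n (Tgt C \<kappa>)"
    using enough_inflations[OF Suc.prems(2)] .
  from Suc.prems(1) show ?case
  proof (cases rule: unit_seq_cases)
    case (single i p)
    obtain D b where b: "is_biproduct C (Tgt C \<kappa>) (Tgt C i) D b"
      using biproduct_exists[of "Tgt C \<kappa>" "Tgt C i"] conflationD[OF single(1)] conflationD[OF \<kappa>(1)] by auto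
    have DP: "n_projective C S n D" using n_projective_biproduct[OF \<kappa>(3) single(2) b] .
    have d: "d \<in> Hom C Y (Src C i)" using Suc.prems(3) single(6) by simp
    obtain j q a where j: "conflation C S j q" "Src C j = Y" "Tgt C j = D" "bsnd b \<cdot> j = i \<cdot> d"
      "deflation C S a" "a \<in> Hom C (Tgt C q) (Tgt C p)" "a \<cdot> q = p \<cdot> bsnd b"
      using conflation_lift[OF single(1) d \<kappa>(1,2) b] .
    have "mor C d [j, q] [i, p] a"
      by (rule mor_pairI[OF _ _ j(6,4,7)])
        (use d j(2,3) biproduct_Hom[OF b] conflationD[OF j(1)] conflationD[OF single(1)] in simp_all)
    moreover have "unit_seq (Suc t) (Tgt C q) Y [j, q]"
      using unit_seq_single[OF j(1)] j(2,3) DP single(4) by simp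
    ultimately show ?thesis using single(3) j(5) by blast
  next
    case (splice i p t' E')
    then have [simp]: "t' = t" by simp
    obtain D b where b: "is_biproduct C (Tgt C \<kappa>) (Tgt C i) D b"
      using biproduct_exists[of "Tgt C \<kappa>" "Tgt C i"] conflationD[OF splice(1)] conflationD[OF \<kappa>(1)] by auto
    have DP: "n_projective C S n D" using n_projective_biproduct[OF \<kappa>(3) splice(2) b] .
    have d: "d \<in> Hom C Y (Src C i)" using Suc.prems(3) splice(7) by simp
    obtain j q a where j: "conflation C S j q" "Src C j = Y" "Tgt C j = D" "bsnd b \<cdot> j = i \<cdot> d"
      "deflation C S a" "a \<in> Hom C (Tgt C q) (Tgt C p)" "a \<cdot> q = p \<cdot> bsnd b"
      using conflation_lift[OF splice(1) d \<kappa>(1,2) b] .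
    have qS: "Tgt C q \<in> S" using conflationD[OF j(1)] by simp
    obtain X F c where F: "unit_seq t X (Tgt C q) F" "mor C a F E' c" "deflation C S c"
      using Suc.IH[OF splice(3)[simplified] qS j(6)] by blast
    have e: "ext_seq C S t X (Tgt C q) F" "ext_seq C S t A (Tgt C p) E'"
      using F(1) splice(3) unfolding unit_seq_def by auto
    have "mor C d (splice C [j, q] F) (splice C [i, p] E') c"
      by (rule mor_splice_conflation[OF j(1) splice(1) e _ _ j(4,6,7) F(2)])
        (use d j(2,3) biproduct_Hom[OF b] in simp_all)
    then show ?thesis
      using unit_seq_splice[OF j(1) _ F(1)] DP j(2,3) F(3) splice(4) by metis
  qed
qed

lemma unit_seq_dsum:
  assumes E: "unit_seq t A B E" and E': "unit_seq t A' B' E'" and F: "dsum C b E E' F b'"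
    and b: "is_biproduct C B B' D b" and b': "is_biproduct C A A' D' b'"
  shows "unit_seq t D' D F"
proof -
  have e: "ext_seq C S t A B E" "ext_seq C S t A' B' E'" using E E' unfolding unit_seq_def by auto
  have P: "path C B E A" "path C B' E' A'" using ext_seq_path[OF e(1)] ext_seq_path[OF e(2)] by auto
  have "n_projective C S n (Tgt C d)" if "d \<in> set (butlast F)" for d
    using dsum_butlast[OF F P that] n_projective_biproduct E E' unfolding unit_seq_def by blast
  then show ?thesis using dsum_ext_seq[OF e F b b'] unfolding unit_seq_def by blast
qed

text \<open>The diagonal of B is lifted to a unit sequence over the direct sum of E and E'.
  Composition with the projections to the summands restores the identity of B at the beginning and
  keeps deflations at the end.\<close>

lemma unit_seq_lift_pair:
  assumes E: "unit_seq t A B E" and E': "unit_seq t A' B E'"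
  obtains X F a a' where "unit_seq t X B F" "mor C (Idt C B) F E a" "mor C (Idt C B) F E' a'"
    "deflation C S a" "deflation C S a'"
proof -
  have e: "ext_seq C S t A B E" "ext_seq C S t A' B E'" using E E' unfolding unit_seq_def by auto
  have P: "path C B E A" "path C B E' A'" "A \<in> S" "A' \<in> S" "B \<in> S"
    using ext_seq_path[OF e(1)] ext_seq_path[OF e(2)] by auto
  obtain D b where b: "is_biproduct C B B D b" using biproduct_exists[of B B] P by auto
  obtain G D' b' where G: "dsum C b E E' G b'" "is_biproduct C A A' D' b'" "ext_seq C S t D' D G"
    using dsum_of_exists[OF e b] .
  have id: "Idt C B \<in> Hom C B B" using Idt_closed P by simp
  note bp = bpair_simps[OF b id id]
  obtain X F a where F: "unit_seq t X B F" "mor C (bpair C b (Idt C B) (Idt C B)) F G a" "deflation C S a"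
    using unit_seq_lift[OF unit_seq_dsum[OF E E' G(1) b G(2)] P(5) bp(1)] by blast
  have f: "ext_seq C S t X B F" using F(1) unfolding unit_seq_def by blast
  have PF: "path C B F X" "path C D G D'" "F \<noteq> []" using ext_seq_path[OF f] ext_seq_path[OF G(3)] by auto
  note m = dsum_mor_fst[OF G(1) P(1,2) b]
  have "a \<in> Hom C X D'" using mor_Hom(2)[OF F(2) PF] .
  then have t: "Src C (bfst b') = Tgt C a" "Src C (bsnd b') = Tgt C a"
    using biproduct_Hom[OF G(2)] by (auto simp: Hom_def)
  note df = biproduct_deflation[OF G(2) P(3,4)]
  show ?thesis
    using that[OF F(1) mor_comp[OF F(2) m(1) PF(1,2) P(1), unfolded bp(2)]
        mor_comp[OF F(2) m(2) PF(1,2) P(2), unfolded bp(3)]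
        deflation_comp[OF df(1) F(3) t(1)] deflation_comp[OF df(2) F(3) t(2)]] .
qed

text \<open>Push out along d, then compose the new inflation with one into an n-projective; h is the
  induced map of cokernels.\<close>

lemma conflation_extend:
  assumes c: "conflation C S i p" and d: "d \<in> Hom C (Src C i) Y" "Y \<in> S"
  obtains j q m h where "conflation C S j q" "Src C j = Y" "n_projective C S n (Tgt C j)"
    "m \<in> Hom C (Tgt C i) (Tgt C j)" "m \<cdot> i = j \<cdot> d" "h \<in> Hom C (Tgt C p) (Tgt C q)" "h \<cdot> p = q \<cdot> m"
proof -
  note cD = conflationD[OF c]
  have d': "d \<in> Arr C" "Src C d = Src C i" "Tgt C d = Y" using d by (auto simp: Hom_def)
  obtain i' g where po: "is_pushout C i d i' g" using pushout_exists[of i d] cD d' by auto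
  note P = pushoutD[OF po]
  obtain p' where p': "conflation C S i' p'" using conflation_pushout[OF c po] d' d by auto
  note pD = conflationD[OF p']
  obtain k k' where k: "conflation C S k k'" "Src C k = Tgt C i'" "n_projective C S n (Tgt C k)"
    using enough_inflations[OF pD(7)] .
  note kD = conflationD[OF k(1)]
  obtain q where q: "conflation C S (k \<cdot> i') q" using conflation_comp[OF p' k(1,2)] .
  note qD = conflationD[OF q]
  have t: "Src C (k \<cdot> i') = Y" "Tgt C (k \<cdot> i') = Tgt C k" using P kD k(2) d' by simp_all
  have m: "k \<cdot> g \<in> Hom C (Tgt C i) (Tgt C (k \<cdot> i'))" using P kD k(2) by (simp add: Hom_def)
  have "(k \<cdot> g) \<cdot> i = k \<cdot> (i' \<cdot> d)" using P kD k(2) by simp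
  then have mi: "(k \<cdot> g) \<cdot> i = (k \<cdot> i') \<cdot> d" using P kD k(2) by simp
  obtain h where h: "h \<in> Arr C" "Src C h = Tgt C p" "Tgt C h = Tgt C q" "h \<cdot> p = q \<cdot> (k \<cdot> g)"
    by (rule cokernel_map[OF cD(1) qD(1), of d "k \<cdot> g"]) (use d' t m mi in \<open>simp_all add: Hom_def\<close>)
  show ?thesis using that[OF q t(1) _ m mi _ h(4)] k(3) t(2) h by (simp add: Hom_def)
qed

lemma ext_seq_factor_unit:
  assumes "ext_seq C S t A B E" "Y \<in> S" "d \<in> Hom C B Y"
  shows "\<exists>X F h. unit_seq t X Y F \<and> mor C d E F h"
  using assms
proof (induction t arbitrary: B E Y d)
  case 0
  then show ?case using ext_seq_path by fastforce
next
  case (Suc t)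
  from Suc.prems(1) show ?case
  proof (cases rule: ext_seq_cases)
    case (single i p)
    have d: "d \<in> Hom C (Src C i) Y" using Suc.prems(3) single by simp
    obtain j q m h where j: "conflation C S j q" "Src C j = Y" "n_projective C S n (Tgt C j)"
      "m \<in> Hom C (Tgt C i) (Tgt C j)" "m \<cdot> i = j \<cdot> d" "h \<in> Hom C (Tgt C p) (Tgt C q)" "h \<cdot> p = q \<cdot> m"
      using conflation_extend[OF single(1) d Suc.prems(2)] .
    have "mor C d [i, p] [j, q] h"
      by (rule mor_pairI[OF _ j(4,6,5,7)])
        (use d j(2) conflationD[OF j(1)] conflationD[OF single(1)] in simp_all)
    moreover have "unit_seq (Suc t) (Tgt C q) Y [j, q]"
      using unit_seq_single[OF j(1,3)] j(2) single(3) by simp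
    ultimately show ?thesis using single(2) by blast
  next
    case (splice i p t' e es)
    then have [simp]: "t' = t" by simp
    have d: "d \<in> Hom C (Src C i) Y" using Suc.prems(3) splice by simp
    obtain j q m h where j: "conflation C S j q" "Src C j = Y" "n_projective C S n (Tgt C j)"
      "m \<in> Hom C (Tgt C i) (Tgt C j)" "m \<cdot> i = j \<cdot> d" "h \<in> Hom C (Tgt C p) (Tgt C q)" "h \<cdot> p = q \<cdot> m"
      using conflation_extend[OF splice(1) d Suc.prems(2)] .
    have qS: "Tgt C q \<in> S" using conflationD[OF j(1)] by simp
    obtain X F k where F: "unit_seq t X (Tgt C q) F" "mor C h (e # es) F k"
      using Suc.IH[OF splice(2)[simplified] qS j(6)] by blast
    have f: "ext_seq C S t X (Tgt C q) F" using F(1) unfolding unit_seq_def by blast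
    have "mor C d (splice C [i, p] (e # es)) (splice C [j, q] F) k"
      by (rule mor_splice_conflation[OF splice(1) j(1) splice(2)[simplified] f j(4) _ j(5,6,7) F(2)])
        (use d j(2) in simp)
    then show ?thesis using unit_seq_splice[OF j(1,3) F(1)] j(2) splice(4) by metis
  qed
qed

abbreviation U where "U \<equiv> unit_conflations C S n"

lemma right_unit_factorization:
  assumes "\<gamma> \<in> Ext C S n M B"
  obtains A \<delta> f where "\<delta> \<in> U A B" "f \<in> Hom C M A" "\<gamma> = \<delta> \<triangleleft> f"
proof -
  have S: "B \<in> S" using Ext_S[OF assms] by simp
  obtain E where E: "ext_seq C S n M B E" "\<gamma> = cl E" using assms by (rule ExtE)
  obtain X F h where F: "unit_seq n X B F" "mor C (Idt C B) E F h"
    using ext_seq_factor_unit[OF E(1) S Idt_closed] S by auto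
  have f: "ext_seq C S n X B F" using F(1) unfolding unit_seq_def by blast
  have P: "path C B E M" "path C B F X" "E \<noteq> []" using ext_seq_path[OF f] ext_seq_path[OF E(1)] by auto
  have "h \<in> Hom C M X" using mor_Hom(2)[OF F(2) P] .
  moreover have "cl F \<in> U X B" using F(1) unit_conflations_iff by blast
  ultimately show ?thesis using that pull_mor[OF f E(1) F(2)] E(2) by metis
qed

section \<open>Cancellation, cosets and co-angled pairs\<close>

lemma U_Ext: "\<delta> \<in> U A B \<Longrightarrow> \<delta> \<in> Ext C S n A B"
  unfolding unit_conflations_iff using unit_seq_Ext by blast

lemma U_left_surjective:
  assumes "\<delta> \<in> U A B" "n \<le> t" "\<gamma> \<in> Ext C S (n + t) X B"
  obtains \<gamma>' where "\<gamma>' \<in> Ext C S t X A" "\<gamma> = \<delta> \<star> \<gamma>'"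
proof -
  obtain E where "unit_seq n A B E" "\<delta> = cl E" using assms(1) unit_conflations_iff by blast
  then show ?thesis
    using unit_left_surjective[of n A B E t \<gamma> X] assms(2,3) Ext_S[OF U_Ext[OF assms(1)]] that by auto
qed

lemma U_right_surjective:
  assumes "\<delta> \<in> U A B" "n \<le> t" "\<gamma> \<in> Ext C S (t + n) A Y"
  obtains \<gamma>' where "\<gamma>' \<in> Ext C S t B Y" "\<gamma> = \<gamma>' \<star> \<delta>"
proof -
  obtain E where "unit_seq n A B E" "\<delta> = cl E" using assms(1) unit_conflations_iff by blast
  then show ?thesis
    using unit_right_surjective[of n A B E t \<gamma> Y] assms(2,3) Ext_S[OF U_Ext[OF assms(1)]] that by auto
qed

lemma U_left_cancel:
  assumes \<delta>: "\<delta> \<in> U A B" and "n < t" "\<beta> \<in> Ext C S t X A" "\<gamma> \<in> Ext C S t X A" "\<delta> \<star> \<beta> = \<delta> \<star> \<gamma>"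
  shows "\<beta> = \<gamma>"
proof (rule yprod_left_cancel[OF U_Ext[OF \<delta>] assms(3-5), of "\<lambda>\<epsilon>. \<epsilon> = ozero t X A"])
  show "\<epsilon> = ozero t X A" if "\<epsilon> \<in> Ext C S t X A" "\<delta> \<star> \<epsilon> = ozero (n + t) X B" for \<epsilon>
    using \<delta> unit_left_injective that assms(2) unfolding unit_conflations_iff by blast
qed (use assms in simp)

lemma U_right_cancel:
  assumes \<delta>: "\<delta> \<in> U A B" and "n < t" "\<beta> \<in> Ext C S t B Y" "\<gamma> \<in> Ext C S t B Y" "\<beta> \<star> \<delta> = \<gamma> \<star> \<delta>"
  shows "\<beta> = \<gamma>"
proof (rule yprod_right_cancel[OF U_Ext[OF \<delta>] assms(3-5), of "\<lambda>\<epsilon>. \<epsilon> = ozero t B Y"])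
  show "\<epsilon> = ozero t B Y" if "\<epsilon> \<in> Ext C S t B Y" "\<epsilon> \<star> \<delta> = ozero (t + n) A Y" for \<epsilon>
    using \<delta> unit_right_injective that assms(2) unfolding unit_conflations_iff by blast
qed (use assms in simp)

text \<open>Membership becomes an equation in degree 2n, which replaces any handling of the
  n-projective objects hidden in the definition.\<close>

lemma proj_part_iff:
  assumes \<tau>: "\<tau> \<in> U A X"
  shows "\<gamma> \<in> proj_part C S n X Y \<longleftrightarrow> \<gamma> \<in> Ext C S n X Y \<and> \<gamma> \<star> \<tau> = ozero (n + n) A Y"
  using proj_part_yprod[OF _ U_Ext[OF \<tau>] order_refl] proj_part_Ext Ext_S[OF U_Ext[OF \<tau>]]
    proj_part_if_right \<tau> unfolding unit_conflations_iff by blast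

text \<open>Agreement on \<tau> puts the difference of \<beta> and \<gamma> into
  \<open>proj_part\<close>, which annihilates every g of degree at least n.\<close>

lemma U_right_transfer:
  assumes \<tau>: "\<tau> \<in> U A X" and "\<beta> \<in> Ext C S n X Y" "\<gamma> \<in> Ext C S n X Y" "\<beta> \<star> \<tau> = \<gamma> \<star> \<tau>"
    and g: "g \<in> Ext C S t D X" "n \<le> t"
  shows "\<beta> \<star> g = \<gamma> \<star> g"
proof (rule yprod_right_cancel[OF U_Ext[OF \<tau>] assms(2-4), of "\<lambda>\<epsilon>. \<epsilon> \<in> proj_part C S n X Y"])
  fix \<epsilon> assume \<epsilon>: "\<epsilon> \<in> Ext C S n X Y" "\<beta> = \<epsilon> \<uplus> \<gamma>" "\<epsilon> \<in> proj_part C S n X Y"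
  show ?thesis
    using baer_yprod[OF \<epsilon>(1) assms(3) g(1)] proj_part_yprod[OF \<epsilon>(3) g] yprod_Ext[OF assms(3) g(1)] \<epsilon>(2) by simp
qed (simp add: proj_part_iff[OF \<tau>])

lemma U_left_proj_part:
  assumes \<delta>: "\<delta> \<in> U A B" and "\<epsilon> \<in> Ext C S n X A" "\<delta> \<star> \<epsilon> = ozero (n + n) X B"
  shows "\<epsilon> \<in> proj_part C S n X A"
  using proj_part_if_left assms unfolding unit_conflations_iff by blast

lemma U_left_transfer:
  assumes \<delta>: "\<delta> \<in> U A B" and "\<beta> \<in> Ext C S n X A" "\<gamma> \<in> Ext C S n X A" "\<delta> \<star> \<beta> = \<delta> \<star> \<gamma>"
    and g: "g \<in> Ext C S t A Y"
  shows "g \<star> \<beta> = g \<star> \<gamma>"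
proof (rule yprod_left_cancel[OF U_Ext[OF \<delta>] assms(2-4), of "\<lambda>\<epsilon>. \<epsilon> \<in> proj_part C S n X A"])
  fix \<epsilon> assume \<epsilon>: "\<epsilon> \<in> Ext C S n X A" "\<beta> = \<epsilon> \<uplus> \<gamma>" "\<epsilon> \<in> proj_part C S n X A"
  have "X \<in> S" using Ext_S[OF assms(2)] by simp
  then show ?thesis
    using yprod_baer[OF g \<epsilon>(1) assms(3)] yprod_proj_part[OF \<epsilon>(3) g] yprod_Ext[OF g assms(3)] \<epsilon>(2) by simp
qed (use U_left_proj_part[OF \<delta>] in simp)

lemma U_from:
  assumes "X \<in> S" "1 \<le> n" obtains A \<tau> where "\<tau> \<in> U A X"
  using unit_seq_from[OF assms] unit_conflations_iff by blast

lemma U_to: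
  assumes "A \<in> S" "1 \<le> n" obtains X \<tau> where "\<tau> \<in> U A X"
  using unit_seq_to[OF assms] unit_conflations_iff by blast

text \<open>Multiplication with \<tau> is additive with kernel \<open>proj_part\<close>, so its
  fibres are the cosets.\<close>

lemma mem_ext_bar:
  assumes \<tau>: "\<tau> \<in> U A X" and \<gamma>: "\<gamma> \<in> Ext C S n X Y"
  shows "\<gamma>' \<in> ext_bar C S n X Y \<gamma> \<longleftrightarrow> \<gamma>' \<in> Ext C S n X Y \<and> \<gamma>' \<star> \<tau> = \<gamma> \<star> \<tau>"
proof
  assume "\<gamma>' \<in> ext_bar C S n X Y \<gamma>"
  then obtain h where h: "h \<in> proj_part C S n X Y" "\<gamma>' = h \<uplus> \<gamma>"
    unfolding ext_bar_def r_coset_def Ext_group_def by auto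
  have h': "h \<in> Ext C S n X Y" "h \<star> \<tau> = ozero (n + n) A Y" using h(1) proj_part_iff[OF \<tau>] by auto
  show "\<gamma>' \<in> Ext C S n X Y \<and> \<gamma>' \<star> \<tau> = \<gamma> \<star> \<tau>"
    unfolding h(2) using baer_yprod[OF h'(1) \<gamma> U_Ext[OF \<tau>]] h' \<gamma> yprod_Ext[OF \<gamma> U_Ext[OF \<tau>]] by simp
next
  assume a: "\<gamma>' \<in> Ext C S n X Y \<and> \<gamma>' \<star> \<tau> = \<gamma> \<star> \<tau>"
  then have a1: "\<gamma>' \<in> Ext C S n X Y" and a2: "\<gamma>' \<star> \<tau> = \<gamma> \<star> \<tau>" by auto
  show "\<gamma>' \<in> ext_bar C S n X Y \<gamma>"
  proof (rule yprod_right_cancel[OF U_Ext[OF \<tau>] a1 \<gamma> a2, of "\<lambda>\<epsilon>. \<epsilon> \<in> proj_part C S n X Y"])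
    fix \<epsilon> assume "\<gamma>' = \<epsilon> \<uplus> \<gamma>" "\<epsilon> \<in> proj_part C S n X Y"
    then show ?thesis unfolding ext_bar_def r_coset_def Ext_group_def by auto
  qed (simp add: proj_part_iff[OF \<tau>])
qed

text \<open>By definition two summands may pass through different n-projectives; as the kernel of
  multiplication with \<tau> the set is visibly a subgroup.\<close>

lemma proj_part_subgroup:
  assumes \<tau>: "\<tau> \<in> U A X" and Y: "Y \<in> S"
  shows "subgroup (proj_part C S n X Y) (Ext_group C S n X Y)"
proof -
  have S: "A \<in> S" "X \<in> S" "1 \<le> n" using Ext_S[OF U_Ext[OF \<tau>]] by auto
  interpret G: comm_group "Ext_group C S n X Y" using Ext_comm_group S Y by simp
  interpret H: comm_group "Ext_group C S (n + n) A Y" using Ext_comm_group S Y by simp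
  have "(\<lambda>\<gamma>. \<gamma> \<star> \<tau>) \<in> hom (Ext_group C S n X Y) (Ext_group C S (n + n) A Y)"
    by (rule homI) (simp_all add: Ext_group_def yprod_Ext[OF _ U_Ext[OF \<tau>]] baer_yprod[OF _ _ U_Ext[OF \<tau>]])
  then interpret f: group_hom "Ext_group C S n X Y" "Ext_group C S (n + n) A Y" "\<lambda>\<gamma>. \<gamma> \<star> \<tau>"
    by unfold_locales
  have "proj_part C S n X Y = kernel (Ext_group C S n X Y) (Ext_group C S (n + n) A Y) (\<lambda>\<gamma>. \<gamma> \<star> \<tau>)"
    unfolding kernel_def using proj_part_iff[OF \<tau>] by (auto simp: Ext_group_def)
  then show ?thesis using f.subgroup_kernel by simp
qed

lemma mem_ext_pull_inv:
  assumes \<zeta>: "\<zeta> \<in> Ext C S n (Src C b) Y" and \<epsilon>: "\<epsilon> \<in> Ext C S n (Tgt C b) Y"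
    and b: "b \<in> Hom C X A" and \<tau>: "\<tau> \<in> U D X"
  shows "\<epsilon> \<in> ext_pull_inv C S n Y \<zeta> b \<longleftrightarrow> \<zeta> \<star> \<tau> = (\<epsilon> \<triangleleft> b) \<star> \<tau>"
proof -
  have b': "Src C b = X" "Tgt C b = A" using b by (auto simp: Hom_def)
  have S: "X \<in> S" using Ext_S[OF \<zeta>] b' by simp
  have \<zeta>: "\<zeta> \<in> Ext C S n X Y" and \<epsilon>: "\<epsilon> \<in> Ext C S n A Y" using \<zeta> \<epsilon> b' by simp_all
  note \<epsilon>b = pull_Ext[OF \<epsilon> b S]
  let ?d = "\<zeta> \<otimes>\<^bsub>Ext_group C S n X Y\<^esub> inv\<^bsub>Ext_group C S n X Y\<^esub> (\<epsilon> \<triangleleft> b)"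
  have "?d \<in> proj_part C S n X Y \<longleftrightarrow> \<zeta> \<star> \<tau> = (\<epsilon> \<triangleleft> b) \<star> \<tau>"
  proof
    assume d: "?d \<in> proj_part C S n X Y"
    obtain \<theta> where \<theta>: "\<theta> \<in> Ext C S n X Y" "\<zeta> = \<theta> \<uplus> (\<epsilon> \<triangleleft> b)" "\<theta> = ?d" using baer_diff[OF \<zeta> \<epsilon>b] .
    have "\<theta> \<star> \<tau> = ozero (n + n) D Y" using d \<theta>(3) proj_part_iff[OF \<tau>] by simp
    then show "\<zeta> \<star> \<tau> = (\<epsilon> \<triangleleft> b) \<star> \<tau>"
      using baer_yprod[OF \<theta>(1) \<epsilon>b U_Ext[OF \<tau>]] \<theta>(2) yprod_Ext[OF \<epsilon>b U_Ext[OF \<tau>]] by simp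
  next
    assume "\<zeta> \<star> \<tau> = (\<epsilon> \<triangleleft> b) \<star> \<tau>"
    then show "?d \<in> proj_part C S n X Y"
    proof (rule yprod_right_cancel[OF U_Ext[OF \<tau>] \<zeta> \<epsilon>b, of "\<lambda>\<epsilon>. \<epsilon> \<in> proj_part C S n X Y"])
      fix \<theta> assume "\<theta> \<in> proj_part C S n X Y" "\<theta> = ?d"
      then show "?d \<in> proj_part C S n X Y" by (simp only:)
    qed (simp only: proj_part_iff[OF \<tau>])
  qed
  then show ?thesis unfolding ext_pull_inv_def Let_def using \<epsilon> b' by simp
qed

text \<open>The exchange law reads \<delta> \<star> (a \<triangleright> x) = (\<delta>
  \<triangleleft> a) \<star> x. In degree n + 1 both unit conflations can be cancelled, and dividing
  \<delta> \<star> y by \<delta> \<triangleleft> a gives a preimage of y.\<close>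

lemma quasi_invertibleI:
  assumes \<delta>: "\<delta> \<in> U A B" and a: "a \<in> Hom C X A" and \<delta>a: "\<delta> \<triangleleft> a \<in> U X B"
  shows "quasi_invertible C S n a"
proof -
  have S: "A \<in> S" "X \<in> S" "1 \<le> n" using Ext_S[OF U_Ext[OF \<delta>]] Ext_S[OF U_Ext[OF \<delta>a]] by auto
  have a': "a \<in> Arr C" "Src C a = X" "Tgt C a = A" using a by (auto simp: Hom_def)
  have "(\<lambda>\<gamma>. a \<triangleright> \<gamma>) \<in> iso (Ext_group C S (n + 1) Y X) (Ext_group C S (n + 1) Y A)" if Y: "Y \<in> S" for Y
  proof (rule isoI)
    show "(\<lambda>\<gamma>. a \<triangleright> \<gamma>) \<in> hom (Ext_group C S (n + 1) Y X) (Ext_group C S (n + 1) Y A)"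
      by (rule homI) (simp_all add: Ext_group_def push_Ext[OF _ a S(1)] push_baer[OF _ _ a S(1)])
    have inj: "inj_on (\<lambda>\<gamma>. a \<triangleright> \<gamma>) (Ext C S (n + 1) Y X)"
    proof (rule inj_onI)
      fix x y assume x: "x \<in> Ext C S (n + 1) Y X" and y: "y \<in> Ext C S (n + 1) Y X" and e: "a \<triangleright> x = a \<triangleright> y"
      have "(\<delta> \<triangleleft> a) \<star> x = (\<delta> \<triangleleft> a) \<star> y"
        using yprod_pull_push[OF U_Ext[OF \<delta>] x a] yprod_pull_push[OF U_Ext[OF \<delta>] y a] e by simp
      then show "x = y" using U_left_cancel[OF \<delta>a _ x y] by simp
    qed
    have "y \<in> (\<lambda>\<gamma>. a \<triangleright> \<gamma>) ` Ext C S (n + 1) Y X" if y: "y \<in> Ext C S (n + 1) Y A" for y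
    proof -
      obtain x where x: "x \<in> Ext C S (n + 1) Y X" "\<delta> \<star> y = (\<delta> \<triangleleft> a) \<star> x"
        using U_left_surjective[OF \<delta>a _ yprod_Ext[OF U_Ext[OF \<delta>] y]] by auto
      then have "\<delta> \<star> y = \<delta> \<star> (a \<triangleright> x)" using yprod_pull_push[OF U_Ext[OF \<delta>] x(1) a] by simp
      then have "y = a \<triangleright> x" using U_left_cancel[OF \<delta> _ y push_Ext[OF x(1) a S(1)]] by simp
      then show ?thesis using x(1) by blast
    qed
    then have "(\<lambda>\<gamma>. a \<triangleright> \<gamma>) ` Ext C S (n + 1) Y X = Ext C S (n + 1) Y A"
      using push_Ext[OF _ a S(1)] by blast
    then show "bij_betw (\<lambda>\<gamma>. a \<triangleright> \<gamma>) (carrier (Ext_group C S (n + 1) Y X)) (carrier (Ext_group C S (n + 1) Y A))"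
      using inj by (simp add: bij_betw_def Ext_group_def)
  qed
  then show ?thesis unfolding quasi_invertible_def using a' S by simp
qed

lemma co_angled_pair_exists:
  assumes \<delta>: "\<delta> \<in> U A B" and \<delta>': "\<delta>' \<in> U A' B"
  obtains a b where "co_angled_pair C S n A A' B \<delta> a \<delta>' b"
proof -
  obtain E where E: "unit_seq n A B E" "\<delta> = cl E" using \<delta> unit_conflations_iff by blast
  obtain E' where E': "unit_seq n A' B E'" "\<delta>' = cl E'" using \<delta>' unit_conflations_iff by blast
  obtain X F a a' where F: "unit_seq n X B F" "mor C (Idt C B) F E a" "mor C (Idt C B) F E' a'"
    "deflation C S a" "deflation C S a'" using unit_seq_lift_pair[OF E(1) E'(1)] .
  have e: "ext_seq C S n A B E" "ext_seq C S n A' B E'" "ext_seq C S n X B F"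
    using E(1) E'(1) F(1) unfolding unit_seq_def by auto
  have P: "path C B E A" "path C B E' A'" "path C B F X" "F \<noteq> []"
    using ext_seq_path[OF e(1)] ext_seq_path[OF e(2)] ext_seq_path[OF e(3)] by auto
  have h: "a \<in> Hom C X A" "a' \<in> Hom C X A'" using mor_Hom(2)[OF F(2) P(3,1,4)] mor_Hom(2)[OF F(3) P(3,2,4)] by auto
  have eq: "\<delta> \<triangleleft> a = cl F" "\<delta>' \<triangleleft> a' = cl F"
    using pull_mor[OF e(1,3) F(2)] pull_mor[OF e(2,3) F(3)] E(2) E'(2) by auto
  have u: "cl F \<in> U X B" using F(1) unit_conflations_iff by blast
  have "quasi_invertible C S n a" "quasi_invertible C S n a'"
    using quasi_invertibleI[OF \<delta> h(1)] quasi_invertibleI[OF \<delta>' h(2)] eq u by auto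
  then have "co_angled_pair C S n A A' B \<delta> a \<delta>' a'"
    unfolding co_angled_pair_def using h F(4,5) eq u by (auto simp: Hom_def)
  then show ?thesis using that by blast
qed

text \<open>With a unit conflation \<rho> ending in B, write \<rho> \<star> \<zeta> = y \<star>
  (\<delta> \<triangleleft> b) = (y \<star> \<delta>) \<triangleleft> b and divide y \<star>
  \<delta> by \<rho>. The quotient \<epsilon> satisfies \<rho> \<star> \<zeta> = \<rho> \<star>
  (\<epsilon> \<triangleleft> b), and in degree n this cancels up to
  \<open>proj_part\<close>.\<close>

lemma ext_pull_inv_exists:
  assumes \<delta>: "\<delta> \<in> U A B" and b: "b \<in> Hom C X A" and u: "\<delta> \<triangleleft> b \<in> U X B" and \<zeta>: "\<zeta> \<in> Ext C S n X B"
  obtains \<epsilon> where "\<epsilon> \<in> Ext C S n A B" "\<epsilon> \<in> ext_pull_inv C S n B \<zeta> b"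
proof -
  have S: "A \<in> S" "B \<in> S" "1 \<le> n" "X \<in> S" using Ext_S[OF U_Ext[OF \<delta>]] Ext_S[OF \<zeta>] by auto
  have b': "Src C b = X" "Tgt C b = A" using b by (auto simp: Hom_def)
  obtain B' \<rho> where \<rho>: "\<rho> \<in> U B B'" using U_to[OF S(2,3)] .
  obtain D \<tau> where \<tau>: "\<tau> \<in> U D X" using U_from[OF S(4,3)] .
  obtain y where y: "y \<in> Ext C S n B B'" "\<rho> \<star> \<zeta> = y \<star> (\<delta> \<triangleleft> b)"
    using U_right_surjective[OF u order_refl yprod_Ext[OF U_Ext[OF \<rho>] \<zeta>]] .
  obtain \<epsilon> where \<epsilon>: "\<epsilon> \<in> Ext C S n A B" "y \<star> \<delta> = \<rho> \<star> \<epsilon>"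
    using U_left_surjective[OF \<rho> order_refl yprod_Ext[OF y(1) U_Ext[OF \<delta>]]] .
  have "\<rho> \<star> \<zeta> = \<rho> \<star> (\<epsilon> \<triangleleft> b)"
    using y(2) yprod_pull[OF y(1) U_Ext[OF \<delta>] b S(4)] \<epsilon>(2) yprod_pull[OF U_Ext[OF \<rho>] \<epsilon>(1) b S(4)] by simp
  then have "\<zeta> \<star> \<tau> = (\<epsilon> \<triangleleft> b) \<star> \<tau>"
  proof (rule yprod_left_cancel[OF U_Ext[OF \<rho>] \<zeta> pull_Ext[OF \<epsilon>(1) b S(4)], of "\<lambda>\<epsilon>. \<epsilon> \<in> proj_part C S n X B"])
    fix \<theta> assume \<theta>: "\<theta> \<in> Ext C S n X B" "\<zeta> = \<theta> \<uplus> (\<epsilon> \<triangleleft> b)" "\<theta> \<in> proj_part C S n X B"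
    then show ?thesis
      using baer_yprod[OF \<theta>(1) pull_Ext[OF \<epsilon>(1) b S(4)] U_Ext[OF \<tau>]] proj_part_iff[OF \<tau>]
        yprod_Ext[OF pull_Ext[OF \<epsilon>(1) b S(4)] U_Ext[OF \<tau>]] by simp
  qed (use U_left_proj_part[OF \<rho>] in simp)
  then show ?thesis using that \<epsilon>(1) mem_ext_pull_inv[of \<zeta> b B \<epsilon> X A \<tau> D] b b' \<zeta> \<tau> by simp
qed

end

section \<open>The stable ring\<close>

text \<open>\<open>circ_rel \<beta> \<gamma> \<epsilon>\<close> expresses \<open>\<epsilon> = \<beta> \<delta>\<^sub>M\<^sup>-\<^sup>1 \<gamma>\<close> modulo \<open>proj_part\<close>, after multiplication with \<open>\<tau>\<close>. The second
  unit conflation \<open>\<sigma>\<close> raises degrees from \<open>n\<close> to \<open>2n\<close>, where cancellation is exact.\<close>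

locale unit_frame = n_Frobenius_category +
  fixes M B :: 'a and \<delta>\<^sub>M :: "'b list set" and A1 :: 'a and \<tau> :: "'b list set" and A2 :: 'a and \<sigma> :: "'b list set"
  assumes \<delta>_unit: "\<delta>\<^sub>M \<in> unit_conflations C S n M B"
    and \<tau>_unit: "\<tau> \<in> unit_conflations C S n A1 M"
    and \<sigma>_unit: "\<sigma> \<in> unit_conflations C S n A2 A1"
begin

lemmas \<delta>_Ext = U_Ext[OF \<delta>_unit] and \<tau>_Ext = U_Ext[OF \<tau>_unit] and \<sigma>_Ext = U_Ext[OF \<sigma>_unit]

lemma frame_S: "M \<in> S" "B \<in> S" "A1 \<in> S" "A2 \<in> S" "1 \<le> n"
  using Ext_S[OF \<delta>_Ext] Ext_S[OF \<sigma>_Ext] by auto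

abbreviation bar where "bar \<equiv> ext_bar C S n M B"

definition circ_rel where
  "circ_rel \<beta> \<gamma> \<epsilon> \<longleftrightarrow> \<beta> \<in> Ext C S n M B \<and> \<gamma> \<in> Ext C S n M B \<and> \<epsilon> \<in> Ext C S n M B \<and>
     (\<exists>g \<in> Ext C S n A1 M. \<gamma> \<star> \<tau> = \<delta>\<^sub>M \<star> g \<and> \<epsilon> \<star> \<tau> = \<beta> \<star> g)"

lemmas mem_bar = mem_ext_bar[OF \<tau>_unit]

lemma bar_eq_iff:
  assumes "\<gamma> \<in> Ext C S n M B" "\<gamma>' \<in> Ext C S n M B"
  shows "bar \<gamma> = bar \<gamma>' \<longleftrightarrow> \<gamma> \<star> \<tau> = \<gamma>' \<star> \<tau>"
proof
  assume "bar \<gamma> = bar \<gamma>'"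
  then have "\<gamma> \<in> bar \<gamma>'" using mem_bar[OF assms(1), of \<gamma>] assms by simp
  then show "\<gamma> \<star> \<tau> = \<gamma>' \<star> \<tau>" using mem_bar[OF assms(2)] by simp
next
  assume "\<gamma> \<star> \<tau> = \<gamma>' \<star> \<tau>"
  then show "bar \<gamma> = bar \<gamma>'" using mem_bar[OF assms(1)] mem_bar[OF assms(2)] by auto
qed

text \<open>Degree n allows division by \<open>\<delta>\<^sub>M\<close> but leaves g ambiguous up to
  \<open>proj_part\<close>; the ambiguity disappears in products \<beta> \<star> g.\<close>

lemma frame_divide:
  assumes "\<gamma> \<in> Ext C S n M B"
  obtains g where "g \<in> Ext C S n A1 M" "\<gamma> \<star> \<tau> = \<delta>\<^sub>M \<star> g"
  using U_left_surjective[OF \<delta>_unit order_refl yprod_Ext[OF assms \<tau>_Ext]] .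

lemma frame_multiply:
  assumes "\<beta> \<in> Ext C S n M B" "g \<in> Ext C S n A1 M"
  obtains \<epsilon> where "\<epsilon> \<in> Ext C S n M B" "\<epsilon> \<star> \<tau> = \<beta> \<star> g"
  using U_right_surjective[OF \<tau>_unit order_refl yprod_Ext[OF assms]] by metis

text \<open>In degree n neither f \<triangleright> \<tau> nor g need lift to the common object X of
  the co-angled pair, but after multiplication with \<sigma> both lift to one x. The rest is
  \<epsilon>1 \<star> (b \<triangleright> x) = \<beta>1 \<star> (a \<triangleright> x), where the
  choice of \<epsilon>1 enters.\<close>

lemma ext_circ_choice:
  assumes r: "circ_rel \<beta> \<gamma> \<epsilon>" and \<beta>1: "\<beta>1 \<in> bar \<beta>" and \<gamma>1: "\<gamma>1 \<in> bar \<gamma>"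
    and \<delta>: "\<delta> \<in> U A B" and f: "f \<in> Hom C M A" and \<gamma>1f: "\<gamma>1 = \<delta> \<triangleleft> f"
    and ab: "co_angled_pair C S n M A B \<delta>\<^sub>M a \<delta> b"
    and \<epsilon>1: "\<epsilon>1 \<in> ext_pull_inv C S n B (\<beta>1 \<triangleleft> a) b"
  shows "\<epsilon>1 \<triangleleft> f \<in> Ext C S n M B" "(\<epsilon>1 \<triangleleft> f) \<star> \<tau> = \<epsilon> \<star> \<tau>"
proof -
  obtain g where g: "\<beta> \<in> Ext C S n M B" "\<gamma> \<in> Ext C S n M B" "\<epsilon> \<in> Ext C S n M B"
    "g \<in> Ext C S n A1 M" "\<gamma> \<star> \<tau> = \<delta>\<^sub>M \<star> g" "\<epsilon> \<star> \<tau> = \<beta> \<star> g"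
    using r unfolding circ_rel_def by blast
  have b1: "\<beta>1 \<in> Ext C S n M B" "\<beta>1 \<star> \<tau> = \<beta> \<star> \<tau>" using mem_bar[OF g(1)] \<beta>1 by auto
  have c1: "\<gamma>1 \<in> Ext C S n M B" "\<gamma>1 \<star> \<tau> = \<gamma> \<star> \<tau>" using mem_bar[OF g(2)] \<gamma>1 by auto
  define X where "X = Src C a"
  have h: "a \<in> Hom C X M" "b \<in> Hom C X A" and u: "\<delta>\<^sub>M \<triangleleft> a = \<delta> \<triangleleft> b" "\<delta>\<^sub>M \<triangleleft> a \<in> U X B"
    using ab unfolding co_angled_pair_def quasi_invertible_def X_def by (auto simp: Hom_def)
  have S: "X \<in> S" "A \<in> S" using Ext_S[OF U_Ext[OF u(2)]] Ext_S[OF U_Ext[OF \<delta>]] by auto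
  have b': "Src C b = X" "Tgt C b = A" using h(2) by (auto simp: Hom_def)
  have e1: "\<epsilon>1 \<in> Ext C S n A B" using \<epsilon>1 b' unfolding ext_pull_inv_def Let_def by simp
  show 1: "\<epsilon>1 \<triangleleft> f \<in> Ext C S n M B" using pull_Ext[OF e1 f frame_S(1)] .
  note \<delta>' = U_Ext[OF \<delta>]
  note f\<tau> = push_Ext[OF \<tau>_Ext f S(2)] and fts = yprod_Ext[OF push_Ext[OF \<tau>_Ext f S(2)] \<sigma>_Ext]
  have "\<delta> \<star> ((f \<triangleright> \<tau>) \<star> \<sigma>) = (\<gamma>1 \<star> \<tau>) \<star> \<sigma>"
    using yprod_assoc[OF \<delta>' f\<tau> \<sigma>_Ext] yprod_pull_push[OF \<delta>' \<tau>_Ext f] \<gamma>1f by simp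
  also have "\<dots> = \<delta>\<^sub>M \<star> (g \<star> \<sigma>)" using c1(2) g(5) yprod_assoc[OF \<delta>_Ext g(4) \<sigma>_Ext] by simp
  finally have eq: "\<delta> \<star> ((f \<triangleright> \<tau>) \<star> \<sigma>) = \<delta>\<^sub>M \<star> (g \<star> \<sigma>)" .
  \<comment> \<open>Division by the common unit conflation of the pair; cancelling \<delta> and
    \<open>\<delta>\<^sub>M\<close> afterwards shows that x lifts (f \<triangleright> \<tau>)
    \<star> \<sigma> along b and g \<star> \<sigma> along a.\<close>
  obtain x where x: "x \<in> Ext C S (n + n) A2 X" "\<delta> \<star> ((f \<triangleright> \<tau>) \<star> \<sigma>) = (\<delta>\<^sub>M \<triangleleft> a) \<star> x"
    using U_left_surjective[OF u(2) _ yprod_Ext[OF \<delta>' fts]] by auto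
  have n: "n < n + n" using frame_S by simp
  have "\<delta> \<star> ((f \<triangleright> \<tau>) \<star> \<sigma>) = \<delta> \<star> (b \<triangleright> x)"
    using x(2) u(1) yprod_pull_push[OF \<delta>' x(1) h(2)] by simp
  then have fx: "(f \<triangleright> \<tau>) \<star> \<sigma> = b \<triangleright> x"
    by (rule U_left_cancel[OF \<delta> n fts push_Ext[OF x(1) h(2) S(2)]])
  have "\<delta>\<^sub>M \<star> (g \<star> \<sigma>) = \<delta>\<^sub>M \<star> (a \<triangleright> x)"
    using x(2) eq yprod_pull_push[OF \<delta>_Ext x(1) h(1)] by simp
  then have gx: "g \<star> \<sigma> = a \<triangleright> x"
    by (rule U_left_cancel[OF \<delta>_unit n yprod_Ext[OF g(4) \<sigma>_Ext] push_Ext[OF x(1) h(1) frame_S(1)]])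
  obtain D \<rho> where \<rho>: "\<rho> \<in> U D X" using U_from[OF S(1) frame_S(5)] .
  note \<beta>a = pull_Ext[OF b1(1) h(1) S(1)] and \<epsilon>b = pull_Ext[OF e1 h(2) S(1)]
  have "(\<beta>1 \<triangleleft> a) \<star> \<rho> = (\<epsilon>1 \<triangleleft> b) \<star> \<rho>"
    using mem_ext_pull_inv[of "\<beta>1 \<triangleleft> a" b B \<epsilon>1 X A \<rho> D] b' \<beta>a e1 h(2) \<rho> \<epsilon>1 by simp
  then have be: "(\<beta>1 \<triangleleft> a) \<star> x = (\<epsilon>1 \<triangleleft> b) \<star> x"
    using U_right_transfer[OF \<rho> \<beta>a \<epsilon>b _ x(1)] by simp
  have "((\<epsilon>1 \<triangleleft> f) \<star> \<tau>) \<star> \<sigma> = \<epsilon>1 \<star> ((f \<triangleright> \<tau>) \<star> \<sigma>)"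
    using yprod_pull_push[OF e1 \<tau>_Ext f] yprod_assoc[OF e1 f\<tau> \<sigma>_Ext] by simp
  also have "\<dots> = (\<epsilon>1 \<triangleleft> b) \<star> x" using fx yprod_pull_push[OF e1 x(1) h(2)] by simp
  also have "\<dots> = \<beta>1 \<star> (a \<triangleright> x)" using be yprod_pull_push[OF b1(1) x(1) h(1)] by simp
  also have "\<dots> = (\<beta>1 \<star> g) \<star> \<sigma>" using gx yprod_assoc[OF b1(1) g(4) \<sigma>_Ext] by simp
  \<comment> \<open>\<beta>1 and \<beta> differ by an element of \<open>proj_part\<close>, and g has
    degree n.\<close>
  also have "\<beta>1 \<star> g = \<beta> \<star> g" using U_right_transfer[OF \<tau>_unit b1(1) g(1) b1(2) g(4)] by simp
  also have "\<dots> = \<epsilon> \<star> \<tau>" using g(6) by simp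
  finally have "((\<epsilon>1 \<triangleleft> f) \<star> \<tau>) \<star> \<sigma> = (\<epsilon> \<star> \<tau>) \<star> \<sigma>" .
  then show "(\<epsilon>1 \<triangleleft> f) \<star> \<tau> = \<epsilon> \<star> \<tau>"
    by (rule U_right_cancel[OF \<sigma>_unit n yprod_Ext[OF 1 \<tau>_Ext] yprod_Ext[OF g(3) \<tau>_Ext]])
qed

text \<open>All admissible choices give the same coset and at least one choice exists, so the union
  in \<open>ext_circ\<close> is that coset.\<close>

lemma ext_circ_bar:
  assumes r: "circ_rel \<beta> \<gamma> \<epsilon>"
  shows "ext_circ C S n M B \<delta>\<^sub>M (bar \<beta>) (bar \<gamma>) = bar \<epsilon>"
proof -
  have e: "\<beta> \<in> Ext C S n M B" "\<gamma> \<in> Ext C S n M B" "\<epsilon> \<in> Ext C S n M B"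
    using r unfolding circ_rel_def by auto
  let ?P = "\<lambda>\<epsilon>1 f \<beta>1 \<gamma>1 A \<delta> a b. \<beta>1 \<in> bar \<beta> \<and> \<gamma>1 \<in> bar \<gamma> \<and> \<delta> \<in> U A B \<and> f \<in> Hom C M A \<and>
    \<gamma>1 = \<delta> \<triangleleft> f \<and> co_angled_pair C S n M A B \<delta>\<^sub>M a \<delta> b \<and> \<epsilon>1 \<in> ext_pull_inv C S n B (\<beta>1 \<triangleleft> a) b"
  have all: "bar (\<epsilon>1 \<triangleleft> f) = bar \<epsilon>" if "?P \<epsilon>1 f \<beta>1 \<gamma>1 A \<delta> a b" for \<epsilon>1 f \<beta>1 \<gamma>1 A \<delta> a b
  proof -
    have "\<epsilon>1 \<triangleleft> f \<in> Ext C S n M B" "(\<epsilon>1 \<triangleleft> f) \<star> \<tau> = \<epsilon> \<star> \<tau>"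
      using ext_circ_choice[OF r, of \<beta>1 \<gamma>1 \<delta> A f a b \<epsilon>1] that by blast+
    then show ?thesis using bar_eq_iff e(3) by simp
  qed
  have ex: "\<exists>\<epsilon>1 f \<beta>1 \<gamma>1 A \<delta> a b. ?P \<epsilon>1 f \<beta>1 \<gamma>1 A \<delta> a b"
  proof -
    obtain A \<delta> f where \<delta>: "\<delta> \<in> U A B" "f \<in> Hom C M A" "\<gamma> = \<delta> \<triangleleft> f" using right_unit_factorization[OF e(2)] .
    obtain a b where ab: "co_angled_pair C S n M A B \<delta>\<^sub>M a \<delta> b" using co_angled_pair_exists[OF \<delta>_unit \<delta>(1)] .
    then have h: "a \<in> Hom C (Src C a) M" "b \<in> Hom C (Src C a) A" "\<delta> \<triangleleft> b \<in> U (Src C a) B"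
      unfolding co_angled_pair_def quasi_invertible_def by (auto simp: Hom_def)
    have X: "Src C a \<in> S" using Ext_S[OF U_Ext[OF h(3)]] by simp
    obtain \<epsilon>1 where "\<epsilon>1 \<in> ext_pull_inv C S n B (\<beta> \<triangleleft> a) b"
      using ext_pull_inv_exists[OF \<delta>(1) h(2,3) pull_Ext[OF e(1) h(1) X]] by blast
    moreover have "\<beta> \<in> bar \<beta>" "\<gamma> \<in> bar \<gamma>" using mem_bar e by auto
    ultimately show ?thesis using \<delta> ab by blast
  qed
  have "ext_circ C S n M B \<delta>\<^sub>M (bar \<beta>) (bar \<gamma>) =
    \<Union>{bar (\<epsilon>1 \<triangleleft> f) | \<epsilon>1 f \<beta>1 \<gamma>1 A \<delta> a b. ?P \<epsilon>1 f \<beta>1 \<gamma>1 A \<delta> a b}"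
    unfolding ext_circ_def ..
  also have "{bar (\<epsilon>1 \<triangleleft> f) | \<epsilon>1 f \<beta>1 \<gamma>1 A \<delta> a b. ?P \<epsilon>1 f \<beta>1 \<gamma>1 A \<delta> a b} = {bar \<epsilon>}"
  proof (rule Set.set_eqI, rule iffI)
    fix y assume "y \<in> {bar \<epsilon>}"
    moreover obtain \<epsilon>1 f \<beta>1 \<gamma>1 A \<delta> a b where P: "?P \<epsilon>1 f \<beta>1 \<gamma>1 A \<delta> a b" using ex by blast
    ultimately have "y = bar (\<epsilon>1 \<triangleleft> f)" using all[OF P] by simp
    then show "y \<in> {bar (\<epsilon>1 \<triangleleft> f) | \<epsilon>1 f \<beta>1 \<gamma>1 A \<delta> a b. ?P \<epsilon>1 f \<beta>1 \<gamma>1 A \<delta> a b}" using P by blast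
  next
    fix y assume "y \<in> {bar (\<epsilon>1 \<triangleleft> f) | \<epsilon>1 f \<beta>1 \<gamma>1 A \<delta> a b. ?P \<epsilon>1 f \<beta>1 \<gamma>1 A \<delta> a b}"
    then obtain \<epsilon>1 f \<beta>1 \<gamma>1 A \<delta> a b where "y = bar (\<epsilon>1 \<triangleleft> f)" and P: "?P \<epsilon>1 f \<beta>1 \<gamma>1 A \<delta> a b" by blast
    then show "y \<in> {bar \<epsilon>}" using all[OF P] by simp
  qed
  finally show ?thesis by simp
qed

section \<open>The ring axioms and the units\<close>

lemma circ_rel_exists:
  assumes "\<beta> \<in> Ext C S n M B" "\<gamma> \<in> Ext C S n M B"
  obtains \<epsilon> where "circ_rel \<beta> \<gamma> \<epsilon>" "\<epsilon> \<in> Ext C S n M B"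
proof -
  obtain g where g: "g \<in> Ext C S n A1 M" "\<gamma> \<star> \<tau> = \<delta>\<^sub>M \<star> g" using frame_divide[OF assms(2)] .
  obtain \<epsilon> where "\<epsilon> \<in> Ext C S n M B" "\<epsilon> \<star> \<tau> = \<beta> \<star> g" using frame_multiply[OF assms(1) g(1)] .
  then show ?thesis using that[of \<epsilon>] g assms unfolding circ_rel_def by blast
qed

text \<open>The two bracketings lead to z \<star> g and \<alpha> \<star> w, already of degree 2n.
  After multiplication with \<sigma>, write g \<star> \<sigma> = \<tau> \<star> h; cancelling
  \<open>\<delta>\<^sub>M\<close> gives w \<star> \<sigma> = b \<star> h, and both products become
  \<alpha> \<star> b \<star> h.\<close>

lemma circ_rel_assoc:
  assumes \<alpha>: "\<alpha> \<in> Ext C S n M B" and \<beta>: "\<beta> \<in> Ext C S n M B" and \<gamma>: "\<gamma> \<in> Ext C S n M B"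
  obtains \<alpha>\<beta> \<beta>\<gamma> \<epsilon> where "circ_rel \<alpha> \<beta> \<alpha>\<beta>" "circ_rel \<beta> \<gamma> \<beta>\<gamma>" "circ_rel \<alpha>\<beta> \<gamma> \<epsilon>" "circ_rel \<alpha> \<beta>\<gamma> \<epsilon>"
proof -
  obtain g where g: "g \<in> Ext C S n A1 M" "\<gamma> \<star> \<tau> = \<delta>\<^sub>M \<star> g" using frame_divide[OF \<gamma>] .
  obtain b where b: "b \<in> Ext C S n A1 M" "\<beta> \<star> \<tau> = \<delta>\<^sub>M \<star> b" using frame_divide[OF \<beta>] .
  obtain y where y: "y \<in> Ext C S n M B" "y \<star> \<tau> = \<beta> \<star> g" using frame_multiply[OF \<beta> g(1)] .
  obtain z where z: "z \<in> Ext C S n M B" "z \<star> \<tau> = \<alpha> \<star> b" using frame_multiply[OF \<alpha> b(1)] .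
  obtain v where v: "v \<in> Ext C S n M B" "v \<star> \<tau> = z \<star> g" using frame_multiply[OF z(1) g(1)] .
  obtain w where w: "w \<in> Ext C S n A1 M" "y \<star> \<tau> = \<delta>\<^sub>M \<star> w" using frame_divide[OF y(1)] .
  obtain h where h: "h \<in> Ext C S n A2 A1" "g \<star> \<sigma> = \<tau> \<star> h"
    using U_left_surjective[OF \<tau>_unit order_refl yprod_Ext[OF g(1) \<sigma>_Ext]] .
  have n: "n < n + n" using frame_S by simp
  have "\<delta>\<^sub>M \<star> (w \<star> \<sigma>) = (\<beta> \<star> g) \<star> \<sigma>" using w(2) y(2) yprod_assoc[OF \<delta>_Ext w(1) \<sigma>_Ext] by simp
  also have "\<dots> = (\<beta> \<star> \<tau>) \<star> h" using yprod_assoc[OF \<beta> g(1) \<sigma>_Ext] h(2) yprod_assoc[OF \<beta> \<tau>_Ext h(1)] by simp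
  also have "\<dots> = \<delta>\<^sub>M \<star> (b \<star> h)" using b(2) yprod_assoc[OF \<delta>_Ext b(1) h(1)] by simp
  finally have wb: "w \<star> \<sigma> = b \<star> h"
    by (rule U_left_cancel[OF \<delta>_unit n yprod_Ext[OF w(1) \<sigma>_Ext] yprod_Ext[OF b(1) h(1)]])
  have "(\<alpha> \<star> w) \<star> \<sigma> = (\<alpha> \<star> b) \<star> h" using wb yprod_assoc[OF \<alpha> w(1) \<sigma>_Ext] yprod_assoc[OF \<alpha> b(1) h(1)] by simp
  also have "\<dots> = z \<star> (\<tau> \<star> h)" using z(2) yprod_assoc[OF z(1) \<tau>_Ext h(1)] by simp
  also have "\<dots> = (z \<star> g) \<star> \<sigma>" using h(2) yprod_assoc[OF z(1) g(1) \<sigma>_Ext] by simp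
  finally have "\<alpha> \<star> w = z \<star> g"
    by (rule U_right_cancel[OF \<sigma>_unit n yprod_Ext[OF \<alpha> w(1)] yprod_Ext[OF z(1) g(1)]])
  then have "circ_rel \<alpha> y v" unfolding circ_rel_def using \<alpha> y v w by auto
  moreover have "circ_rel \<alpha> \<beta> z" "circ_rel \<beta> \<gamma> y" "circ_rel z \<gamma> v"
    unfolding circ_rel_def using \<alpha> \<beta> \<gamma> b g y z v by auto
  ultimately show ?thesis using that by blast
qed

text \<open>As right factor, \<open>\<delta>\<^sub>M\<close> has \<tau> itself as its quotient; as
  left factor, it restores the quotient g of \<gamma> to \<gamma> \<star> \<tau>.\<close>

lemma circ_rel_one:
  assumes "\<gamma> \<in> Ext C S n M B" shows "circ_rel \<delta>\<^sub>M \<gamma> \<gamma>" "circ_rel \<gamma> \<delta>\<^sub>M \<gamma>"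
proof -
  obtain g where "g \<in> Ext C S n A1 M" "\<gamma> \<star> \<tau> = \<delta>\<^sub>M \<star> g" using frame_divide[OF assms] .
  then show "circ_rel \<delta>\<^sub>M \<gamma> \<gamma>" "circ_rel \<gamma> \<delta>\<^sub>M \<gamma>" unfolding circ_rel_def using assms \<delta>_Ext \<tau>_Ext by auto
qed

lemma circ_rel_baer_left:
  assumes \<alpha>: "\<alpha> \<in> Ext C S n M B" and \<beta>: "\<beta> \<in> Ext C S n M B" and \<gamma>: "\<gamma> \<in> Ext C S n M B"
  obtains x y where "circ_rel \<alpha> \<gamma> x" "circ_rel \<beta> \<gamma> y" "circ_rel (\<alpha> \<uplus> \<beta>) \<gamma> (x \<uplus> y)"
proof -
  obtain g where g: "g \<in> Ext C S n A1 M" "\<gamma> \<star> \<tau> = \<delta>\<^sub>M \<star> g" using frame_divide[OF \<gamma>] .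
  obtain x where x: "x \<in> Ext C S n M B" "x \<star> \<tau> = \<alpha> \<star> g" using frame_multiply[OF \<alpha> g(1)] .
  obtain y where y: "y \<in> Ext C S n M B" "y \<star> \<tau> = \<beta> \<star> g" using frame_multiply[OF \<beta> g(1)] .
  have "(x \<uplus> y) \<star> \<tau> = (\<alpha> \<uplus> \<beta>) \<star> g"
    using baer_yprod[OF x(1) y(1) \<tau>_Ext] baer_yprod[OF \<alpha> \<beta> g(1)] x(2) y(2) by simp
  then show ?thesis using that[of x y] \<alpha> \<beta> \<gamma> g x y unfolding circ_rel_def by auto
qed

lemma circ_rel_baer_right:
  assumes \<alpha>: "\<alpha> \<in> Ext C S n M B" and \<beta>: "\<beta> \<in> Ext C S n M B" and \<gamma>: "\<gamma> \<in> Ext C S n M B"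
  obtains x y where "circ_rel \<gamma> \<alpha> x" "circ_rel \<gamma> \<beta> y" "circ_rel \<gamma> (\<alpha> \<uplus> \<beta>) (x \<uplus> y)"
proof -
  obtain a where a: "a \<in> Ext C S n A1 M" "\<alpha> \<star> \<tau> = \<delta>\<^sub>M \<star> a" using frame_divide[OF \<alpha>] .
  obtain b where b: "b \<in> Ext C S n A1 M" "\<beta> \<star> \<tau> = \<delta>\<^sub>M \<star> b" using frame_divide[OF \<beta>] .
  obtain x where x: "x \<in> Ext C S n M B" "x \<star> \<tau> = \<gamma> \<star> a" using frame_multiply[OF \<gamma> a(1)] .
  obtain y where y: "y \<in> Ext C S n M B" "y \<star> \<tau> = \<gamma> \<star> b" using frame_multiply[OF \<gamma> b(1)] .
  have "(x \<uplus> y) \<star> \<tau> = \<gamma> \<star> (a \<uplus> b)"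
    using baer_yprod[OF x(1) y(1) \<tau>_Ext] yprod_baer[OF \<gamma> a(1) b(1)] x(2) y(2) by simp
  moreover have "(\<alpha> \<uplus> \<beta>) \<star> \<tau> = \<delta>\<^sub>M \<star> (a \<uplus> b)"
    using baer_yprod[OF \<alpha> \<beta> \<tau>_Ext] yprod_baer[OF \<delta>_Ext a(1) b(1)] a(2) b(2) by simp
  moreover have "a \<uplus> b \<in> Ext C S n A1 M" using a(1) b(1) by simp
  ultimately have "circ_rel \<gamma> (\<alpha> \<uplus> \<beta>) (x \<uplus> y)" unfolding circ_rel_def using \<alpha> \<beta> \<gamma> x y by auto
  then show ?thesis using that[of x y] \<alpha> \<beta> \<gamma> a b x y unfolding circ_rel_def by blast
qed

abbreviation R where "R \<equiv> stable_ring C S n M B \<delta>\<^sub>M"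

lemma bar_baer:
  assumes "\<alpha> \<in> Ext C S n M B" "\<beta> \<in> Ext C S n M B"
  shows "bar \<alpha> \<oplus>\<^bsub>R\<^esub> bar \<beta> = bar (\<alpha> \<uplus> \<beta>)"
proof -
  interpret G: comm_group "Ext_group C S n M B" using Ext_comm_group frame_S by simp
  have "proj_part C S n M B \<lhd> Ext_group C S n M B"
    using G.normal_iff_subgroup proj_part_subgroup[OF \<tau>_unit frame_S(2)] by simp
  from normal.rcos_sum[OF this, of \<alpha> \<beta>] show ?thesis
    using assms unfolding stable_ring_def Let_def ext_bar_def by (simp add: FactGroup_def Ext_group_def)
qed

lemma R_simps:
  "carrier R = bar ` Ext C S n M B" "\<one>\<^bsub>R\<^esub> = bar \<delta>\<^sub>M" "add_monoid R = Ext_group C S n M B Mod proj_part C S n M B"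
  "x \<otimes>\<^bsub>R\<^esub> y = ext_circ C S n M B \<delta>\<^sub>M x y"
  unfolding stable_ring_def Let_def FactGroup_def RCOSETS_def ext_bar_def by (auto simp: Ext_group_def)

lemma R_mult: "circ_rel \<beta> \<gamma> \<epsilon> \<Longrightarrow> bar \<beta> \<otimes>\<^bsub>R\<^esub> bar \<gamma> = bar \<epsilon>"
  unfolding R_simps(4) by (rule ext_circ_bar)

lemma R_ring: "ring R"
proof (rule ringI)
  interpret G: comm_group "Ext_group C S n M B" using Ext_comm_group frame_S by simp
  interpret Q: comm_group "Ext_group C S n M B Mod proj_part C S n M B"
    using G.abelian_FactGroup proj_part_subgroup[OF \<tau>_unit frame_S(2)] by simp
  have "comm_group (add_monoid R)" unfolding R_simps(3) by (rule Q.comm_group_axioms)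
  then show "abelian_group R"
    using comm_group.axioms(1) by (intro abelian_group.intro abelian_monoid.intro abelian_group_axioms.intro)
  show "monoid R"
  proof (rule monoidI)
    fix x y assume "x \<in> carrier R" "y \<in> carrier R"
    then obtain \<alpha> \<beta> where *: "\<alpha> \<in> Ext C S n M B" "\<beta> \<in> Ext C S n M B" "x = bar \<alpha>" "y = bar \<beta>"
      unfolding R_simps by blast
    obtain \<epsilon> where "circ_rel \<alpha> \<beta> \<epsilon>" "\<epsilon> \<in> Ext C S n M B" using circ_rel_exists[OF *(1,2)] .
    then show "x \<otimes>\<^bsub>R\<^esub> y \<in> carrier R" using R_mult * unfolding R_simps(1) by simp
  next
    fix x y z assume "x \<in> carrier R" "y \<in> carrier R" "z \<in> carrier R"
    then obtain \<alpha> \<beta> \<gamma> where *: "\<alpha> \<in> Ext C S n M B" "\<beta> \<in> Ext C S n M B" "\<gamma> \<in> Ext C S n M B"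
      "x = bar \<alpha>" "y = bar \<beta>" "z = bar \<gamma>" unfolding R_simps by blast
    show "x \<otimes>\<^bsub>R\<^esub> y \<otimes>\<^bsub>R\<^esub> z = x \<otimes>\<^bsub>R\<^esub> (y \<otimes>\<^bsub>R\<^esub> z)"
      unfolding *(4-6) by (rule circ_rel_assoc[OF *(1-3)]) (simp add: R_mult)
  next
    show "\<one>\<^bsub>R\<^esub> \<in> carrier R" unfolding R_simps using \<delta>_Ext by simp
    fix x assume "x \<in> carrier R"
    then obtain \<alpha> where "\<alpha> \<in> Ext C S n M B" "x = bar \<alpha>" unfolding R_simps by blast
    then show "\<one>\<^bsub>R\<^esub> \<otimes>\<^bsub>R\<^esub> x = x" "x \<otimes>\<^bsub>R\<^esub> \<one>\<^bsub>R\<^esub> = x"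
      unfolding R_simps(2) by (simp_all add: R_mult circ_rel_one)
  qed
  fix x y z assume "x \<in> carrier R" "y \<in> carrier R" "z \<in> carrier R"
  then obtain \<alpha> \<beta> \<gamma> where *: "\<alpha> \<in> Ext C S n M B" "\<beta> \<in> Ext C S n M B" "\<gamma> \<in> Ext C S n M B"
    "x = bar \<alpha>" "y = bar \<beta>" "z = bar \<gamma>" unfolding R_simps by blast
  obtain u v where uv: "circ_rel \<alpha> \<gamma> u" "circ_rel \<beta> \<gamma> v" "circ_rel (\<alpha> \<uplus> \<beta>) \<gamma> (u \<uplus> v)"
    using circ_rel_baer_left[OF *(1-3)] .
  moreover from uv have "u \<in> Ext C S n M B" "v \<in> Ext C S n M B" unfolding circ_rel_def by auto
  ultimately show "(x \<oplus>\<^bsub>R\<^esub> y) \<otimes>\<^bsub>R\<^esub> z = x \<otimes>\<^bsub>R\<^esub> z \<oplus>\<^bsub>R\<^esub> y \<otimes>\<^bsub>R\<^esub> z"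
    using R_mult bar_baer * by simp
  obtain u v where uv: "circ_rel \<gamma> \<alpha> u" "circ_rel \<gamma> \<beta> v" "circ_rel \<gamma> (\<alpha> \<uplus> \<beta>) (u \<uplus> v)"
    using circ_rel_baer_right[OF *(1-3)] .
  moreover from uv have "u \<in> Ext C S n M B" "v \<in> Ext C S n M B" unfolding circ_rel_def by auto
  ultimately show "z \<otimes>\<^bsub>R\<^esub> (x \<oplus>\<^bsub>R\<^esub> y) = z \<otimes>\<^bsub>R\<^esub> x \<oplus>\<^bsub>R\<^esub> z \<otimes>\<^bsub>R\<^esub> y"
    using R_mult bar_baer * by simp
qed

text \<open>Dividing \<open>\<delta>\<^sub>M \<star> \<tau>\<close> by \<delta> yields a right
  inverse. Left multiplication with the class of \<delta> is injective, and this makes the right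
  inverse two-sided.\<close>

lemma R_Units:
  assumes \<delta>: "\<delta> \<in> U M B" shows "bar \<delta> \<in> Units R"
proof -
  interpret ring R by (rule R_ring)
  note \<delta>' = U_Ext[OF \<delta>]
  obtain g where g: "g \<in> Ext C S n A1 M" "\<delta>\<^sub>M \<star> \<tau> = \<delta> \<star> g"
    using U_left_surjective[OF \<delta> order_refl yprod_Ext[OF \<delta>_Ext \<tau>_Ext]] .
  obtain \<epsilon> where \<epsilon>: "\<epsilon> \<in> Ext C S n M B" "\<epsilon> \<star> \<tau> = \<delta>\<^sub>M \<star> g" using frame_multiply[OF \<delta>_Ext g(1)] .
  have "circ_rel \<delta> \<epsilon> \<delta>\<^sub>M" unfolding circ_rel_def using \<delta>' \<epsilon> \<delta>_Ext g by blast
  then have right: "bar \<delta> \<otimes>\<^bsub>R\<^esub> bar \<epsilon> = \<one>\<^bsub>R\<^esub>" using R_mult R_simps(2) by simp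
  have c: "bar \<delta> \<in> carrier R" "bar \<epsilon> \<in> carrier R" unfolding R_simps(1) using \<delta>' \<epsilon>(1) by auto
  \<comment> \<open>The quotients a and b satisfy \<delta> \<star> a = \<delta> \<star> b;
    \<open>U_left_transfer\<close> replaces \<delta> by \<open>\<delta>\<^sub>M\<close> on both
    sides.\<close>
  have inj: "x = y" if xy: "x \<in> carrier R" "y \<in> carrier R" "bar \<delta> \<otimes>\<^bsub>R\<^esub> x = bar \<delta> \<otimes>\<^bsub>R\<^esub> y" for x y
  proof -
    obtain \<alpha> \<beta> where *: "\<alpha> \<in> Ext C S n M B" "\<beta> \<in> Ext C S n M B" "x = bar \<alpha>" "y = bar \<beta>"
      using xy(1,2) unfolding R_simps by blast
    obtain u where u: "circ_rel \<delta> \<alpha> u" "u \<in> Ext C S n M B" using circ_rel_exists[OF \<delta>' *(1)] .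
    obtain v where v: "circ_rel \<delta> \<beta> v" "v \<in> Ext C S n M B" using circ_rel_exists[OF \<delta>' *(2)] .
    have uv: "u \<star> \<tau> = v \<star> \<tau>" using xy(3) R_mult[OF u(1)] R_mult[OF v(1)] bar_eq_iff[OF u(2) v(2)] * by simp
    obtain a where a: "a \<in> Ext C S n A1 M" "\<alpha> \<star> \<tau> = \<delta>\<^sub>M \<star> a" "u \<star> \<tau> = \<delta> \<star> a"
      using u(1) unfolding circ_rel_def by blast
    obtain b where b: "b \<in> Ext C S n A1 M" "\<beta> \<star> \<tau> = \<delta>\<^sub>M \<star> b" "v \<star> \<tau> = \<delta> \<star> b"
      using v(1) unfolding circ_rel_def by blast
    have "\<delta> \<star> a = \<delta> \<star> b" using uv a(3) b(3) by simp
    then have "\<delta>\<^sub>M \<star> a = \<delta>\<^sub>M \<star> b" using U_left_transfer[OF \<delta> a(1) b(1) _ \<delta>_Ext] by simp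
    then show "x = y" using a(2) b(2) bar_eq_iff[OF *(1,2)] * by simp
  qed
  have "bar \<delta> \<otimes>\<^bsub>R\<^esub> (bar \<epsilon> \<otimes>\<^bsub>R\<^esub> bar \<delta>) = bar \<delta> \<otimes>\<^bsub>R\<^esub> \<one>\<^bsub>R\<^esub>"
    using m_assoc[OF c c(1)] right c by simp
  then have "bar \<epsilon> \<otimes>\<^bsub>R\<^esub> bar \<delta> = \<one>\<^bsub>R\<^esub>" by (rule inj[rotated 2]) (use c in auto)
  then show ?thesis using right c unfolding Units_def by blast
qed

end

theorem corollary7p10:
  fixes C :: "('o, 'm) add_cat" and S :: "'o set" and n :: nat
    and M \<Omega>M :: 'o and \<delta>\<^sub>M :: "'m list set"
  assumes "n \<ge> 1"
    and "n_Frobenius_category C S n"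
    and "M \<in> S"
    and "\<delta>\<^sub>M \<in> unit_conflations C S n M \<Omega>M"
  shows "ring (stable_ring C S n M \<Omega>M \<delta>\<^sub>M) \<and>
    \<one>\<^bsub>stable_ring C S n M \<Omega>M \<delta>\<^sub>M\<^esub> = ext_bar C S n M \<Omega>M \<delta>\<^sub>M \<and>
    (\<forall>\<delta> \<in> unit_conflations C S n M \<Omega>M.
       ext_bar C S n M \<Omega>M \<delta> \<in> Units (stable_ring C S n M \<Omega>M \<delta>\<^sub>M))"
proof -
  interpret n_Frobenius_category C S n by (rule assms(2))
  obtain A1 \<tau> where \<tau>: "\<tau> \<in> U A1 M" using U_from[OF assms(3,1)] .
  have "A1 \<in> S" using Ext_S[OF U_Ext[OF \<tau>]] by simp
  then obtain A2 \<sigma> where \<sigma>: "\<sigma> \<in> U A2 A1" using U_from[OF _ assms(1)] by blast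
  interpret unit_frame C S n M \<Omega>M \<delta>\<^sub>M A1 \<tau> A2 \<sigma>
    by unfold_locales (use assms(4) \<tau> \<sigma> in auto)
  show ?thesis using R_ring R_simps(2) R_Units by blast
qed

end
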